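(* Fix an integer $m\ge 2$. (a) Let $F\in H^1(\mathbb{R}^2)$. Then $T_nF\in H^{1/2}(\mathrm{gp}_{m^n})$ for all $n\in\mathbb{Z}$, with uniformly bounded norms, and $$\sup_{n\in\mathbb{Z}}\|T_nF\|_{H^{1/2}(\mathrm{gp}_{m^n})}^2\le c\,\|F\|_{H^1(\mathbb{R}^2)}^2 .$$ (b) Let $f_n\in H^{1/2}(\mathrm{gp}_{m^n})$, $n\in\mathbb{Z}$, be a sequence of functions with uniformly bounded norms satisfying the consistency condition $T_nf_{n'}=f_n$ whenever $n'<n$. Then there exists $F\in H^1(\mathbb{R}^2)$ such that $T_nF=f_n$ for all $n$ and $$\|F\|_{H^1(\mathbb{R}^2)}^2\le c\sup_{n\in\mathbb{Z}}\|f_n\|_{H^{1/2}(\mathrm{gp}_{m^n})}^2 .$$ Here $c$ is a constant independent of $F$, $\{f_n\}$ and $n$.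
   Context: $H^1(\mathbb{R}^2)$ is the homogeneous Sobolev space of functions with distributional gradient in $L^2(\mathbb{R}^2)$ (modulo constants), with $\|F\|_{H^1(\mathbb{R}^2)}^2=\int|\nabla F|^2$. For $\delta>0$, $\mathrm{gp}_\delta$ is the graph-paper metric graph (also viewed as the union of the lines $x=j\delta$, $y=k\delta$, $j,k\in\mathbb{Z}$) with vertices $(j\delta,k\delta)$ and horizontal/vertical edges of length $\delta$ joining $(j\delta,k\delta)$ to $((j+1)\delta,k\delta)$ and to $(j\delta,(k+1)\delta)$. Since $\mathrm{gp}_{m^n}\subset\mathrm{gp}_{m^{n'}}$ for $n'<n$, $T_n$ denotes the trace (restriction) onto $\mathrm{gp}_{m^n}$ both of functions on $\mathbb{R}^2$ and of functions on $\mathrm{gp}_{m^{n'}}$, $n'<n$. $H^{1/2}(\mathrm{gp}_\delta)$ is the space of locally $L^2$ functions $f$ on $\mathrm{gp}_\delta$ (modulo constants) with finite norm $$\begin{aligned}\|f\|_{H^{1/2}(\mathrm{gp}_\delta)}^2&=\sum_{j,k}\int_0^\delta\!\!\int_0^\delta\frac{|f(j\delta+x,k\delta)-f(j\delta+y,k\delta)|^2}{|x-y|^2}dxdy+\sum_{j,k}\int_0^\delta\!\!\int_0^\delta\frac{|f(j\delta,k\delta+x)-f(j\delta,k\delta+y)|^2}{|x-y|^2}dxdy\\&+\sum_{j,k}\int_{-\delta}^\delta|f(j\delta+x,k\delta)-f(j\delta,k\delta+x)|^2\frac{dx}{|x|}+\sum_{j,k}\int_0^\delta|f(j\delta+x,k\delta)-f(j\delta-x,k\delta)|^2\frac{dx}{x}\\&+\sum_{j,k}\int_0^\delta|f(j\delta,k\delta+x)-f(j\delta,k\delta-x)|^2\frac{dx}{x}.\end{aligned}$$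 *)

theory Defs
  imports "HOL-Analysis.Analysis"
begin

type_synonym pt = "real \<times> real"

coinductive smooth2 :: "(pt \<Rightarrow> real) \<Rightarrow> bool" where
  "\<lbrakk> \<forall>p. phi differentiable (at p);
     smooth2 (\<lambda>p. frechet_derivative phi (at p) (1, 0));
     smooth2 (\<lambda>p. frechet_derivative phi (at p) (0, 1)) \<rbrakk> \<Longrightarrow> smooth2 phi"

definition test_fun :: "(pt \<Rightarrow> real) \<Rightarrow> bool" where
  "test_fun phi \<longleftrightarrow> smooth2 phi \<and> (\<exists>R. \<forall>p. norm p > R \<longrightarrow> phi p = 0)"

definition loc_integrable :: "(pt \<Rightarrow> real) \<Rightarrow> bool" where
  "loc_integrable F \<longleftrightarrow> F \<in> borel_measurable lebesgue \<and>
     (\<forall>K. compact K \<longrightarrow> set_integrable lebesgue K F)"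

definition weak_grad_L2 :: "(pt \<Rightarrow> real) \<Rightarrow> (pt \<Rightarrow> real) \<Rightarrow> (pt \<Rightarrow> real) \<Rightarrow> bool" where
  "weak_grad_L2 F G1 G2 \<longleftrightarrow> loc_integrable F \<and>
     G1 \<in> borel_measurable lebesgue \<and> G2 \<in> borel_measurable lebesgue \<and>
     (\<integral>\<^sup>+ p. ennreal ((G1 p)\<^sup>2 + (G2 p)\<^sup>2) \<partial>lebesgue) < \<infinity> \<and>
     (\<forall>phi. test_fun phi \<longrightarrow>
        (\<integral>p. F p * frechet_derivative phi (at p) (1, 0) \<partial>lebesgue) = - (\<integral>p. G1 p * phi p \<partial>lebesgue) \<and>
        (\<integral>p. F p * frechet_derivative phi (at p) (0, 1) \<partial>lebesgue) = - (\<integral>p. G2 p * phi p \<partial>lebesgue))"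

definition in_H1 :: "(pt \<Rightarrow> real) \<Rightarrow> bool" where
  "in_H1 F \<longleftrightarrow> (\<exists>G1 G2. weak_grad_L2 F G1 G2)"

text \<open>Squared homogeneous H^1 seminorm: integral of |grad F|^2 (independent of the
  choice of a.e.-representative of the gradient).\<close>
definition H1_norm2 :: "(pt \<Rightarrow> real) \<Rightarrow> ennreal" where
  "H1_norm2 F = (let G = (SOME G. weak_grad_L2 F (fst G) (snd G)) in
     \<integral>\<^sup>+ p. ennreal ((fst G p)\<^sup>2 + (snd G p)\<^sup>2) \<partial>lebesgue)"

definition AE_gp :: "real \<Rightarrow> (pt \<Rightarrow> bool) \<Rightarrow> bool" where
  "AE_gp \<delta> P \<longleftrightarrow> (\<forall>k::int. AE x in lebesgue. P (x, of_int k * \<delta>)) \<and>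
                  (\<forall>j::int. AE y in lebesgue. P (of_int j * \<delta>, y))"

text \<open>Locally L^2 on gp_delta (only the values on the lines matter).\<close>
definition loc_L2_gp :: "real \<Rightarrow> (pt \<Rightarrow> real) \<Rightarrow> bool" where
  "loc_L2_gp \<delta> f \<longleftrightarrow>
     (\<forall>k::int. (\<lambda>x. f (x, of_int k * \<delta>)) \<in> borel_measurable lebesgue \<and>
        (\<forall>a b. (\<integral>\<^sup>+ x\<in>{a..b}. ennreal ((f (x, of_int k * \<delta>))\<^sup>2) \<partial>lebesgue) < \<infinity>)) \<and>
     (\<forall>j::int. (\<lambda>y. f (of_int j * \<delta>, y)) \<in> borel_measurable lebesgue \<and>
        (\<forall>a b. (\<integral>\<^sup>+ y\<in>{a..b}. ennreal ((f (of_int j * \<delta>, y))\<^sup>2) \<partial>lebesgue) < \<infinity>))"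

definition H12_norm2 :: "real \<Rightarrow> (pt \<Rightarrow> real) \<Rightarrow> ennreal" where
  "H12_norm2 \<delta> f =
    (\<integral>\<^sup>+ jk. (let a = of_int (fst jk) * \<delta>; b = of_int (snd jk) * \<delta> in
        (\<integral>\<^sup>+ x\<in>{0..\<delta>}. \<integral>\<^sup>+ y\<in>{0..\<delta>}.
            ennreal ((f (a + x, b) - f (a + y, b))\<^sup>2 / (x - y)\<^sup>2) \<partial>lebesgue \<partial>lebesgue)
      + (\<integral>\<^sup>+ x\<in>{0..\<delta>}. \<integral>\<^sup>+ y\<in>{0..\<delta>}.
            ennreal ((f (a, b + x) - f (a, b + y))\<^sup>2 / (x - y)\<^sup>2) \<partial>lebesgue \<partial>lebesgue)
      + (\<integral>\<^sup>+ x\<in>{-\<delta>..\<delta>}. ennreal ((f (a + x, b) - f (a, b + x))\<^sup>2 / \<bar>x\<bar>) \<partial>lebesgue)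
      + (\<integral>\<^sup>+ x\<in>{0..\<delta>}. ennreal ((f (a + x, b) - f (a - x, b))\<^sup>2 / x) \<partial>lebesgue)
      + (\<integral>\<^sup>+ x\<in>{0..\<delta>}. ennreal ((f (a, b + x) - f (a, b - x))\<^sup>2 / x) \<partial>lebesgue))
     \<partial>count_space (UNIV :: (int \<times> int) set))"

definition in_H12 :: "real \<Rightarrow> (pt \<Rightarrow> real) \<Rightarrow> bool" where
  "in_H12 \<delta> f \<longleftrightarrow> loc_L2_gp \<delta> f \<and> H12_norm2 \<delta> f < \<infinity>"

definition is_trace :: "real \<Rightarrow> (pt \<Rightarrow> real) \<Rightarrow> (pt \<Rightarrow> real) \<Rightarrow> bool" where
  "is_trace \<delta> F f \<longleftrightarrow> AE_gp \<delta> (\<lambda>p.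
     ((\<lambda>r. (\<integral>q. indicator (ball p r) q * F q \<partial>lebesgue) / measure lebesgue (ball p r))
        \<longlongrightarrow> f p) (at_right 0))"

text \<open>Trace modulo additive constants (H^1 and H^{1/2} are taken modulo constants).\<close>
definition trace_eq :: "real \<Rightarrow> (pt \<Rightarrow> real) \<Rightarrow> (pt \<Rightarrow> real) \<Rightarrow> bool" where
  "trace_eq \<delta> F f \<longleftrightarrow> (\<exists>C. is_trace \<delta> F (\<lambda>p. f p + C))"

definition restr_eq :: "real \<Rightarrow> (pt \<Rightarrow> real) \<Rightarrow> (pt \<Rightarrow> real) \<Rightarrow> bool" where
  "restr_eq \<delta> f g \<longleftrightarrow> (\<exists>C. AE_gp \<delta> (\<lambda>p. f p = g p + C))"

end

theory Submission
  imports Defs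
begin

text \<open>For (a), \<open>F\<close> has one version that is absolutely continuous on horizontal lines and one that is so on
  vertical lines. These supply the traces, by Lebesgue differentiation of the disc means, and two points of the
  grid are joined by a path of horizontal and vertical segments changing direction on the diagonals. With
  Cauchy-Schwarz along the path (and Hardy's inequality for the terms of a single edge) each vertex term is bounded by the
  energy in the squares around the vertex, and these squares overlap boundedly.

  For (b), take the means of \<open>f\<^sub>n\<close> over the edges and their difference quotients, which are constant on the cells of
  the grid. Passing to a finer grid they form an \<open>L\<^sup>2\<close> bounded martingale: consistency makes the difference quotient on a
  cell the mean of those on its subcells. The limits of the two martingales (one per direction) are the partial
  derivatives of \<open>F\<close>. Integrating them from the axes, horizontally or vertically, gives the same function, which has
  the prescribed values on all the grids.\<close>

section \<open>Locally integrable functions and their primitives\<close>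

text \<open>Grid lines are null sets, so a version of \<open>F\<close> chosen almost everywhere says
  nothing about them; the disc means single out the right one. Near a horizontal line they are
  controlled by vertical increments, whose energy in small squares tends to 0, so the limit is the
  vertically continuous version. This works for every line of slope at most 1 in modulus; done in
  both directions on the diagonals, it shows that the two versions have the same values there, so
  that a path may turn at a corner. Both norms are invariant under dilation, hence no constant
  depends on the mesh: 990 is 110 per vertex times 9 overlapping squares, and \<open>m\<close>
  matters only for the nesting in (b). There each partial derivative costs at most 12 times the
  supremum, in all 24. That the two limits built separately are the partial derivatives of one
  function is not automatic: it rests on the edge and cross terms of the norm, which bound the
  squared distance of the two primitives by a multiple of the squared mesh. Only meshes up to 1 are
  used in this construction, since coarser grids lie inside the unit grid.\<close>

definition loc_int :: "(real \<Rightarrow> real) \<Rightarrow> bool" where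
  "loc_int g \<longleftrightarrow> g \<in> borel_measurable borel \<and> (\<forall>a b. set_integrable lborel {a..b} g)"

text \<open>Signed indicator of the interval from \<open>a\<close> to \<open>b\<close>: integrals
  with endpoints in either order need no case distinction and depend measurably on the endpoints.
  Half-open intervals make additivity in the endpoints hold at every point, not only almost
  everywhere.\<close>

definition orient :: "real \<Rightarrow> real \<Rightarrow> real \<Rightarrow> real" where
  "orient a b s = (if a < s \<and> s \<le> b then 1 else if b < s \<and> s \<le> a then - 1 else 0)"

definition lineint :: "(real \<Rightarrow> real) \<Rightarrow> real \<Rightarrow> real \<Rightarrow> real" where
  "lineint g a b = (\<integral>s. orient a b s * g s \<partial>lborel)"

lemma orient_measurable [measurable]:
  assumes [measurable]: "A \<in> borel_measurable M" "B \<in> borel_measurable M" "S \<in> borel_measurable M"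
  shows "(\<lambda>x. orient (A x) (B x) (S x)) \<in> borel_measurable M"
  unfolding orient_def by measurable

lemma lineint_measurable [measurable]:
  assumes [measurable]: "(\<lambda>p. g (fst p) (snd p)) \<in> borel_measurable (M \<Otimes>\<^sub>M borel)"
    "A \<in> borel_measurable M" "B \<in> borel_measurable M"
  shows "(\<lambda>x. lineint (g x) (A x) (B x)) \<in> borel_measurable M"
  unfolding lineint_def
  by (rule lborel.borel_measurable_lebesgue_integral) (simp add: split_beta)

lemma loc_intD: "loc_int g \<Longrightarrow> set_integrable lborel {a..b} g"
  and loc_int_measurable [measurable_dest]: "loc_int g \<Longrightarrow> g \<in> borel_measurable borel"
  by (auto simp: loc_int_def)

lemma orient_abs: "\<bar>orient a b s\<bar> \<le> indicator {min a b..max a b} s"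
  by (auto simp: orient_def indicator_def)

lemma loc_int_orient:
  assumes "loc_int g"
  shows "integrable lborel (\<lambda>s. orient a b s * g s)"
proof (rule Bochner_Integration.integrable_bound)
  show "integrable lborel (\<lambda>s. indicator {min a b..max a b} s *\<^sub>R g s)"
    using loc_intD[OF assms] unfolding set_integrable_def .
  have [measurable]: "g \<in> borel_measurable borel" using assms by (simp add: loc_int_def)
  show "(\<lambda>s. orient a b s * g s) \<in> borel_measurable lborel" by measurable
  show "AE s in lborel. norm (orient a b s * g s) \<le> norm (indicat_real {min a b..max a b} s *\<^sub>R g s)"
    using orient_abs[of a b] by (auto simp: abs_mult intro!: mult_right_mono)
qed

lemma orient_add: "orient a b s + orient b c s = orient a c s"
  by (auto simp: orient_def)

lemma lineint_add:
  assumes "loc_int g"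
  shows "lineint g a b + lineint g b c = lineint g a c"
proof -
  have "orient a c s * g s = orient a b s * g s + orient b c s * g s" for s
    by (simp add: orient_add[symmetric, of a c _ b] algebra_simps)
  then show ?thesis
    using loc_int_orient[OF assms] by (simp add: lineint_def)
qed

lemma lineint_self [simp]: "lineint g a a = 0"
proof -
  have "orient a a s = 0" for s by (auto simp: orient_def)
  then show ?thesis by (simp add: lineint_def)
qed

lemma lineint_swap: "lineint g b a = - lineint g a b"
proof -
  have "orient b a s = - orient a b s" for s by (auto simp: orient_def)
  then show ?thesis by (simp add: lineint_def)
qed

lemma lineint_diff:
  assumes "loc_int g"
  shows "lineint g a c - lineint g a b = lineint g b c"
  using lineint_add[OF assms, of a b c] by simp

lemma lineint_eq:
  assumes "a \<le> b" and [measurable]: "g \<in> borel_measurable borel"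
  shows "lineint g a b = (\<integral>s. indicator {a..b} s * g s \<partial>lborel)"
  unfolding lineint_def
  by (rule integral_cong_AE) (use AE_lborel_singleton[of a] assms in \<open>auto simp: orient_def indicator_def\<close>)

text \<open>Integrability need not be checked: the Bochner integral of a non-integrable function is
  0, so the bound is trivial in that case.\<close>

lemma ennreal_abs_integral_le:
  fixes f :: "'a \<Rightarrow> real"
  shows "ennreal \<bar>integral\<^sup>L M f\<bar> \<le> (\<integral>\<^sup>+ x. ennreal \<bar>f x\<bar> \<partial>M)"
proof (cases "integrable M f")
  case True
  then show ?thesis using integral_norm_bound_ennreal[OF True] by simp
qed (simp add: not_integrable_integral_eq)

lemma lineint_abs_le:
  shows "ennreal \<bar>lineint g a b\<bar> \<le> (\<integral>\<^sup>+ s\<in>{min a b..max a b}. ennreal \<bar>g s\<bar> \<partial>lborel)"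
proof -
  have "ennreal \<bar>lineint g a b\<bar> \<le> (\<integral>\<^sup>+ s. ennreal \<bar>orient a b s * g s\<bar> \<partial>lborel)"
    unfolding lineint_def by (rule ennreal_abs_integral_le)
  also have "\<dots> \<le> (\<integral>\<^sup>+ s\<in>{min a b..max a b}. ennreal \<bar>g s\<bar> \<partial>lborel)"
    by (rule nn_integral_mono) (auto simp: orient_def indicator_def)
  finally show ?thesis .
qed

section \<open>Cauchy-Schwarz bounds for primitives\<close>

lemma ennreal_power2: "ennreal (x\<^sup>2) = (ennreal \<bar>x\<bar>)\<^sup>2"
  by (simp add: ennreal_power)

lemma nn_integral_sq_le:
  assumes [measurable]: "f \<in> borel_measurable M" "A \<in> sets M"
  shows "(\<integral>\<^sup>+ x\<in>A. f x \<partial>M)\<^sup>2 \<le> emeasure M A * (\<integral>\<^sup>+ x\<in>A. (f x)\<^sup>2 \<partial>M)"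
proof -
  have "(\<integral>\<^sup>+ x. indicator A x * (f x * indicator A x) \<partial>M)\<^sup>2 \<le> (\<integral>\<^sup>+ x. (indicator A x)\<^sup>2 \<partial>M) * (\<integral>\<^sup>+ x. (f x * indicator A x)\<^sup>2 \<partial>M)"
    by (rule Cauchy_Schwarz_nn_integral) auto
  also have "(\<integral>\<^sup>+ x. indicator A x * (f x * indicator A x) \<partial>M) = (\<integral>\<^sup>+ x\<in>A. f x \<partial>M)"
    by (rule nn_integral_cong) (auto simp: indicator_def)
  also have "(\<integral>\<^sup>+ x. (indicator A x)\<^sup>2 \<partial>M) = (\<integral>\<^sup>+ x. indicator A x \<partial>M)"
    by (rule nn_integral_cong) (auto simp: indicator_def)
  also have "(\<integral>\<^sup>+ x. (f x * indicator A x)\<^sup>2 \<partial>M) = (\<integral>\<^sup>+ x\<in>A. (f x)\<^sup>2 \<partial>M)"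
    by (rule nn_integral_cong) (auto simp: indicator_def)
  finally show ?thesis by simp
qed

text \<open>Cauchy-Schwarz along a segment. The length in front is what cancels the singular weights
  of the grid norm: a leg of length comparable to the denominator leaves just the energy on the
  leg.\<close>

lemma lineint_sq_le:
  assumes [measurable]: "g \<in> borel_measurable borel"
  shows "ennreal ((lineint g a b)\<^sup>2) \<le> ennreal \<bar>b - a\<bar> * (\<integral>\<^sup>+ s\<in>{min a b..max a b}. ennreal ((g s)\<^sup>2) \<partial>lborel)"
proof -
  have "ennreal ((lineint g a b)\<^sup>2) = (ennreal \<bar>lineint g a b\<bar>)\<^sup>2" by (rule ennreal_power2)
  also have "\<dots> \<le> (\<integral>\<^sup>+ s\<in>{min a b..max a b}. ennreal \<bar>g s\<bar> \<partial>lborel)\<^sup>2"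
    by (intro power_mono lineint_abs_le) auto
  also have "\<dots> \<le> emeasure lborel {min a b..max a b} * (\<integral>\<^sup>+ s\<in>{min a b..max a b}. (ennreal \<bar>g s\<bar>)\<^sup>2 \<partial>lborel)"
    by (rule nn_integral_sq_le) auto
  also have "emeasure lborel {min a b..max a b} = ennreal \<bar>b - a\<bar>"
    by (auto simp: min_def max_def)
  finally show ?thesis by (simp add: ennreal_power2)
qed

lemma loc_int_L2:
  assumes [measurable]: "g \<in> borel_measurable borel"
    and fin: "\<And>a b. (\<integral>\<^sup>+ s\<in>{a..b}. ennreal ((g s)\<^sup>2) \<partial>lborel) < \<infinity>"
  shows "loc_int g"
  unfolding loc_int_def set_integrable_def
proof (intro conjI allI integrableI_bounded)
  fix a b
  have "(\<integral>\<^sup>+ s\<in>{a..b}. ennreal \<bar>g s\<bar> \<partial>lborel)\<^sup>2 \<le> emeasure lborel {a..b} * (\<integral>\<^sup>+ s\<in>{a..b}. (ennreal \<bar>g s\<bar>)\<^sup>2 \<partial>lborel)"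
    by (rule nn_integral_sq_le) auto
  also have "\<dots> < \<infinity>"
    using fin[of a b] by (simp add: ennreal_power2 ennreal_mult_less_top emeasure_lborel_Icc_eq)
  finally have "(\<integral>\<^sup>+ s\<in>{a..b}. ennreal \<bar>g s\<bar> \<partial>lborel) < \<infinity>"
    by (auto simp: power2_eq_square ennreal_mult_less_top)
  also have "(\<integral>\<^sup>+ s\<in>{a..b}. ennreal \<bar>g s\<bar> \<partial>lborel) = (\<integral>\<^sup>+ x. ennreal (norm (indicat_real {a..b} x *\<^sub>R g x)) \<partial>lborel)"
    by (rule nn_integral_cong) (auto simp: indicator_def)
  finally show "(\<integral>\<^sup>+ x. ennreal (norm (indicat_real {a..b} x *\<^sub>R g x)) \<partial>lborel) < \<infinity>" .
qed auto

lemma loc_int_bound: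
  assumes "loc_int f" "g \<in> borel_measurable borel" "\<And>x. \<bar>g x\<bar> \<le> \<bar>f x\<bar>"
  shows "loc_int g"
  unfolding loc_int_def set_integrable_def
proof (intro conjI allI)
  fix a b
  show "integrable lborel (\<lambda>x. indicat_real {a..b} x *\<^sub>R g x)"
    by (rule Bochner_Integration.integrable_bound[OF loc_intD[OF assms(1), of a b, unfolded set_integrable_def]])
       (use assms in \<open>auto simp: abs_mult intro!: mult_left_mono\<close>)
qed fact

lemma loc_int_add: "loc_int f \<Longrightarrow> loc_int g \<Longrightarrow> loc_int (\<lambda>x. f x + g x)"
  and loc_int_diff: "loc_int f \<Longrightarrow> loc_int g \<Longrightarrow> loc_int (\<lambda>x. f x - g x)"
  by (auto simp: loc_int_def)

lemma loc_int_abs: "loc_int f \<Longrightarrow> loc_int (\<lambda>x. \<bar>f x\<bar>)"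
  by (rule loc_int_bound[of f]) (auto simp: loc_int_def)

lemma loc_int_continuous: "continuous_on UNIV g \<Longrightarrow> loc_int g"
  by (auto simp: loc_int_def intro!: borel_measurable_continuous_onI borel_integrable_atLeastAtMost' continuous_on_subset[of UNIV])

section \<open>Lebesgue differentiation on the line\<close>

lemma AE_lebesgue_lborel: "(AE x in lebesgue. P x) \<longleftrightarrow> (AE x in lborel. P x)"
  by (rule AE_completion_iff)

text \<open>One-sided, because the cubes in \<open>integrable_ccontinuous_explicit\<close> have the
  point as their lower corner. The left half follows later by reflection.\<close>

lemma lineint_right_deriv:
  assumes g: "loc_int g"
  shows "AE x in lborel. ((\<lambda>h. lineint g x (x + h) / h) \<longlongrightarrow> g x) (at_right 0)"
proof -
  have [measurable]: "g \<in> borel_measurable borel" using g by (simp add: loc_int_def)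
  have "g integrable_on cbox a b" for a b
    using set_borel_integral_eq_integral(1)[OF loc_intD[OF g]] by simp
  then obtain N where N: "negligible N" and
     *: "\<And>x e. \<lbrakk>x \<notin> N; 0 < e\<rbrakk> \<Longrightarrow> \<exists>d>0. \<forall>h. 0 < h \<and> h < d \<longrightarrow>
                         norm(integral (cbox x (x + h *\<^sub>R One)) g /\<^sub>R h ^ DIM(real) - g x) < e"
    using integrable_ccontinuous_explicit[of g] by blast
  have "((\<lambda>h. lineint g x (x + h) / h) \<longlongrightarrow> g x) (at_right 0)" if "x \<notin> N" for x
  proof (rule tendstoI)
    fix e :: real assume "e > 0"
    from *[OF that this] obtain d where d: "d > 0" "\<And>h. 0 < h \<Longrightarrow> h < d \<Longrightarrow> norm(integral {x..x + h} g / h - g x) < e"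
      by (auto simp: field_simps)
    have "lineint g x (x + h) = integral {x..x + h} g" if "h > 0" for h
      using that set_borel_integral_eq_integral(2)[OF loc_intD[OF g], of x "x + h"]
      by (simp add: lineint_eq set_lebesgue_integral_def)
    then show "\<forall>\<^sub>F h in at_right 0. dist (lineint g x (x + h) / h) (g x) < e"
      unfolding eventually_at_right_field using d by (auto intro!: exI[of _ d] simp: dist_real_def)
  qed
  moreover have "AE x in lebesgue. x \<notin> N"
    using N by (simp add: negligible_iff_null_sets AE_not_in)
  ultimately show ?thesis unfolding AE_lebesgue_lborel by auto
qed

section \<open>Traces as limits of disc means\<close>

lemma measurable_fst_pt [measurable]: "fst \<in> borel_measurable (borel :: pt measure)"
  and measurable_snd_pt [measurable]: "snd \<in> borel_measurable (borel :: pt measure)"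
  by (auto intro!: borel_measurable_continuous_onI continuous_intros)

section \<open>Slicing the plane measure and exchanging its coordinates\<close>

lemma nn_integral_pt:
  fixes f :: "pt \<Rightarrow> ennreal"
  assumes [measurable]: "f \<in> borel_measurable borel"
  shows "(\<integral>\<^sup>+ p. f p \<partial>lborel) = (\<integral>\<^sup>+ x. \<integral>\<^sup>+ t. f (x, t) \<partial>lborel \<partial>lborel)"
    and "(\<integral>\<^sup>+ p. f p \<partial>lborel) = (\<integral>\<^sup>+ t. \<integral>\<^sup>+ x. f (x, t) \<partial>lborel \<partial>lborel)"
proof -
  show "(\<integral>\<^sup>+ p. f p \<partial>lborel) = (\<integral>\<^sup>+ x. \<integral>\<^sup>+ t. f (x, t) \<partial>lborel \<partial>lborel)"
    unfolding lborel_prod[symmetric] by (rule lborel.nn_integral_fst[symmetric]) (simp add: lborel_prod)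
  show "(\<integral>\<^sup>+ p. f p \<partial>lborel) = (\<integral>\<^sup>+ t. \<integral>\<^sup>+ x. f (x, t) \<partial>lborel \<partial>lborel)"
    unfolding lborel_prod[symmetric] by (rule lborel_pair.nn_integral_snd[symmetric]) (simp add: lborel_prod)
qed

lemma AE_pt:
  fixes P :: "pt \<Rightarrow> bool"
  assumes "AE p in lborel. P p"
  shows "AE x in lborel. AE t in lborel. P (x, t)"
  using assms unfolding lborel_prod[symmetric] by (rule lborel_pair.AE_pair)

lemma AE_pt_I:
  fixes P :: "pt \<Rightarrow> bool"
  assumes "Measurable.pred borel P" "AE x in lborel. AE t in lborel. P (x, t)"
  shows "AE p in lborel. P p"
proof -
  have "{p \<in> space (lborel \<Otimes>\<^sub>M lborel). P p} \<in> sets (lborel \<Otimes>\<^sub>M lborel)"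
    using assms(1) unfolding lborel_prod by (simp add: pred_def)
  from lborel_pair.AE_pair_measure[OF this assms(2)] show ?thesis by (simp only: lborel_prod)
qed

text \<open>This invariance transfers every result about one coordinate direction to the other, so
  that each is proved only once.\<close>

lemma lborel_pt_swap: "distr lborel lborel prod.swap = (lborel :: pt measure)"
proof -
  have "(prod.swap :: pt \<Rightarrow> pt) = (\<lambda>(x, y). (y, x))" by (auto simp: fun_eq_iff)
  then show ?thesis
    using lborel_pair.distr_pair_swap[symmetric, where ?'a=real and ?'b=real] by (simp only: lborel_prod)
qed

lemma measurable_swap_pt [measurable]: "(prod.swap :: pt \<Rightarrow> pt) \<in> borel_measurable borel"
  by (auto intro!: borel_measurable_continuous_onI continuous_intros simp: prod.swap_def)

lemma nn_integral_swap:
  fixes f :: "pt \<Rightarrow> ennreal"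
  assumes [measurable]: "f \<in> borel_measurable borel"
  shows "(\<integral>\<^sup>+ p. f (prod.swap p) \<partial>lborel) = (\<integral>\<^sup>+ p. f p \<partial>lborel)"
  by (subst (2) lborel_pt_swap[symmetric], subst nn_integral_distr) auto

lemma AE_swap:
  fixes P :: "pt \<Rightarrow> bool"
  assumes "AE p in lborel. P p"
  shows "AE p in lborel. P (prod.swap p)"
proof -
  have "AE p in distr lborel lborel prod.swap. P p"
    unfolding lborel_pt_swap by fact
  from AE_distrD[OF _ this] show ?thesis by simp
qed

text \<open>The predicate may fail to be measurable, so the change of variables is applied to a
  Borel null set that contains its exceptions.\<close>

lemma AE_affine_comp:
  assumes "AE x::real in lborel. P x" "c \<noteq> 0"
  shows "AE x in lborel. P (t + c * x)"
proof -
  obtain N where N: "{x. \<not> P x} \<subseteq> N" "N \<in> null_sets lborel"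
    using assms(1) by (auto simp: eventually_ae_filter)
  have "AE x in lborel. x \<notin> N" using N by (simp add: AE_not_in)
  moreover have "Measurable.pred borel (\<lambda>x. x \<notin> N)"
    by (rule pred_intros_logic(2)) (use N in \<open>simp add: null_sets_def pred_def\<close>)
  ultimately have "AE x in lborel. t + c * x \<notin> N"
    using AE_borel_affine[OF assms(2), of "\<lambda>x. x \<notin> N" t] by simp
  then show ?thesis using N by auto
qed

text \<open>Literally the quotient in \<open>is_trace\<close>, with the completed measure, so that
  it can be folded and unfolded there.\<close>

definition disc_mean :: "(pt \<Rightarrow> real) \<Rightarrow> pt \<Rightarrow> real \<Rightarrow> real" where
  "disc_mean F p r = (\<integral>q. indicator (ball p r) q * F q \<partial>lebesgue) / measure lebesgue (ball p r)"

section \<open>Lebesgue points of locally integrable functions\<close>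

lemma loc_int_const [simp]: "loc_int (\<lambda>_. c)"
  by (intro loc_int_continuous continuous_intros)

lemma loc_int_const_diff: "loc_int w \<Longrightarrow> loc_int (\<lambda>y. \<bar>w y - c\<bar>)"
  by (intro loc_int_abs loc_int_diff) auto

lemma lineint_mono:
  assumes "loc_int f" "loc_int g" "a \<le> b" "\<And>x. f x \<le> g x"
  shows "lineint f a b \<le> lineint g a b"
  unfolding lineint_def
  by (rule integral_mono[OF loc_int_orient[OF assms(1)] loc_int_orient[OF assms(2)]])
     (use assms in \<open>auto simp: orient_def\<close>)

lemma lineint_plus: 
  assumes "loc_int f" "loc_int g"
  shows "lineint (\<lambda>x. f x + g x) a b = lineint f a b + lineint g a b"
  using loc_int_orient[OF assms(1)] loc_int_orient[OF assms(2)] by (simp add: lineint_def distrib_left)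

lemma lineint_const: "lineint (\<lambda>_. c) a b = c * (b - a)"
proof (cases "a \<le> b")
  case True then show ?thesis by (simp add: lineint_eq)
next
  case False then show ?thesis using lineint_swap[of "\<lambda>_. c" b a] by (simp add: lineint_eq algebra_simps)
qed

lemma lineint_nonneg: "a \<le> b \<Longrightarrow> (\<And>x. 0 \<le> g x) \<Longrightarrow> 0 \<le> lineint g a b"
  unfolding lineint_def by (rule Bochner_Integration.integral_nonneg) (auto simp: orient_def)

text \<open>The function under the integral depends on the point \<open>x\<close>, so
  differentiation does not apply to it directly. It is applied to the countably many functions
  \<open>\<bar>w y - q\<bar>\<close> with rational \<open>q\<close>, outside one common null set,
  and \<open>w x\<close> is then approximated by some \<open>q\<close>.\<close>

lemma lebesgue_point_right:
  assumes w: "loc_int w"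
  shows "AE x in lborel. ((\<lambda>r. lineint (\<lambda>y. \<bar>w y - w x\<bar>) x (x + r) / r) \<longlongrightarrow> 0) (at_right 0)"
proof -
  have "AE x in lborel. \<forall>q\<in>\<rat>. ((\<lambda>r. lineint (\<lambda>y. \<bar>w y - q\<bar>) x (x + r) / r) \<longlongrightarrow> \<bar>w x - q\<bar>) (at_right 0)"
    by (rule AE_ball_countable'[OF _ countable_rat]) (rule lineint_right_deriv[OF loc_int_const_diff[OF w]])
  then show ?thesis
  proof eventually_elim
    case (elim x)
    show ?case
    proof (rule tendstoI)
      fix e :: real assume e: "e > 0"
      obtain q where q: "q \<in> \<rat>" "w x < q" "q < w x + e / 3"
        using Rats_dense_in_real[of "w x" "w x + e/3"] e by auto
      have "\<bar>w x - q\<bar> < e / 3" using q by auto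
      then have "\<forall>\<^sub>F r in at_right 0. lineint (\<lambda>y. \<bar>w y - q\<bar>) x (x + r) / r < e / 3"
        using order_tendstoD(2)[OF elim[rule_format, OF q(1)]] by blast
      moreover have "\<forall>\<^sub>F r in at_right (0::real). r > 0"
        by (simp add: eventually_at_filter)
      ultimately show "\<forall>\<^sub>F r in at_right 0. dist (lineint (\<lambda>y. \<bar>w y - w x\<bar>) x (x + r) / r) 0 < e"
      proof eventually_elim
        case (elim r)
        have "lineint (\<lambda>y. \<bar>w y - w x\<bar>) x (x + r) \<le> lineint (\<lambda>y. \<bar>w y - q\<bar> + \<bar>q - w x\<bar>) x (x + r)"
          by (rule lineint_mono) (use elim in \<open>auto intro!: loc_int_const_diff[OF w] loc_int_add\<close>)
        also have "\<dots> = lineint (\<lambda>y. \<bar>w y - q\<bar>) x (x + r) + \<bar>q - w x\<bar> * r"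
          by (subst lineint_plus) (auto intro!: loc_int_const_diff[OF w] simp: lineint_const)
        finally have "lineint (\<lambda>y. \<bar>w y - w x\<bar>) x (x + r) / r \<le> lineint (\<lambda>y. \<bar>w y - q\<bar>) x (x + r) / r + \<bar>q - w x\<bar>"
          using elim by (simp add: field_simps)
        also have "\<dots> < e / 3 + e / 3" using elim q by auto
        finally have "lineint (\<lambda>y. \<bar>w y - w x\<bar>) x (x + r) / r < e" using e by linarith
        moreover have "lineint (\<lambda>y. \<bar>w y - w x\<bar>) x (x + r) / r \<ge> 0"
          using elim by (intro divide_nonneg_nonneg lineint_nonneg) auto
        ultimately show ?case by simp
      qed
    qed
  qed
qed

lemma lineint_uminus:
  assumes [measurable]: "g \<in> borel_measurable borel"
  shows "lineint (\<lambda>x. g (- x)) a b = lineint g (- b) (- a)"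
proof -
  have "lineint g (- b) (- a) = (\<integral>s. orient (-b) (-a) (-s) * g (- s) \<partial>lborel)"
    unfolding lineint_def
    by (subst lborel_integral_real_affine[where c="-1" and t=0]) auto
  \<comment> \<open>Reflection moves the closed end of the half-open interval to the other side, so
    the integrands differ at the two endpoints.\<close>
  also have "\<dots> = lineint (\<lambda>x. g (- x)) a b" unfolding lineint_def
    by (rule integral_cong_AE) (use AE_lborel_singleton[of a] AE_lborel_singleton[of b] in \<open>auto simp: orient_def\<close>)
  finally show ?thesis by simp
qed

lemma loc_int_uminus:
  assumes "loc_int w" shows "loc_int (\<lambda>x. w (- x))"
  unfolding loc_int_def set_integrable_def
proof (intro conjI allI)
  have [measurable]: "w \<in> borel_measurable borel" using assms by (rule loc_int_measurable)
  show "(\<lambda>x. w (- x)) \<in> borel_measurable borel" by measurable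
  fix a b
  have "integrable lborel (\<lambda>x. indicat_real {-b..-a} (0 + (-1) * x) *\<^sub>R w (0 + (-1) * x))"
    by (rule lborel_integrable_real_affine) (use loc_intD[OF assms] in \<open>simp_all add: set_integrable_def\<close>)
  moreover have "indicat_real {-b..-a} (- x) = indicator {a..b} x" for x by (auto simp: indicator_def)
  ultimately show "integrable lborel (\<lambda>x. indicat_real {a..b} x *\<^sub>R w (- x))" by simp
qed

text \<open>The left half of the mean at \<open>x\<close> is the right half of the mean at
  \<open>- x\<close> for the reflected function.\<close>

lemma lebesgue_point:
  assumes w: "loc_int w"
  shows "AE x in lborel. ((\<lambda>r. lineint (\<lambda>y. \<bar>w y - w x\<bar>) (x - r) (x + r) / r) \<longlongrightarrow> 0) (at_right 0)"
proof -
  have [measurable]: "w \<in> borel_measurable borel" using w by (rule loc_int_measurable)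
  have "AE x in lborel. ((\<lambda>r. lineint (\<lambda>y. \<bar>w (- y) - w (- x)\<bar>) x (x + r) / r) \<longlongrightarrow> 0) (at_right 0)"
    by (rule lebesgue_point_right[OF loc_int_uminus[OF w]])
  from AE_affine_comp[OF this, of "-1" 0]
  have "AE x in lborel. ((\<lambda>r. lineint (\<lambda>y. \<bar>w (- y) - w x\<bar>) (- x) (- x + r) / r) \<longlongrightarrow> 0) (at_right 0)"
    by simp
  then show ?thesis using lebesgue_point_right[OF w]
  proof eventually_elim
    case (elim x)
    have "lineint (\<lambda>y. \<bar>w (- y) - w x\<bar>) (- x) (- x + r) / r + lineint (\<lambda>y. \<bar>w y - w x\<bar>) x (x + r) / r
      = lineint (\<lambda>y. \<bar>w y - w x\<bar>) (x - r) (x + r) / r" for r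
    proof -
      have "lineint (\<lambda>y. \<bar>w (- y) - w x\<bar>) (- x) (- x + r) = lineint (\<lambda>y. \<bar>w y - w x\<bar>) (x - r) x"
        using lineint_uminus[of "\<lambda>y. \<bar>w y - w x\<bar>" "- x" "- x + r"] by simp
      then show ?thesis
        using lineint_add[OF loc_int_const_diff[OF w], of "w x" "x - r" x "x + r"] by (simp add: add_divide_distrib[symmetric])
    qed
    then show ?case using tendsto_add[OF elim] by simp
  qed
qed

text \<open>The measure with density \<open>h\<close> is finite, and the squares shrink to one
  point, which has measure 0. Continuity from above gives the limit along the radii
  \<open>inverse (Suc n)\<close>, and monotonicity in the radius fills the gaps.\<close>

lemma small_square_tendsto:
  fixes h :: "pt \<Rightarrow> ennreal"
  assumes [measurable]: "h \<in> borel_measurable borel" and fin: "(\<integral>\<^sup>+ p. h p \<partial>lborel) < \<infinity>"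
  shows "((\<lambda>r. \<integral>\<^sup>+ p\<in>{x - r..x + r} \<times> {t - r..t + r}. h p \<partial>lborel) \<longlongrightarrow> 0) (at_right 0)"
proof -
  define Q where "Q r = {x - r..x + r} \<times> {t - r..t + r}" for r
  have [measurable]: "Q r \<in> sets borel" for r unfolding Q_def by (simp add: borel_Times)
  define M where "M = density lborel h"
  have M: "emeasure M (Q r) = (\<integral>\<^sup>+ p\<in>Q r. h p \<partial>lborel)" for r
    unfolding M_def by (rule emeasure_density) auto
  have "(\<lambda>n. emeasure M (Q (inverse (real (Suc n))))) \<longlonglongrightarrow> emeasure M (\<Inter>n. Q (inverse (real (Suc n))))"
  proof (rule Lim_emeasure_decseq)
    show "range (\<lambda>n. Q (inverse (real (Suc n)))) \<subseteq> sets M" by (auto simp: M_def)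
    show "decseq (\<lambda>n. Q (inverse (real (Suc n))))"
    proof (rule decseq_SucI)
      fix n
      have "inverse (real (Suc (Suc n))) \<le> inverse (real (Suc n))" by simp
      moreover have "Q a \<subseteq> Q b" if "a \<le> b" for a b using that unfolding Q_def by auto
      ultimately show "Q (inverse (real (Suc (Suc n)))) \<subseteq> Q (inverse (real (Suc n)))" by blast
    qed
    have "emeasure M (Q r) \<le> (\<integral>\<^sup>+ p. h p \<partial>lborel)" for r
      unfolding M by (rule nn_integral_mono) (auto simp: indicator_def)
    then show "emeasure M (Q (inverse (real (Suc i)))) \<noteq> \<infinity>" for i
      using fin by (metis infinity_ennreal_def leD top.not_eq_extremum)
  qed
  also have "(\<Inter>n. Q (inverse (real (Suc n)))) = {(x, t)}"
  proof -
    have *: "a = b" if "\<forall>n. b - inverse (real (Suc n)) \<le> a \<and> a \<le> b + inverse (real (Suc n))" for a b :: real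
    proof (rule ccontr)
      assume "a \<noteq> b"
      then obtain n where "inverse (real (Suc n)) < \<bar>a - b\<bar>" using reals_Archimedean[of "\<bar>a - b\<bar>"] by auto
      with that[rule_format, of n] show False by auto
    qed
    show ?thesis unfolding Q_def by (auto intro!: *)
  qed
  also have "emeasure M {(x, t)} = 0"
    unfolding M_def by (subst emeasure_density) (auto simp: nn_integral_0_iff_AE intro: AE_mp[OF AE_lborel_singleton[of "(x,t)"]])
  finally have lim: "(\<lambda>n. \<integral>\<^sup>+ p\<in>Q (inverse (real (Suc n))). h p \<partial>lborel) \<longlonglongrightarrow> 0" unfolding M .
  show ?thesis unfolding Q_def[symmetric]
  proof (rule order_tendstoI)
    fix e :: ennreal assume "0 < e"
    from order_tendstoD(2)[OF lim this] obtain n where n: "(\<integral>\<^sup>+ p\<in>Q (inverse (real (Suc n))). h p \<partial>lborel) < e"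
      by (auto simp: eventually_sequentially)
    have "(\<integral>\<^sup>+ p\<in>Q r. h p \<partial>lborel) < e" if "r < inverse (real (Suc n))" for r
    proof (rule le_less_trans[OF _ n])
      show "(\<integral>\<^sup>+ p\<in>Q r. h p \<partial>lborel) \<le> (\<integral>\<^sup>+ p\<in>Q (inverse (real (Suc n))). h p \<partial>lborel)"
        using that by (intro nn_integral_mono) (auto simp: Q_def indicator_def simp del: of_nat_Suc)
    qed
    then show "\<forall>\<^sub>F r in at_right 0. (\<integral>\<^sup>+ p\<in>Q r. h p \<partial>lborel) < e"
      unfolding eventually_at_right_field by (auto intro!: exI[of _ "inverse (real (Suc n))"] simp del: of_nat_Suc)
  qed auto
qed

lemma nn_integral_lineint:
  assumes "loc_int f" "a \<le> b" "\<And>x. 0 \<le> f x"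
  shows "(\<integral>\<^sup>+ y\<in>{a..b}. ennreal (f y) \<partial>lborel) = ennreal (lineint f a b)"
proof -
  have [measurable]: "f \<in> borel_measurable borel" using assms(1) by (rule loc_int_measurable)
  have "(\<integral>\<^sup>+ y\<in>{a..b}. ennreal (f y) \<partial>lborel) = (\<integral>\<^sup>+ y. ennreal (indicator {a..b} y * f y) \<partial>lborel)"
    by (rule nn_integral_cong) (auto simp: indicator_def)
  also have "\<dots> = ennreal (\<integral>y. indicator {a..b} y * f y \<partial>lborel)"
    by (rule nn_integral_eq_integral) (use loc_intD[OF assms(1), of a b] assms in \<open>auto simp: set_integrable_def\<close>)
  finally show ?thesis using assms by (simp add: lineint_eq)
qed

lemma ennreal_abs_triangle: "ennreal \<bar>a + b\<bar> \<le> ennreal \<bar>a\<bar> + ennreal \<bar>b\<bar>"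
  by (metis abs_ge_zero abs_triangle_ineq ennreal_leI ennreal_plus)

lemma ennreal_power2_le_imp_le:
  assumes "(a::ennreal)\<^sup>2 \<le> b\<^sup>2"
  shows "a \<le> b"
proof (cases a; cases b)
  fix x y assume "0 \<le> x" "a = ennreal x" "0 \<le> y" "b = ennreal y"
  then show ?thesis using assms power2_le_imp_le[of x y] by (auto simp: ennreal_power intro!: ennreal_leI)
qed (use assms in \<open>auto simp: power2_eq_square ennreal_mult_eq_top_iff top_unique\<close>)

text \<open>The function is given by its values \<open>w\<close> on a line and by vertical
  primitives started on that line. On a disc of radius \<open>r\<close> its deviation from
  \<open>w x\<close> is at most \<open>\<bar>w x' - w x\<bar>\<close>, small in mean at a Lebesgue
  point, plus the integral of \<open>\<bar>g\<bar>\<close> over a vertical segment of length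
  \<open>2 * r\<close>. By Cauchy-Schwarz the mean of the latter is bounded by the root of the
  energy in a square that shrinks to a point. Sloping lines are allowed because the diagonals will
  be needed.\<close>

lemma disc_mean_tendsto:
  fixes F :: "pt \<Rightarrow> real"
  assumes F: "\<And>K. compact K \<Longrightarrow> set_integrable lebesgue K F"
    and w: "loc_int w"
    and [measurable]: "g \<in> borel_measurable borel"
    and g: "\<And>x. loc_int (\<lambda>s. g (x, s))"
    and fin: "(\<integral>\<^sup>+ p. ennreal ((g p)\<^sup>2) \<partial>lborel) < \<infinity>"
    and al: "\<bar>\<alpha>\<bar> \<le> 1"
    and eq: "AE p in lborel. F p = w (fst p) + lineint (\<lambda>s. g (fst p, s)) (\<alpha> * fst p + \<beta>) (snd p)"
  shows "AE x in lborel. (disc_mean F (x, \<alpha> * x + \<beta>) \<longlongrightarrow> w x) (at_right 0)"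
  using lebesgue_point[OF w]
proof eventually_elim
  case (elim x)
  have [measurable]: "w \<in> borel_measurable borel" using w by (rule loc_int_measurable)
  define t where "t = \<alpha> * x + \<beta>"
  define I where "I r = {x - r..x + r}" for r
  define J where "J r = {t - r..t + r}" for r
  define L where "L r = lineint (\<lambda>y. \<bar>w y - w x\<bar>) (x - r) (x + r)" for r
  define \<epsilon> where "\<epsilon> r = (\<integral>\<^sup>+ p\<in>I r \<times> J r. ennreal ((g p)\<^sup>2) \<partial>lborel)" for r
  have [measurable]: "I r \<in> sets borel" "J r \<in> sets borel" "I r \<times> J r \<in> sets borel" for r
    by (auto simp: I_def J_def borel_Times)
  have eps0: "(\<epsilon> \<longlongrightarrow> 0) (at_right 0)"
    unfolding \<epsilon>_def I_def J_def by (rule small_square_tendsto) (use fin in auto)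
  have eps_fin: "\<epsilon> r < \<infinity>" for r
    unfolding \<epsilon>_def by (rule le_less_trans[OF nn_integral_mono fin]) (auto simp: indicator_def)
  \<comment> \<open>The disc is enlarged to its circumscribed square: the factor
    \<open>2 * r\<close> of the vertical side and the area \<open>pi * r^2\<close> of the disc give
    the constants.\<close>
  have bound: "\<bar>disc_mean F (x, t) r - w x\<bar> \<le> 2 / pi * (L r / r) + 4 / pi * sqrt (enn2real (\<epsilon> r))"
    if r: "r > 0" for r
  proof -
    let ?B = "ball (x, t) r"
    have B: "measure lebesgue ?B = pi * r\<^sup>2"
      using r by (simp add: content_ball unit_ball_vol_2 measure_completion power2_eq_square)
    have intF: "integrable lebesgue (\<lambda>q. indicator ?B q * F q)"
    proof -
      have "set_integrable lebesgue ?B F"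
        by (rule set_integrable_subset[OF F[of "cball (x, t) r"]]) auto
      then show ?thesis by (simp add: set_integrable_def)
    qed
    have intw: "integrable lebesgue (\<lambda>q. indicator ?B q * w x)"
      using emeasure_lborel_ball_finite[of "(x, t)" r] by (intro integrable_mult_left integrable_real_indicator) auto
    have "(\<integral>q. indicator ?B q * F q \<partial>lebesgue) - w x * (pi * r\<^sup>2) = (\<integral>q. indicator ?B q * (F q - w x) \<partial>lebesgue)"
      using intF intw by (simp add: right_diff_distrib B)
    then have d: "disc_mean F (x, t) r - w x = (\<integral>q. indicator ?B q * (F q - w x) \<partial>lebesgue) / (pi * r\<^sup>2)"
      using r by (simp add: disc_mean_def B field_simps)
    define K where "K x' = (\<integral>\<^sup>+ s\<in>J r. ennreal \<bar>g (x', s)\<bar> \<partial>lborel)" for x'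
    have [measurable]: "K \<in> borel_measurable borel" unfolding K_def by measurable
    have "ennreal \<bar>\<integral>q. indicator ?B q * (F q - w x) \<partial>lebesgue\<bar> \<le> (\<integral>\<^sup>+ q. ennreal \<bar>indicator ?B q * (F q - w x)\<bar> \<partial>lborel)"
      using ennreal_abs_integral_le[of lebesgue] by (simp add: nn_integral_completion)
    also have "\<dots> \<le> (\<integral>\<^sup>+ q\<in>I r \<times> J r. (ennreal \<bar>w (fst q) - w x\<bar> + K (fst q)) \<partial>lborel)"
    proof (rule nn_integral_mono_AE)
      show "AE q in lborel. ennreal \<bar>indicator ?B q * (F q - w x)\<bar> \<le> (ennreal \<bar>w (fst q) - w x\<bar> + K (fst q)) * indicator (I r \<times> J r) q"
        using eq
      proof eventually_elim
        case (elim q)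
        show ?case
        proof (cases "q \<in> ?B")
          case True
          obtain x' t' where q: "q = (x', t')" by (cases q)
          have "dist x x' < r" "dist t t' < r"
            using True dist_fst_le[of "(x,t)" q] dist_snd_le[of "(x,t)" q] by (auto simp: q)
          then have x't': "x' \<in> I r" "t' \<in> J r" and ax: "\<bar>x' - x\<bar> \<le> r" by (auto simp: I_def J_def dist_real_def)
          \<comment> \<open>Slope at most 1 keeps the starting point of the vertical segment inside
            the square.\<close>
          have "\<bar>\<alpha> * (x' - x)\<bar> \<le> 1 * r" unfolding abs_mult using al ax by (intro mult_mono) auto
          then have gx: "\<alpha> * x' + \<beta> \<in> J r" by (auto simp: J_def t_def algebra_simps)
          have "ennreal \<bar>lineint (\<lambda>s. g (x', s)) (\<alpha> * x' + \<beta>) t'\<bar> \<le> (\<integral>\<^sup>+ s\<in>{min (\<alpha> * x' + \<beta>) t'..max (\<alpha> * x' + \<beta>) t'}. ennreal \<bar>g (x', s)\<bar> \<partial>lborel)"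
            by (rule lineint_abs_le)
          also have "\<dots> \<le> K x'" unfolding K_def
            by (rule nn_integral_mono) (use gx x't' in \<open>auto simp: J_def indicator_def\<close>)
          finally have "ennreal \<bar>w x' - w x\<bar> + ennreal \<bar>lineint (\<lambda>s. g (x', s)) (\<alpha> * x' + \<beta>) t'\<bar> \<le> ennreal \<bar>w x' - w x\<bar> + K x'"
            by (rule add_left_mono)
          moreover have "ennreal \<bar>F q - w x\<bar> \<le> ennreal \<bar>w x' - w x\<bar> + ennreal \<bar>lineint (\<lambda>s. g (x', s)) (\<alpha> * x' + \<beta>) t'\<bar>"
            using elim ennreal_abs_triangle[of "w x' - w x" "lineint (\<lambda>s. g (x', s)) (\<alpha> * x' + \<beta>) t'"]
            by (simp add: q algebra_simps)
          ultimately have "ennreal \<bar>F q - w x\<bar> \<le> ennreal \<bar>w x' - w x\<bar> + K x'" by (rule order_trans[rotated])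
          then show ?thesis using True x't' by (simp add: q)
        qed (simp add: indicator_def)
      qed
    qed
    also have "\<dots> = (\<integral>\<^sup>+ x'. \<integral>\<^sup>+ t'. ((ennreal \<bar>w x' - w x\<bar> + K x') * indicator (I r) x') * indicator (J r) t' \<partial>lborel \<partial>lborel)"
      by (subst nn_integral_pt(1)) (auto simp: indicator_times mult.assoc)
    also have "\<dots> = (\<integral>\<^sup>+ x'. ((ennreal \<bar>w x' - w x\<bar> + K x') * indicator (I r) x') * ennreal (2 * r) \<partial>lborel)"
      using r by (subst nn_integral_cmult) (auto simp: J_def)
    also have "\<dots> = ((\<integral>\<^sup>+ x'. ennreal \<bar>w x' - w x\<bar> * indicator (I r) x' \<partial>lborel) + (\<integral>\<^sup>+ x'. K x' * indicator (I r) x' \<partial>lborel)) * ennreal (2 * r)"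
      by (subst nn_integral_multc) (auto simp: distrib_right nn_integral_add)
    also have "(\<integral>\<^sup>+ x'. ennreal \<bar>w x' - w x\<bar> * indicator (I r) x' \<partial>lborel) = ennreal (L r)"
      unfolding I_def L_def using r by (intro nn_integral_lineint loc_int_const_diff w) auto
    also have "(\<integral>\<^sup>+ x'. K x' * indicator (I r) x' \<partial>lborel) = (\<integral>\<^sup>+ p\<in>I r \<times> J r. ennreal \<bar>g p\<bar> \<partial>lborel)"
      unfolding K_def by (subst nn_integral_pt(1))
        (auto simp: indicator_times mult_ac nn_integral_cmult)
    also have "(\<integral>\<^sup>+ p\<in>I r \<times> J r. ennreal \<bar>g p\<bar> \<partial>lborel) \<le> ennreal (2 * r * sqrt (enn2real (\<epsilon> r)))"
    proof -
      have "(\<integral>\<^sup>+ p\<in>I r \<times> J r. ennreal \<bar>g p\<bar> \<partial>lborel)\<^sup>2 \<le> emeasure lborel (I r \<times> J r) * (\<integral>\<^sup>+ p\<in>I r \<times> J r. (ennreal \<bar>g p\<bar>)\<^sup>2 \<partial>lborel)"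
        by (rule nn_integral_sq_le) auto
      also have "emeasure lborel (I r \<times> J r) = ennreal (2 * r) * ennreal (2 * r)"
        unfolding lborel_prod[symmetric] using r by (subst lborel.emeasure_pair_measure_Times) (auto simp: I_def J_def)
      also have "(\<integral>\<^sup>+ p\<in>I r \<times> J r. (ennreal \<bar>g p\<bar>)\<^sup>2 \<partial>lborel) = \<epsilon> r"
        by (simp add: \<epsilon>_def ennreal_power2)
      also have "\<epsilon> r = ennreal (enn2real (\<epsilon> r))" using eps_fin[of r] by (simp add: less_top)
      also have "ennreal (2 * r) * ennreal (2 * r) * ennreal (enn2real (\<epsilon> r)) = (ennreal (2 * r * sqrt (enn2real (\<epsilon> r))))\<^sup>2"
        using r by (simp add: ennreal_mult[symmetric] ennreal_power power_mult_distrib, simp only: power2_eq_square, simp)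
      finally show ?thesis by (rule ennreal_power2_le_imp_le)
    qed
    finally have "ennreal \<bar>\<integral>q. indicator ?B q * (F q - w x) \<partial>lebesgue\<bar> \<le> (ennreal (L r) + ennreal (2 * r * sqrt (enn2real (\<epsilon> r)))) * ennreal (2 * r)"
      by (simp add: add_left_mono mult_right_mono)
    also have "\<dots> = ennreal ((L r + 2 * r * sqrt (enn2real (\<epsilon> r))) * (2 * r))"
      using r by (simp add: ennreal_mult ennreal_plus L_def lineint_nonneg)
    finally have "\<bar>\<integral>q. indicator ?B q * (F q - w x) \<partial>lebesgue\<bar> \<le> (L r + 2 * r * sqrt (enn2real (\<epsilon> r))) * (2 * r)"
      using r by (subst (asm) ennreal_le_iff) (auto simp: L_def intro!: mult_nonneg_nonneg add_nonneg_nonneg lineint_nonneg)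
    then have "\<bar>disc_mean F (x, t) r - w x\<bar> \<le> (L r + 2 * r * sqrt (enn2real (\<epsilon> r))) * (2 * r) / (pi * r\<^sup>2)"
      using r by (simp add: d abs_divide divide_right_mono)
    also have "\<dots> = 2 / pi * (L r / r) + 4 / pi * sqrt (enn2real (\<epsilon> r))"
      using r by (simp add: field_simps power2_eq_square)
    finally show ?thesis .
  qed
  have "((\<lambda>r. 2 / pi * (L r / r) + 4 / pi * sqrt (enn2real (\<epsilon> r))) \<longlongrightarrow> 2 / pi * 0 + 4 / pi * sqrt (enn2real 0)) (at_right 0)"
    using elim eps0 unfolding L_def
    by (intro tendsto_intros tendsto_enn2real) auto
  then have "((\<lambda>r. 2 / pi * (L r / r) + 4 / pi * sqrt (enn2real (\<epsilon> r))) \<longlongrightarrow> 0) (at_right 0)" by simp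
  then have "((\<lambda>r. disc_mean F (x, t) r - w x) \<longlongrightarrow> 0) (at_right 0)"
    by (rule Lim_null_comparison[rotated])
       (use bound in \<open>simp add: eventually_at_filter\<close>)
  then show ?case unfolding t_def by (simp add: LIM_zero_iff)
qed

section \<open>Hardy's inequality\<close>

lemma nn_integral_powr_minus_half:
  assumes "h \<ge> 0"
  shows "(\<integral>\<^sup>+ s\<in>{0..h}. ennreal (s powr (-1/2)) \<partial>lborel) = ennreal (2 * h powr (1/2))"
proof -
  have "((\<lambda>s. s powr (-1/2)) has_integral (h powr (-1/2 + 1) / (-1/2 + 1))) {0..h}"
    by (rule has_integral_powr_from_0) (use assms in auto)
  then have "((\<lambda>s. s powr (-1/2)) has_integral (2 * h powr (1/2))) {0..h}" by (simp add: mult.commute)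
  from nn_integral_has_integral_lebesgue[OF _ this]
  have "integral\<^sup>N lborel (\<lambda>s. indicator {0..h} s * s powr (-1/2)) = ennreal (2 * h powr (1/2))" by simp
  moreover have "(\<integral>\<^sup>+ s\<in>{0..h}. ennreal (s powr (-1/2)) \<partial>lborel) = integral\<^sup>N lborel (\<lambda>s. indicator {0..h} s * s powr (-1/2))"
    by (rule nn_integral_cong) (auto simp: indicator_def)
  ultimately show ?thesis by simp
qed

lemma nn_integral_powr_tail:
  assumes "s > 0"
  shows "(\<integral>\<^sup>+ h\<in>{s..}. ennreal (2 * h powr (-3/2)) \<partial>lborel) = ennreal (4 * s powr (-1/2))"
proof -
  have "(\<integral>\<^sup>+ h\<in>{s..}. ennreal (2 * h powr (-3/2)) \<partial>lborel) = ennreal (0 - (- 4 * s powr (-1/2)))"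
  proof (rule nn_integral_FTC_atLeast)
    show "DERIV (\<lambda>h. - 4 * h powr (-1/2)) h :> 2 * h powr (-3/2)" if "s \<le> h" for h
      using that assms by (auto intro!: derivative_eq_intros)
    show "((\<lambda>h::real. - 4 * h powr (-1/2)) \<longlongrightarrow> 0) at_top"
      by (intro tendsto_mult_right_zero tendsto_neg_powr filterlim_ident) (auto simp: divide_less_0_iff)
  qed auto
  then show ?thesis by simp
qed

lemma ennreal_powr_mult:
  assumes "a + b = c"
  shows "ennreal (s powr a) * ennreal (s powr b) = ennreal (s powr c)"
  by (subst ennreal_mult[symmetric]) (auto simp: assms[symmetric] powr_add)

text \<open>Cauchy-Schwarz with \<open>\<phi> s\<close> split as \<open>s powr (-1/4)\<close> times
  \<open>s powr (1/4) * \<phi> s\<close>, followed by Tonelli. The two elementary integrals are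
  \<open>2 * h powr (1/2)\<close> and, after interchange, \<open>4 * s powr (-1/2)\<close>; the
  remaining powers of \<open>s\<close> cancel and leave the constant 4.\<close>

lemma hardy:
  fixes \<phi> :: "real \<Rightarrow> ennreal"
  assumes [measurable]: "\<phi> \<in> borel_measurable borel"
  shows "(\<integral>\<^sup>+ h\<in>{0<..\<delta>}. (\<integral>\<^sup>+ s\<in>{0..h}. \<phi> s \<partial>lborel)\<^sup>2 * ennreal (1 / h\<^sup>2) \<partial>lborel)
    \<le> 4 * (\<integral>\<^sup>+ s\<in>{0..\<delta>}. (\<phi> s)\<^sup>2 \<partial>lborel)"
proof -
  define \<psi> where "\<psi> s = ennreal (s powr (1/2)) * (\<phi> s)\<^sup>2" for s
  have [measurable]: "\<psi> \<in> borel_measurable borel" unfolding \<psi>_def by measurable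
  have 1: "(\<integral>\<^sup>+ s\<in>{0..h}. \<phi> s \<partial>lborel)\<^sup>2 \<le> ennreal (2 * h powr (1/2)) * (\<integral>\<^sup>+ s\<in>{0..h}. \<psi> s \<partial>lborel)" if "h > 0" for h
  proof -
    let ?f = "\<lambda>s. ennreal (s powr (-1/4)) * indicator {0..h} s"
    let ?g = "\<lambda>s. ennreal (s powr (1/4)) * \<phi> s * indicator {0..h} s"
    have eq: "(\<integral>\<^sup>+ s\<in>{0..h}. \<phi> s \<partial>lborel) = (\<integral>\<^sup>+ s. ?f s * ?g s \<partial>lborel)"
    proof (rule nn_integral_cong_AE)
      \<comment> \<open>The splitting fails at \<open>s = 0\<close>, where \<open>powr\<close>
        returns 0.\<close>
      show "AE s in lborel. \<phi> s * indicator {0..h} s = ?f s * ?g s"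
        using AE_lborel_singleton[of 0]
      proof eventually_elim
        case (elim s)
        show ?case
        proof (cases "0 < s")
          case True
          have "ennreal (s powr (-1/4)) * ennreal (s powr (1/4)) = 1"
            by (subst ennreal_powr_mult[where c=0]) (use True in auto)
          then have "ennreal (s powr (-1/4)) * (ennreal (s powr (1/4)) * \<phi> s) = \<phi> s"
            unfolding mult.assoc[symmetric] by simp
          then show ?thesis by (cases "s \<in> {0..h}") simp_all
        next
          case False
          with elim show ?thesis by (auto simp: indicator_def)
        qed
      qed
    qed
    have "(\<integral>\<^sup>+ s\<in>{0..h}. \<phi> s \<partial>lborel)\<^sup>2 \<le> (\<integral>\<^sup>+ s. (?f s)\<^sup>2 \<partial>lborel) * (\<integral>\<^sup>+ s. (?g s)\<^sup>2 \<partial>lborel)"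
      unfolding eq by (rule Cauchy_Schwarz_nn_integral) auto
    also have "(\<integral>\<^sup>+ s. (?f s)\<^sup>2 \<partial>lborel) = (\<integral>\<^sup>+ s\<in>{0..h}. ennreal (s powr (-1/2)) \<partial>lborel)"
    proof (rule nn_integral_cong)
      fix s :: real
      have "ennreal (s powr (-1/4)) * ennreal (s powr (-1/4)) = ennreal (s powr (-1/2))"
        by (rule ennreal_powr_mult) simp
      then show "(?f s)\<^sup>2 = ennreal (s powr (-1/2)) * indicator {0..h} s"
        unfolding power2_eq_square by (cases "s \<in> {0..h}") simp_all
    qed
    also have "\<dots> = ennreal (2 * h powr (1/2))"
      using that by (intro nn_integral_powr_minus_half) auto
    also have "(\<integral>\<^sup>+ s. (?g s)\<^sup>2 \<partial>lborel) = (\<integral>\<^sup>+ s\<in>{0..h}. \<psi> s \<partial>lborel)"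
    proof (rule nn_integral_cong)
      fix s
      have "ennreal (s powr (1/4)) * ennreal (s powr (1/4)) = ennreal (s powr (1/2))"
        by (rule ennreal_powr_mult) simp
      from this[symmetric] have "(ennreal (s powr (1/4)) * \<phi> s)\<^sup>2 = \<psi> s"
        unfolding \<psi>_def power2_eq_square by (simp add: mult_ac)
      then show "(?g s)\<^sup>2 = \<psi> s * indicator {0..h} s"
        by (cases "s \<in> {0..h}") simp_all
    qed
    finally show ?thesis .
  qed
  \<comment> \<open>From \<open>s \<le> h\<close> and \<open>h \<le> \<delta>\<close> the bound by
    \<open>\<delta>\<close> is passed on to \<open>s\<close>; after that \<open>h\<close> may run up
    to infinity, where the tail integral is explicit.\<close>
  have "(\<integral>\<^sup>+ h\<in>{0<..\<delta>}. (\<integral>\<^sup>+ s\<in>{0..h}. \<phi> s \<partial>lborel)\<^sup>2 * ennreal (1 / h\<^sup>2) \<partial>lborel)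
    \<le> (\<integral>\<^sup>+ h. \<integral>\<^sup>+ s. ennreal (2 * h powr (-3/2)) * (if s \<le> h then 1 else 0) * (\<psi> s * indicator {0..\<delta>} s) \<partial>lborel \<partial>lborel)"
  proof (rule nn_integral_mono)
    fix h
    show "(\<integral>\<^sup>+ s\<in>{0..h}. \<phi> s \<partial>lborel)\<^sup>2 * ennreal (1 / h\<^sup>2) * indicator {0<..\<delta>} h
      \<le> (\<integral>\<^sup>+ s. ennreal (2 * h powr (-3/2)) * (if s \<le> h then 1 else 0) * (\<psi> s * indicator {0..\<delta>} s) \<partial>lborel)"
    proof (cases "h \<in> {0<..\<delta>}")
      case True
      then have h: "h > 0" by simp
      have "(\<integral>\<^sup>+ s\<in>{0..h}. \<phi> s \<partial>lborel)\<^sup>2 * ennreal (1 / h\<^sup>2) \<le> ennreal (2 * h powr (1/2)) * (\<integral>\<^sup>+ s\<in>{0..h}. \<psi> s \<partial>lborel) * ennreal (1 / h\<^sup>2)"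
        by (intro mult_right_mono 1 h) auto
      also have "\<dots> = (ennreal (2 * h powr (1/2)) * ennreal (1 / h\<^sup>2)) * (\<integral>\<^sup>+ s\<in>{0..h}. \<psi> s \<partial>lborel)" by (simp add: mult_ac)
      also have "ennreal (2 * h powr (1/2)) * ennreal (1 / h\<^sup>2) = ennreal (2 * h powr (-3/2))"
      proof -
        have "h powr (1/2) / h\<^sup>2 = h powr (1/2 - 2)"
          using h by (subst powr_diff) (simp add: powr_numeral)
        then have "2 * h powr (1/2) * (1 / h\<^sup>2) = 2 * h powr (-3/2)" by simp
        then show ?thesis by (subst ennreal_mult[symmetric]) simp_all
      qed
      also have "ennreal (2 * h powr (-3/2)) * (\<integral>\<^sup>+ s\<in>{0..h}. \<psi> s \<partial>lborel) = (\<integral>\<^sup>+ s. ennreal (2 * h powr (-3/2)) * (\<psi> s * indicator {0..h} s) \<partial>lborel)"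
        by (subst nn_integral_cmult) auto
      also have "\<dots> \<le> (\<integral>\<^sup>+ s. ennreal (2 * h powr (-3/2)) * (if s \<le> h then 1 else 0) * (\<psi> s * indicator {0..\<delta>} s) \<partial>lborel)"
        by (rule nn_integral_mono) (use True in \<open>auto simp: indicator_def\<close>)
      finally show ?thesis using True by simp
    qed simp
  qed
  also have "\<dots> = (\<integral>\<^sup>+ s. \<integral>\<^sup>+ h. ennreal (2 * h powr (-3/2)) * (if s \<le> h then 1 else 0) * (\<psi> s * indicator {0..\<delta>} s) \<partial>lborel \<partial>lborel)"
    by (rule lborel_pair.Fubini') measurable
  also have "\<dots> = (\<integral>\<^sup>+ s. (\<integral>\<^sup>+ h\<in>{s..}. ennreal (2 * h powr (-3/2)) \<partial>lborel) * (\<psi> s * indicator {0..\<delta>} s) \<partial>lborel)"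
  proof (rule nn_integral_cong)
    fix s :: real
    have "(\<integral>\<^sup>+ h. ennreal (2 * h powr (-3/2)) * (if s \<le> h then 1 else 0) * (\<psi> s * indicator {0..\<delta>} s) \<partial>lborel)
      = (\<integral>\<^sup>+ h. ennreal (2 * h powr (-3/2)) * indicator {s..} h * (\<psi> s * indicator {0..\<delta>} s) \<partial>lborel)"
      by (rule nn_integral_cong) (auto simp: indicator_def)
    also have "\<dots> = (\<integral>\<^sup>+ h\<in>{s..}. ennreal (2 * h powr (-3/2)) \<partial>lborel) * (\<psi> s * indicator {0..\<delta>} s)"
      by (rule nn_integral_multc) measurable
    finally show "(\<integral>\<^sup>+ h. ennreal (2 * h powr (-3/2)) * (if s \<le> h then 1 else 0) * (\<psi> s * indicator {0..\<delta>} s) \<partial>lborel)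
      = (\<integral>\<^sup>+ h\<in>{s..}. ennreal (2 * h powr (-3/2)) \<partial>lborel) * (\<psi> s * indicator {0..\<delta>} s)" .
  qed
  also have "\<dots> = (\<integral>\<^sup>+ s. 4 * ((\<phi> s)\<^sup>2 * indicator {0..\<delta>} s) \<partial>lborel)"
  proof (rule nn_integral_cong_AE)
    show "AE s in lborel. (\<integral>\<^sup>+ h\<in>{s..}. ennreal (2 * h powr (-3/2)) \<partial>lborel) * (\<psi> s * indicator {0..\<delta>} s) = 4 * ((\<phi> s)\<^sup>2 * indicator {0..\<delta>} s)"
      using AE_lborel_singleton[of 0]
    proof eventually_elim
      case (elim s)
      show ?case
      proof (cases "0 < s")
        case True
        have "ennreal (4 * s powr (-1/2)) * ennreal (s powr (1/2)) = 4"
        proof (subst ennreal_mult[symmetric])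
          have "s powr (-1/2) * s powr (1/2) = 1" using True by (subst powr_add[symmetric]) simp
          then have "4 * s powr (-1/2) * s powr (1/2) = 4" unfolding mult.assoc by (simp only: mult_1_right)
          then show "ennreal (4 * s powr (-1/2) * s powr (1/2)) = 4" by (simp only: ennreal_numeral)
        qed auto
        then show ?thesis
          unfolding nn_integral_powr_tail[OF True] \<psi>_def mult.assoc[symmetric] by simp
      next
        case False
        with elim show ?thesis by (auto simp: indicator_def)
      qed
    qed
  qed
  also have "\<dots> = 4 * (\<integral>\<^sup>+ s\<in>{0..\<delta>}. (\<phi> s)\<^sup>2 \<partial>lborel)"
    by (subst nn_integral_cmult) auto
  finally show ?thesis .
qed

section \<open>The grid norm of functions absolutely continuous on lines\<close>

definition edge :: "real \<Rightarrow> (real \<Rightarrow> real) \<Rightarrow> real \<Rightarrow> ennreal" where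
  "edge \<delta> p a = (\<integral>\<^sup>+ x\<in>{0..\<delta>}. \<integral>\<^sup>+ y\<in>{0..\<delta>}. ennreal ((p (a + x) - p (a + y))\<^sup>2 / (x - y)\<^sup>2) \<partial>lborel \<partial>lborel)"

definition cross :: "real \<Rightarrow> (real \<Rightarrow> real) \<Rightarrow> (real \<Rightarrow> real) \<Rightarrow> real \<Rightarrow> real \<Rightarrow> ennreal" where
  "cross \<delta> p q a b = (\<integral>\<^sup>+ x\<in>{-\<delta>..\<delta>}. ennreal ((p (a + x) - q (b + x))\<^sup>2 / \<bar>x\<bar>) \<partial>lborel)"

definition straight :: "real \<Rightarrow> (real \<Rightarrow> real) \<Rightarrow> real \<Rightarrow> ennreal" where
  "straight \<delta> p a = (\<integral>\<^sup>+ x\<in>{0..\<delta>}. ennreal ((p (a + x) - p (a - x))\<^sup>2 / x) \<partial>lborel)"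

text \<open>The two lines through the vertex carry independent functions of one variable instead of
  a single function of the plane, so that horizontal and vertical lines may be given values from
  different versions.\<close>

definition vertex :: "real \<Rightarrow> (real \<Rightarrow> real) \<Rightarrow> (real \<Rightarrow> real) \<Rightarrow> real \<Rightarrow> real \<Rightarrow> ennreal" where
  "vertex \<delta> p q a b = edge \<delta> p a + edge \<delta> q b + cross \<delta> p q a b + straight \<delta> p a + straight \<delta> q b"

lemma H12_norm2_vertex:
  "H12_norm2 \<delta> f = (\<integral>\<^sup>+ jk. vertex \<delta> (\<lambda>x. f (x, of_int (snd jk) * \<delta>)) (\<lambda>t. f (of_int (fst jk) * \<delta>, t))
     (of_int (fst jk) * \<delta>) (of_int (snd jk) * \<delta>) \<partial>count_space UNIV)"
  unfolding H12_norm2_def Let_def vertex_def edge_def cross_def straight_def nn_integral_completion ..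

lemma AE_shift: "AE x::real in lborel. P x \<Longrightarrow> AE x in lborel. P (a + x)"
  using AE_affine_comp[of P 1 a] by simp

lemma AE_reflect: "AE x::real in lborel. P x \<Longrightarrow> AE x in lborel. P (a - x)"
  using AE_affine_comp[of P "-1" a] by simp

text \<open>The norm sees traces only up to null sets of each line; this allows the traces to be
  replaced by the continuous versions in (a), and the data by Borel ones in (b).\<close>

lemma vertex_cong_AE:
  assumes p: "AE x in lborel. p x = p' x" and q: "AE x in lborel. q x = q' x"
  shows "vertex \<delta> p q a b = vertex \<delta> p' q' a b"
proof -
  have e: "edge \<delta> p a = edge \<delta> p' a" if "AE x in lborel. p x = p' x" for p p' a
    unfolding edge_def
  proof (rule nn_integral_cong_AE, use AE_shift[OF that, of a] in eventually_elim)
    case (elim x)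
    have "(\<integral>\<^sup>+ y\<in>{0..\<delta>}. ennreal ((p (a + x) - p (a + y))\<^sup>2 / (x - y)\<^sup>2) \<partial>lborel)
      = (\<integral>\<^sup>+ y\<in>{0..\<delta>}. ennreal ((p' (a + x) - p' (a + y))\<^sup>2 / (x - y)\<^sup>2) \<partial>lborel)"
      by (rule nn_integral_cong_AE, use AE_shift[OF that, of a] in eventually_elim) (use elim in simp)
    then show ?case by simp
  qed
  have s: "straight \<delta> p a = straight \<delta> p' a" if "AE x in lborel. p x = p' x" for p p' a
    unfolding straight_def
    by (rule nn_integral_cong_AE, use AE_shift[OF that, of a] AE_reflect[OF that, of a] in eventually_elim) simp
  have c: "cross \<delta> p q a b = cross \<delta> p' q' a b"
    unfolding cross_def
    by (rule nn_integral_cong_AE, use AE_shift[OF p, of a] AE_shift[OF q, of b] in eventually_elim) simp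
  show ?thesis unfolding vertex_def c e[OF p] e[OF q] s[OF p] s[OF q] ..
qed

lemma set_nn_integral_shift:
  fixes f :: "real \<Rightarrow> ennreal"
  assumes [measurable]: "f \<in> borel_measurable borel"
  shows "(\<integral>\<^sup>+ x\<in>{c..d}. f (a + x) \<partial>lborel) = (\<integral>\<^sup>+ x\<in>{a + c..a + d}. f x \<partial>lborel)"
  by (subst (2) nn_integral_real_affine[where c=1 and t=a]) (auto simp: indicator_def intro!: nn_integral_cong)

lemma set_nn_integral_reflect:
  fixes f :: "real \<Rightarrow> ennreal"
  assumes [measurable]: "f \<in> borel_measurable borel"
  shows "(\<integral>\<^sup>+ x\<in>{c..d}. f (a - x) \<partial>lborel) = (\<integral>\<^sup>+ x\<in>{a - d..a - c}. f x \<partial>lborel)"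
  by (subst (2) nn_integral_real_affine[where c="-1" and t=a]) (auto simp: indicator_def intro!: nn_integral_cong)

lemma ennreal_divide_le:
  assumes "ennreal Y \<le> ennreal c * A" "c > 0" "Y \<ge> 0"
  shows "ennreal (Y / c) \<le> A"
proof (cases A)
  case (real r)
  then show ?thesis using assms by (simp add: ennreal_mult[symmetric] ennreal_le_iff pos_divide_le_eq mult.commute)
qed simp

lemma sq_add2: "((a::real) + b)\<^sup>2 \<le> 2 * (a\<^sup>2 + b\<^sup>2)"
  using sum_squares_bound[of a b] by (simp add: power2_sum)

lemma sq_add3: "((a::real) + b + c)\<^sup>2 \<le> 3 * (a\<^sup>2 + b\<^sup>2 + c\<^sup>2)"
  using sum_squares_bound[of a b] sum_squares_bound[of a c] sum_squares_bound[of b c] by (simp add: power2_sum algebra_simps)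

text \<open>By symmetry the double integral is twice its part with \<open>y > x\<close>, and
  \<open>h = y - x\<close> becomes the outer variable. For fixed \<open>h\<close> both endpoints can
  be joined by a detour at height \<open>h\<close>, uniformly along the edge.\<close>

lemma edge_le:
  assumes [measurable]: "p \<in> borel_measurable borel"
  shows "edge \<delta> p a \<le> 2 * (\<integral>\<^sup>+ h\<in>{0<..\<delta>}. \<integral>\<^sup>+ x\<in>{0..\<delta> - h}. ennreal ((p (a + x + h) - p (a + x))\<^sup>2 / h\<^sup>2) \<partial>lborel \<partial>lborel)"
proof -
  \<comment> \<open>The diagonal is left out without loss, since the difference vanishes
    there.\<close>
  define \<Psi> where "\<Psi> x y = ennreal ((p (a + y) - p (a + x))\<^sup>2 / (y - x)\<^sup>2) * (indicator {0..} x * indicator {0<..} (y - x) * indicator {..\<delta>} y)" for x y :: real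
  have [measurable]: "case_prod \<Psi> \<in> borel_measurable (borel \<Otimes>\<^sub>M borel)" unfolding \<Psi>_def by measurable
  have [measurable]: "case_prod (\<lambda>x y. \<Psi> y x) \<in> borel_measurable (borel \<Otimes>\<^sub>M borel)" unfolding \<Psi>_def by measurable
  have "edge \<delta> p a = (\<integral>\<^sup>+ x. \<integral>\<^sup>+ y. ennreal ((p (a + x) - p (a + y))\<^sup>2 / (x - y)\<^sup>2) * indicator {0..\<delta>} y * indicator {0..\<delta>} x \<partial>lborel \<partial>lborel)"
    unfolding edge_def by (subst nn_integral_multc) auto
  also have "\<dots> \<le> (\<integral>\<^sup>+ x. \<integral>\<^sup>+ y. \<Psi> x y + \<Psi> y x \<partial>lborel \<partial>lborel)"
    by (intro nn_integral_mono) (auto simp: \<Psi>_def indicator_def power2_commute)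
  also have "\<dots> = (\<integral>\<^sup>+ x. \<integral>\<^sup>+ y. \<Psi> x y \<partial>lborel \<partial>lborel) + (\<integral>\<^sup>+ x. \<integral>\<^sup>+ y. \<Psi> y x \<partial>lborel \<partial>lborel)"
    by (simp add: nn_integral_add)
  also have "(\<integral>\<^sup>+ x. \<integral>\<^sup>+ y. \<Psi> y x \<partial>lborel \<partial>lborel) = (\<integral>\<^sup>+ y. \<integral>\<^sup>+ x. \<Psi> y x \<partial>lborel \<partial>lborel)"
    by (rule lborel_pair.Fubini') measurable
  also have "(\<integral>\<^sup>+ x. \<integral>\<^sup>+ y. \<Psi> x y \<partial>lborel \<partial>lborel) = (\<integral>\<^sup>+ x. \<integral>\<^sup>+ h. \<Psi> x (x + h) \<partial>lborel \<partial>lborel)"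
  proof (rule nn_integral_cong)
    fix x :: real
    show "(\<integral>\<^sup>+ y. \<Psi> x y \<partial>lborel) = (\<integral>\<^sup>+ h. \<Psi> x (x + h) \<partial>lborel)"
      using nn_integral_real_affine[of "\<Psi> x" 1 x] by simp
  qed
  also have "\<dots> = (\<integral>\<^sup>+ h. \<integral>\<^sup>+ x. \<Psi> x (x + h) \<partial>lborel \<partial>lborel)"
    by (rule lborel_pair.Fubini') measurable
  also have "\<dots> = (\<integral>\<^sup>+ h\<in>{0<..\<delta>}. \<integral>\<^sup>+ x\<in>{0..\<delta> - h}. ennreal ((p (a + x + h) - p (a + x))\<^sup>2 / h\<^sup>2) \<partial>lborel \<partial>lborel)"
  proof (rule nn_integral_cong)
    fix h :: real
    have "(\<integral>\<^sup>+ x. \<Psi> x (x + h) \<partial>lborel) = (\<integral>\<^sup>+ x. ennreal ((p (a + x + h) - p (a + x))\<^sup>2 / h\<^sup>2) * indicator {0..\<delta> - h} x * indicator {0<..\<delta>} h \<partial>lborel)"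
      by (intro nn_integral_cong) (auto simp: \<Psi>_def indicator_def algebra_simps)
    then show "(\<integral>\<^sup>+ x. \<Psi> x (x + h) \<partial>lborel) = (\<integral>\<^sup>+ x\<in>{0..\<delta> - h}. ennreal ((p (a + x + h) - p (a + x))\<^sup>2 / h\<^sup>2) \<partial>lborel) * indicator {0<..\<delta>} h"
      by (simp add: nn_integral_multc)
  qed
  finally show ?thesis by (simp add: mult_2)
qed

text \<open>\<open>V\<close> and \<open>H\<close> are versions of the same function, absolutely continuous on vertical and on horizontal lines.
  The values on a horizontal line of the grid are those of \<open>V\<close>, and those on a vertical line are those of \<open>H\<close>.
  The last two assumptions allow paths to change direction on the diagonals, which are null sets of the plane.\<close>

locale two_versions =
  fixes V H g1 g2 :: "pt \<Rightarrow> real"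
  assumes V_meas [measurable]: "V \<in> borel_measurable borel" and H_meas [measurable]: "H \<in> borel_measurable borel"
    and g1_meas [measurable]: "g1 \<in> borel_measurable borel" and g2_meas [measurable]: "g2 \<in> borel_measurable borel"
    and V_le: "\<And>x t t'. ennreal \<bar>V (x, t') - V (x, t)\<bar> \<le> (\<integral>\<^sup>+ s\<in>{min t t'..max t t'}. ennreal \<bar>g2 (x, s)\<bar> \<partial>lborel)"
    and H_le: "\<And>x x' t. ennreal \<bar>H (x', t) - H (x, t)\<bar> \<le> (\<integral>\<^sup>+ s\<in>{min x x'..max x x'}. ennreal \<bar>g1 (s, t)\<bar> \<partial>lborel)"
    and VH: "AE p in lborel. V p = H p"
    and VH_diag: "\<And>c. AE x in lborel. V (x, x + c) = H (x, x + c)"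
    and VH_anti: "\<And>c. AE x in lborel. V (x, c - x) = H (x, c - x)"
begin

text \<open>Exchanging the coordinates turns estimates on horizontal lines into those on vertical
  lines. A diagonal with offset \<open>c\<close> becomes the one with offset \<open>- c\<close>,
  while each antidiagonal is mapped to itself.\<close>

lemma two_versions_swap: "two_versions (H \<circ> prod.swap) (V \<circ> prod.swap) (g2 \<circ> prod.swap) (g1 \<circ> prod.swap)"
proof
  show "AE p in lborel. (H \<circ> prod.swap) p = (V \<circ> prod.swap) p"
    using AE_swap[OF VH] by (auto simp: eq_commute)
  show "AE x in lborel. (H \<circ> prod.swap) (x, x + c) = (V \<circ> prod.swap) (x, x + c)" for c
    using AE_shift[OF VH_diag[of "- c"], of c] by (auto simp: eq_commute add.commute)
  show "AE x in lborel. (H \<circ> prod.swap) (x, c - x) = (V \<circ> prod.swap) (x, c - x)" for c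
    using AE_reflect[OF VH_anti[of c], of c] by (auto simp: eq_commute)
qed (use V_le H_le in \<open>auto simp: comp_def\<close>)

lemma V_sq_le: "ennreal ((V (x, t') - V (x, t))\<^sup>2) \<le> ennreal \<bar>t' - t\<bar> * (\<integral>\<^sup>+ s\<in>{min t t'..max t t'}. ennreal ((g2 (x, s))\<^sup>2) \<partial>lborel)"
proof -
  have "ennreal ((V (x, t') - V (x, t))\<^sup>2) \<le> (\<integral>\<^sup>+ s\<in>{min t t'..max t t'}. ennreal \<bar>g2 (x, s)\<bar> \<partial>lborel)\<^sup>2"
    unfolding ennreal_power2 by (intro power_mono V_le) auto
  also have "\<dots> \<le> emeasure lborel {min t t'..max t t'} * (\<integral>\<^sup>+ s\<in>{min t t'..max t t'}. (ennreal \<bar>g2 (x, s)\<bar>)\<^sup>2 \<partial>lborel)"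
    by (rule nn_integral_sq_le) auto
  also have "emeasure lborel {min t t'..max t t'} = ennreal \<bar>t' - t\<bar>"
    by (auto simp: min_def max_def)
  finally show ?thesis by (simp add: ennreal_power2)
qed

lemma H_sq_le: "ennreal ((H (x', t) - H (x, t))\<^sup>2) \<le> ennreal \<bar>x' - x\<bar> * (\<integral>\<^sup>+ s\<in>{min x x'..max x x'}. ennreal ((g1 (s, t))\<^sup>2) \<partial>lborel)"
  using two_versions.V_sq_le[OF two_versions_swap, of t x' x] by simp

section \<open>Paths in the squares around a vertex\<close>

definition energy :: "real \<Rightarrow> real \<Rightarrow> real \<Rightarrow> ennreal" where
  "energy \<delta> a b = (\<integral>\<^sup>+ p\<in>{a - \<delta>..a + \<delta>} \<times> {b - \<delta>..b + \<delta>}. ennreal ((g1 p)\<^sup>2 + (g2 p)\<^sup>2) \<partial>lborel)"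

definition A1 :: "real \<Rightarrow> real \<Rightarrow> real \<Rightarrow> ennreal" where
  "A1 \<delta> a t = (\<integral>\<^sup>+ s\<in>{a - \<delta>..a + \<delta>}. ennreal ((g1 (s, t))\<^sup>2) \<partial>lborel)"

definition A2 :: "real \<Rightarrow> real \<Rightarrow> real \<Rightarrow> ennreal" where
  "A2 \<delta> b x = (\<integral>\<^sup>+ s\<in>{b - \<delta>..b + \<delta>}. ennreal ((g2 (x, s))\<^sup>2) \<partial>lborel)"

lemma A_meas [measurable]: "A1 \<delta> a \<in> borel_measurable borel" "A2 \<delta> b \<in> borel_measurable borel"
  unfolding A1_def A2_def by measurable

lemma energy_split:
  "(\<integral>\<^sup>+ t\<in>{b - \<delta>..b + \<delta>}. A1 \<delta> a t \<partial>lborel) + (\<integral>\<^sup>+ x\<in>{a - \<delta>..a + \<delta>}. A2 \<delta> b x \<partial>lborel) = energy \<delta> a b"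
proof -
  have [measurable]: "{a - \<delta>..a + \<delta>} \<times> {b - \<delta>..b + \<delta>} \<in> sets borel" by (simp add: borel_Times)
  have "energy \<delta> a b = (\<integral>\<^sup>+ p\<in>{a - \<delta>..a + \<delta>} \<times> {b - \<delta>..b + \<delta>}. ennreal ((g1 p)\<^sup>2) \<partial>lborel) + (\<integral>\<^sup>+ p\<in>{a - \<delta>..a + \<delta>} \<times> {b - \<delta>..b + \<delta>}. ennreal ((g2 p)\<^sup>2) \<partial>lborel)"
    unfolding energy_def by (subst nn_integral_add[symmetric]) (auto simp: distrib_right)
  also have "(\<integral>\<^sup>+ p\<in>{a - \<delta>..a + \<delta>} \<times> {b - \<delta>..b + \<delta>}. ennreal ((g1 p)\<^sup>2) \<partial>lborel) = (\<integral>\<^sup>+ t\<in>{b - \<delta>..b + \<delta>}. A1 \<delta> a t \<partial>lborel)"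
    unfolding A1_def by (subst nn_integral_pt(2)) (auto simp: indicator_times nn_integral_multc[symmetric] mult.assoc)
  also have "(\<integral>\<^sup>+ p\<in>{a - \<delta>..a + \<delta>} \<times> {b - \<delta>..b + \<delta>}. ennreal ((g2 p)\<^sup>2) \<partial>lborel) = (\<integral>\<^sup>+ x\<in>{a - \<delta>..a + \<delta>}. A2 \<delta> b x \<partial>lborel)"
    unfolding A2_def by (subst nn_integral_pt(1)) (auto intro!: nn_integral_cong simp: indicator_def nn_integral_multc[symmetric])
  finally show ?thesis by simp
qed

lemma V_step:
  assumes "\<bar>t' - b\<bar> \<le> \<delta>" "\<bar>t - b\<bar> \<le> \<delta>"
  shows "ennreal ((V (x, t') - V (x, t))\<^sup>2) \<le> ennreal \<bar>t' - t\<bar> * A2 \<delta> b x"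
  unfolding A2_def
  by (rule order_trans[OF V_sq_le mult_left_mono[OF nn_integral_mono]]) (use assms in \<open>auto simp: indicator_def\<close>)

lemma H_step:
  assumes "\<bar>x' - a\<bar> \<le> \<delta>" "\<bar>x - a\<bar> \<le> \<delta>"
  shows "ennreal ((H (x', t) - H (x, t))\<^sup>2) \<le> ennreal \<bar>x' - x\<bar> * A1 \<delta> a t"
  unfolding A1_def
  by (rule order_trans[OF H_sq_le mult_left_mono[OF nn_integral_mono]]) (use assms in \<open>auto simp: indicator_def\<close>)

text \<open>The path goes vertically from \<open>(a + x, b)\<close> to \<open>(a + x, b + x)\<close>
  along \<open>V\<close>, then horizontally to \<open>(a, b + x)\<close> along \<open>H\<close>. It
  changes version on the diagonal through the vertex, and both legs have length
  \<open>\<bar>x\<bar>\<close>, which cancels the weight.\<close>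

lemma cross_le: "cross \<delta> (\<lambda>x. V (x, b)) (\<lambda>t. H (a, t)) a b \<le> 2 * energy \<delta> a b"
proof -
  have "cross \<delta> (\<lambda>x. V (x, b)) (\<lambda>t. H (a, t)) a b \<le> (\<integral>\<^sup>+ x\<in>{-\<delta>..\<delta>}. 2 * (A1 \<delta> a (b + x) + A2 \<delta> b (a + x)) \<partial>lborel)"
    unfolding cross_def
  proof (rule nn_integral_mono_AE, use AE_shift[OF VH_diag[of "b - a"], of a] AE_lborel_singleton[of 0] in eventually_elim)
    case (elim x)
    show ?case
    proof (cases "\<bar>x\<bar> \<le> \<delta>")
      case True
      have "ennreal ((V (a + x, b) - H (a, b + x))\<^sup>2) \<le> ennreal (2 * ((V (a + x, b) - V (a + x, b + x))\<^sup>2 + (H (a + x, b + x) - H (a, b + x))\<^sup>2))"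
        using sq_add2[of "V (a + x, b) - V (a + x, b + x)" "H (a + x, b + x) - H (a, b + x)"] elim by (intro ennreal_leI) (simp add: algebra_simps)
      also have "\<dots> = 2 * (ennreal ((V (a + x, b) - V (a + x, b + x))\<^sup>2) + ennreal ((H (a + x, b + x) - H (a, b + x))\<^sup>2))"
        by (simp add: ennreal_mult)
      also have "\<dots> \<le> 2 * (ennreal \<bar>b - (b + x)\<bar> * A2 \<delta> b (a + x) + ennreal \<bar>a + x - a\<bar> * A1 \<delta> a (b + x))"
        by (intro mult_left_mono add_mono V_step H_step) (use True in auto)
      also have "\<dots> = ennreal \<bar>x\<bar> * (2 * (A1 \<delta> a (b + x) + A2 \<delta> b (a + x)))"
        by (simp add: distrib_left mult_ac add_ac)
      finally have "ennreal ((V (a + x, b) - H (a, b + x))\<^sup>2 / \<bar>x\<bar>) \<le> 2 * (A1 \<delta> a (b + x) + A2 \<delta> b (a + x))"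
        by (rule ennreal_divide_le) (use elim in auto)
      then show ?thesis by (intro mult_right_mono) auto
    qed (auto simp: indicator_def)
  qed
  also have "\<dots> = 2 * ((\<integral>\<^sup>+ x\<in>{-\<delta>..\<delta>}. A1 \<delta> a (b + x) \<partial>lborel) + (\<integral>\<^sup>+ x\<in>{-\<delta>..\<delta>}. A2 \<delta> b (a + x) \<partial>lborel))"
    by (simp add: nn_integral_cmult nn_integral_add distrib_right mult.assoc)
  also have "\<dots> = 2 * energy \<delta> a b"
    by (simp add: set_nn_integral_shift energy_split[symmetric])
  finally show ?thesis .
qed

lemma set_nn_integral_sub:
  fixes f :: "real \<Rightarrow> ennreal"
  shows "A \<subseteq> B \<Longrightarrow> (\<integral>\<^sup>+ x\<in>A. f x \<partial>lborel) \<le> (\<integral>\<^sup>+ x\<in>B. f x \<partial>lborel)"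
  by (intro nn_integral_mono) (auto simp: indicator_def)

text \<open>The path rises from \<open>(a + x, b)\<close> to height \<open>b + x\<close>, crosses to
  \<open>a - x\<close> and descends. One corner is on the diagonal and one on the antidiagonal of
  the vertex. The middle leg has length \<open>2 * x\<close>, and two vertical legs are estimated by
  the same integral, so both directions end with the factor 3 * 2.\<close>

lemma straight_le: "straight \<delta> (\<lambda>x. V (x, b)) a \<le> 6 * energy \<delta> a b"
proof -
  have "straight \<delta> (\<lambda>x. V (x, b)) a \<le> (\<integral>\<^sup>+ x\<in>{0..\<delta>}. 3 * (A2 \<delta> b (a + x) + 2 * A1 \<delta> a (b + x) + A2 \<delta> b (a - x)) \<partial>lborel)"
    unfolding straight_def
  proof (rule nn_integral_mono_AE, use AE_shift[OF VH_diag[of "b - a"], of a] AE_reflect[OF VH_anti[of "b + a"], of a] AE_lborel_singleton[of 0] in eventually_elim)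
    case (elim x)
    show ?case
    proof (cases "x \<in> {0..\<delta>}")
      case True
      then have x: "0 < x" "x \<le> \<delta>" using elim by auto
      have eq: "V (a + x, b + x) = H (a + x, b + x)" "V (a - x, b + x) = H (a - x, b + x)"
        using elim by (auto simp: algebra_simps)
      have "ennreal ((V (a + x, b) - V (a - x, b))\<^sup>2) \<le> ennreal (3 * ((V (a + x, b) - V (a + x, b + x))\<^sup>2 + (H (a + x, b + x) - H (a - x, b + x))\<^sup>2 + (V (a - x, b + x) - V (a - x, b))\<^sup>2))"
        using sq_add3[of "V (a + x, b) - V (a + x, b + x)" "H (a + x, b + x) - H (a - x, b + x)" "V (a - x, b + x) - V (a - x, b)"] eq by (intro ennreal_leI) (simp add: algebra_simps)
      also have "\<dots> = 3 * (ennreal ((V (a + x, b) - V (a + x, b + x))\<^sup>2) + ennreal ((H (a + x, b + x) - H (a - x, b + x))\<^sup>2) + ennreal ((V (a - x, b + x) - V (a - x, b))\<^sup>2))"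
        by (simp add: ennreal_mult)
      also have "\<dots> \<le> 3 * (ennreal \<bar>b - (b + x)\<bar> * A2 \<delta> b (a + x) + ennreal \<bar>(a + x) - (a - x)\<bar> * A1 \<delta> a (b + x) + ennreal \<bar>b + x - b\<bar> * A2 \<delta> b (a - x))"
        by (intro mult_left_mono add_mono V_step H_step) (use x in auto)
      also have "\<dots> = ennreal x * (3 * (A2 \<delta> b (a + x) + 2 * A1 \<delta> a (b + x) + A2 \<delta> b (a - x)))"
        using x by (simp add: distrib_left mult_ac add_ac ennreal_mult)
      finally have "ennreal ((V (a + x, b) - V (a - x, b))\<^sup>2 / x) \<le> 3 * (A2 \<delta> b (a + x) + 2 * A1 \<delta> a (b + x) + A2 \<delta> b (a - x))"
        by (rule ennreal_divide_le) (use x in auto)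
      then show ?thesis by (intro mult_right_mono) auto
    qed (auto simp: indicator_def)
  qed
  also have "\<dots> = 3 * ((\<integral>\<^sup>+ x\<in>{0..\<delta>}. A2 \<delta> b (a + x) \<partial>lborel) + 2 * (\<integral>\<^sup>+ x\<in>{0..\<delta>}. A1 \<delta> a (b + x) \<partial>lborel) + (\<integral>\<^sup>+ x\<in>{0..\<delta>}. A2 \<delta> b (a - x) \<partial>lborel))"
    by (simp add: nn_integral_cmult nn_integral_add distrib_right mult.assoc)
  also have "\<dots> \<le> 3 * ((\<integral>\<^sup>+ x\<in>{a - \<delta>..a + \<delta>}. A2 \<delta> b x \<partial>lborel) + 2 * (\<integral>\<^sup>+ x\<in>{b - \<delta>..b + \<delta>}. A1 \<delta> a x \<partial>lborel) + (\<integral>\<^sup>+ x\<in>{a - \<delta>..a + \<delta>}. A2 \<delta> b x \<partial>lborel))"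
  proof (cases "\<delta> \<ge> 0")
    case True
    then show ?thesis
      unfolding set_nn_integral_shift[OF A_meas(1)] set_nn_integral_shift[OF A_meas(2)] set_nn_integral_reflect[OF A_meas(2)]
      by (intro mult_left_mono add_mono set_nn_integral_sub) auto
  qed simp
  also have "\<dots> = 6 * energy \<delta> a b"
  proof -
    have "3 * (x + 2 * y + x) = 6 * (y + x)" for x y :: ennreal
    proof -
      have "x + 2 * y + x = 2 * (y + x)" by (simp only: mult_2 distrib_left add_ac)
      then have "3 * (x + 2 * y + x) = (3 * 2) * (y + x)" by (simp only: mult.assoc)
      then show ?thesis by simp
    qed
    then show ?thesis unfolding energy_split[symmetric] by blast
  qed
  finally show ?thesis .
qed

text \<open>Points at distance \<open>h\<close> are joined by a detour at height \<open>h\<close>: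
  up, across, down. The vertical legs contribute squared increments divided by \<open>h^2\<close>,
  which is exactly what Hardy's inequality controls; the horizontal leg has length \<open>h\<close>,
  and averaging over its position gains the other power of \<open>h\<close>. The constant is 2 from
  the symmetry, 3 from the three legs, 2 for the pair of vertical legs and 4 from Hardy.\<close>

lemma edge_V_le: "edge \<delta> (\<lambda>x. V (x, b)) a \<le> 48 * energy \<delta> a b"
proof -
  define D where "D x h = ennreal ((V (x, b + h) - V (x, b))\<^sup>2)" for x h
  have [measurable]: "(\<lambda>p. D (fst p) (snd p)) \<in> borel_measurable (borel \<Otimes>\<^sub>M borel)" "D x \<in> borel_measurable borel" "(\<lambda>x. D x h) \<in> borel_measurable borel" for x h
    unfolding D_def by measurable
  define B where "B t = (\<integral>\<^sup>+ s\<in>{a..a + \<delta>}. ennreal ((g1 (s, t))\<^sup>2) \<partial>lborel)" for t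
  have [measurable]: "B \<in> borel_measurable borel" unfolding B_def by measurable
  define DD where "DD h = (\<integral>\<^sup>+ x\<in>{0..\<delta>}. D (a + x) h \<partial>lborel)" for h
  have [measurable]: "DD \<in> borel_measurable borel" unfolding DD_def D_def by measurable
  have inner: "(\<integral>\<^sup>+ x\<in>{0..\<delta> - h}. ennreal ((V (a + x + h, b) - V (a + x, b))\<^sup>2 / h\<^sup>2) \<partial>lborel)
      \<le> 6 * (DD h * ennreal (1 / h\<^sup>2)) + 3 * B (b + h)"
    if h: "0 < h" "h \<le> \<delta>" and ae: "AE x in lborel. V (x, b + h) = H (x, b + h)" for h
  proof -
    define E where "E x = (\<integral>\<^sup>+ s\<in>{a + x..a + x + h}. ennreal ((g1 (s, b + h))\<^sup>2) \<partial>lborel)" for x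
    have E_eq: "E x = (\<integral>\<^sup>+ s. ennreal ((g1 (s, b + h))\<^sup>2) * (if a + x \<le> s \<and> s \<le> a + x + h then 1 else 0) \<partial>lborel)" for x
      unfolding E_def by (rule nn_integral_cong) (auto simp: indicator_def)
    have [measurable]: "E \<in> borel_measurable borel" unfolding E_eq by measurable
    have "(\<integral>\<^sup>+ x\<in>{0..\<delta> - h}. ennreal ((V (a + x + h, b) - V (a + x, b))\<^sup>2 / h\<^sup>2) \<partial>lborel)
      \<le> (\<integral>\<^sup>+ x\<in>{0..\<delta> - h}. 3 * ((D (a + h + x) h + D (a + x) h) * ennreal (1 / h\<^sup>2) + E x * ennreal (1 / h)) \<partial>lborel)"
    proof (rule nn_integral_mono_AE, use AE_shift[OF ae, of a] AE_shift[OF ae, of "a + h"] in eventually_elim)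
      case (elim x)
      have eq: "V (a + x + h, b + h) = H (a + x + h, b + h)" "V (a + x, b + h) = H (a + x, b + h)"
        using elim by (auto simp: algebra_simps)
      have "ennreal ((V (a + x + h, b) - V (a + x, b))\<^sup>2 / h\<^sup>2) = ennreal ((V (a + x + h, b) - V (a + x, b))\<^sup>2) * ennreal (1 / h\<^sup>2)"
        by (subst ennreal_mult[symmetric]) auto
      also have "\<dots> \<le> ennreal (3 * ((V (a + x + h, b + h) - V (a + x + h, b))\<^sup>2 + (V (a + x, b + h) - V (a + x, b))\<^sup>2 + (H (a + x + h, b + h) - H (a + x, b + h))\<^sup>2)) * ennreal (1 / h\<^sup>2)"
        using sq_add3[of "V (a + x + h, b) - V (a + x + h, b + h)" "V (a + x, b + h) - V (a + x, b)" "H (a + x + h, b + h) - H (a + x, b + h)"] eq 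
        by (intro mult_right_mono ennreal_leI) (simp_all add: power2_commute algebra_simps)
      also have "\<dots> = 3 * ((D (a + h + x) h + D (a + x) h) * ennreal (1 / h\<^sup>2) + ennreal ((H (a + x + h, b + h) - H (a + x, b + h))\<^sup>2) * ennreal (1 / h\<^sup>2))"
        by (simp add: D_def ennreal_mult distrib_right distrib_left mult.assoc add_ac)
      also have "\<dots> \<le> 3 * ((D (a + h + x) h + D (a + x) h) * ennreal (1 / h\<^sup>2) + E x * ennreal (1 / h))"
      proof (intro mult_left_mono add_left_mono)
        have "ennreal ((H (a + x + h, b + h) - H (a + x, b + h))\<^sup>2) \<le> ennreal h * E x"
          using H_sq_le[of "a + x + h" "b + h" "a + x"] h by (simp add: E_def)
        then have "ennreal ((H (a + x + h, b + h) - H (a + x, b + h))\<^sup>2) * ennreal (1 / h\<^sup>2) \<le> ennreal h * E x * ennreal (1 / h\<^sup>2)"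
          by (rule mult_right_mono) auto
        also have "\<dots> = E x * (ennreal h * ennreal (1 / h\<^sup>2))" by (simp add: mult_ac)
        also have "ennreal h * ennreal (1 / h\<^sup>2) = ennreal (1 / h)"
          using h by (subst ennreal_mult[symmetric]) (auto simp: power2_eq_square)
        finally show "ennreal ((H (a + x + h, b + h) - H (a + x, b + h))\<^sup>2) * ennreal (1 / h\<^sup>2) \<le> E x * ennreal (1 / h)" .
      qed auto
      finally show ?case by (intro mult_right_mono) auto
    qed
    also have "\<dots> = 3 * (((\<integral>\<^sup>+ x\<in>{0..\<delta> - h}. D (a + h + x) h \<partial>lborel) + (\<integral>\<^sup>+ x\<in>{0..\<delta> - h}. D (a + x) h \<partial>lborel)) * ennreal (1 / h\<^sup>2) + (\<integral>\<^sup>+ x\<in>{0..\<delta> - h}. E x \<partial>lborel) * ennreal (1 / h))"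
    proof -
      have "(\<integral>\<^sup>+ x\<in>{0..\<delta> - h}. 3 * ((D (a + h + x) h + D (a + x) h) * ennreal (1 / h\<^sup>2) + E x * ennreal (1 / h)) \<partial>lborel)
        = (\<integral>\<^sup>+ x. 3 * ((D (a + h + x) h * indicator {0..\<delta> - h} x + D (a + x) h * indicator {0..\<delta> - h} x) * ennreal (1 / h\<^sup>2) + (E x * indicator {0..\<delta> - h} x) * ennreal (1 / h)) \<partial>lborel)"
        by (rule nn_integral_cong) (auto simp: indicator_def)
      then show ?thesis
        by (simp add: nn_integral_cmult nn_integral_multc nn_integral_add)
    qed
    also have "\<dots> \<le> 3 * ((DD h + DD h) * ennreal (1 / h\<^sup>2) + (B (b + h) * ennreal h) * ennreal (1 / h))"
    proof (intro mult_left_mono add_mono mult_right_mono)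
      have "(\<integral>\<^sup>+ x\<in>{0..\<delta> - h}. D (a + h + x) h \<partial>lborel) = (\<integral>\<^sup>+ x\<in>{a + h..a + \<delta>}. D x h \<partial>lborel)"
        by (subst set_nn_integral_shift) auto
      also have "\<dots> \<le> (\<integral>\<^sup>+ x\<in>{a..a + \<delta>}. D x h \<partial>lborel)" using h by (intro set_nn_integral_sub) auto
      also have "\<dots> = DD h" unfolding DD_def by (subst set_nn_integral_shift) auto
      finally show "(\<integral>\<^sup>+ x\<in>{0..\<delta> - h}. D (a + h + x) h \<partial>lborel) \<le> DD h" .
      show "(\<integral>\<^sup>+ x\<in>{0..\<delta> - h}. D (a + x) h \<partial>lborel) \<le> DD h"
        unfolding DD_def using h by (intro set_nn_integral_sub) auto
      \<comment> \<open>Each point of the horizontal line is covered by windows of length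
        \<open>h\<close> whose starting points fill an interval of length \<open>h\<close>.\<close>
      have "(\<integral>\<^sup>+ x\<in>{0..\<delta> - h}. E x \<partial>lborel) = (\<integral>\<^sup>+ x. \<integral>\<^sup>+ s. ennreal ((g1 (s, b + h))\<^sup>2) * (if a + x \<le> s \<and> s \<le> a + x + h then 1 else 0) * indicator {0..\<delta> - h} x \<partial>lborel \<partial>lborel)"
        unfolding E_eq by (subst nn_integral_multc) auto
      also have "\<dots> \<le> (\<integral>\<^sup>+ x. \<integral>\<^sup>+ s. ennreal ((g1 (s, b + h))\<^sup>2) * indicator {a..a + \<delta>} s * (if s - a - h \<le> x \<and> x \<le> s - a then 1 else 0) \<partial>lborel \<partial>lborel)"
        by (intro nn_integral_mono) (auto simp: indicator_def)
      also have "\<dots> = (\<integral>\<^sup>+ s. \<integral>\<^sup>+ x. ennreal ((g1 (s, b + h))\<^sup>2) * indicator {a..a + \<delta>} s * (if s - a - h \<le> x \<and> x \<le> s - a then 1 else 0) \<partial>lborel \<partial>lborel)"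
        by (rule lborel_pair.Fubini') measurable
      also have "\<dots> = (\<integral>\<^sup>+ s. ennreal ((g1 (s, b + h))\<^sup>2) * indicator {a..a + \<delta>} s * ennreal h \<partial>lborel)"
      proof (rule nn_integral_cong)
        fix s
        have "(\<integral>\<^sup>+ x. ennreal ((g1 (s, b + h))\<^sup>2) * indicator {a..a + \<delta>} s * (if s - a - h \<le> x \<and> x \<le> s - a then 1 else 0) \<partial>lborel)
          = (\<integral>\<^sup>+ x. ennreal ((g1 (s, b + h))\<^sup>2) * indicator {a..a + \<delta>} s * indicator {s - a - h..s - a} x \<partial>lborel)"
          by (rule nn_integral_cong) (auto simp: indicator_def)
        also have "\<dots> = ennreal ((g1 (s, b + h))\<^sup>2) * indicator {a..a + \<delta>} s * ennreal h"
          using h by (subst nn_integral_cmult) auto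
        finally show "(\<integral>\<^sup>+ x. ennreal ((g1 (s, b + h))\<^sup>2) * indicator {a..a + \<delta>} s * (if s - a - h \<le> x \<and> x \<le> s - a then 1 else 0) \<partial>lborel)
          = ennreal ((g1 (s, b + h))\<^sup>2) * indicator {a..a + \<delta>} s * ennreal h" .
      qed
      also have "\<dots> = B (b + h) * ennreal h" unfolding B_def by (rule nn_integral_multc) measurable
      finally show "(\<integral>\<^sup>+ x\<in>{0..\<delta> - h}. E x \<partial>lborel) \<le> B (b + h) * ennreal h" .
    qed auto
    also have "(B (b + h) * ennreal h) * ennreal (1 / h) = B (b + h)"
      using h by (subst mult.assoc, subst ennreal_mult[symmetric]) auto
    also have "3 * ((DD h + DD h) * ennreal (1 / h\<^sup>2) + B (b + h)) = 6 * (DD h * ennreal (1 / h\<^sup>2)) + 3 * B (b + h)"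
      by (simp add: distrib_left mult_2[symmetric] mult.assoc[symmetric])
    finally show ?thesis .
  qed
  \<comment> \<open>Here the height of the detour is the same along the edge, so no diagonal is
    involved: by Fubini almost every horizontal line has \<open>V = H\<close> almost
    everywhere.\<close>
  have ae: "AE h in lborel. AE x in lborel. V (x, b + h) = H (x, b + h)"
    using AE_shift[OF AE_pt[OF AE_swap[OF VH]], of b] by simp
  have "edge \<delta> (\<lambda>x. V (x, b)) a \<le> 2 * (\<integral>\<^sup>+ h\<in>{0<..\<delta>}. \<integral>\<^sup>+ x\<in>{0..\<delta> - h}. ennreal ((V (a + x + h, b) - V (a + x, b))\<^sup>2 / h\<^sup>2) \<partial>lborel \<partial>lborel)"
    by (rule edge_le) measurable
  also have "\<dots> \<le> 2 * (\<integral>\<^sup>+ h\<in>{0<..\<delta>}. (6 * (DD h * ennreal (1 / h\<^sup>2)) + 3 * B (b + h)) \<partial>lborel)"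
  proof (intro mult_left_mono nn_integral_mono_AE, use ae in eventually_elim)
    case (elim h)
    show ?case
      by (cases "h \<in> {0<..\<delta>}") (use inner[of h] elim in auto)
  qed auto
  also have "\<dots> = 2 * (6 * (\<integral>\<^sup>+ h\<in>{0<..\<delta>}. DD h * ennreal (1 / h\<^sup>2) \<partial>lborel) + 3 * (\<integral>\<^sup>+ h\<in>{0<..\<delta>}. B (b + h) \<partial>lborel))"
    by (simp add: distrib_right nn_integral_add nn_integral_cmult mult.assoc)
  also have "\<dots> \<le> 2 * (6 * (4 * (\<integral>\<^sup>+ x\<in>{a - \<delta>..a + \<delta>}. A2 \<delta> b x \<partial>lborel)) + 3 * (\<integral>\<^sup>+ t\<in>{b - \<delta>..b + \<delta>}. A1 \<delta> a t \<partial>lborel))"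
  proof (intro mult_left_mono add_mono)
    have "(\<integral>\<^sup>+ h\<in>{0<..\<delta>}. B (b + h) \<partial>lborel) \<le> (\<integral>\<^sup>+ h\<in>{-\<delta>..\<delta>}. A1 \<delta> a (b + h) \<partial>lborel)"
      unfolding A1_def B_def by (intro nn_integral_mono mult_mono) (auto simp: indicator_def)
    also have "\<dots> = (\<integral>\<^sup>+ t\<in>{b - \<delta>..b + \<delta>}. A1 \<delta> a t \<partial>lborel)"
      by (subst set_nn_integral_shift) auto
    finally show "(\<integral>\<^sup>+ h\<in>{0<..\<delta>}. B (b + h) \<partial>lborel) \<le> (\<integral>\<^sup>+ t\<in>{b - \<delta>..b + \<delta>}. A1 \<delta> a t \<partial>lborel)" .
    have "(\<integral>\<^sup>+ h\<in>{0<..\<delta>}. DD h * ennreal (1 / h\<^sup>2) \<partial>lborel)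
      = (\<integral>\<^sup>+ h. \<integral>\<^sup>+ x. D (a + x) h * indicator {0..\<delta>} x * (ennreal (1 / h\<^sup>2) * indicator {0<..\<delta>} h) \<partial>lborel \<partial>lborel)"
      unfolding DD_def by (subst nn_integral_multc) (auto simp: mult.assoc)
    also have "\<dots> = (\<integral>\<^sup>+ x. \<integral>\<^sup>+ h. D (a + x) h * indicator {0..\<delta>} x * (ennreal (1 / h\<^sup>2) * indicator {0<..\<delta>} h) \<partial>lborel \<partial>lborel)"
      by (rule lborel_pair.Fubini') (unfold D_def, measurable)
    also have "\<dots> = (\<integral>\<^sup>+ x\<in>{0..\<delta>}. (\<integral>\<^sup>+ h\<in>{0<..\<delta>}. D (a + x) h * ennreal (1 / h\<^sup>2) \<partial>lborel) \<partial>lborel)"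
      by (subst nn_integral_multc[symmetric]) (auto intro!: nn_integral_cong simp: mult_ac)
    also have "\<dots> \<le> (\<integral>\<^sup>+ x\<in>{0..\<delta>}. 4 * A2 \<delta> b (a + x) \<partial>lborel)"
    proof (intro nn_integral_mono mult_right_mono)
      fix x
      have "(\<integral>\<^sup>+ h\<in>{0<..\<delta>}. D (a + x) h * ennreal (1 / h\<^sup>2) \<partial>lborel) \<le> (\<integral>\<^sup>+ h\<in>{0<..\<delta>}. (\<integral>\<^sup>+ s\<in>{0..h}. ennreal \<bar>g2 (a + x, b + s)\<bar> \<partial>lborel)\<^sup>2 * ennreal (1 / h\<^sup>2) \<partial>lborel)"
      proof (intro nn_integral_mono)
        fix h
        show "D (a + x) h * ennreal (1 / h\<^sup>2) * indicator {0<..\<delta>} h \<le> (\<integral>\<^sup>+ s\<in>{0..h}. ennreal \<bar>g2 (a + x, b + s)\<bar> \<partial>lborel)\<^sup>2 * ennreal (1 / h\<^sup>2) * indicator {0<..\<delta>} h"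
        proof (cases "h \<in> {0<..\<delta>}")
          case True
          then have "ennreal \<bar>V (a + x, b + h) - V (a + x, b)\<bar> \<le> (\<integral>\<^sup>+ s\<in>{b..b + h}. ennreal \<bar>g2 (a + x, s)\<bar> \<partial>lborel)"
            using V_le[of "a + x" "b + h" b] by simp
          also have "\<dots> = (\<integral>\<^sup>+ s\<in>{0..h}. ennreal \<bar>g2 (a + x, b + s)\<bar> \<partial>lborel)"
            by (subst set_nn_integral_shift[where f="\<lambda>s. ennreal \<bar>g2 (a + x, s)\<bar>"]) auto
          finally have "D (a + x) h \<le> (\<integral>\<^sup>+ s\<in>{0..h}. ennreal \<bar>g2 (a + x, b + s)\<bar> \<partial>lborel)\<^sup>2"
            unfolding D_def ennreal_power2 by (intro power_mono) auto
          then show ?thesis by (intro mult_right_mono) auto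
        qed simp
      qed
      also have "\<dots> \<le> 4 * (\<integral>\<^sup>+ s\<in>{0..\<delta>}. (ennreal \<bar>g2 (a + x, b + s)\<bar>)\<^sup>2 \<partial>lborel)"
        by (rule hardy) measurable
      also have "(\<integral>\<^sup>+ s\<in>{0..\<delta>}. (ennreal \<bar>g2 (a + x, b + s)\<bar>)\<^sup>2 \<partial>lborel) \<le> (\<integral>\<^sup>+ s\<in>{-\<delta>..\<delta>}. (ennreal \<bar>g2 (a + x, b + s)\<bar>)\<^sup>2 \<partial>lborel)"
        by (intro nn_integral_mono) (auto simp: indicator_def)
      also have "\<dots> = A2 \<delta> b (a + x)"
        unfolding A2_def ennreal_power2
        by (subst set_nn_integral_shift[where f="\<lambda>s. (ennreal \<bar>g2 (a + x, s)\<bar>)\<^sup>2"]) auto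
      finally show "(\<integral>\<^sup>+ h\<in>{0<..\<delta>}. D (a + x) h * ennreal (1 / h\<^sup>2) \<partial>lborel) \<le> 4 * A2 \<delta> b (a + x)" by (simp add: mult_left_mono)
    qed auto
    also have "\<dots> = 4 * (\<integral>\<^sup>+ x\<in>{a..a + \<delta>}. A2 \<delta> b x \<partial>lborel)"
      by (simp add: set_nn_integral_shift nn_integral_cmult mult.assoc)
    also have "\<dots> \<le> 4 * (\<integral>\<^sup>+ x\<in>{a - \<delta>..a + \<delta>}. A2 \<delta> b x \<partial>lborel)"
      by (intro mult_left_mono nn_integral_mono) (auto simp: indicator_def)
    finally show "(\<integral>\<^sup>+ h\<in>{0<..\<delta>}. DD h * ennreal (1 / h\<^sup>2) \<partial>lborel) \<le> 4 * (\<integral>\<^sup>+ x\<in>{a - \<delta>..a + \<delta>}. A2 \<delta> b x \<partial>lborel)" .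
  qed auto
  \<comment> \<open>The horizontal coefficient is raised from 3 to 24 so that both directions
    combine into the energy.\<close>
  also have "\<dots> \<le> 2 * (6 * (4 * (\<integral>\<^sup>+ x\<in>{a - \<delta>..a + \<delta>}. A2 \<delta> b x \<partial>lborel)) + 24 * (\<integral>\<^sup>+ t\<in>{b - \<delta>..b + \<delta>}. A1 \<delta> a t \<partial>lborel))"
    by (intro mult_left_mono add_mono mult_right_mono) auto
  also have "\<dots> = 48 * energy \<delta> a b"
    unfolding energy_split[symmetric] by (simp add: distrib_left mult.assoc[symmetric] add.commute)
  finally show ?thesis .
qed

lemma straight_edge_le:
  "edge \<delta> (\<lambda>x. V (x, b)) a + straight \<delta> (\<lambda>x. V (x, b)) a \<le> 54 * energy \<delta> a b"
proof -
  have "edge \<delta> (\<lambda>x. V (x, b)) a + straight \<delta> (\<lambda>x. V (x, b)) a \<le> 48 * energy \<delta> a b + 6 * energy \<delta> a b"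
    by (intro add_mono edge_V_le straight_le)
  then show ?thesis by (simp add: distrib_right[symmetric])
qed

lemma energy_swap:
  "two_versions.energy (g2 \<circ> prod.swap) (g1 \<circ> prod.swap) \<delta> b a = energy \<delta> a b"
proof -
  have [measurable]: "{a - \<delta>..a + \<delta>} \<times> {b - \<delta>..b + \<delta>} \<in> sets borel" by (simp add: borel_Times)
  have "energy \<delta> a b = (\<integral>\<^sup>+ p. ennreal ((g1 (prod.swap p))\<^sup>2 + (g2 (prod.swap p))\<^sup>2) * indicator ({a - \<delta>..a + \<delta>} \<times> {b - \<delta>..b + \<delta>}) (prod.swap p) \<partial>lborel)"
    unfolding energy_def by (rule nn_integral_swap[symmetric]) measurable
  also have "\<dots> = two_versions.energy (g2 \<circ> prod.swap) (g1 \<circ> prod.swap) \<delta> b a"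
    unfolding two_versions.energy_def[OF two_versions_swap]
    by (rule nn_integral_cong) (auto simp: indicator_def add.commute)
  finally show ?thesis by simp
qed

text \<open>The edge and straight terms cost 48 + 6 on each of the two lines, the vertical one by
  exchange of coordinates, and the cross term costs 2.\<close>

lemma vertex_le: "vertex \<delta> (\<lambda>x. V (x, b)) (\<lambda>t. H (a, t)) a b \<le> 110 * energy \<delta> a b"
proof -
  have "edge \<delta> (\<lambda>t. H (a, t)) b + straight \<delta> (\<lambda>t. H (a, t)) b \<le> 54 * energy \<delta> a b"
    using two_versions.straight_edge_le[OF two_versions_swap, of \<delta> a b] unfolding energy_swap by simp
  then have "(edge \<delta> (\<lambda>x. V (x, b)) a + straight \<delta> (\<lambda>x. V (x, b)) a) + (edge \<delta> (\<lambda>t. H (a, t)) b + straight \<delta> (\<lambda>t. H (a, t)) b) + cross \<delta> (\<lambda>x. V (x, b)) (\<lambda>t. H (a, t)) a b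
      \<le> 54 * energy \<delta> a b + 54 * energy \<delta> a b + 2 * energy \<delta> a b"
    by (intro add_mono straight_edge_le cross_le)
  then show ?thesis
    by (simp add: vertex_def distrib_right[symmetric] add_ac)
qed

text \<open>The squares have side \<open>2 * \<delta>\<close>, so a coordinate of a point admits at
  most three indices, and a point lies in at most nine squares.\<close>

lemma sum_energy_le:
  assumes "\<delta> > 0"
  shows "(\<integral>\<^sup>+ jk. energy \<delta> (of_int (fst jk) * \<delta>) (of_int (snd jk) * \<delta>) \<partial>count_space (UNIV :: (int \<times> int) set))
    \<le> 9 * (\<integral>\<^sup>+ p. ennreal ((g1 p)\<^sup>2 + (g2 p)\<^sup>2) \<partial>lborel)"
proof -
  define Q where "Q jk = {of_int (fst jk) * \<delta> - \<delta>..of_int (fst jk) * \<delta> + \<delta>} \<times> {of_int (snd jk) * \<delta> - \<delta>..of_int (snd jk) * \<delta> + \<delta>}" for jk :: "int \<times> int"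
  have [measurable]: "Q jk \<in> sets borel" for jk unfolding Q_def by (simp add: borel_Times)
  have "(\<integral>\<^sup>+ jk. energy \<delta> (of_int (fst jk) * \<delta>) (of_int (snd jk) * \<delta>) \<partial>count_space (UNIV :: (int \<times> int) set))
    = (\<integral>\<^sup>+ jk. \<integral>\<^sup>+ p. ennreal ((g1 p)\<^sup>2 + (g2 p)\<^sup>2) * indicator (Q jk) p \<partial>lborel \<partial>count_space UNIV)"
    unfolding energy_def Q_def ..
  also have "\<dots> = (\<integral>\<^sup>+ p. \<integral>\<^sup>+ jk. ennreal ((g1 p)\<^sup>2 + (g2 p)\<^sup>2) * indicator (Q jk) p \<partial>count_space UNIV \<partial>lborel)"
    by (rule nn_integral_count_space_nn_integral[symmetric]) auto
  also have "\<dots> \<le> (\<integral>\<^sup>+ p. 9 * ennreal ((g1 p)\<^sup>2 + (g2 p)\<^sup>2) \<partial>lborel)"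
  proof (rule nn_integral_mono)
    fix p :: pt
    obtain x t where p: "p = (x, t)" by (cases p)
    define J where "J y = {\<lfloor>y / \<delta>\<rfloor> - 1..\<lfloor>y / \<delta>\<rfloor> + 1}" for y
    have J: "j \<in> J y" if "of_int j * \<delta> - \<delta> \<le> y" "y \<le> of_int j * \<delta> + \<delta>" for j y
    proof -
      have "of_int (j - 1) \<le> y / \<delta>" "y / \<delta> \<le> of_int (j + 1)"
        using that assms by (auto simp: field_simps)
      then have "j - 1 \<le> \<lfloor>y / \<delta>\<rfloor>" "\<lfloor>y / \<delta>\<rfloor> \<le> j + 1" by linarith+
      then show ?thesis unfolding J_def by auto
    qed
    have "(\<integral>\<^sup>+ jk. ennreal ((g1 p)\<^sup>2 + (g2 p)\<^sup>2) * indicator (Q jk) p \<partial>count_space UNIV) 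
      \<le> (\<integral>\<^sup>+ jk. ennreal ((g1 p)\<^sup>2 + (g2 p)\<^sup>2) * indicator (J x \<times> J t) jk \<partial>count_space UNIV)"
      by (intro nn_integral_mono mult_left_mono) (auto simp: indicator_def Q_def p J)
    also have "\<dots> = ennreal ((g1 p)\<^sup>2 + (g2 p)\<^sup>2) * emeasure (count_space UNIV) (J x \<times> J t)"
      by (subst nn_integral_cmult) auto
    also have "emeasure (count_space UNIV) (J x \<times> J t) = 9"
      by (subst emeasure_count_space_finite) (auto simp: J_def card_cartesian_product)
    finally show "(\<integral>\<^sup>+ jk. ennreal ((g1 p)\<^sup>2 + (g2 p)\<^sup>2) * indicator (Q jk) p \<partial>count_space UNIV) \<le> 9 * ennreal ((g1 p)\<^sup>2 + (g2 p)\<^sup>2)"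
      by (simp add: mult.commute)
  qed
  also have "\<dots> = 9 * (\<integral>\<^sup>+ p. ennreal ((g1 p)\<^sup>2 + (g2 p)\<^sup>2) \<partial>lborel)"
    by (rule nn_integral_cmult) measurable
  finally show ?thesis .
qed

lemma grid_norm_le:
  assumes "\<delta> > 0"
  shows "(\<integral>\<^sup>+ jk. vertex \<delta> (\<lambda>x. V (x, of_int (snd jk) * \<delta>)) (\<lambda>t. H (of_int (fst jk) * \<delta>, t))
     (of_int (fst jk) * \<delta>) (of_int (snd jk) * \<delta>) \<partial>count_space (UNIV :: (int \<times> int) set))
    \<le> 990 * (\<integral>\<^sup>+ p. ennreal ((g1 p)\<^sup>2 + (g2 p)\<^sup>2) \<partial>lborel)"
proof -
  have "(\<integral>\<^sup>+ jk. vertex \<delta> (\<lambda>x. V (x, of_int (snd jk) * \<delta>)) (\<lambda>t. H (of_int (fst jk) * \<delta>, t))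
     (of_int (fst jk) * \<delta>) (of_int (snd jk) * \<delta>) \<partial>count_space (UNIV :: (int \<times> int) set))
    \<le> (\<integral>\<^sup>+ jk. 110 * energy \<delta> (of_int (fst jk) * \<delta>) (of_int (snd jk) * \<delta>) \<partial>count_space (UNIV :: (int \<times> int) set))"
    by (intro nn_integral_mono vertex_le)
  also have "\<dots> = 110 * (\<integral>\<^sup>+ jk. energy \<delta> (of_int (fst jk) * \<delta>) (of_int (snd jk) * \<delta>) \<partial>count_space (UNIV :: (int \<times> int) set))"
    by (rule nn_integral_cmult) simp
  also have "\<dots> \<le> 110 * (9 * (\<integral>\<^sup>+ p. ennreal ((g1 p)\<^sup>2 + (g2 p)\<^sup>2) \<partial>lborel))"
    by (intro mult_left_mono sum_energy_le assms) auto
  finally show ?thesis by (simp add: mult.assoc[symmetric])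
qed

end

section \<open>Weak derivatives and absolute continuity on lines\<close>

fun Ck :: "nat \<Rightarrow> (real \<Rightarrow> real) \<Rightarrow> bool" where
  "Ck 0 f = True"
| "Ck (Suc n) f = (\<exists>f'. (\<forall>x. (f has_real_derivative f' x) (at x)) \<and> Ck n f')"

text \<open>Finite orders make closure under sums, products and affine substitutions plain
  inductions. Functions that are smooth in this sense are then the building blocks for the
  coinductive smoothness of test functions.\<close>

definition smooth1 :: "(real \<Rightarrow> real) \<Rightarrow> bool" where
  "smooth1 f \<longleftrightarrow> (\<forall>n. Ck n f)"

lemma Ck_SucD: "Ck (Suc n) f \<Longrightarrow> Ck n f"
proof (induction n arbitrary: f)
  case (Suc n)
  from Suc.prems obtain f' where f': "\<forall>x. (f has_real_derivative f' x) (at x)" "Ck (Suc n) f'"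
    unfolding Ck.simps(2)[of "Suc n"] by blast
  from Suc.IH[OF f'(2)] f'(1) show ?case unfolding Ck.simps(2)[of n f] by blast
qed simp

lemma Ck_add: "Ck n f \<Longrightarrow> Ck n g \<Longrightarrow> Ck n (\<lambda>x. f x + g x)"
proof (induction n arbitrary: f g)
  case (Suc n)
  then obtain f' g' where "\<forall>x. (f has_real_derivative f' x) (at x)" "Ck n f'" "\<forall>x. (g has_real_derivative g' x) (at x)" "Ck n g'"
    by auto
  then show ?case
    by (auto intro!: exI[of _ "\<lambda>x. f' x + g' x"] Suc.IH derivative_eq_intros)
qed simp

lemma Ck_mult: "Ck n f \<Longrightarrow> Ck n g \<Longrightarrow> Ck n (\<lambda>x. f x * g x)"
proof (induction n arbitrary: f g)
  case (Suc n)
  then obtain f' g' where "\<forall>x. (f has_real_derivative f' x) (at x)" "Ck n f'" "\<forall>x. (g has_real_derivative g' x) (at x)" "Ck n g'"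
    by auto
  moreover have "Ck n f" "Ck n g" using Suc.prems Ck_SucD by blast+
  ultimately show ?case
    by (auto intro!: exI[of _ "\<lambda>x. f' x * g x + f x * g' x"] Ck_add Suc.IH derivative_eq_intros)
qed simp

lemma Ck_const: "Ck n (\<lambda>x. c)"
proof (induction n arbitrary: c)
  case (Suc n)
  show ?case unfolding Ck.simps
    by (rule exI[of _ "\<lambda>x. 0"]) (use Suc in \<open>auto intro!: derivative_eq_intros\<close>)
qed simp

lemma Ck_affine: "Ck n f \<Longrightarrow> Ck n (\<lambda>x. f (a + c * x))"
proof (induction n arbitrary: f)
  case (Suc n)
  then obtain f' where f': "\<And>x. (f has_real_derivative f' x) (at x)" "Ck n f'" by auto
  have "((\<lambda>x. f (a + c * x)) has_real_derivative c * f' (a + c * x)) (at x)" for x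
  proof -
    have "((\<lambda>x. a + c * x) has_real_derivative c) (at x)" by (auto intro!: derivative_eq_intros)
    from DERIV_chain'[OF this f'(1)] show ?thesis by (simp add: mult.commute)
  qed
  then show ?case unfolding Ck.simps
    by (intro exI[of _ "\<lambda>x. c * f' (a + c * x)"] conjI allI Ck_mult Ck_const Suc.IH f') auto
qed simp

lemma smooth1_intros:
  "smooth1 (\<lambda>x. c)"
  "smooth1 f \<Longrightarrow> smooth1 g \<Longrightarrow> smooth1 (\<lambda>x. f x + g x)"
  "smooth1 f \<Longrightarrow> smooth1 g \<Longrightarrow> smooth1 (\<lambda>x. f x * g x)"
  "smooth1 f \<Longrightarrow> smooth1 (\<lambda>x. f (a + c * x))"
  by (auto simp: smooth1_def intro: Ck_add Ck_mult Ck_affine Ck_const)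

lemma smooth1_diff: "smooth1 f \<Longrightarrow> smooth1 g \<Longrightarrow> smooth1 (\<lambda>x. f x - g x)"
  using smooth1_intros(2)[of f "\<lambda>x. (-1) * g x"] smooth1_intros(3)[of "\<lambda>x. -1" g] smooth1_intros(1)[of "-1"] by simp

text \<open>Each order comes with its own derivative function; uniqueness of derivatives makes them
  equal, so a single one has all orders.\<close>

lemma smooth1_deriv:
  assumes "smooth1 f"
  obtains f' where "\<And>x. (f has_real_derivative f' x) (at x)" "smooth1 f'"
proof -
  have "\<exists>f'. (\<forall>x. (f has_real_derivative f' x) (at x)) \<and> Ck n f'" for n
    using assms Ck.simps(2)[of n f] unfolding smooth1_def by blast
  then obtain D where D: "\<And>n x. (f has_real_derivative D n x) (at x)" "\<And>n. Ck n (D n)" by metis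
  have "D n = D 0" for n using DERIV_unique[OF D(1) D(1)] by auto
  then have "smooth1 (D 0)" unfolding smooth1_def using D(2) by metis
  with D(1) show ?thesis by (rule that)
qed

lemma smooth1_antideriv:
  assumes "\<And>x. (f has_real_derivative f' x) (at x)" "smooth1 f'"
  shows "smooth1 f"
  unfolding smooth1_def
proof
  fix n show "Ck n f" using assms by (cases n) (auto simp: smooth1_def)
qed

lemma smooth1_cont: "smooth1 f \<Longrightarrow> continuous_on UNIV f"
  by (erule smooth1_deriv) (auto intro!: continuous_at_imp_continuous_on DERIV_isCont)

text \<open>\<open>flat 0\<close> is the classical smooth non-analytic function
  \<open>exp (- 1 / x)\<close>, extended by 0. The powers of \<open>1 / x\<close> are included
  because they make the family closed under differentiation up to linear combination.\<close>

definition flat :: "nat \<Rightarrow> real \<Rightarrow> real" where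
  "flat k x = (if x \<le> 0 then 0 else (1 / x) ^ k * exp (- (1 / x)))"

lemma flat_deriv: "(flat k has_real_derivative (flat (k + 2) x - k * flat (k + 1) x)) (at x)"
proof -
  consider "x < 0" | "x = 0" | "x > 0" by linarith
  then show ?thesis
  proof cases
    case 1
    have "((\<lambda>x. 0) has_real_derivative 0) (at x)" by (auto intro!: derivative_eq_intros)
    then have "(flat k has_real_derivative 0) (at x)"
      by (rule has_field_derivative_transform_within_open[where S="{..<0}"]) (use 1 in \<open>auto simp: flat_def\<close>)
    then show ?thesis using 1 by (simp add: flat_def)
  next
    case 3
    have "((\<lambda>x. (1 / x) ^ k) has_real_derivative k * (1 / x) ^ (k - 1) * (- 1 / x\<^sup>2)) (at x)"
      using 3 by (auto intro!: derivative_eq_intros simp: power2_eq_square)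
    moreover have "((\<lambda>x. exp (- (1 / x))) has_real_derivative exp (- (1 / x)) * (1 / x\<^sup>2)) (at x)"
      using 3 by (auto intro!: derivative_eq_intros simp: power2_eq_square)
    ultimately have "((\<lambda>x. (1 / x) ^ k * exp (- (1 / x))) has_real_derivative
        k * (1 / x) ^ (k - 1) * (- 1 / x\<^sup>2) * exp (- (1 / x)) + exp (- (1 / x)) * (1 / x\<^sup>2) * (1 / x) ^ k) (at x)"
      by (rule DERIV_mult)
    also have "k * (1 / x) ^ (k - 1) * (- 1 / x\<^sup>2) * exp (- (1 / x)) + exp (- (1 / x)) * (1 / x\<^sup>2) * (1 / x) ^ k = flat (k + 2) x - k * flat (k + 1) x"
      using 3 by (cases k) (auto simp: flat_def field_simps power2_eq_square)
    finally show ?thesis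
      by (rule has_field_derivative_transform_within_open[where S="{0<..}"]) (use 3 in \<open>auto simp: flat_def\<close>)
  next
    case 2
    \<comment> \<open>On the right of 0 the substitution \<open>z = 1 / h\<close> turns the
      difference quotient into a power divided by an exponential; on the left the quotient is
      0.\<close>
    have "((\<lambda>z. z ^ Suc k / exp z) \<longlongrightarrow> 0) (at_top :: real filter)"
      by (rule tendsto_power_div_exp_0)
    then have "((\<lambda>h. (inverse h) ^ Suc k / exp (inverse h)) \<longlongrightarrow> 0) (at_right (0::real))"
      by (rule filterlim_compose) (rule filterlim_inverse_at_top_right)
    then have r: "((\<lambda>h. flat k h / h) \<longlongrightarrow> 0) (at_right 0)"
      by (rule Lim_transform_eventually)
        (auto simp: eventually_at_filter flat_def exp_minus field_simps intro!: always_eventually)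
    have "((\<lambda>h. 0) \<longlongrightarrow> (0::real)) (at_left (0::real))" by simp
    then have l: "((\<lambda>h. flat k h / h) \<longlongrightarrow> 0) (at_left 0)"
      by (rule Lim_transform_eventually) (auto simp: eventually_at_filter flat_def intro!: always_eventually)
    have "((\<lambda>h. flat k h / h) \<longlongrightarrow> 0) (at 0)" using l r by (rule filterlim_split_at)
    then show ?thesis unfolding 2 DERIV_def by (simp add: flat_def)
  qed
qed

lemma smooth1_flat: "smooth1 (flat k)"
  unfolding smooth1_def
proof
  fix n show "Ck n (flat k)"
  proof (induction n arbitrary: k)
    case (Suc n)
    have "Ck n (\<lambda>x. flat (k + 2) x + (- k) * flat (k + 1) x)"
      by (intro Ck_add Ck_mult Ck_const Suc)
    then show ?case using flat_deriv by (auto intro!: exI[of _ "\<lambda>x. flat (k + 2) x - k * flat (k + 1) x"])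
  qed simp
qed

text \<open>\<open>flat 0 (n * (x - s)) * flat 0 (n * (t - x))\<close>, with arguments written as
  affine functions to suit the closure rules. The support stays in the interval and the values in
  [0, 1] for all \<open>n\<close>, while steepening drives the function to the indicator; dominated
  convergence thus replaces mollification.\<close>

definition bump :: "real \<Rightarrow> real \<Rightarrow> nat \<Rightarrow> real \<Rightarrow> real" where
  "bump s t n x = flat 0 (- real n * s + real n * x) * flat 0 (real n * t + (- real n) * x)"

lemma smooth1_bump: "smooth1 (bump s t n)"
  unfolding bump_def by (intro smooth1_intros smooth1_flat)

lemma bump_bounds: "0 \<le> bump s t n x" "bump s t n x \<le> 1"
  by (auto simp: bump_def flat_def intro!: mult_le_one)

lemma bump_zero: "x \<notin> {s<..<t} \<Longrightarrow> bump s t n x = 0"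
proof -
  assume "x \<notin> {s<..<t}"
  then have "x \<le> s \<or> t \<le> x" by auto
  then have "real n * x \<le> real n * s \<or> real n * t \<le> real n * x" by (auto intro: mult_left_mono)
  then show ?thesis by (auto simp: bump_def flat_def)
qed

lemma bump_tendsto: "(\<lambda>n. bump s t n x) \<longlonglongrightarrow> indicator {s<..<t} x"
proof (cases "x \<in> {s<..<t}")
  case True
  have *: "(\<lambda>n. flat 0 (real n * c)) \<longlonglongrightarrow> 1" if "c > 0" for c
  proof -
    have "(\<lambda>n. exp (- (1 / c) * inverse (real n))) \<longlonglongrightarrow> exp (- (1 / c) * 0)"
      by (intro tendsto_intros lim_inverse_n)
    then have "(\<lambda>n. exp (- (1 / c) * inverse (real n))) \<longlonglongrightarrow> 1" by simp
    then show ?thesis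
    proof (rule Lim_transform_eventually)
      show "\<forall>\<^sub>F n in sequentially. exp (- (1 / c) * inverse (real n)) = flat 0 (real n * c)"
        using eventually_gt_at_top[of 0]
      proof eventually_elim
        case (elim n)
        then have "real n * c > 0" using that by simp
        then show ?case by (simp add: flat_def field_simps)
      qed
    qed
  qed
  have "(\<lambda>n. flat 0 (real n * (x - s)) * flat 0 (real n * (t - x))) \<longlonglongrightarrow> 1 * 1"
    using True by (intro tendsto_mult *) auto
  then show ?thesis using True by (simp add: bump_def algebra_simps)
qed (simp add: bump_zero)

section \<open>Test functions that are products\<close>

lemma has_derivative_prod_fun:
  fixes p :: pt
  assumes "(a has_real_derivative a') (at (fst p))" "(b has_real_derivative b') (at (snd p))"
  shows "((\<lambda>p. a (fst p) * b (snd p)) has_derivative (\<lambda>h. a' * fst h * b (snd p) + a (fst p) * (b' * snd h))) (at p)"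
proof -
  have 1: "((\<lambda>p. a (fst p)) has_derivative (\<lambda>h. a' * fst h)) (at p)"
    using diff_chain_at[OF has_derivative_fst[OF has_derivative_ident], of a "(*) a'" p] assms(1)
    by (simp add: has_field_derivative_def o_def)
  have 2: "((\<lambda>p. b (snd p)) has_derivative (\<lambda>h. b' * snd h)) (at p)"
    using diff_chain_at[OF has_derivative_snd[OF has_derivative_ident], of b "(*) b'" p] assms(2)
    by (simp add: has_field_derivative_def o_def)
  show ?thesis
    using has_derivative_mult[OF 1 2] by (simp add: add.commute)
qed

lemma frechet_derivative_prod_fun:
  fixes p :: pt
  assumes "(a has_real_derivative a') (at (fst p))" "(b has_real_derivative b') (at (snd p))"
  shows "frechet_derivative (\<lambda>p. a (fst p) * b (snd p)) (at p) (1, 0) = a' * b (snd p)"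
    "frechet_derivative (\<lambda>p. a (fst p) * b (snd p)) (at p) (0, 1) = a (fst p) * b'"
  using frechet_derivative_at[OF has_derivative_prod_fun[OF assms], symmetric] by simp_all

text \<open>Coinduction with the class of all products of smooth functions of one variable, which
  both partial derivatives preserve.\<close>

lemma smooth2_prod:
  assumes "smooth1 a" "smooth1 b"
  shows "smooth2 (\<lambda>p. a (fst p) * b (snd p))"
proof -
  define phi where "phi = (\<lambda>p. a (fst p) * b (snd p))"
  have "\<exists>a b. smooth1 a \<and> smooth1 b \<and> phi = (\<lambda>p. a (fst p) * b (snd p))" using assms phi_def by blast
  then have "smooth2 phi"
  proof (coinduction arbitrary: phi)
    case smooth2
    then obtain a b where ab: "smooth1 a" "smooth1 b" and phi: "phi = (\<lambda>p. a (fst p) * b (snd p))" by blast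
    obtain a' where a': "\<And>x. (a has_real_derivative a' x) (at x)" "smooth1 a'" using ab(1) smooth1_deriv by metis
    obtain b' where b': "\<And>x. (b has_real_derivative b' x) (at x)" "smooth1 b'" using ab(2) smooth1_deriv by metis
    have "\<forall>p. phi differentiable (at p)"
      unfolding phi using has_derivative_prod_fun[OF a'(1) b'(1)] by (auto simp: differentiable_def)
    moreover have "(\<lambda>p. frechet_derivative phi (at p) (1, 0)) = (\<lambda>p. a' (fst p) * b (snd p))"
      "(\<lambda>p. frechet_derivative phi (at p) (0, 1)) = (\<lambda>p. a (fst p) * b' (snd p))"
      unfolding phi by (auto simp: frechet_derivative_prod_fun[OF a'(1) b'(1)])
    ultimately show ?case using ab a' b' by blast
  qed
  then show ?thesis unfolding phi_def .
qed

lemma test_fun_prod: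
  assumes "smooth1 a" "smooth1 b" "\<And>x. \<bar>x\<bar> > R \<Longrightarrow> a x = 0" "\<And>x. \<bar>x\<bar> > R \<Longrightarrow> b x = 0"
  shows "test_fun (\<lambda>p. a (fst p) * b (snd p))"
  unfolding test_fun_def
proof (intro conjI exI[of _ "2 * R"] allI impI)
  show "smooth2 (\<lambda>p. a (fst p) * b (snd p))" using assms by (intro smooth2_prod)
  fix p :: pt assume "norm p > 2 * R"
  moreover have "norm p \<le> \<bar>fst p\<bar> + \<bar>snd p\<bar>" using norm_Pair_le[of "fst p" "snd p"] by simp
  ultimately have "\<bar>fst p\<bar> > R \<or> \<bar>snd p\<bar> > R" by linarith
  then show "a (fst p) * b (snd p) = 0" using assms by auto
qed

text \<open>Lebesgue differentiation over cubes. It needs closed boxes, while limits of bump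
  functions provide open ones; the boundaries are null.\<close>

lemma AE_zero_of_boxes:
  fixes f :: "'a::euclidean_space \<Rightarrow> real"
  assumes f: "\<And>a b. set_integrable lborel (cbox a b) f"
    and z: "\<And>a b. (\<integral>x. indicator (box a b) x * f x \<partial>lborel) = 0"
  shows "AE x in lborel. f x = 0"
proof -
  have "f integrable_on cbox a b" for a b
    using set_borel_integral_eq_integral(1)[OF f] .
  then obtain N where N: "negligible N" and
     *: "\<And>x e. \<lbrakk>x \<notin> N; 0 < e\<rbrakk> \<Longrightarrow> \<exists>d>0. \<forall>h. 0 < h \<and> h < d \<longrightarrow>
                         norm(integral (cbox x (x + h *\<^sub>R One)) f /\<^sub>R h ^ DIM('a) - f x) < e"
    using integrable_ccontinuous_explicit[of f] by blast
  have zero: "integral (cbox a b) f = 0" for a b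
  proof -
    have "set_integrable lborel (box a b) f"
      by (rule set_integrable_subset[OF f[of a b]]) (auto simp: box_subset_cbox)
    from set_borel_integral_eq_integral(2)[OF this] have "integral (box a b) f = 0"
      using z[of a b] by (simp add: set_lebesgue_integral_def)
    then show ?thesis by (simp add: integral_open_interval)
  qed
  have "f x = 0" if xN: "x \<notin> N" for x
  proof (rule ccontr)
    assume "f x \<noteq> 0"
    then obtain d where d: "d > 0" "\<And>h. 0 < h \<Longrightarrow> h < d \<Longrightarrow> norm(integral (cbox x (x + h *\<^sub>R One)) f /\<^sub>R h ^ DIM('a) - f x) < \<bar>f x\<bar>"
      using *[OF xN, of "\<bar>f x\<bar>"] by auto
    from d(2)[of "d / 2"] d(1) show False by (simp add: zero)
  qed
  moreover have "AE x in lebesgue. x \<notin> N"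
    using N by (simp add: negligible_iff_null_sets AE_not_in)
  ultimately show ?thesis unfolding AE_lebesgue_lborel by auto
qed

section \<open>Integration by parts for primitives\<close>

lemma integrable_prod_mult:
  fixes f g :: "real \<Rightarrow> real"
  assumes f: "integrable lborel f" and g: "integrable lborel g"
  shows "integrable (lborel \<Otimes>\<^sub>M lborel) (\<lambda>(x, s). f x * g s)"
proof (rule lborel_pair.Fubini_integrable)
  have [measurable]: "f \<in> borel_measurable borel" "g \<in> borel_measurable borel" using f g by auto
  show "(\<lambda>(x, s). f x * g s) \<in> borel_measurable (lborel \<Otimes>\<^sub>M lborel)" by measurable
qed (use f g in \<open>auto simp: abs_mult\<close>)

lemma bounded_of_compact_support:
  fixes f :: "real \<Rightarrow> real"
  assumes "continuous_on UNIV f" "\<And>x. \<bar>x\<bar> > R \<Longrightarrow> f x = 0"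
  obtains C where "\<And>x. \<bar>f x\<bar> \<le> C" "C \<ge> 0"
proof -
  have "bounded (f ` {-R..R})"
    using assms(1) by (intro compact_imp_bounded compact_continuous_image) (auto intro: continuous_on_subset)
  then obtain C where C: "\<forall>x\<in>{-R..R}. \<bar>f x\<bar> \<le> C" by (auto simp: bounded_iff)
  have "\<bar>f x\<bar> \<le> max C 0" for x
  proof (cases "\<bar>x\<bar> > R")
    case False
    then have "x \<in> {-R..R}" by auto
    then have "\<bar>f x\<bar> \<le> C" using C by blast
    then show ?thesis by simp
  qed (simp add: assms(2))
  then show ?thesis by (rule that) auto
qed

lemma integral_derivative_compact_support:
  assumes d: "\<And>x. (a has_real_derivative a' x) (at x)" and c: "continuous_on UNIV a'"
    and z: "\<And>x. \<bar>x\<bar> > R \<Longrightarrow> a x = 0"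
  shows "\<bar>x\<bar> > R \<Longrightarrow> a' x = 0"
    and "s \<le> t \<Longrightarrow> (\<integral>x. indicator {s..t} x * a' x \<partial>lborel) = a t - a s"
proof -
  show "a' x = 0" if "\<bar>x\<bar> > R"
  proof -
    have "((\<lambda>x. 0) has_real_derivative 0) (at x)" by (auto intro!: derivative_eq_intros)
    then have "(a has_real_derivative 0) (at x)"
      by (rule has_field_derivative_transform_within_open[where S="- cball 0 R"])
        (use that z in \<open>auto simp: dist_real_def intro!: open_Compl\<close>)
    then show ?thesis using d DERIV_unique by blast
  qed
  show "(\<integral>x. indicator {s..t} x * a' x \<partial>lborel) = a t - a s" if "s \<le> t"
    using integral_FTC_Icc[OF that, of a a'] d c
    by (simp add: has_real_derivative_iff_has_vector_derivative[symmetric] has_field_derivative_at_within continuous_on_subset)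
qed

text \<open>Fubini for the kernel \<open>orient 0 x s * g s * a' x\<close>. For fixed
  \<open>s\<close>, the integral over \<open>x\<close> is that of \<open>a'\<close> from
  \<open>s\<close> to infinity if \<open>s > 0\<close>, and minus that from minus infinity to
  \<open>s\<close> otherwise; both equal \<open>- a s\<close> by compact support. The primitive of
  \<open>g\<close> is never differentiated.\<close>

lemma integration_by_parts_lineint:
  assumes g: "loc_int g"
    and d: "\<And>x. (a has_real_derivative a' x) (at x)" and c: "continuous_on UNIV a'"
    and z: "\<And>x. \<bar>x\<bar> > R \<Longrightarrow> a x = 0"
  shows "integrable lborel (\<lambda>x. g x * a x)" "integrable lborel (\<lambda>x. lineint g 0 x * a' x)"
    "(\<integral>x. lineint g 0 x * a' x \<partial>lborel) = - (\<integral>x. g x * a x \<partial>lborel)"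
proof -
  have [measurable]: "g \<in> borel_measurable borel" using g by (rule loc_int_measurable)
  have [measurable]: "a' \<in> borel_measurable borel" using c by (rule borel_measurable_continuous_onI)
  have ac: "continuous_on UNIV a" using d by (auto intro!: continuous_at_imp_continuous_on DERIV_isCont)
  then have [measurable]: "a \<in> borel_measurable borel" by (rule borel_measurable_continuous_onI)
  note cs = integral_derivative_compact_support[where R=R, OF d c z]
  obtain C where C: "\<And>x. \<bar>a' x\<bar> \<le> C" "C \<ge> 0" using bounded_of_compact_support[OF c, of R] cs(1) by blast
  obtain C2 where C2: "\<And>x. \<bar>a x\<bar> \<le> C2" "C2 \<ge> 0" using bounded_of_compact_support[OF ac, of R] z by blast
  have gR: "integrable lborel (\<lambda>s. indicator {-R..R} s * \<bar>g s\<bar>)"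
    using loc_intD[OF loc_int_abs[OF g], of "-R" R] by (simp add: set_integrable_def)
  show "integrable lborel (\<lambda>x. g x * a x)"
  proof (rule Bochner_Integration.integrable_bound)
    show "integrable lborel (\<lambda>s. C2 * (indicator {-R..R} s * \<bar>g s\<bar>))" using gR by simp
    show "AE x in lborel. norm (g x * a x) \<le> norm (C2 * (indicat_real {-R..R} x * \<bar>g x\<bar>))"
    proof (rule AE_I2)
      fix x
      show "norm (g x * a x) \<le> norm (C2 * (indicat_real {-R..R} x * \<bar>g x\<bar>))"
      proof (cases "\<bar>x\<bar> > R")
        case False
        then have "\<bar>g x\<bar> * \<bar>a x\<bar> \<le> C2 * \<bar>g x\<bar>" using C2(1)[of x] by (simp add: mult.commute[of "\<bar>g x\<bar>"] mult_right_mono)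
        then show ?thesis using False C2(2) by (auto simp: abs_mult indicator_def)
      qed (use z[of x] in auto)
    qed
  qed auto
  define K where "K x s = orient 0 x s * g s * a' x" for x s
  have K_le: "\<bar>K x s\<bar> \<le> (C * indicator {-R..R} x) * (indicator {-R..R} s * \<bar>g s\<bar>)" for x s
  proof (cases "\<bar>x\<bar> > R \<or> \<bar>s\<bar> > R")
    case True
    then have "K x s = 0" using cs(1)[of x] by (auto simp: K_def orient_def)
    then show ?thesis using C(2) by simp
  next
    case False
    have "\<bar>K x s\<bar> = \<bar>orient 0 x s\<bar> * (\<bar>g s\<bar> * \<bar>a' x\<bar>)" by (simp add: K_def abs_mult)
    also have "\<dots> \<le> 1 * (\<bar>g s\<bar> * C)" by (intro mult_mono C) (auto simp: orient_def)
    finally show ?thesis using False by (auto simp: indicator_def mult.commute)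
  qed
  have K: "integrable (lborel \<Otimes>\<^sub>M lborel) (case_prod K)"
  proof (rule Bochner_Integration.integrable_bound)
    have "integrable lborel (\<lambda>x. C * indicator {-R..R} x :: real)"
      by (intro integrable_mult_right integrable_real_indicator) (auto simp: emeasure_lborel_Icc_eq)
    from integrable_prod_mult[OF this gR]
    show "integrable (lborel \<Otimes>\<^sub>M lborel) (\<lambda>(x, s). (C * indicator {-R..R} x) * (indicator {-R..R} s * \<bar>g s\<bar>))" .
    show "case_prod K \<in> borel_measurable (lborel \<Otimes>\<^sub>M lborel)" unfolding K_def by measurable
    show "AE p in lborel \<Otimes>\<^sub>M lborel. norm (case_prod K p) \<le> norm (case p of (x, s) \<Rightarrow> C * indicat_real {-R..R} x * (indicat_real {-R..R} s * \<bar>g s\<bar>))"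
      using K_le by (intro AE_I2) (auto simp: abs_of_nonneg C intro: order_trans[OF K_le])
  qed
  have Kx: "(\<integral>s. K x s \<partial>lborel) = lineint g 0 x * a' x" for x
    unfolding K_def lineint_def by simp
  have Ks: "(\<integral>x. K x s \<partial>lborel) = - (g s * a s)" for s
  proof -
    \<comment> \<open>Beyond the support of \<open>a\<close> and beyond \<open>s\<close>, so that
      one of the two intervals between \<open>s\<close> and the ends covers all of the relevant
      half-line.\<close>
    define R' where "R' = max R 0 + \<bar>s\<bar> + 1"
    have aR: "a R' = 0" "a (- R') = 0" using z by (auto simp: R'_def)
    have "(\<integral>x. K x s \<partial>lborel) = g s * (\<integral>x. orient 0 x s * a' x \<partial>lborel)"
      unfolding K_def by (subst integral_mult_right_zero[symmetric]) (auto simp: mult_ac)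
    also have "(\<integral>x. orient 0 x s * a' x \<partial>lborel) = - a s"
    proof (cases "s > 0")
      case True
      have "(\<integral>x. orient 0 x s * a' x \<partial>lborel) = (\<integral>x. indicator {s..R'} x * a' x \<partial>lborel)"
      proof (rule Bochner_Integration.integral_cong[OF refl])
        fix x show "orient 0 x s * a' x = indicator {s..R'} x * a' x"
          using cs(1)[of x] True by (cases "x > R'") (auto simp: orient_def indicator_def R'_def)
      qed
      also have "\<dots> = - a s" using cs(2)[of s R'] aR by (simp add: R'_def)
      finally show ?thesis .
    next
      case False
      have "(\<integral>x. orient 0 x s * a' x \<partial>lborel) = (\<integral>x. - (indicator {-R'..s} x * a' x) \<partial>lborel)"
      proof (rule integral_cong_AE)
        show "AE x in lborel. orient 0 x s * a' x = - (indicator {-R'..s} x * a' x)"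
          using AE_lborel_singleton[of s]
        proof eventually_elim
          case (elim x) then show ?case
            using cs(1)[of x] False by (cases "x < - R'") (auto simp: orient_def indicator_def R'_def)
        qed
      qed auto
      also have "\<dots> = - a s" using cs(2)[of "-R'" s] aR by (simp add: R'_def)
      finally show ?thesis .
    qed
    finally show ?thesis by simp
  qed
  show "integrable lborel (\<lambda>x. lineint g 0 x * a' x)"
    using lborel_pair.integrable_fst'[OF K] by (simp add: Kx)
  show "(\<integral>x. lineint g 0 x * a' x \<partial>lborel) = - (\<integral>x. g x * a x \<partial>lborel)"
    using lborel_pair.Fubini_integral[OF K] by (simp add: Kx Ks)
qed

section \<open>Locally integrable functions of the plane\<close>

definition loc_int_pt :: "(pt \<Rightarrow> real) \<Rightarrow> bool" where
  "loc_int_pt u \<longleftrightarrow> u \<in> borel_measurable borel \<and> (\<forall>a b. set_integrable lborel (cbox a b) u)"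

lemma loc_int_ptD: "loc_int_pt u \<Longrightarrow> u \<in> borel_measurable borel"
  "loc_int_pt u \<Longrightarrow> set_integrable lborel (cbox a b) u"
  unfolding loc_int_pt_def by blast+

lemma loc_int_pt_diff: "loc_int_pt u \<Longrightarrow> loc_int_pt v \<Longrightarrow> loc_int_pt (\<lambda>p. u p - v p)"
  and loc_int_pt_add: "loc_int_pt u \<Longrightarrow> loc_int_pt v \<Longrightarrow> loc_int_pt (\<lambda>p. u p + v p)"
  unfolding loc_int_pt_def
  by (intro conjI allI set_integral_diff(1) set_integral_add(1) borel_measurable_diff borel_measurable_add; blast)+

lemma loc_int_pt_mult:
  assumes u: "loc_int_pt u" and [measurable]: "h \<in> borel_measurable borel"
    and h: "\<And>p. \<bar>h p\<bar> \<le> C" "\<And>p. p \<notin> cbox a b \<Longrightarrow> h p = 0"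
  shows "integrable lborel (\<lambda>p. u p * h p)"
proof (rule Bochner_Integration.integrable_bound)
  show "integrable lborel (\<lambda>p. C * (indicator (cbox a b) p *\<^sub>R u p))"
    using loc_int_ptD(2)[OF u] unfolding set_integrable_def by (intro integrable_mult_right)
  have [measurable]: "u \<in> borel_measurable borel" using u by (rule loc_int_ptD)
  show "(\<lambda>p. u p * h p) \<in> borel_measurable lborel" by measurable
  show "AE p in lborel. norm (u p * h p) \<le> norm (C * (indicat_real (cbox a b) p *\<^sub>R u p))"
  proof (rule AE_I2)
    fix p
    have "\<bar>h p\<bar> \<le> \<bar>C\<bar>" using h(1)[of p] by linarith
    then show "norm (u p * h p) \<le> norm (C * (indicat_real (cbox a b) p *\<^sub>R u p))"
      using h(2)[of p] by (cases "p \<in> cbox a b") (auto simp: abs_mult mult.commute[of "\<bar>u p\<bar>"] mult_right_mono)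
  qed
qed

lemma integral_pt:
  fixes f :: "pt \<Rightarrow> real"
  assumes "integrable lborel f"
  shows "(\<integral>p. f p \<partial>lborel) = (\<integral>t. \<integral>x. f (x, t) \<partial>lborel \<partial>lborel)"
    and "AE t in lborel. integrable lborel (\<lambda>x. f (x, t))"
    and "integrable lborel (\<lambda>t. \<integral>x. f (x, t) \<partial>lborel)"
proof -
  have i: "integrable (lborel \<Otimes>\<^sub>M lborel) (\<lambda>(x, t). f (x, t))" using assms by (simp add: lborel_prod)
  from lborel_pair.integral_snd[OF i] show "(\<integral>p. f p \<partial>lborel) = (\<integral>t. \<integral>x. f (x, t) \<partial>lborel \<partial>lborel)"
    by (simp add: lborel_prod)
  from lborel_pair.AE_integrable_snd[OF i] show "AE t in lborel. integrable lborel (\<lambda>x. f (x, t))" .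
  from lborel_pair.integrable_snd[OF i] show "integrable lborel (\<lambda>t. \<integral>x. f (x, t) \<partial>lborel)" .
qed

lemma AE_swap_pt:
  fixes P :: "pt \<Rightarrow> bool"
  assumes "AE p in lborel. P p"
  shows "AE t in lborel. AE x in lborel. P (x, t)"
  using AE_pt[OF AE_swap[OF assms]] by simp

lemma AE_swap_pt_I:
  fixes P :: "pt \<Rightarrow> bool"
  assumes [measurable]: "Measurable.pred borel P" and "AE t in lborel. AE x in lborel. P (x, t)"
  shows "AE p in lborel. P p"
proof -
  have "AE p in lborel. P (prod.swap p)"
    by (rule AE_pt_I) (use assms(2) in simp_all)
  from AE_swap[OF this] show ?thesis by simp
qed

lemma integral_shift_pt:
  fixes f :: "pt \<Rightarrow> real"
  assumes [measurable]: "f \<in> borel_measurable borel"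
  shows "(\<integral>p. f (p + c) \<partial>lborel) = (\<integral>p. f p \<partial>lborel)"
    "integrable lborel f \<Longrightarrow> integrable lborel (\<lambda>p. f (p + c))"
proof -
  have d: "distr lborel borel ((+) c) = lborel" by (rule lborel_distr_plus)
  show "(\<integral>p. f (p + c) \<partial>lborel) = (\<integral>p. f p \<partial>lborel)"
    by (subst (2) d[symmetric], subst integral_distr) (auto simp: add.commute)
  assume "integrable lborel f"
  then have "integrable (distr lborel borel ((+) c)) f" unfolding d .
  then show "integrable lborel (\<lambda>p. f (p + c))"
    by (subst (asm) integrable_distr_eq) (auto simp: add.commute)
qed

lemma AE_lborel_ex:
  assumes "AE x::real in lborel. P x"
  shows "\<exists>x. P x"
proof (rule ccontr)
  assume "\<nexists>x. P x"
  with assms obtain N :: "real set" where "UNIV \<subseteq> N" "N \<in> null_sets lborel"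
    by (auto simp: eventually_ae_filter)
  then have "emeasure lborel (UNIV :: real set) = 0" by (simp add: null_sets_def top.extremum_unique)
  then show False by simp
qed

text \<open>Testing with \<open>a' x * b y\<close>, where \<open>a\<close> is the difference of an antiderivative of a bump function
  and its translate, shows that the integrals of \<open>u\<close> over boxes are invariant under horizontal translation.\<close>

lemma weak_derivative_zero:
  assumes u: "loc_int_pt u"
    and weak: "\<And>a a' b R. smooth1 a \<Longrightarrow> smooth1 b \<Longrightarrow> (\<And>x. (a has_real_derivative a' x) (at x)) \<Longrightarrow>
      (\<And>x. \<bar>x\<bar> > R \<Longrightarrow> a x = 0) \<Longrightarrow> (\<And>x. \<bar>x\<bar> > R \<Longrightarrow> b x = 0) \<Longrightarrow>
      (\<integral>p. u p * (a' (fst p) * b (snd p)) \<partial>lborel) = 0"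
  obtains c where "c \<in> borel_measurable borel" "AE p in lborel. u p = c (snd p)"
proof -
  have [measurable]: "u \<in> borel_measurable borel" using u by (rule loc_int_ptD)
  have shift: "AE p in lborel. u (p + (\<tau>, 0)) = u p" for \<tau>
  proof -
    have ut: "loc_int_pt (\<lambda>p. u (p + (\<tau>, 0)))"
      unfolding loc_int_pt_def set_integrable_def
    proof (intro conjI allI)
      fix a b :: pt
      have "integrable lborel (\<lambda>p. indicat_real (cbox (a + (\<tau>, 0)) (b + (\<tau>, 0))) (p + (\<tau>, 0)) *\<^sub>R u (p + (\<tau>, 0)))"
        by (rule integral_shift_pt(2)) (use loc_int_ptD(2)[OF u] in \<open>simp_all add: set_integrable_def\<close>)
      moreover have "indicat_real (cbox (a + (\<tau>, 0)) (b + (\<tau>, 0))) (p + (\<tau>, 0)) = indicator (cbox a b) p" for p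
        by (cases a; cases b; cases p) (auto simp: indicator_def cbox_Pair_eq)
      ultimately show "integrable lborel (\<lambda>p. indicat_real (cbox a b) p *\<^sub>R u (p + (\<tau>, 0)))" by simp
    qed measurable
    have "AE p in lborel. u (p + (\<tau>, 0)) - u p = 0"
    proof (rule AE_zero_of_boxes)
      show "set_integrable lborel (cbox a b) (\<lambda>p. u (p + (\<tau>, 0)) - u p)" for a b
        using loc_int_ptD(2)[OF loc_int_pt_diff[OF ut u]] .
      fix A B :: pt
      obtain s t s' t' where AB: "A = (s, s')" "B = (t, t')" by (cases A; cases B)
      define h where "h n p = (bump s t n (fst p) - bump s t n (fst p - \<tau>)) * bump s' t' n (snd p)" for n and p :: pt
      \<comment> \<open>The summand \<open>\<bar>\<tau>\<bar>\<close> ensures that for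
        \<open>\<bar>x\<bar> > R\<close> the points \<open>x\<close> and \<open>x - \<tau>\<close>
        lie on the same side of the support of the bump. The antiderivative is constant on each
        side, though with different constants, so only its difference with the translate has compact
        support.\<close>
      define R where "R = \<bar>s\<bar> + \<bar>t\<bar> + \<bar>\<tau>\<bar> + \<bar>s'\<bar> + \<bar>t'\<bar>"
      have bm: "bump s t n \<in> borel_measurable borel" for s t n
        by (rule borel_measurable_continuous_onI[OF smooth1_cont[OF smooth1_bump]])
      note [measurable] = bm
      have hz: "(\<integral>p. u p * h n p \<partial>lborel) = 0" for n
      proof -
        obtain \<beta> where \<beta>: "\<And>x. (\<beta> has_real_derivative bump s t n x) (at x)"
          "smooth1 \<beta>" "\<And>x y. x \<le> s \<Longrightarrow> y \<le> s \<Longrightarrow> \<beta> x = \<beta> y" "\<And>x y. t \<le> x \<Longrightarrow> t \<le> y \<Longrightarrow> \<beta> x = \<beta> y"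
        proof -
          have "\<exists>\<beta>. \<forall>x::real. (\<beta> has_vector_derivative bump s t n x) (at x)"
            using einterval_antiderivative[of "-\<infinity>" "\<infinity>" "bump s t n"] smooth1_cont[OF smooth1_bump]
            by (auto simp: continuous_on_eq_continuous_at)
          then obtain \<beta> where \<beta>: "\<And>x::real. (\<beta> has_real_derivative bump s t n x) (at x)"
            by (auto simp: has_real_derivative_iff_has_vector_derivative)
          have const: "\<beta> x = \<beta> y" if "x \<le> y" "\<And>z. x \<le> z \<Longrightarrow> z \<le> y \<Longrightarrow> bump s t n z = 0" for x y
          proof (cases "x = y")
            case False
            then have "x < y" using that by simp
            then show ?thesis
              by (rule DERIV_isconst_end[symmetric])
                 (use that \<beta> in \<open>auto intro!: continuous_at_imp_continuous_on DERIV_isCont\<close>, metis less_imp_le)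
          qed simp
          show ?thesis
          proof (rule that[OF \<beta> smooth1_antideriv[OF \<beta> smooth1_bump]])
            show "\<beta> x = \<beta> y" if "x \<le> s" "y \<le> s" for x y
            proof (cases "x \<le> y")
              case True
              then show ?thesis by (rule const) (use that in \<open>auto intro!: bump_zero\<close>)
            next
              case False
              then have "y \<le> x" by simp
              then have "\<beta> y = \<beta> x" by (rule const) (use that in \<open>auto intro!: bump_zero\<close>)
              then show ?thesis by simp
            qed
            show "\<beta> x = \<beta> y" if "t \<le> x" "t \<le> y" for x y
            proof (cases "x \<le> y")
              case True
              then show ?thesis by (rule const) (use that in \<open>auto intro!: bump_zero\<close>)
            next
              case False
              then have "y \<le> x" by simp
              then have "\<beta> y = \<beta> x" by (rule const) (use that in \<open>auto intro!: bump_zero\<close>)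
              then show ?thesis by simp
            qed
          qed
        qed
        have "(\<integral>p. u p * ((bump s t n (fst p) - bump s t n (fst p - \<tau>)) * bump s' t' n (snd p)) \<partial>lborel) = 0"
        proof (rule weak[where R=R])
          show "smooth1 (\<lambda>x. \<beta> x - \<beta> (x - \<tau>))"
            using smooth1_diff[OF \<beta>(2) smooth1_intros(4)[OF \<beta>(2), of "- \<tau>" 1]] by simp
          show "((\<lambda>x. \<beta> x - \<beta> (x - \<tau>)) has_real_derivative bump s t n x - bump s t n (x - \<tau>)) (at x)" for x
            using DERIV_diff[OF \<beta>(1)[of x] DERIV_shift[THEN iffD1, of \<beta> _ x "- \<tau>"]] \<beta>(1)[of "x - \<tau>"] by simp
          show "\<beta> x - \<beta> (x - \<tau>) = 0" if "\<bar>x\<bar> > R" for x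
            using that \<beta>(3)[of x "x - \<tau>"] \<beta>(4)[of x "x - \<tau>"] by (cases "x > 0") (auto simp: R_def)
          show "bump s' t' n x = 0" if "\<bar>x\<bar> > R" for x
            using that by (intro bump_zero) (auto simp: R_def)
        qed (rule smooth1_bump)
        then show ?thesis unfolding h_def .
      qed
      define h0 where "h0 p = (indicat_real {s<..<t} (fst p) - indicator {s<..<t} (fst p - \<tau>)) * indicator {s'<..<t'} (snd p)" for p :: pt
      have h_lim: "(\<lambda>n. h n p) \<longlonglongrightarrow> h0 p" for p
        unfolding h_def h0_def by (intro tendsto_intros bump_tendsto)
      have h_bd: "\<bar>h n p\<bar> \<le> 1" for n p
      proof -
        have "\<bar>h n p\<bar> \<le> 1 * 1" unfolding h_def abs_mult
          using bump_bounds[of s t n "fst p"] bump_bounds[of s t n "fst p - \<tau>"] bump_bounds[of s' t' n "snd p"]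
          by (intro mult_mono) (auto simp: abs_le_iff)
        then show ?thesis by simp
      qed
      have h_z: "h n p = 0" if "p \<notin> cbox (-R, -R) (R, R)" for n p
      proof -
        have "\<bar>fst p\<bar> > R \<or> \<bar>snd p\<bar> > R" using that by (cases p) (auto simp: cbox_Pair_eq)
        then show ?thesis
        proof
          assume "\<bar>fst p\<bar> > R"
          then have "bump s t n (fst p) = 0" "bump s t n (fst p - \<tau>) = 0" by (auto intro!: bump_zero simp: R_def)
          then show ?thesis by (simp add: h_def)
        next
          assume "\<bar>snd p\<bar> > R"
          then have "bump s' t' n (snd p) = 0" by (auto intro!: bump_zero simp: R_def)
          then show ?thesis by (simp add: h_def)
        qed
      qed
      have h0m: "(\<integral>p. u p * h0 p \<partial>lborel) = 0"
      proof -
        have "(\<lambda>n. \<integral>p. u p * h n p \<partial>lborel) \<longlonglongrightarrow> (\<integral>p. u p * h0 p \<partial>lborel)"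
        proof (rule integral_dominated_convergence[where w="\<lambda>p. indicator (cbox (-R, -R) (R, R)) p * \<bar>u p\<bar>"])
          show "(\<lambda>p. u p * h0 p) \<in> borel_measurable lborel" unfolding h0_def by measurable
          show "(\<lambda>p. u p * h n p) \<in> borel_measurable lborel" for n unfolding h_def by measurable
          show "integrable lborel (\<lambda>p. indicator (cbox (-R, -R) (R, R)) p * \<bar>u p\<bar>)"
            using set_integrable_abs[OF loc_int_ptD(2)[OF u]] by (simp add: set_integrable_def)
          show "AE p in lborel. (\<lambda>n. u p * h n p) \<longlonglongrightarrow> u p * h0 p"
            by (intro AE_I2 tendsto_intros h_lim)
          show "AE p in lborel. norm (u p * h n p) \<le> indicator (cbox (-R, -R) (R, R)) p * \<bar>u p\<bar>" for n
            using h_bd h_z[of _ n] by (intro AE_I2) (auto simp: indicator_def abs_mult intro!: mult_left_le)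
        qed
        then show ?thesis using LIMSEQ_unique tendsto_const[of 0 sequentially] unfolding hz by metis
      qed
      define \<iota> where "\<iota> p = indicat_real (box A B) p" for p
      have [measurable]: "\<iota> \<in> borel_measurable borel" unfolding \<iota>_def by measurable
      have \<iota>: "\<iota> p = indicator {s<..<t} (fst p) * indicator {s'<..<t'} (snd p)" for p
        by (cases p) (auto simp: \<iota>_def AB indicator_def mem_box Basis_prod_def)
      have \<iota>_eq: "h0 p = \<iota> p - \<iota> (p - (\<tau>, 0))" for p
        unfolding h0_def \<iota> by (simp add: left_diff_distrib)
      have i1: "integrable lborel (\<lambda>p. u p * \<iota> p)"
        by (rule loc_int_pt_mult[OF u, of _ 1 A B]) (auto simp: \<iota>_def indicator_def box_subset_cbox[THEN subsetD])
      have i2: "integrable lborel (\<lambda>p. u (p + (\<tau>, 0)) * \<iota> p)"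
        by (rule loc_int_pt_mult[OF ut, of _ 1 A B]) (auto simp: \<iota>_def indicator_def box_subset_cbox[THEN subsetD])
      have i3: "integrable lborel (\<lambda>p. u p * \<iota> (p - (\<tau>, 0)))"
      proof -
        have e: "p + (- \<tau>, 0) + (\<tau>, 0) = p" "p + (- \<tau>, 0) = p - (\<tau>, 0)" for p :: pt by (cases p; simp)+
        have "integrable lborel (\<lambda>p. u (p + (- \<tau>, 0) + (\<tau>, 0)) * \<iota> (p + (- \<tau>, 0)))"
          by (rule integral_shift_pt(2)[OF _ i2]) measurable
        then show ?thesis unfolding e(1) unfolding e(2) .
      qed
      have "(\<integral>p. u (p + (\<tau>, 0)) * \<iota> p \<partial>lborel) = (\<integral>p. u p * \<iota> (p - (\<tau>, 0)) \<partial>lborel)"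
        using integral_shift_pt(1)[of "\<lambda>p. u p * \<iota> (p - (\<tau>, 0))" "(\<tau>, 0)"] by simp
      moreover have "(\<integral>p. u p * h0 p \<partial>lborel) = (\<integral>p. u p * \<iota> p \<partial>lborel) - (\<integral>p. u p * \<iota> (p - (\<tau>, 0)) \<partial>lborel)"
        unfolding \<iota>_eq right_diff_distrib by (rule Bochner_Integration.integral_diff[OF i1 i3])
      ultimately show "(\<integral>p. indicator (box A B) p * (u (p + (\<tau>, 0)) - u p) \<partial>lborel) = 0"
        using h0m i1 i2 unfolding \<iota>_def by (simp add: right_diff_distrib mult.commute)
    qed
    then show ?thesis by simp
  qed
  \<comment> \<open>The exceptional set depended on the translation; interchanging the two
    quantifiers makes almost every point good for almost every translation.\<close>
  have "AE p in lborel. AE \<tau> in lborel. u (p + (\<tau>, 0)) = u p"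
  proof (rule lborel_pair.AE_commute[THEN iffD1])
    show "{x \<in> space (lborel \<Otimes>\<^sub>M lborel). u (snd x + (fst x, 0)) = u (snd x)} \<in> sets (lborel \<Otimes>\<^sub>M lborel)"
      by measurable
    show "AE x in lborel. AE y in lborel. u (y + (x, 0)) = u y" using shift by simp
  qed
  from AE_pt[OF this] have "AE x in lborel. AE t in lborel. AE \<tau> in lborel. u (x + \<tau>, t) = u (x, t)"
    by simp
  \<comment> \<open>One good column determines everything: on almost every row \<open>u\<close>
    equals its value at \<open>x0\<close>.\<close>
  from AE_lborel_ex[OF this] obtain x0 where x0: "AE t in lborel. AE \<tau> in lborel. u (x0 + \<tau>, t) = u (x0, t)" ..
  have "AE p in lborel. u p = u (x0, snd p)"
  proof (rule AE_swap_pt_I)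
    show "Measurable.pred borel (\<lambda>p. u p = u (x0, snd p))" by measurable
    show "AE t in lborel. AE x in lborel. u (x, t) = u (x0, snd (x, t))"
      using x0
    proof eventually_elim
      case (elim t)
      from AE_shift[OF elim, of "- x0"] show ?case by simp
    qed
  qed
  then show ?thesis by (rule that[rotated]) measurable
qed

text \<open>Absolute continuity on horizontal lines, made explicit: \<open>c\<close> holds the
  values on the vertical axis and \<open>g\<close> the derivative. The sections of \<open>g\<close>
  are locally integrable for every \<open>t\<close>, not only for almost every one, so that
  primitives can be rebased without exceptional rows. Vertical lines are treated by composing with
  \<open>prod.swap\<close>.\<close>

definition hrep :: "(pt \<Rightarrow> real) \<Rightarrow> (real \<Rightarrow> real) \<Rightarrow> (pt \<Rightarrow> real) \<Rightarrow> bool" where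
  "hrep F c g \<longleftrightarrow> c \<in> borel_measurable borel \<and> g \<in> borel_measurable borel \<and> (\<forall>t. loc_int (\<lambda>s. g (s, t))) \<and>
     (\<integral>\<^sup>+ p. ennreal ((g p)\<^sup>2) \<partial>lborel) < \<infinity> \<and>
     (AE p in lborel. F p = c (snd p) + lineint (\<lambda>s. g (s, snd p)) 0 (fst p))"

lemma lineint_pt_measurable [measurable]:
  assumes [measurable]: "g \<in> borel_measurable borel" "A \<in> borel_measurable borel" "B \<in> borel_measurable borel"
  shows "(\<lambda>p::pt. lineint (\<lambda>s. g (s, snd p)) (A p) (B p)) \<in> borel_measurable borel"
    "(\<lambda>p::pt. lineint (\<lambda>s. g (fst p, s)) (A p) (B p)) \<in> borel_measurable borel"
proof -
  show "(\<lambda>p::pt. lineint (\<lambda>s. g (s, snd p)) (A p) (B p)) \<in> borel_measurable borel"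
    by (rule lineint_measurable) measurable
  show "(\<lambda>p::pt. lineint (\<lambda>s. g (fst p, s)) (A p) (B p)) \<in> borel_measurable borel"
    by (rule lineint_measurable) measurable
qed

lemma outside_square:
  fixes p :: pt
  assumes "p \<notin> cbox (-R, -R) (R, R)"
  shows "\<bar>fst p\<bar> > R \<or> \<bar>snd p\<bar> > R"
  using assms by (cases p) (auto simp: cbox_Pair_eq)

lemma emeasure_cbox_pt_finite: "emeasure lborel (cbox a b :: pt set) < \<infinity>"
  by (rule emeasure_lborel_cbox_finite)

lemma loc_int_pt_L2:
  fixes u :: "pt \<Rightarrow> real"
  assumes [measurable]: "u \<in> borel_measurable borel"
    and fin: "\<And>a b. (\<integral>\<^sup>+ p\<in>cbox a b. ennreal ((u p)\<^sup>2) \<partial>lborel) < \<infinity>"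
  shows "loc_int_pt u"
  unfolding loc_int_pt_def set_integrable_def
proof (intro conjI allI integrableI_bounded)
  fix a b :: pt
  have "(\<integral>\<^sup>+ s\<in>cbox a b. ennreal \<bar>u s\<bar> \<partial>lborel)\<^sup>2 \<le> emeasure lborel (cbox a b) * (\<integral>\<^sup>+ s\<in>cbox a b. (ennreal \<bar>u s\<bar>)\<^sup>2 \<partial>lborel)"
    by (rule nn_integral_sq_le) auto
  also have "\<dots> < \<infinity>"
    using fin[of a b] emeasure_cbox_pt_finite[of a b] by (simp add: ennreal_power2 ennreal_mult_less_top)
  finally have "(\<integral>\<^sup>+ s\<in>cbox a b. ennreal \<bar>u s\<bar> \<partial>lborel) < \<infinity>"
    by (auto simp: power2_eq_square ennreal_mult_less_top)
  also have "(\<integral>\<^sup>+ s\<in>cbox a b. ennreal \<bar>u s\<bar> \<partial>lborel) = (\<integral>\<^sup>+ x. ennreal (norm (indicat_real (cbox a b) x *\<^sub>R u x)) \<partial>lborel)"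
    by (rule nn_integral_cong) (auto simp: indicator_def)
  finally show "(\<integral>\<^sup>+ x. ennreal (norm (indicat_real (cbox a b) x *\<^sub>R u x)) \<partial>lborel) < \<infinity>" .
qed auto

lemma loc_int_pt_L2':
  fixes u :: "pt \<Rightarrow> real"
  assumes [measurable]: "u \<in> borel_measurable borel"
    and fin: "(\<integral>\<^sup>+ p. ennreal ((u p)\<^sup>2) \<partial>lborel) < \<infinity>"
  shows "loc_int_pt u"
  by (rule loc_int_pt_L2[OF assms(1)], rule le_less_trans[OF nn_integral_mono fin]) (auto simp: indicator_def)

lemma loc_int_pt_lineint:
  fixes g :: "pt \<Rightarrow> real"
  assumes [measurable]: "g \<in> borel_measurable borel"
    and fin: "(\<integral>\<^sup>+ p. ennreal ((g p)\<^sup>2) \<partial>lborel) < \<infinity>"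
  shows "loc_int_pt (\<lambda>p. lineint (\<lambda>s. g (s, snd p)) 0 (fst p))"
proof (rule loc_int_pt_L2)
  show "(\<lambda>p. lineint (\<lambda>s. g (s, snd p)) 0 (fst p)) \<in> borel_measurable borel" by measurable
  fix a b :: pt
  define N where "N = \<bar>fst a\<bar> + \<bar>fst b\<bar>"
  have N: "N \<ge> 0" by (simp add: N_def)
  have "(\<integral>\<^sup>+ p\<in>cbox a b. ennreal ((lineint (\<lambda>s. g (s, snd p)) 0 (fst p))\<^sup>2) \<partial>lborel)
    \<le> (\<integral>\<^sup>+ p. ennreal N * (\<integral>\<^sup>+ s. ennreal ((g (s, snd p))\<^sup>2) \<partial>lborel) * indicator {-N..N} (fst p) \<partial>lborel)"
  proof (rule nn_integral_mono)
    fix p :: pt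
    show "ennreal ((lineint (\<lambda>s. g (s, snd p)) 0 (fst p))\<^sup>2) * indicator (cbox a b) p \<le> ennreal N * (\<integral>\<^sup>+ s. ennreal ((g (s, snd p))\<^sup>2) \<partial>lborel) * indicator {-N..N} (fst p)"
    proof (cases "p \<in> cbox a b")
      case True
      then have x: "\<bar>fst p\<bar> \<le> N" by (cases a; cases b; cases p) (auto simp: cbox_Pair_eq N_def)
      have "ennreal ((lineint (\<lambda>s. g (s, snd p)) 0 (fst p))\<^sup>2) \<le> ennreal \<bar>fst p - 0\<bar> * (\<integral>\<^sup>+ s\<in>{min 0 (fst p)..max 0 (fst p)}. ennreal ((g (s, snd p))\<^sup>2) \<partial>lborel)"
        by (rule lineint_sq_le) measurable
      also have "\<dots> \<le> ennreal N * (\<integral>\<^sup>+ s. ennreal ((g (s, snd p))\<^sup>2) \<partial>lborel)"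
        using x by (intro mult_mono ennreal_leI nn_integral_mono) (auto simp: indicator_def)
      finally show ?thesis using x by (auto simp: indicator_def)
    qed simp
  qed
  also have "\<dots> = (\<integral>\<^sup>+ t. \<integral>\<^sup>+ x. ennreal N * (\<integral>\<^sup>+ s. ennreal ((g (s, t))\<^sup>2) \<partial>lborel) * indicator {-N..N} x \<partial>lborel \<partial>lborel)"
    by (subst nn_integral_pt(2)) auto
  also have "\<dots> = (\<integral>\<^sup>+ t. ennreal N * (\<integral>\<^sup>+ s. ennreal ((g (s, t))\<^sup>2) \<partial>lborel) * ennreal (2 * N) \<partial>lborel)"
    using N by (subst nn_integral_cmult) auto
  also have "\<dots> = ennreal N * (\<integral>\<^sup>+ p. ennreal ((g p)\<^sup>2) \<partial>lborel) * ennreal (2 * N)"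
    by (subst nn_integral_multc, measurable, subst nn_integral_cmult, measurable) (simp add: nn_integral_pt(2))
  also have "\<dots> < \<infinity>" using fin by (simp add: ennreal_mult_less_top)
  finally show "(\<integral>\<^sup>+ p\<in>cbox a b. ennreal ((lineint (\<lambda>s. g (s, snd p)) 0 (fst p))\<^sup>2) \<partial>lborel) < \<infinity>" .
qed

text \<open>Rows of infinite energy form a null set by Tonelli; putting the function equal to 0 on
  them makes every section locally square integrable.\<close>

lemma truncate_L2:
  fixes g :: "pt \<Rightarrow> real"
  assumes [measurable]: "g \<in> borel_measurable borel"
    and fin: "(\<integral>\<^sup>+ p. ennreal ((g p)\<^sup>2) \<partial>lborel) < \<infinity>"
  obtains g' where "g' \<in> borel_measurable borel" "AE p in lborel. g' p = g p" "\<And>t. loc_int (\<lambda>s. g' (s, t))"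
    "(\<integral>\<^sup>+ p. ennreal ((g' p)\<^sup>2) \<partial>lborel) < \<infinity>"
proof -
  define I where "I t = (\<integral>\<^sup>+ s. ennreal ((g (s, t))\<^sup>2) \<partial>lborel)" for t
  have [measurable]: "I \<in> borel_measurable borel" unfolding I_def by measurable
  define g' where "g' p = (if I (snd p) < \<infinity> then g p else 0)" for p
  have m [measurable]: "g' \<in> borel_measurable borel" unfolding g'_def by measurable
  have "(\<integral>\<^sup>+ t. I t \<partial>lborel) < \<infinity>" using fin by (simp add: nn_integral_pt(2) I_def)
  then have "AE t in lborel. I t < \<infinity>" using nn_integral_PInf_AE[of I lborel] by (auto simp: less_top)
  then have ae: "AE p in lborel. g' p = g p"
    by (intro AE_swap_pt_I) (auto simp: g'_def)
  have l: "loc_int (\<lambda>s. g' (s, t))" for t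
  proof (rule loc_int_L2)
    fix a b
    have "(\<integral>\<^sup>+ s\<in>{a..b}. ennreal ((g' (s, t))\<^sup>2) \<partial>lborel) \<le> (if I t < \<infinity> then I t else 0)"
    proof (cases "I t < \<infinity>")
      case True
      then show ?thesis unfolding I_def g'_def by (auto intro!: nn_integral_mono simp: indicator_def)
    qed (simp add: g'_def)
    also have "\<dots> < \<infinity>" by simp
    finally show "(\<integral>\<^sup>+ s\<in>{a..b}. ennreal ((g' (s, t))\<^sup>2) \<partial>lborel) < \<infinity>" .
  qed measurable
  have "(\<integral>\<^sup>+ p. ennreal ((g' p)\<^sup>2) \<partial>lborel) \<le> (\<integral>\<^sup>+ p. ennreal ((g p)\<^sup>2) \<partial>lborel)"
    by (intro nn_integral_mono) (auto simp: g'_def)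
  then show ?thesis using that[OF m ae l] fin by simp
qed

text \<open>Row by row, with the one-variable formula. The weight need not be a product: products
  suffice to extract a representation from a weak derivative, but general test functions occur when
  a weak derivative has to be produced.\<close>

lemma hrep_integration_by_parts:
  fixes \<phi> D :: "pt \<Rightarrow> real"
  assumes F: "loc_int_pt F" and h: "hrep F c g"
    and d: "\<And>x t. ((\<lambda>x. \<phi> (x, t)) has_real_derivative D (x, t)) (at x)"
    and D: "continuous_on UNIV D" and ph: "continuous_on UNIV \<phi>"
    and z: "\<And>x t. \<bar>x\<bar> > R \<or> \<bar>t\<bar> > R \<Longrightarrow> \<phi> (x, t) = 0"
  shows "(\<integral>p. F p * D p \<partial>lborel) = - (\<integral>p. g p * \<phi> p \<partial>lborel)"
proof -
  have [measurable]: "F \<in> borel_measurable borel" "c \<in> borel_measurable borel" "g \<in> borel_measurable borel"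
    and gl: "\<And>t. loc_int (\<lambda>s. g (s, t))" and fin: "(\<integral>\<^sup>+ p. ennreal ((g p)\<^sup>2) \<partial>lborel) < \<infinity>"
    and rep: "AE p in lborel. F p = c (snd p) + lineint (\<lambda>s. g (s, snd p)) 0 (fst p)"
    using F h by (auto simp: hrep_def loc_int_pt_def)
  have [measurable]: "D \<in> borel_measurable borel" "\<phi> \<in> borel_measurable borel"
    using D ph by (auto intro: borel_measurable_continuous_onI)
  have Dc: "continuous_on UNIV (\<lambda>x. D (x, t))" for t
    by (rule continuous_on_compose2[OF D]) (auto intro!: continuous_intros)
  have zt: "\<phi> (x, t) = 0" if "\<bar>x\<bar> > R" for x t using z that by blast
  have cs1: "D (x, t) = 0" if "\<bar>x\<bar> > R" for x t
    by (rule integral_derivative_compact_support(1)[where a="\<lambda>x. \<phi> (x, t)" and a'="\<lambda>x. D (x, t)", OF d Dc zt that])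
  have cs2: "(\<integral>x. indicator {s..u} x * D (x, t) \<partial>lborel) = \<phi> (u, t) - \<phi> (s, t)" if "s \<le> u" for s u t
    by (rule integral_derivative_compact_support(2)[where a="\<lambda>x. \<phi> (x, t)" and a'="\<lambda>x. D (x, t)", OF d Dc zt that])
  have Dz: "D (x, t) = 0" if "\<bar>x\<bar> > R \<or> \<bar>t\<bar> > R" for x t
  proof (cases "\<bar>x\<bar> > R")
    case True then show ?thesis by (rule cs1)
  next
    case False
    then have "((\<lambda>x. \<phi> (x, t)) has_real_derivative 0) (at x)" using that z by (auto simp: zt)
    then show ?thesis using d DERIV_unique by blast
  qed
  have bd: "\<exists>C. \<forall>p. \<bar>f p\<bar> \<le> C" if "continuous_on UNIV f" "\<And>x t. \<bar>x\<bar> > R \<or> \<bar>t\<bar> > R \<Longrightarrow> f (x, t) = 0" for f :: "pt \<Rightarrow> real"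
  proof -
    have "bounded (f ` cbox (-R, -R) (R, R))"
      using that(1) by (intro compact_imp_bounded compact_continuous_image) (auto intro: continuous_on_subset)
    then obtain C where C: "\<forall>p\<in>cbox (-R, -R) (R, R). \<bar>f p\<bar> \<le> C" by (auto simp: bounded_iff)
    have "\<bar>f p\<bar> \<le> max C 0" for p
    proof (cases "p \<in> cbox (-R, -R) (R, R)")
      case True
      then have "\<bar>f p\<bar> \<le> C" using C by blast
      then show ?thesis by simp
    next
      case False
      then have "f p = 0" using outside_square[OF False] that(2)[of "fst p" "snd p"] by simp
      then show ?thesis by simp
    qed
    then show ?thesis by blast
  qed
  obtain C1 where C1: "\<forall>p. \<bar>D p\<bar> \<le> C1" using bd[OF D Dz] by blast
  obtain C2 where C2: "\<forall>p. \<bar>\<phi> p\<bar> \<le> C2" using bd[OF ph z] by blast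
  have i1: "integrable lborel (\<lambda>p. F p * D p)"
    by (rule loc_int_pt_mult[OF F, of _ C1 "(-R, -R)" "(R, R)"]) (use C1 Dz outside_square in \<open>auto simp: prod_eq_iff dest!: outside_square\<close>)
  have i2: "integrable lborel (\<lambda>p. g p * \<phi> p)"
    by (rule loc_int_pt_mult[OF loc_int_pt_L2'[OF _ fin], of _ C2 "(-R, -R)" "(R, R)"]) (use C2 z outside_square in \<open>auto simp: prod_eq_iff dest!: outside_square\<close>)
  have "(\<integral>p. F p * D p \<partial>lborel) = (\<integral>t. \<integral>x. F (x, t) * D (x, t) \<partial>lborel \<partial>lborel)"
    by (rule integral_pt(1)[OF i1])
  also have "\<dots> = (\<integral>t. - (\<integral>x. g (x, t) * \<phi> (x, t) \<partial>lborel) \<partial>lborel)"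
  proof (rule integral_cong_AE)
    show "AE t in lborel. (\<integral>x. F (x, t) * D (x, t) \<partial>lborel) = - (\<integral>x. g (x, t) * \<phi> (x, t) \<partial>lborel)"
      using AE_swap_pt[OF rep]
    proof eventually_elim
      case (elim t)
      note ibp = integration_by_parts_lineint[where a="\<lambda>x. \<phi> (x, t)" and a'="\<lambda>x. D (x, t)" and R=R, OF gl d Dc zt]
      \<comment> \<open>The derivative integrates to 0 over each row, so the axis value
        \<open>c t\<close> drops out.\<close>
      have iD: "integrable lborel (\<lambda>x. D (x, t))" "(\<integral>x. D (x, t) \<partial>lborel) = 0"
      proof -
        have e: "D (x, t) = indicator {- \<bar>R\<bar> - 1..\<bar>R\<bar> + 1} x *\<^sub>R D (x, t)" for x
          using cs1[of x t] by (cases "\<bar>x\<bar> > R") (auto simp: indicator_def)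
        have "set_integrable lborel {- \<bar>R\<bar> - 1..\<bar>R\<bar> + 1} (\<lambda>x. D (x, t))"
          using loc_int_continuous[OF Dc] by (rule loc_intD)
        then show "integrable lborel (\<lambda>x. D (x, t))" unfolding set_integrable_def by (subst e)
        have "(\<integral>x. D (x, t) \<partial>lborel) = (\<integral>x. indicator {- \<bar>R\<bar> - 1..\<bar>R\<bar> + 1} x * D (x, t) \<partial>lborel)"
          by (subst e) simp
        also have "\<dots> = \<phi> (\<bar>R\<bar> + 1, t) - \<phi> (- \<bar>R\<bar> - 1, t)" by (rule cs2) simp
        also have "\<dots> = 0" by (simp add: zt)
        finally show "(\<integral>x. D (x, t) \<partial>lborel) = 0" .
      qed
      have "(\<integral>x. F (x, t) * D (x, t) \<partial>lborel) = (\<integral>x. c t * D (x, t) + lineint (\<lambda>s. g (s, t)) 0 x * D (x, t) \<partial>lborel)"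
      proof (rule integral_cong_AE)
        have [measurable]: "(\<lambda>x. lineint (\<lambda>s. g (s, t)) 0 x) \<in> borel_measurable borel"
          by (rule lineint_measurable) measurable
        show "(\<lambda>x. c t * D (x, t) + lineint (\<lambda>s. g (s, t)) 0 x * D (x, t)) \<in> borel_measurable lborel" by measurable
        show "AE x in lborel. F (x, t) * D (x, t) = c t * D (x, t) + lineint (\<lambda>s. g (s, t)) 0 x * D (x, t)"
          using elim by eventually_elim (simp add: distrib_right)
      qed measurable
      also have "\<dots> = c t * (\<integral>x. D (x, t) \<partial>lborel) + (\<integral>x. lineint (\<lambda>s. g (s, t)) 0 x * D (x, t) \<partial>lborel)"
        using iD(1) ibp(2) by simp
      also have "\<dots> = - (\<integral>x. g (x, t) * \<phi> (x, t) \<partial>lborel)" using iD(2) ibp(3) by simp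
      finally show ?case .
    qed
    show "(\<lambda>t. \<integral>x. F (x, t) * D (x, t) \<partial>lborel) \<in> borel_measurable lborel"
      using integral_pt(3)[OF i1] by (rule borel_measurable_integrable)
    show "(\<lambda>t. - (\<integral>x. g (x, t) * \<phi> (x, t) \<partial>lborel)) \<in> borel_measurable lborel"
      using integral_pt(3)[OF i2] by (intro borel_measurable_uminus borel_measurable_integrable)
  qed
  also have "\<dots> = - (\<integral>p. g p * \<phi> p \<partial>lborel)"
    using integral_pt(1)[OF i2] by simp
  finally show ?thesis .
qed

text \<open>The horizontal primitive of \<open>g\<close> has the same weak derivative as
  \<open>F\<close>, so their difference has weak derivative 0 and depends on the second coordinate
  only; that function is \<open>c\<close>.\<close>

lemma weak_derivative_hrep:
  assumes F: "loc_int_pt F" and [measurable]: "g0 \<in> borel_measurable borel"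
    and fin0: "(\<integral>\<^sup>+ p. ennreal ((g0 p)\<^sup>2) \<partial>lborel) < \<infinity>"
    and weak: "\<And>a a' b R. smooth1 a \<Longrightarrow> smooth1 b \<Longrightarrow> (\<And>x. (a has_real_derivative a' x) (at x)) \<Longrightarrow>
      (\<And>x. \<bar>x\<bar> > R \<Longrightarrow> a x = 0) \<Longrightarrow> (\<And>x. \<bar>x\<bar> > R \<Longrightarrow> b x = 0) \<Longrightarrow>
      (\<integral>p. F p * (a' (fst p) * b (snd p)) \<partial>lborel) = - (\<integral>p. g0 p * (a (fst p) * b (snd p)) \<partial>lborel)"
  obtains c g where "AE p in lborel. g p = g0 p" "hrep F c g"
proof -
  have [measurable]: "F \<in> borel_measurable borel" using F by (rule loc_int_ptD)
  obtain g where g [measurable]: "g \<in> borel_measurable borel" and gg0: "AE p in lborel. g p = g0 p"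
    and gl: "\<And>t. loc_int (\<lambda>s. g (s, t))" and fin: "(\<integral>\<^sup>+ p. ennreal ((g p)\<^sup>2) \<partial>lborel) < \<infinity>"
    by (rule truncate_L2[OF assms(2) fin0]) (rule that, assumption+)
  define P where "P p = lineint (\<lambda>s. g (s, snd p)) 0 (fst p)" for p :: pt
  have P: "loc_int_pt P" unfolding P_def by (rule loc_int_pt_lineint[OF g fin])
  have [measurable]: "P \<in> borel_measurable borel" using P by (rule loc_int_ptD)
  have hP: "hrep P (\<lambda>_. 0) g" unfolding hrep_def P_def using gl fin by auto
  obtain c where c: "c \<in> borel_measurable borel" "AE p in lborel. F p - P p = c (snd p)"
  proof (rule weak_derivative_zero[of "\<lambda>p. F p - P p"])
    show "loc_int_pt (\<lambda>p. F p - P p)" by (rule loc_int_pt_diff[OF F P])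
    fix a a' b :: "real \<Rightarrow> real" and R :: real
    assume a: "smooth1 a" and b: "smooth1 b" and d: "\<And>x. (a has_real_derivative a' x) (at x)"
      and za: "\<And>x. \<bar>x\<bar> > R \<Longrightarrow> a x = 0" and zb: "\<And>x. \<bar>x\<bar> > R \<Longrightarrow> b x = 0"
    \<comment> \<open>The given \<open>a'\<close> is only known to be a derivative of
      \<open>a\<close>; uniqueness identifies it with the smooth one.\<close>
    obtain a2 where a2: "\<And>x. (a has_real_derivative a2 x) (at x)" "smooth1 a2" using a smooth1_deriv by metis
    have "a2 = a'" by (rule ext, rule DERIV_unique[OF a2(1) d])
    with a2 have a': "smooth1 a'" by simp
    have ca: "continuous_on UNIV a" "continuous_on UNIV a'" "continuous_on UNIV b"
      using a a' b by (auto intro: smooth1_cont)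
    have ca': "continuous_on UNIV (\<lambda>p::pt. a (fst p))" "continuous_on UNIV (\<lambda>p::pt. a' (fst p))" "continuous_on UNIV (\<lambda>p::pt. b (snd p))"
      by (auto intro!: continuous_on_compose2[OF ca(1)] continuous_on_compose2[OF ca(2)] continuous_on_compose2[OF ca(3)] continuous_intros)
    have [measurable]: "a \<in> borel_measurable borel" "a' \<in> borel_measurable borel" "b \<in> borel_measurable borel"
      using ca by (auto intro: borel_measurable_continuous_onI)
    have za': "a' x = 0" if "\<bar>x\<bar> > R" for x
      by (rule integral_derivative_compact_support(1)[OF d ca(2) za that])
    have "(\<integral>p. P p * (a' (fst p) * b (snd p)) \<partial>lborel) = - (\<integral>p. g p * (a (fst p) * b (snd p)) \<partial>lborel)"
    proof (rule hrep_integration_by_parts[where R=R, OF P hP])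
      show "((\<lambda>x. a (fst (x, t)) * b (snd (x, t))) has_real_derivative a' (fst (x, t)) * b (snd (x, t))) (at x)" for x t
        using d by (auto intro!: derivative_eq_intros)
      show "continuous_on UNIV (\<lambda>p::pt. a' (fst p) * b (snd p))" "continuous_on UNIV (\<lambda>p::pt. a (fst p) * b (snd p))"
        using ca' by (auto intro!: continuous_on_mult)
      show "a (fst (x, t)) * b (snd (x, t)) = 0" if "\<bar>x\<bar> > R \<or> \<bar>t\<bar> > R" for x t using that za zb by auto
    qed
    also have "\<dots> = - (\<integral>p. g0 p * (a (fst p) * b (snd p)) \<partial>lborel)"
      by (intro arg_cong[where f=uminus] integral_cong_AE) (use gg0 in auto)
    also have "\<dots> = (\<integral>p. F p * (a' (fst p) * b (snd p)) \<partial>lborel)"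
      by (rule weak[OF a b d za zb, symmetric])
    finally have eq: "(\<integral>p. P p * (a' (fst p) * b (snd p)) \<partial>lborel) = (\<integral>p. F p * (a' (fst p) * b (snd p)) \<partial>lborel)" .
    obtain A where A: "\<And>x. \<bar>a' x\<bar> \<le> A" "A \<ge> 0" using bounded_of_compact_support[OF ca(2), of R] za' by blast
    obtain B where B: "\<And>x. \<bar>b x\<bar> \<le> B" "B \<ge> 0" using bounded_of_compact_support[OF ca(3), of R] zb by blast
    have int: "integrable lborel (\<lambda>p. u p * (a' (fst p) * b (snd p)))" if "loc_int_pt u" for u
    proof (rule loc_int_pt_mult[OF that, of _ "A * B" "(-R, -R)" "(R, R)"])
      show "\<bar>a' (fst p) * b (snd p)\<bar> \<le> A * B" for p :: pt unfolding abs_mult by (intro mult_mono A B) auto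
      fix p :: pt assume "p \<notin> cbox (-R, -R) (R, R)"
      from outside_square[OF this] show "a' (fst p) * b (snd p) = 0" using za' zb by auto
    qed measurable
    show "(\<integral>p. (F p - P p) * (a' (fst p) * b (snd p)) \<partial>lborel) = 0"
      unfolding left_diff_distrib using Bochner_Integration.integral_diff[OF int[OF F] int[OF P]] eq by simp
  qed (rule that)
  have "AE p in lborel. F p = c (snd p) + lineint (\<lambda>s. g (s, snd p)) 0 (fst p)"
    using c(2) by eventually_elim (simp add: P_def algebra_simps)
  then have "hrep F c g" unfolding hrep_def using c(1) g gl fin by auto
  with gg0 show ?thesis by (rule that)
qed

text \<open>Products of bumps converge boundedly to indicators of open boxes, so all box integrals
  vanish.\<close>

lemma zero_of_weak_zero:
  assumes w: "loc_int_pt w"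
    and z: "\<And>s t s' t' n. (\<integral>p. w p * (bump s t n (fst p) * bump s' t' n (snd p)) \<partial>lborel) = 0"
  shows "AE p in lborel. w p = 0"
proof (rule AE_zero_of_boxes)
  show "set_integrable lborel (cbox a b) w" for a b using w by (rule loc_int_ptD)
  have [measurable]: "w \<in> borel_measurable borel" using w by (rule loc_int_ptD)
  fix A B :: pt
  obtain s t s' t' where AB: "A = (s, s')" "B = (t, t')" by (cases A; cases B)
  have bm: "bump s t n \<in> borel_measurable borel" for s t n
    by (rule borel_measurable_continuous_onI[OF smooth1_cont[OF smooth1_bump]])
  note [measurable] = bm
  have "(\<lambda>n. \<integral>p. w p * (bump s t n (fst p) * bump s' t' n (snd p)) \<partial>lborel) \<longlonglongrightarrow> (\<integral>p. w p * (indicator {s<..<t} (fst p) * indicator {s'<..<t'} (snd p)) \<partial>lborel)"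
  proof (rule integral_dominated_convergence[where w="\<lambda>p. indicator (cbox A B) p * \<bar>w p\<bar>"])
    show "integrable lborel (\<lambda>p. indicator (cbox A B) p * \<bar>w p\<bar>)"
      using set_integrable_abs[OF loc_int_ptD(2)[OF w]] by (simp add: set_integrable_def)
    show "AE p in lborel. (\<lambda>n. w p * (bump s t n (fst p) * bump s' t' n (snd p))) \<longlonglongrightarrow> w p * (indicator {s<..<t} (fst p) * indicator {s'<..<t'} (snd p))"
      by (intro AE_I2 tendsto_intros bump_tendsto)
    show "AE p in lborel. norm (w p * (bump s t n (fst p) * bump s' t' n (snd p))) \<le> indicator (cbox A B) p * \<bar>w p\<bar>" for n
    proof (rule AE_I2)
      fix p :: pt
      show "norm (w p * (bump s t n (fst p) * bump s' t' n (snd p))) \<le> indicator (cbox A B) p * \<bar>w p\<bar>"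
      proof (cases "p \<in> cbox A B")
        case True
        have "\<bar>bump s t n (fst p) * bump s' t' n (snd p)\<bar> \<le> 1 * 1"
          unfolding abs_mult using bump_bounds by (intro mult_mono) (auto simp: abs_of_nonneg)
        then show ?thesis using True by (auto simp: abs_mult intro!: mult_left_le)
      next
        case False
        then have "fst p \<notin> {s<..<t} \<or> snd p \<notin> {s'<..<t'}" by (cases p) (auto simp: AB cbox_Pair_eq)
        then show ?thesis using False by (auto simp: bump_zero)
      qed
    qed
  qed measurable
  then have "(\<integral>p. w p * (indicator {s<..<t} (fst p) * indicator {s'<..<t'} (snd p)) \<partial>lborel) = 0"
    unfolding z using LIMSEQ_unique tendsto_const by blast
  moreover have "indicat_real (box A B) p = indicator {s<..<t} (fst p) * indicator {s'<..<t'} (snd p)" for p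
    by (cases p) (auto simp: AB indicator_def mem_box Basis_prod_def)
  ultimately show "(\<integral>p. indicator (box A B) p * w p \<partial>lborel) = 0" by (simp add: mult.commute)
qed

section \<open>Passing from Lebesgue measurable functions to Borel versions\<close>

lemma lebesgue_borel_version:
  fixes f g :: "'a::euclidean_space \<Rightarrow> real"
  assumes g: "g \<in> borel_measurable borel" and ae: "AE p in lborel. f p = g p"
  shows "f \<in> borel_measurable lebesgue" "integral\<^sup>L lebesgue f = integral\<^sup>L lborel g"
    "integrable lebesgue f \<longleftrightarrow> integrable lborel g"
proof -
  have gl: "g \<in> borel_measurable lebesgue" using g by (intro measurable_completion) simp
  have ae': "AE p in lebesgue. g p = f p" using ae unfolding AE_lebesgue_lborel by (auto simp: eq_commute)
  show fl: "f \<in> borel_measurable lebesgue" by (rule borel_measurable_AE[OF gl ae'])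
  have "integral\<^sup>L lebesgue f = integral\<^sup>L lebesgue g"
    by (rule integral_cong_AE[OF fl gl]) (use ae' in \<open>auto simp: eq_commute\<close>)
  then show "integral\<^sup>L lebesgue f = integral\<^sup>L lborel g" using g by (simp add: integral_completion)
  have "integrable lebesgue f \<longleftrightarrow> integrable lebesgue g"
    by (rule integrable_cong_AE[OF fl gl]) (use ae' in \<open>auto simp: eq_commute\<close>)
  then show "integrable lebesgue f \<longleftrightarrow> integrable lborel g" using g by (simp add: integrable_completion)
qed

lemma loc_integrable_borel:
  assumes "loc_integrable F"
  obtains F0 where "loc_int_pt F0" "AE p in lborel. F p = F0 p"
proof -
  obtain F0 where F0 [measurable]: "F0 \<in> borel_measurable borel" and ae: "AE p in lborel. F p = F0 p"
    using assms completion_ex_borel_measurable_real[of F lborel] by (auto simp: loc_integrable_def)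
  have "loc_int_pt F0" unfolding loc_int_pt_def set_integrable_def
  proof (intro conjI allI)
    fix a b :: pt
    have "integrable lebesgue (\<lambda>p. indicat_real (cbox a b) p *\<^sub>R F p)"
      using assms by (auto simp: loc_integrable_def set_integrable_def)
    then show "integrable lborel (\<lambda>p. indicat_real (cbox a b) p *\<^sub>R F0 p)"
      by (subst (asm) lebesgue_borel_version(3)[where g="\<lambda>p. indicat_real (cbox a b) p *\<^sub>R F0 p"]) (use ae in auto)
  qed measurable
  then show ?thesis using ae by (rule that)
qed

lemma loc_int_pt_compact:
  assumes F: "loc_int_pt F" and K: "compact K"
  shows "set_integrable lebesgue K F"
proof -
  obtain a b where ab: "K \<subseteq> cbox a b" using bounded_subset_cbox_symmetric compact_imp_bounded[OF K] by metis
  have "integrable lebesgue (\<lambda>p. indicat_real (cbox a b) p *\<^sub>R F p)"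
    using loc_int_ptD(2)[OF F, of a b] loc_int_ptD(1)[OF F]
    by (subst lebesgue_borel_version(3)[OF _ AE_I2[OF refl]]) (auto simp: set_integrable_def)
  then have "set_integrable lebesgue (cbox a b) F" by (simp add: set_integrable_def)
  then show ?thesis by (rule set_integrable_subset) (use ab lmeasurable_compact[OF K] in auto)
qed

lemma loc_integrable_of_loc_int_pt: "loc_int_pt F \<Longrightarrow> loc_integrable F"
  unfolding loc_integrable_def
  by (auto intro: loc_int_pt_compact loc_int_ptD lebesgue_borel_version(1)[OF _ AE_I2[OF refl]])

lemma smooth2D:
  assumes "smooth2 phi"
  shows "phi differentiable (at p)" "smooth2 (\<lambda>p. frechet_derivative phi (at p) (1, 0))"
    "smooth2 (\<lambda>p. frechet_derivative phi (at p) (0, 1))"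
  using assms by (auto elim: smooth2.cases)

lemma smooth2_continuous: "smooth2 phi \<Longrightarrow> continuous_on UNIV phi"
  by (auto intro!: continuous_at_imp_continuous_on differentiable_imp_continuous_within smooth2D(1))

lemma smooth2_section_derivative:
  assumes "smooth2 phi"
  shows "((\<lambda>x. phi (x, t)) has_real_derivative frechet_derivative phi (at (x, t)) (1, 0)) (at x)"
    "((\<lambda>t. phi (x, t)) has_real_derivative frechet_derivative phi (at (x, t)) (0, 1)) (at t)"
proof -
  let ?D = "frechet_derivative phi (at (x, t))"
  have D: "(phi has_derivative ?D) (at (x, t))"
    using smooth2D(1)[OF assms] by (simp add: frechet_derivative_works)
  then have lin: "linear ?D" by (rule has_derivative_linear)
  have "((\<lambda>x. (x, t)) has_derivative (\<lambda>h. (h, 0))) (at x)" by (auto intro!: derivative_eq_intros)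
  from diff_chain_at[OF this D] have 1: "((\<lambda>x. phi (x, t)) has_derivative (\<lambda>h. ?D (h, 0))) (at x)" by (simp add: o_def)
  have "(\<lambda>h. ?D (h, 0)) = (*) (?D (1, 0))"
  proof
    fix h show "?D (h, 0) = ?D (1, 0) * h"
      using linear_cmul[OF lin, of h "(1, 0)"] by (simp add: mult.commute)
  qed
  with 1 show "((\<lambda>x. phi (x, t)) has_real_derivative ?D (1, 0)) (at x)" by (simp add: has_field_derivative_def)
  have "((\<lambda>t. (x, t)) has_derivative (\<lambda>h. (0, h))) (at t)" by (auto intro!: derivative_eq_intros)
  from diff_chain_at[OF this D] have 1: "((\<lambda>t. phi (x, t)) has_derivative (\<lambda>h. ?D (0, h))) (at t)" by (simp add: o_def)
  have "(\<lambda>h. ?D (0, h)) = (*) (?D (0, 1))"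
  proof
    fix h show "?D (0, h) = ?D (0, 1) * h"
      using linear_cmul[OF lin, of h "(0, 1)"] by (simp add: mult.commute)
  qed
  with 1 show "((\<lambda>t. phi (x, t)) has_real_derivative ?D (0, 1)) (at t)" by (simp add: has_field_derivative_def)
qed

lemma weak_grad_borel:
  assumes "weak_grad_L2 F G1 G2"
  obtains F0 g1 g2 where "loc_int_pt F0" "AE p in lborel. F p = F0 p"
    "g1 \<in> borel_measurable borel" "AE p in lborel. G1 p = g1 p"
    "g2 \<in> borel_measurable borel" "AE p in lborel. G2 p = g2 p"
    "(\<integral>\<^sup>+ p. ennreal ((g1 p)\<^sup>2 + (g2 p)\<^sup>2) \<partial>lborel) = (\<integral>\<^sup>+ p. ennreal ((G1 p)\<^sup>2 + (G2 p)\<^sup>2) \<partial>lebesgue)"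
    "(\<integral>\<^sup>+ p. ennreal ((g1 p)\<^sup>2 + (g2 p)\<^sup>2) \<partial>lborel) < \<infinity>"
    "\<And>phi. test_fun phi \<Longrightarrow> (\<integral>p. F0 p * frechet_derivative phi (at p) (1, 0) \<partial>lborel) = - (\<integral>p. g1 p * phi p \<partial>lborel)"
    "\<And>phi. test_fun phi \<Longrightarrow> (\<integral>p. F0 p * frechet_derivative phi (at p) (0, 1) \<partial>lborel) = - (\<integral>p. g2 p * phi p \<partial>lborel)"
proof -
  have W: "loc_integrable F" "G1 \<in> borel_measurable lebesgue" "G2 \<in> borel_measurable lebesgue"
    "(\<integral>\<^sup>+ p. ennreal ((G1 p)\<^sup>2 + (G2 p)\<^sup>2) \<partial>lebesgue) < \<infinity>"
    "\<And>phi. test_fun phi \<Longrightarrow> (\<integral>p. F p * frechet_derivative phi (at p) (1, 0) \<partial>lebesgue) = - (\<integral>p. G1 p * phi p \<partial>lebesgue)"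
    "\<And>phi. test_fun phi \<Longrightarrow> (\<integral>p. F p * frechet_derivative phi (at p) (0, 1) \<partial>lebesgue) = - (\<integral>p. G2 p * phi p \<partial>lebesgue)"
    using assms unfolding weak_grad_L2_def by blast+
  obtain F0 where F0: "loc_int_pt F0" "AE p in lborel. F p = F0 p" using W(1) by (rule loc_integrable_borel)
  have [measurable]: "F0 \<in> borel_measurable borel" using F0(1) by (rule loc_int_ptD)
  obtain g1 where g1 [measurable]: "g1 \<in> borel_measurable borel" and a1: "AE p in lborel. G1 p = g1 p"
    using completion_ex_borel_measurable_real[OF W(2)] by auto
  obtain g2 where g2 [measurable]: "g2 \<in> borel_measurable borel" and a2: "AE p in lborel. G2 p = g2 p"
    using completion_ex_borel_measurable_real[OF W(3)] by auto
  have n: "(\<integral>\<^sup>+ p. ennreal ((g1 p)\<^sup>2 + (g2 p)\<^sup>2) \<partial>lborel) = (\<integral>\<^sup>+ p. ennreal ((G1 p)\<^sup>2 + (G2 p)\<^sup>2) \<partial>lebesgue)"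
    unfolding nn_integral_completion by (rule nn_integral_cong_AE) (use a1 a2 in auto)
  have fd: "(\<lambda>p. frechet_derivative phi (at p) (1, 0)) \<in> borel_measurable borel"
     "(\<lambda>p. frechet_derivative phi (at p) (0, 1)) \<in> borel_measurable borel" "phi \<in> borel_measurable borel" if "test_fun phi" for phi
    using that unfolding test_fun_def
    by (auto intro!: borel_measurable_continuous_onI smooth2_continuous dest: smooth2D)
  have conv: "(\<integral>p. u p * h p \<partial>lebesgue) = (\<integral>p. v p * h p \<partial>lborel)"
    if "AE p in lborel. u p = v p" "v \<in> borel_measurable borel" "h \<in> borel_measurable borel" for u v h :: "pt \<Rightarrow> real"
    by (rule lebesgue_borel_version(2)) (use that in auto)
  show ?thesis
  proof (rule that[OF F0 g1 a1 g2 a2 n])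
    show "(\<integral>\<^sup>+ p. ennreal ((g1 p)\<^sup>2 + (g2 p)\<^sup>2) \<partial>lborel) < \<infinity>" using n W(4) by simp
    fix phi assume phi: "test_fun phi"
    show "(\<integral>p. F0 p * frechet_derivative phi (at p) (1, 0) \<partial>lborel) = - (\<integral>p. g1 p * phi p \<partial>lborel)"
      using W(5)[OF phi] conv[OF F0(2) _ fd(1)[OF phi]] conv[OF a1 g1 fd(3)[OF phi]] by simp
    show "(\<integral>p. F0 p * frechet_derivative phi (at p) (0, 1) \<partial>lborel) = - (\<integral>p. g2 p * phi p \<partial>lborel)"
      using W(6)[OF phi] conv[OF F0(2) _ fd(2)[OF phi]] conv[OF a2 g2 fd(3)[OF phi]] by simp
  qed
qed

section \<open>Uniqueness of the weak gradient\<close>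

lemma nn_integral_sum_sq_finite:
  fixes g1 g2 :: "pt \<Rightarrow> real"
  assumes "(\<integral>\<^sup>+ p. ennreal ((g1 p)\<^sup>2 + (g2 p)\<^sup>2) \<partial>M) < \<infinity>"
  shows "(\<integral>\<^sup>+ p. ennreal ((g1 p)\<^sup>2) \<partial>M) < \<infinity>" "(\<integral>\<^sup>+ p. ennreal ((g2 p)\<^sup>2) \<partial>M) < \<infinity>"
  by (rule le_less_trans[OF nn_integral_mono assms], simp add: ennreal_leI del: ennreal_plus)+

text \<open>\<open>H1_norm2\<close> uses a chosen gradient, so its value is known only once all
  gradients are seen to agree almost everywhere. Testing with products of bumps, which are test
  functions, separates square integrable functions.\<close>

lemma weak_grad_unique:
  assumes "weak_grad_L2 F G1 G2" "weak_grad_L2 F G1' G2'"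
  shows "(\<integral>\<^sup>+ p. ennreal ((G1 p)\<^sup>2 + (G2 p)\<^sup>2) \<partial>lebesgue) = (\<integral>\<^sup>+ p. ennreal ((G1' p)\<^sup>2 + (G2' p)\<^sup>2) \<partial>lebesgue)"
proof -
  obtain F0 g1 g2 where *: "loc_int_pt F0" "AE p in lborel. F p = F0 p"
    "g1 \<in> borel_measurable borel" "g2 \<in> borel_measurable borel"
    "(\<integral>\<^sup>+ p. ennreal ((g1 p)\<^sup>2 + (g2 p)\<^sup>2) \<partial>lborel) = (\<integral>\<^sup>+ p. ennreal ((G1 p)\<^sup>2 + (G2 p)\<^sup>2) \<partial>lebesgue)"
    "(\<integral>\<^sup>+ p. ennreal ((g1 p)\<^sup>2 + (g2 p)\<^sup>2) \<partial>lborel) < \<infinity>"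
    "\<And>phi. test_fun phi \<Longrightarrow> (\<integral>p. F0 p * frechet_derivative phi (at p) (1, 0) \<partial>lborel) = - (\<integral>p. g1 p * phi p \<partial>lborel)"
    "\<And>phi. test_fun phi \<Longrightarrow> (\<integral>p. F0 p * frechet_derivative phi (at p) (0, 1) \<partial>lborel) = - (\<integral>p. g2 p * phi p \<partial>lborel)"
    by (rule weak_grad_borel[OF assms(1)]) (rule that, assumption+)
  obtain F0' g1' g2' where prm: "loc_int_pt F0'" "AE p in lborel. F p = F0' p"
    "g1' \<in> borel_measurable borel" "g2' \<in> borel_measurable borel"
    "(\<integral>\<^sup>+ p. ennreal ((g1' p)\<^sup>2 + (g2' p)\<^sup>2) \<partial>lborel) = (\<integral>\<^sup>+ p. ennreal ((G1' p)\<^sup>2 + (G2' p)\<^sup>2) \<partial>lebesgue)"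
    "(\<integral>\<^sup>+ p. ennreal ((g1' p)\<^sup>2 + (g2' p)\<^sup>2) \<partial>lborel) < \<infinity>"
    "\<And>phi. test_fun phi \<Longrightarrow> (\<integral>p. F0' p * frechet_derivative phi (at p) (1, 0) \<partial>lborel) = - (\<integral>p. g1' p * phi p \<partial>lborel)"
    "\<And>phi. test_fun phi \<Longrightarrow> (\<integral>p. F0' p * frechet_derivative phi (at p) (0, 1) \<partial>lborel) = - (\<integral>p. g2' p * phi p \<partial>lborel)"
    by (rule weak_grad_borel[OF assms(2)]) (rule that, assumption+)
  note [measurable] = *(3,4) prm(3,4) loc_int_ptD(1)[OF *(1)] loc_int_ptD(1)[OF prm(1)]
  have FF: "AE p in lborel. F0 p = F0' p" using *(2) prm(2) by eventually_elim simp
  have bt: "test_fun (\<lambda>p. bump s t n (fst p) * bump s' t' n (snd p))" for s t s' t' n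
    by (rule test_fun_prod[of _ _ "\<bar>s\<bar> + \<bar>t\<bar> + \<bar>s'\<bar> + \<bar>t'\<bar>"]) (auto intro!: smooth1_bump bump_zero)
  have bm: "bump s t n \<in> borel_measurable borel" for s t n
    by (rule borel_measurable_continuous_onI[OF smooth1_cont[OF smooth1_bump]])
  note [measurable] = bm
  \<comment> \<open>The direction \<open>e\<close> is kept general so that one argument serves both
    partial derivatives.\<close>
  have key: "AE p in lborel. g p = g' p"
    if [measurable]: "g \<in> borel_measurable borel" "g' \<in> borel_measurable borel"
      and f: "(\<integral>\<^sup>+ p. ennreal ((g p)\<^sup>2) \<partial>lborel) < \<infinity>" "(\<integral>\<^sup>+ p. ennreal ((g' p)\<^sup>2) \<partial>lborel) < \<infinity>"
      and w: "\<And>phi. test_fun phi \<Longrightarrow> (\<integral>p. F0 p * frechet_derivative phi (at p) e \<partial>lborel) = - (\<integral>p. g p * phi p \<partial>lborel)"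
        "\<And>phi. test_fun phi \<Longrightarrow> (\<integral>p. F0' p * frechet_derivative phi (at p) e \<partial>lborel) = - (\<integral>p. g' p * phi p \<partial>lborel)"
      and fd: "\<And>phi. test_fun phi \<Longrightarrow> (\<lambda>p. frechet_derivative phi (at p) e) \<in> borel_measurable borel"
    for g g' e
  proof -
    have l: "loc_int_pt g" "loc_int_pt g'" using f by (auto intro: loc_int_pt_L2')
    have "AE p in lborel. g p - g' p = 0"
    proof (rule zero_of_weak_zero[OF loc_int_pt_diff[OF l]])
      fix s t s' t' :: real and n
      let ?phi = "\<lambda>p::pt. bump s t n (fst p) * bump s' t' n (snd p)"
      have "(\<integral>p. F0 p * frechet_derivative ?phi (at p) e \<partial>lborel) = (\<integral>p. F0' p * frechet_derivative ?phi (at p) e \<partial>lborel)"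
        by (rule integral_cong_AE) (use FF fd[OF bt] in auto)
      then have "(\<integral>p. g p * ?phi p \<partial>lborel) = (\<integral>p. g' p * ?phi p \<partial>lborel)" using w[OF bt] by simp
      moreover have "integrable lborel (\<lambda>p. u p * ?phi p)" if "loc_int_pt u" for u
      proof (rule loc_int_pt_mult[OF that, of _ 1 "(s, s')" "(t, t')"])
        show "\<bar>?phi p\<bar> \<le> 1" for p
          unfolding abs_mult using bump_bounds by (intro mult_le_one) (auto simp: abs_of_nonneg)
        show "?phi p = 0" if "p \<notin> cbox (s, s') (t, t')" for p
          using that by (cases p) (auto simp: cbox_Pair_eq bump_zero)
      qed measurable
      ultimately show "(\<integral>p. (g p - g' p) * ?phi p \<partial>lborel) = 0"
        using l by (simp add: left_diff_distrib)
    qed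
    then show ?thesis by simp
  qed
  have fd: "(\<lambda>p. frechet_derivative phi (at p) (1, 0)) \<in> borel_measurable borel"
     "(\<lambda>p. frechet_derivative phi (at p) (0, 1)) \<in> borel_measurable borel" if "test_fun phi" for phi
    using that unfolding test_fun_def
    by (auto intro!: borel_measurable_continuous_onI smooth2_continuous dest: smooth2D)
  have "AE p in lborel. g1 p = g1' p"
    by (rule key[OF *(3) prm(3) nn_integral_sum_sq_finite(1)[OF *(6)] nn_integral_sum_sq_finite(1)[OF prm(6)] *(7) prm(7) fd(1)])
  moreover have "AE p in lborel. g2 p = g2' p"
    by (rule key[OF *(4) prm(4) nn_integral_sum_sq_finite(2)[OF *(6)] nn_integral_sum_sq_finite(2)[OF prm(6)] *(8) prm(8) fd(2)])
  ultimately have "(\<integral>\<^sup>+ p. ennreal ((g1 p)\<^sup>2 + (g2 p)\<^sup>2) \<partial>lborel) = (\<integral>\<^sup>+ p. ennreal ((g1' p)\<^sup>2 + (g2' p)\<^sup>2) \<partial>lborel)"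
    by (intro nn_integral_cong_AE) auto
  then show ?thesis using *(5) prm(5) by simp
qed

lemma H1_norm2_eq:
  assumes "weak_grad_L2 F G1 G2"
  shows "H1_norm2 F = (\<integral>\<^sup>+ p. ennreal ((G1 p)\<^sup>2 + (G2 p)\<^sup>2) \<partial>lebesgue)"
proof -
  have "weak_grad_L2 F (fst (SOME G. weak_grad_L2 F (fst G) (snd G))) (snd (SOME G. weak_grad_L2 F (fst G) (snd G)))"
    by (rule someI[of "\<lambda>G. weak_grad_L2 F (fst G) (snd G)" "(G1, G2)"]) (use assms in simp)
  from weak_grad_unique[OF this assms] show ?thesis unfolding H1_norm2_def Let_def .
qed

section \<open>The trace of a function with square integrable gradient\<close>

lemma disc_mean_cong_AE:
  assumes "AE p in lborel. F p = F0 p" "F0 \<in> borel_measurable borel"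
  shows "disc_mean F = disc_mean F0"
proof -
  have "(\<integral>q. indicator (ball p r) q * F q \<partial>lebesgue) = (\<integral>q. indicator (ball p r) q * F0 q \<partial>lebesgue)" for p r
  proof -
    have m: "(\<lambda>q. indicator (ball p r) q * F0 q) \<in> borel_measurable borel"
      using assms(2) by (intro borel_measurable_times borel_measurable_indicator) auto
    have "AE q in lborel. indicator (ball p r) q * F q = indicator (ball p r) q * F0 q" using assms(1) by eventually_elim simp
    from lebesgue_borel_version(2)[OF m this] lebesgue_borel_version(2)[OF m AE_I2[OF refl]] show ?thesis by simp
  qed
  then show ?thesis by (auto simp: disc_mean_def fun_eq_iff)
qed

lemma disc_mean_swap:
  assumes [measurable]: "F \<in> borel_measurable borel"
  shows "disc_mean (F \<circ> prod.swap) p r = disc_mean F (prod.swap p) r"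
proof -
  have "(\<integral>q. indicator (ball (prod.swap p) r) q * F q \<partial>lborel) = (\<integral>q. indicator (ball (prod.swap p) r) q * F q \<partial>distr lborel lborel prod.swap)"
    unfolding lborel_pt_swap ..
  also have "\<dots> = (\<integral>q. indicator (ball (prod.swap p) r) (prod.swap q) * F (prod.swap q) \<partial>lborel)"
    by (rule integral_distr) (simp, intro borel_measurable_times borel_measurable_indicator, auto)
  also have "\<dots> = (\<integral>q. indicator (ball p r) q * (F \<circ> prod.swap) q \<partial>lborel)"
  proof (rule Bochner_Integration.integral_cong[OF refl])
    fix q
    have "dist (prod.swap p) (prod.swap q) = dist p q" by (cases p; cases q) (simp add: dist_Pair_Pair add.commute)
    then show "indicator (ball (prod.swap p) r) (prod.swap q) * F (prod.swap q) = indicator (ball p r) q * (F \<circ> prod.swap) q"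
      by (auto simp: indicator_def)
  qed
  finally have "(\<integral>q. indicator (ball (prod.swap p) r) q * F q \<partial>lborel) = (\<integral>q. indicator (ball p r) q * (F \<circ> prod.swap) q \<partial>lborel)" .
  moreover have "(\<integral>q. indicator (ball (prod.swap p) r) q * F q \<partial>lebesgue) = (\<integral>q. indicator (ball (prod.swap p) r) q * F q \<partial>lborel)"
    "(\<integral>q. indicator (ball p r) q * (F \<circ> prod.swap) q \<partial>lebesgue) = (\<integral>q. indicator (ball p r) q * (F \<circ> prod.swap) q \<partial>lborel)"
    by (rule lebesgue_borel_version(2)[OF _ AE_I2[OF refl]], intro borel_measurable_times borel_measurable_indicator, auto)+
  moreover have "measure lebesgue (ball p r) = measure lebesgue (ball (prod.swap p) r)"
    by (cases "r \<ge> 0") (auto simp: content_ball measure_completion ball_empty)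
  ultimately show ?thesis by (simp add: disc_mean_def)
qed

lemma loc_int_pt_swap:
  assumes "loc_int_pt F" shows "loc_int_pt (F \<circ> prod.swap)"
  unfolding loc_int_pt_def set_integrable_def
proof (intro conjI allI)
  have [measurable]: "F \<in> borel_measurable borel" using assms by (rule loc_int_ptD)
  show "F \<circ> prod.swap \<in> borel_measurable borel" by (simp add: comp_def)
  fix a b :: pt
  have "integrable (distr lborel lborel prod.swap) (\<lambda>p. indicat_real (cbox (prod.swap a) (prod.swap b)) p *\<^sub>R F p)"
    unfolding lborel_pt_swap using loc_int_ptD(2)[OF assms] by (simp add: set_integrable_def)
  then have "integrable lborel (\<lambda>p. indicat_real (cbox (prod.swap a) (prod.swap b)) (prod.swap p) *\<^sub>R F (prod.swap p))"
    by (subst (asm) integrable_distr_eq) auto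
  moreover have "indicat_real (cbox (prod.swap a) (prod.swap b)) (prod.swap p) = indicator (cbox a b) p" for p
    by (cases a; cases b; cases p) (auto simp: indicator_def cbox_Pair_eq)
  ultimately show "integrable lborel (\<lambda>p. indicat_real (cbox a b) p *\<^sub>R (F \<circ> prod.swap) p)" by simp
qed

lemma hrepD:
  assumes "hrep F c g"
  shows "c \<in> borel_measurable borel" "g \<in> borel_measurable borel" "\<And>t. loc_int (\<lambda>s. g (s, t))"
    "(\<integral>\<^sup>+ p. ennreal ((g p)\<^sup>2) \<partial>lborel) < \<infinity>"
    "AE p in lborel. F p = c (snd p) + lineint (\<lambda>s. g (s, snd p)) 0 (fst p)"
  using assms by (auto simp: hrep_def)

lemma loc_int_pt_nn_integral:
  assumes "loc_int_pt u"
  shows "(\<integral>\<^sup>+ p\<in>cbox a b. ennreal \<bar>u p\<bar> \<partial>lborel) < \<infinity>"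
proof -
  have "(\<integral>\<^sup>+ p. ennreal (norm (indicat_real (cbox a b) p *\<^sub>R u p)) \<partial>lborel) < \<infinity>"
    using loc_int_ptD(2)[OF assms, of a b] unfolding set_integrable_def integrable_iff_bounded by blast
  also have "(\<integral>\<^sup>+ p. ennreal (norm (indicat_real (cbox a b) p *\<^sub>R u p)) \<partial>lborel) = (\<integral>\<^sup>+ p\<in>cbox a b. ennreal \<bar>u p\<bar> \<partial>lborel)"
    by (rule nn_integral_cong) (auto simp: indicator_def)
  finally show ?thesis .
qed

text \<open>Restriction to a line has no meaning for \<open>F\<close> itself, but the representation
  gives \<open>w t = F (x, t)\<close> plus the integral of \<open>g\<close> from \<open>x\<close> to
  the line, for almost every point. Averaging over \<open>x\<close> in [0, 1] bounds
  \<open>w\<close> by integrals of \<open>F\<close> and \<open>g\<close> over boxes.\<close>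

lemma hrep_line_loc_int:
  assumes F: "loc_int_pt F" and h: "hrep F c g"
  shows "loc_int (\<lambda>t. c t + lineint (\<lambda>s. g (s, t)) 0 (\<alpha> * t + \<beta>))"
proof -
  note [measurable] = hrepD(1,2)[OF h] loc_int_ptD(1)[OF F]
  define w where "w t = c t + lineint (\<lambda>s. g (s, t)) 0 (\<alpha> * t + \<beta>)" for t
  have [measurable]: "(\<lambda>t. lineint (\<lambda>s. g (s, t)) 0 (\<alpha> * t + \<beta>)) \<in> borel_measurable borel"
    by (rule lineint_measurable) measurable
  have wm [measurable]: "w \<in> borel_measurable borel" unfolding w_def by measurable
  have fin: "(\<integral>\<^sup>+ t\<in>{a..b}. ennreal \<bar>w t\<bar> \<partial>lborel) < \<infinity>" for a b
  proof -
    \<comment> \<open>Bounds the position of the line for \<open>t\<close> in \<open>{a..b}\<close>;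
      the added 1 makes \<open>{-M..M}\<close> contain the averaging interval too.\<close>
    define M where "M = \<bar>\<alpha>\<bar> * (\<bar>a\<bar> + \<bar>b\<bar>) + \<bar>\<beta>\<bar> + 1"
    have M0: "M \<ge> 1" by (simp add: M_def)
    define K where "K t = (\<integral>\<^sup>+ s\<in>{-M..M}. ennreal \<bar>g (s, t)\<bar> \<partial>lborel)" for t
    have [measurable]: "K \<in> borel_measurable borel" unfolding K_def by measurable
    have unit: "(\<integral>\<^sup>+ x. C * indicator {0..1::real} x \<partial>lborel) = C" for C :: ennreal
      by (subst nn_integral_cmult_indicator) auto
    have gl: "loc_int_pt g" by (rule loc_int_pt_L2'[OF hrepD(2,4)[OF h]])
    \<comment> \<open>A dummy variable of total mass 1 is inserted in order to average.\<close>
    have "(\<integral>\<^sup>+ t\<in>{a..b}. ennreal \<bar>w t\<bar> \<partial>lborel) = (\<integral>\<^sup>+ t. \<integral>\<^sup>+ x. ennreal \<bar>w t\<bar> * indicator {a..b} t * indicator {0..1::real} x \<partial>lborel \<partial>lborel)"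
      by (simp only: unit)
    also have "\<dots> = (\<integral>\<^sup>+ p. ennreal \<bar>w (snd p)\<bar> * indicator {a..b} (snd p) * indicator {0..1::real} (fst p) \<partial>lborel)"
      by (subst nn_integral_pt(2)) auto
    also have "\<dots> \<le> (\<integral>\<^sup>+ p. ennreal \<bar>F p\<bar> * indicator (cbox (0, a) (1, b)) p + K (snd p) * indicator {a..b} (snd p) * indicator {0..1::real} (fst p) \<partial>lborel)"
    proof (rule nn_integral_mono_AE, use hrepD(5)[OF h] in eventually_elim)
      case (elim p)
      show ?case
      proof (cases "snd p \<in> {a..b} \<and> fst p \<in> {0..1}")
        case True
        then have p: "p \<in> cbox (0, a) (1, b)" by (cases p) (auto simp: cbox_Pair_eq)
        let ?t = "snd p"
        have "\<bar>\<alpha>\<bar> * \<bar>?t\<bar> \<le> \<bar>\<alpha>\<bar> * (\<bar>a\<bar> + \<bar>b\<bar>)" using True by (intro mult_left_mono) auto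
        then have *: "\<bar>\<alpha> * ?t + \<beta>\<bar> \<le> M" using abs_triangle_ineq[of "\<alpha> * ?t" \<beta>] by (simp add: M_def abs_mult)
        have "w ?t = F p + lineint (\<lambda>s. g (s, ?t)) (fst p) (\<alpha> * ?t + \<beta>)"
          using elim lineint_add[OF hrepD(3)[OF h], of ?t 0 "fst p" "\<alpha> * ?t + \<beta>"] by (simp add: w_def)
        then have "ennreal \<bar>w ?t\<bar> \<le> ennreal \<bar>F p\<bar> + ennreal \<bar>lineint (\<lambda>s. g (s, ?t)) (fst p) (\<alpha> * ?t + \<beta>)\<bar>"
          by (simp only: ennreal_abs_triangle)
        also have "ennreal \<bar>lineint (\<lambda>s. g (s, ?t)) (fst p) (\<alpha> * ?t + \<beta>)\<bar> \<le> (\<integral>\<^sup>+ s\<in>{min (fst p) (\<alpha> * ?t + \<beta>)..max (fst p) (\<alpha> * ?t + \<beta>)}. ennreal \<bar>g (s, ?t)\<bar> \<partial>lborel)"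
          by (rule lineint_abs_le)
        also have "\<dots> \<le> K ?t" unfolding K_def
          by (rule nn_integral_mono) (use True * M0 in \<open>auto simp: indicator_def abs_le_iff\<close>)
        finally have "ennreal \<bar>w ?t\<bar> \<le> ennreal \<bar>F p\<bar> + K ?t" by (simp add: add_left_mono)
        then show ?thesis using True p by simp
      qed auto
    qed
    also have "\<dots> = (\<integral>\<^sup>+ p\<in>cbox (0, a) (1, b). ennreal \<bar>F p\<bar> \<partial>lborel) + (\<integral>\<^sup>+ p. K (snd p) * indicator {a..b} (snd p) * indicator {0..1::real} (fst p) \<partial>lborel)"
      by (rule nn_integral_add) measurable
    also have "(\<integral>\<^sup>+ p. K (snd p) * indicator {a..b} (snd p) * indicator {0..1::real} (fst p) \<partial>lborel) = (\<integral>\<^sup>+ t. \<integral>\<^sup>+ x. K t * indicator {a..b} t * indicator {0..1::real} x \<partial>lborel \<partial>lborel)"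
      by (subst nn_integral_pt(2)) auto
    also have "\<dots> = (\<integral>\<^sup>+ t. K t * indicator {a..b} t \<partial>lborel)"
      by (simp only: unit)
    also have "\<dots> = (\<integral>\<^sup>+ t. \<integral>\<^sup>+ s. ennreal \<bar>g (s, t)\<bar> * indicator {-M..M} s * indicator {a..b} t \<partial>lborel \<partial>lborel)"
      unfolding K_def by (subst nn_integral_multc) auto
    also have "\<dots> = (\<integral>\<^sup>+ p\<in>cbox (-M, a) (M, b). ennreal \<bar>g p\<bar> \<partial>lborel)"
      by (subst nn_integral_pt(2), measurable) (auto intro!: nn_integral_cong simp: indicator_def cbox_Pair_eq)
    also have "(\<integral>\<^sup>+ p\<in>cbox (0, a) (1, b). ennreal \<bar>F p\<bar> \<partial>lborel) + \<dots> < \<infinity>"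
      using loc_int_pt_nn_integral[OF F, of "(0, a)" "(1, b)"] loc_int_pt_nn_integral[OF gl, of "(-M, a)" "(M, b)"]
      by (simp only: infinity_ennreal_def ennreal_add_less_top)
    finally show ?thesis .
  qed
  show ?thesis unfolding w_def[symmetric] loc_int_def set_integrable_def
  proof (intro conjI allI integrableI_bounded wm)
    fix a b
    have "(\<integral>\<^sup>+ x. ennreal (norm (indicat_real {a..b} x *\<^sub>R w x)) \<partial>lborel) = (\<integral>\<^sup>+ t\<in>{a..b}. ennreal \<bar>w t\<bar> \<partial>lborel)"
      by (rule nn_integral_cong) (auto simp: indicator_def)
    then show "(\<integral>\<^sup>+ x. ennreal (norm (indicat_real {a..b} x *\<^sub>R w x)) \<partial>lborel) < \<infinity>" using fin by simp
  qed measurable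
qed

text \<open>Moving the base point of the primitives from the axis to the given line brings
  \<open>F\<close>, after exchange of coordinates, into the form required by
  \<open>disc_mean_tendsto\<close>.\<close>

lemma hrep_trace:
  assumes F: "loc_int_pt F" and h: "hrep F c g" and al: "\<bar>\<alpha>\<bar> \<le> 1"
  shows "AE t in lborel. (disc_mean F (\<alpha> * t + \<beta>, t) \<longlongrightarrow> c t + lineint (\<lambda>s. g (s, t)) 0 (\<alpha> * t + \<beta>)) (at_right 0)"
proof -
  note [measurable] = hrepD(1,2)[OF h] loc_int_ptD(1)[OF F]
  define w where "w t = c t + lineint (\<lambda>s. g (s, t)) 0 (\<alpha> * t + \<beta>)" for t
  have "AE t in lborel. (disc_mean (F \<circ> prod.swap) (t, \<alpha> * t + \<beta>) \<longlongrightarrow> w t) (at_right 0)"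
  proof (rule disc_mean_tendsto[where g="g \<circ> prod.swap"])
    show "set_integrable lebesgue K (F \<circ> prod.swap)" if "compact K" for K
      by (rule loc_int_pt_compact[OF loc_int_pt_swap[OF F] that])
    show "loc_int w" unfolding w_def by (rule hrep_line_loc_int[OF F h])
    show "g \<circ> prod.swap \<in> borel_measurable borel" by (simp add: comp_def)
    show "loc_int (\<lambda>s. (g \<circ> prod.swap) (x, s))" for x using hrepD(3)[OF h] by simp
    show "(\<integral>\<^sup>+ p. ennreal (((g \<circ> prod.swap) p)\<^sup>2) \<partial>lborel) < \<infinity>"
      using hrepD(4)[OF h] nn_integral_swap[of "\<lambda>p. ennreal ((g p)\<^sup>2)"] by simp
    show "AE p in lborel. (F \<circ> prod.swap) p = w (fst p) + lineint (\<lambda>s. (g \<circ> prod.swap) (fst p, s)) (\<alpha> * fst p + \<beta>) (snd p)"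
      using AE_swap[OF hrepD(5)[OF h]]
    proof eventually_elim
      case (elim p)
      then show ?case
        using lineint_add[OF hrepD(3)[OF h], of "fst p" 0 "\<alpha> * fst p + \<beta>" "snd p"] by (simp add: w_def)
    qed
  qed fact
  moreover have "disc_mean (F \<circ> prod.swap) p = disc_mean F (prod.swap p)" for p
    by (rule ext) (rule disc_mean_swap, measurable)
  ultimately show ?thesis by (simp add: w_def)
qed

section \<open>Local square integrability from finite edge terms\<close>

lemma ennreal_plus_mult:
  "0 \<le> A \<Longrightarrow> 0 \<le> B \<Longrightarrow> 0 \<le> Z \<Longrightarrow> ennreal (A + B * Z) = ennreal A + ennreal B * ennreal Z"
  by (simp add: ennreal_mult)

text \<open>The inner integral must be finite for some \<open>x0\<close> in the edge, which has
  positive length. There \<open>p\<close> is compared with the single value at \<open>x0\<close>: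
  since distances are at most \<open>\<delta>\<close>, the squared difference is at most
  \<open>\<delta>^2\<close> times the integrand of the edge term.\<close>

lemma edge_finite_L2:
  assumes [measurable]: "p \<in> borel_measurable borel" and d: "\<delta> > 0" and fin: "edge \<delta> p a < \<infinity>"
  shows "(\<integral>\<^sup>+ x\<in>{a..a + \<delta>}. ennreal ((p x)\<^sup>2) \<partial>lborel) < \<infinity>"
proof -
  define I where "I x = (\<integral>\<^sup>+ y\<in>{0..\<delta>}. ennreal ((p (a + x) - p (a + y))\<^sup>2 / (x - y)\<^sup>2) \<partial>lborel)" for x
  have [measurable]: "I \<in> borel_measurable borel" unfolding I_def by measurable
  have "(\<integral>\<^sup>+ x. I x * indicator {0..\<delta>} x \<partial>lborel) < \<infinity>" using fin by (simp add: edge_def I_def)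
  then have ae: "AE x in lborel. I x * indicator {0..\<delta>} x \<noteq> \<infinity>" by (intro nn_integral_PInf_AE) auto
  have pos: "\<not> (AE x in lborel. x \<notin> {0..\<delta>})"
  proof
    assume "AE x in lborel. x \<notin> {0..\<delta>}"
    then have "{0..\<delta>} \<in> null_sets lborel" using AE_iff_null_sets[of "{0..\<delta>}" lborel] by simp
    then show False using d by (simp add: null_sets_def)
  qed
  have "\<exists>x0\<in>{0..\<delta>}. I x0 \<noteq> \<infinity>"
  proof (rule ccontr)
    assume *: "\<not> (\<exists>x0\<in>{0..\<delta>}. I x0 \<noteq> \<infinity>)"
    have "AE x in lborel. x \<notin> {0..\<delta>}"
      using ae by eventually_elim (use * in \<open>auto simp: indicator_def\<close>)
    with pos show False ..
  qed
  then obtain x0 where x0: "x0 \<in> {0..\<delta>}" "I x0 < \<infinity>" by (auto simp: less_top)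
  have "(\<integral>\<^sup>+ x\<in>{a..a + \<delta>}. ennreal ((p x)\<^sup>2) \<partial>lborel) = (\<integral>\<^sup>+ y\<in>{0..\<delta>}. ennreal ((p (a + y))\<^sup>2) \<partial>lborel)"
    by (subst set_nn_integral_shift[of "\<lambda>x. ennreal ((p x)\<^sup>2)"]) auto
  also have "\<dots> \<le> (\<integral>\<^sup>+ y. ennreal (2 * (p (a + x0))\<^sup>2) * indicator {0..\<delta>} y + ennreal (2 * \<delta>\<^sup>2) * (ennreal ((p (a + x0) - p (a + y))\<^sup>2 / (x0 - y)\<^sup>2) * indicator {0..\<delta>} y) \<partial>lborel)"
  proof (rule nn_integral_mono_AE, use AE_lborel_singleton[of x0] in eventually_elim)
    case (elim y)
    show ?case
    proof (cases "y \<in> {0..\<delta>}")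
      case True
      have "(x0 - y)\<^sup>2 \<le> \<delta>\<^sup>2" using x0 True by (intro power2_le_iff_abs_le[THEN iffD2]) auto
      then have "(p (a + x0) - p (a + y))\<^sup>2 * (x0 - y)\<^sup>2 \<le> \<delta>\<^sup>2 * (p (a + x0) - p (a + y))\<^sup>2"
        by (simp add: mult.commute mult_right_mono)
      then have "(p (a + x0) - p (a + y))\<^sup>2 \<le> \<delta>\<^sup>2 * ((p (a + x0) - p (a + y))\<^sup>2 / (x0 - y)\<^sup>2)"
        using elim by (simp add: field_simps)
      then have "(p (a + y))\<^sup>2 \<le> 2 * (p (a + x0))\<^sup>2 + 2 * \<delta>\<^sup>2 * ((p (a + x0) - p (a + y))\<^sup>2 / (x0 - y)\<^sup>2)"
        using sq_add2[of "p (a + x0)" "p (a + y) - p (a + x0)"] by (simp add: power2_commute[of "p (a + y)"])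
      then have "ennreal ((p (a + y))\<^sup>2) \<le> ennreal (2 * (p (a + x0))\<^sup>2 + 2 * \<delta>\<^sup>2 * ((p (a + x0) - p (a + y))\<^sup>2 / (x0 - y)\<^sup>2))"
        by (rule ennreal_leI)
      also have "\<dots> = ennreal (2 * (p (a + x0))\<^sup>2) + ennreal (2 * \<delta>\<^sup>2) * ennreal ((p (a + x0) - p (a + y))\<^sup>2 / (x0 - y)\<^sup>2)"
        by (rule ennreal_plus_mult) auto
      finally show ?thesis using True by simp
    qed simp
  qed
  also have "\<dots> = ennreal (2 * (p (a + x0))\<^sup>2) * ennreal \<delta> + ennreal (2 * \<delta>\<^sup>2) * I x0"
    using d unfolding I_def by (subst nn_integral_add) (auto simp: nn_integral_cmult nn_integral_cmult_indicator)
  also have "\<dots> < \<infinity>" using x0 by (simp add: ennreal_mult_less_top)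
  finally show ?thesis .
qed

lemma L2_of_cells:
  fixes p :: "real \<Rightarrow> real"
  assumes [measurable]: "p \<in> borel_measurable borel" and d: "\<delta> > 0"
    and fin: "\<And>j::int. (\<integral>\<^sup>+ x\<in>{of_int j * \<delta>..of_int j * \<delta> + \<delta>}. ennreal ((p x)\<^sup>2) \<partial>lborel) < \<infinity>"
  shows "(\<integral>\<^sup>+ x\<in>{A..B}. ennreal ((p x)\<^sup>2) \<partial>lborel) < \<infinity>"
proof -
  define J where "J = {\<lfloor>A / \<delta>\<rfloor>..\<lfloor>B / \<delta>\<rfloor>}"
  define Q where "Q j = {of_int j * \<delta>..of_int j * \<delta> + \<delta>}" for j :: int
  have "(\<integral>\<^sup>+ x\<in>{A..B}. ennreal ((p x)\<^sup>2) \<partial>lborel) \<le> (\<integral>\<^sup>+ x. (\<Sum>j\<in>J. ennreal ((p x)\<^sup>2) * indicator (Q j) x) \<partial>lborel)"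
  proof (rule nn_integral_mono)
    fix x
    show "ennreal ((p x)\<^sup>2) * indicator {A..B} x \<le> (\<Sum>j\<in>J. ennreal ((p x)\<^sup>2) * indicator (Q j) x)"
    proof (cases "x \<in> {A..B}")
      case True
      define j where "j = \<lfloor>x / \<delta>\<rfloor>"
      have "j \<in> J" using True d unfolding J_def j_def by (auto intro!: floor_mono divide_right_mono)
      have "of_int j \<le> x / \<delta>" "x / \<delta> < of_int j + 1" unfolding j_def by linarith+
      then have "x \<in> Q j" using d by (auto simp: Q_def field_simps)
      have "ennreal ((p x)\<^sup>2) * indicator (Q j) x \<le> (\<Sum>j\<in>J. ennreal ((p x)\<^sup>2) * indicator (Q j) x)"
        by (rule member_le_sum[OF \<open>j \<in> J\<close>]) (auto simp: J_def)
      then show ?thesis using \<open>x \<in> Q j\<close> True by simp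
    qed simp
  qed
  also have "\<dots> = (\<Sum>j\<in>J. \<integral>\<^sup>+ x\<in>Q j. ennreal ((p x)\<^sup>2) \<partial>lborel)"
    by (rule nn_integral_sum) (auto simp: Q_def)
  also have "\<dots> < \<infinity>" using fin by (auto simp: J_def Q_def)
  finally show ?thesis .
qed

lemma integral_swap_pt:
  fixes f :: "pt \<Rightarrow> real"
  assumes [measurable]: "f \<in> borel_measurable borel"
  shows "(\<integral>p. f (prod.swap p) \<partial>lborel) = (\<integral>p. f p \<partial>lborel)"
  by (subst (2) lborel_pt_swap[symmetric], subst integral_distr) auto

text \<open>A single trace \<open>f\<close> serves all meshes. Each coordinate direction gives a
  representation of the same function, and their disc-mean limits supply the hypotheses of
  \<open>two_versions\<close>.\<close>

lemma trace_theorem: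
  assumes W: "weak_grad_L2 F G1 G2"
  obtains f where "\<And>\<delta>. \<delta> > 0 \<Longrightarrow> is_trace \<delta> F f" "\<And>\<delta>. \<delta> > 0 \<Longrightarrow> in_H12 \<delta> f"
    "\<And>\<delta>. \<delta> > 0 \<Longrightarrow> H12_norm2 \<delta> f \<le> 990 * (\<integral>\<^sup>+ p. ennreal ((G1 p)\<^sup>2 + (G2 p)\<^sup>2) \<partial>lebesgue)"
proof -
  obtain F0 h1 h2 where F0: "loc_int_pt F0" "AE p in lborel. F p = F0 p"
    and h1: "h1 \<in> borel_measurable borel" and h2: "h2 \<in> borel_measurable borel"
    and n: "(\<integral>\<^sup>+ p. ennreal ((h1 p)\<^sup>2 + (h2 p)\<^sup>2) \<partial>lborel) = (\<integral>\<^sup>+ p. ennreal ((G1 p)\<^sup>2 + (G2 p)\<^sup>2) \<partial>lebesgue)"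
    and fin: "(\<integral>\<^sup>+ p. ennreal ((h1 p)\<^sup>2 + (h2 p)\<^sup>2) \<partial>lborel) < \<infinity>"
    and w1: "\<And>phi. test_fun phi \<Longrightarrow> (\<integral>p. F0 p * frechet_derivative phi (at p) (1, 0) \<partial>lborel) = - (\<integral>p. h1 p * phi p \<partial>lborel)"
    and w2: "\<And>phi. test_fun phi \<Longrightarrow> (\<integral>p. F0 p * frechet_derivative phi (at p) (0, 1) \<partial>lborel) = - (\<integral>p. h2 p * phi p \<partial>lborel)"
    by (rule weak_grad_borel[OF W]) (rule that, assumption+)
  note [measurable] = h1 h2 loc_int_ptD(1)[OF F0(1)]
  note fin12 = nn_integral_sum_sq_finite[OF fin]
  obtain c g1 where g1e: "AE p in lborel. g1 p = h1 p" and hr: "hrep F0 c g1"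
  proof (rule weak_derivative_hrep[OF F0(1) h1 fin12(1)])
    fix a a' b :: "real \<Rightarrow> real" and R :: real
    assume a: "smooth1 a" "smooth1 b" and d: "\<And>x. (a has_real_derivative a' x) (at x)"
      and z: "\<And>x. \<bar>x\<bar> > R \<Longrightarrow> a x = 0" "\<And>x. \<bar>x\<bar> > R \<Longrightarrow> b x = 0"
    obtain b' where b': "\<And>x. (b has_real_derivative b' x) (at x)" using a(2) smooth1_deriv by metis
    show "(\<integral>p. F0 p * (a' (fst p) * b (snd p)) \<partial>lborel) = - (\<integral>p. h1 p * (a (fst p) * b (snd p)) \<partial>lborel)"
      using w1[OF test_fun_prod[OF a z]] by (simp add: frechet_derivative_prod_fun(1)[OF d b'])
  qed (rule that)
  have F0s: "loc_int_pt (F0 \<circ> prod.swap)" by (rule loc_int_pt_swap[OF F0(1)])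
  have fins: "(\<integral>\<^sup>+ p. ennreal (((h2 \<circ> prod.swap) p)\<^sup>2) \<partial>lborel) < \<infinity>"
    using fin12(2) nn_integral_swap[of "\<lambda>p. ennreal ((h2 p)\<^sup>2)"] by simp
  have h2s: "h2 \<circ> prod.swap \<in> borel_measurable borel" by (simp add: comp_def)
  obtain d gv where gve: "AE p in lborel. gv p = (h2 \<circ> prod.swap) p" and vr: "hrep (F0 \<circ> prod.swap) d gv"
  proof (rule weak_derivative_hrep[OF F0s h2s fins])
    fix a a' b :: "real \<Rightarrow> real" and R :: real
    assume a: "smooth1 a" "smooth1 b" and d: "\<And>x. (a has_real_derivative a' x) (at x)"
      and z: "\<And>x. \<bar>x\<bar> > R \<Longrightarrow> a x = 0" "\<And>x. \<bar>x\<bar> > R \<Longrightarrow> b x = 0"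
    obtain b' where b': "\<And>x. (b has_real_derivative b' x) (at x)" using a(2) smooth1_deriv by metis
    obtain a2 where a2: "\<And>x. (a has_real_derivative a2 x) (at x)" "smooth1 a2" using a(1) smooth1_deriv by metis
    have "a2 = a'" by (rule ext, rule DERIV_unique[OF a2(1) d])
    then have "smooth1 a'" using a2 by simp
    then have [measurable]: "a \<in> borel_measurable borel" "a' \<in> borel_measurable borel" "b \<in> borel_measurable borel"
      using a by (auto intro!: borel_measurable_continuous_onI smooth1_cont)
    have "(\<integral>p. (F0 \<circ> prod.swap) p * (a' (fst p) * b (snd p)) \<partial>lborel) = (\<integral>p. F0 p * (b (fst p) * a' (snd p)) \<partial>lborel)"
      using integral_swap_pt[of "\<lambda>p. F0 p * (b (fst p) * a' (snd p))"] by (simp add: mult.commute)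
    also have "\<dots> = - (\<integral>p. h2 p * (b (fst p) * a (snd p)) \<partial>lborel)"
      using w2[OF test_fun_prod[OF a(2,1) z(2,1)]] by (simp add: frechet_derivative_prod_fun(2)[OF b' d])
    also have "(\<integral>p. h2 p * (b (fst p) * a (snd p)) \<partial>lborel) = (\<integral>p. (h2 \<circ> prod.swap) p * (a (fst p) * b (snd p)) \<partial>lborel)"
      using integral_swap_pt[of "\<lambda>p. h2 p * (b (fst p) * a (snd p))"] by (simp add: mult.commute)
    finally show "(\<integral>p. (F0 \<circ> prod.swap) p * (a' (fst p) * b (snd p)) \<partial>lborel) = - (\<integral>p. (h2 \<circ> prod.swap) p * (a (fst p) * b (snd p)) \<partial>lborel)" .
  qed (rule that)
  note [measurable] = hrepD(1,2)[OF hr] hrepD(1,2)[OF vr]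
  define g2 where "g2 p = gv (prod.swap p)" for p :: pt
  define V where "V p = d (fst p) + lineint (\<lambda>s. gv (s, fst p)) 0 (snd p)" for p :: pt
  define H where "H p = c (snd p) + lineint (\<lambda>s. g1 (s, snd p)) 0 (fst p)" for p :: pt
  have [measurable]: "g2 \<in> borel_measurable borel" unfolding g2_def by measurable
  have Vm [measurable]: "V \<in> borel_measurable borel"
  proof -
    have "V = (\<lambda>p. d (fst p) + lineint (\<lambda>s. g2 (fst p, s)) 0 (snd p))" by (auto simp: V_def g2_def)
    then show ?thesis by simp
  qed
  have Hm [measurable]: "H \<in> borel_measurable borel" unfolding H_def by measurable
  have g2e: "AE p in lborel. g2 p = h2 p" using AE_swap[OF gve] by (simp add: g2_def)
  have trH: "AE t in lborel. (disc_mean F0 (\<alpha> * t + \<beta>, t) \<longlongrightarrow> H (\<alpha> * t + \<beta>, t)) (at_right 0)" if "\<bar>\<alpha>\<bar> \<le> 1" for \<alpha> \<beta>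
    using hrep_trace[OF F0(1) hr that, of \<beta>] by (simp add: H_def)
  have trV: "AE x in lborel. (disc_mean F0 (x, \<alpha> * x + \<beta>) \<longlongrightarrow> V (x, \<alpha> * x + \<beta>)) (at_right 0)" if "\<bar>\<alpha>\<bar> \<le> 1" for \<alpha> \<beta>
  proof -
    have "disc_mean (F0 \<circ> prod.swap) p = disc_mean F0 (prod.swap p)" for p
      by (rule ext) (rule disc_mean_swap, measurable)
    then show ?thesis using hrep_trace[OF F0s vr that, of \<beta>] by (simp add: V_def)
  qed
  have Vl: "V (x, t') - V (x, t) = lineint (\<lambda>s. gv (s, x)) t t'" for x t t'
    using lineint_diff[OF hrepD(3)[OF vr], of x 0 t' t] by (simp add: V_def)
  have Hl: "H (x', t) - H (x, t) = lineint (\<lambda>s. g1 (s, t)) x x'" for x x' t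
    using lineint_diff[OF hrepD(3)[OF hr], of t 0 x' x] by (simp add: H_def)
  interpret two_versions V H g1 g2
  proof
    show "ennreal \<bar>V (x, t') - V (x, t)\<bar> \<le> (\<integral>\<^sup>+ s\<in>{min t t'..max t t'}. ennreal \<bar>g2 (x, s)\<bar> \<partial>lborel)" for x t t'
      unfolding Vl g2_def using lineint_abs_le[of "\<lambda>s. gv (s, x)" t t'] by simp
    show "ennreal \<bar>H (x', t) - H (x, t)\<bar> \<le> (\<integral>\<^sup>+ s\<in>{min x x'..max x x'}. ennreal \<bar>g1 (s, t)\<bar> \<partial>lborel)" for x x' t
      unfolding Hl by (rule lineint_abs_le)
    show "AE p in lborel. V p = H p"
      using hrepD(5)[OF hr] AE_swap[OF hrepD(5)[OF vr]] by eventually_elim (simp add: V_def H_def)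
    \<comment> \<open>Almost everywhere equality in the plane does not reach a diagonal. Both
      versions are limits of the same disc means there, so they agree by uniqueness of
      limits.\<close>
    show "AE x in lborel. V (x, x + k) = H (x, x + k)" for k
    proof -
      have "AE x in lborel. (disc_mean F0 (x, x + k) \<longlongrightarrow> V (x, x + k)) (at_right 0)" using trV[of 1 k] by simp
      moreover have "AE x in lborel. (disc_mean F0 (x, x + k) \<longlongrightarrow> H (x, x + k)) (at_right 0)"
        using AE_shift[OF trH[of 1 "- k"], of k] by (simp add: add.commute)
      ultimately show ?thesis by eventually_elim (rule tendsto_unique[OF trivial_limit_at_right_real])
    qed
    show "AE x in lborel. V (x, k - x) = H (x, k - x)" for k
    proof -
      have "AE x in lborel. (disc_mean F0 (x, k - x) \<longlongrightarrow> V (x, k - x)) (at_right 0)" using trV[of "-1" k] by simp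
      moreover have "AE x in lborel. (disc_mean F0 (x, k - x) \<longlongrightarrow> H (x, k - x)) (at_right 0)"
        using AE_reflect[OF trH[of "-1" k], of k] by simp
      ultimately show ?thesis by eventually_elim (rule tendsto_unique[OF trivial_limit_at_right_real])
    qed
  qed measurable
  \<comment> \<open>Defined without reference to a grid. At points where the limit does not exist
    the value is arbitrary; on each line these form a null set.\<close>
  define f where "f p = Lim (at_right 0) (disc_mean F0 p)" for p
  have fh: "AE x in lborel. (disc_mean F0 (x, b) \<longlongrightarrow> f (x, b)) (at_right 0) \<and> f (x, b) = V (x, b)" for b
  proof -
    have "AE x in lborel. (disc_mean F0 (x, b) \<longlongrightarrow> V (x, b)) (at_right 0)" using trV[of 0 b] by simp
    then show ?thesis
    proof eventually_elim
      case (elim x)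
      from tendsto_Lim[OF trivial_limit_at_right_real elim] elim show ?case by (simp add: f_def)
    qed
  qed
  have fv: "AE t in lborel. (disc_mean F0 (a, t) \<longlongrightarrow> f (a, t)) (at_right 0) \<and> f (a, t) = H (a, t)" for a
  proof -
    have "AE t in lborel. (disc_mean F0 (a, t) \<longlongrightarrow> H (a, t)) (at_right 0)" using trH[of 0 a] by simp
    then show ?thesis
    proof eventually_elim
      case (elim t)
      from tendsto_Lim[OF trivial_limit_at_right_real elim] elim show ?case by (simp add: f_def)
    qed
  qed
  have norm: "H12_norm2 \<delta> f \<le> 990 * (\<integral>\<^sup>+ p. ennreal ((G1 p)\<^sup>2 + (G2 p)\<^sup>2) \<partial>lebesgue)"
     and norm_eq: "H12_norm2 \<delta> f = (\<integral>\<^sup>+ jk. vertex \<delta> (\<lambda>x. V (x, of_int (snd jk) * \<delta>)) (\<lambda>t. H (of_int (fst jk) * \<delta>, t))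
       (of_int (fst jk) * \<delta>) (of_int (snd jk) * \<delta>) \<partial>count_space UNIV)" if "\<delta> > 0" for \<delta>
  proof -
    show e: "H12_norm2 \<delta> f = (\<integral>\<^sup>+ jk. vertex \<delta> (\<lambda>x. V (x, of_int (snd jk) * \<delta>)) (\<lambda>t. H (of_int (fst jk) * \<delta>, t))
       (of_int (fst jk) * \<delta>) (of_int (snd jk) * \<delta>) \<partial>count_space UNIV)"
      unfolding H12_norm2_vertex
      by (intro nn_integral_cong vertex_cong_AE) (use fh fv in \<open>auto elim!: eventually_mono\<close>)
    also have "\<dots> \<le> 990 * (\<integral>\<^sup>+ p. ennreal ((g1 p)\<^sup>2 + (g2 p)\<^sup>2) \<partial>lborel)"
      by (rule grid_norm_le[OF that])
    also have "(\<integral>\<^sup>+ p. ennreal ((g1 p)\<^sup>2 + (g2 p)\<^sup>2) \<partial>lborel) = (\<integral>\<^sup>+ p. ennreal ((h1 p)\<^sup>2 + (h2 p)\<^sup>2) \<partial>lborel)"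
      by (rule nn_integral_cong_AE) (use g1e g2e in auto)
    finally show "H12_norm2 \<delta> f \<le> 990 * (\<integral>\<^sup>+ p. ennreal ((G1 p)\<^sup>2 + (G2 p)\<^sup>2) \<partial>lebesgue)" unfolding n .
  qed
  have nfin: "H12_norm2 \<delta> f < \<infinity>" if "\<delta> > 0" for \<delta>
    by (rule le_less_trans[OF norm[OF that]]) (use fin n in \<open>simp add: ennreal_mult_less_top\<close>)
  show ?thesis
  proof (rule that)
    fix \<delta> :: real assume d: "\<delta> > 0"
    have dm: "disc_mean F = disc_mean F0" by (rule disc_mean_cong_AE[OF F0(2)]) measurable
    show "is_trace \<delta> F f"
      unfolding is_trace_def AE_gp_def disc_mean_def[symmetric] dm AE_lebesgue_lborel
      using fh fv by (auto elim!: eventually_mono)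
    show "H12_norm2 \<delta> f \<le> 990 * (\<integral>\<^sup>+ p. ennreal ((G1 p)\<^sup>2 + (G2 p)\<^sup>2) \<partial>lebesgue)" by (rule norm[OF d])
    have cell: "vertex \<delta> (\<lambda>x. V (x, of_int k * \<delta>)) (\<lambda>t. H (of_int j * \<delta>, t)) (of_int j * \<delta>) (of_int k * \<delta>) < \<infinity>" for j k :: int
    proof -
      have "AE jk in count_space UNIV. vertex \<delta> (\<lambda>x. V (x, of_int (snd jk) * \<delta>)) (\<lambda>t. H (of_int (fst jk) * \<delta>, t))
       (of_int (fst jk) * \<delta>) (of_int (snd jk) * \<delta>) \<noteq> \<infinity>"
        by (rule nn_integral_PInf_AE) (use nfin[OF d] norm_eq[OF d] in auto)
      then show ?thesis unfolding AE_count_space by (auto simp: less_top dest!: spec[of _ "(j, k)"])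
    qed
    have l2: "(\<integral>\<^sup>+ x\<in>{A..B}. ennreal ((V (x, of_int k * \<delta>))\<^sup>2) \<partial>lborel) < \<infinity>" for A B and k :: int
    proof (rule L2_of_cells[OF _ d])
      show "(\<integral>\<^sup>+ x\<in>{of_int j * \<delta>..of_int j * \<delta> + \<delta>}. ennreal ((V (x, of_int k * \<delta>))\<^sup>2) \<partial>lborel) < \<infinity>" for j :: int
        by (rule edge_finite_L2[OF _ d]) (use cell[of k j] in \<open>auto simp: vertex_def\<close>)
    qed measurable
    have l2': "(\<integral>\<^sup>+ t\<in>{A..B}. ennreal ((H (of_int j * \<delta>, t))\<^sup>2) \<partial>lborel) < \<infinity>" for A B and j :: int
    proof (rule L2_of_cells[OF _ d])
      show "(\<integral>\<^sup>+ x\<in>{of_int k * \<delta>..of_int k * \<delta> + \<delta>}. ennreal ((H (of_int j * \<delta>, x))\<^sup>2) \<partial>lborel) < \<infinity>" for k :: int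
        by (rule edge_finite_L2[OF _ d]) (use cell[of k j] in \<open>auto simp: vertex_def\<close>)
    qed measurable
    have "loc_L2_gp \<delta> f"
      unfolding loc_L2_gp_def nn_integral_completion
    proof (intro conjI allI)
      fix k :: int
      show "(\<lambda>x. f (x, of_int k * \<delta>)) \<in> borel_measurable lebesgue"
        by (rule lebesgue_borel_version(1)[of "\<lambda>x. V (x, of_int k * \<delta>)"]) (use fh[of "of_int k * \<delta>"] in \<open>auto elim!: eventually_mono\<close>)
      fix A B
      have "(\<integral>\<^sup>+ x\<in>{A..B}. ennreal ((f (x, of_int k * \<delta>))\<^sup>2) \<partial>lborel) = (\<integral>\<^sup>+ x\<in>{A..B}. ennreal ((V (x, of_int k * \<delta>))\<^sup>2) \<partial>lborel)"
        by (rule nn_integral_cong_AE, use fh[of "of_int k * \<delta>"] in eventually_elim) simp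
      then show "(\<integral>\<^sup>+ x\<in>{A..B}. ennreal ((f (x, of_int k * \<delta>))\<^sup>2) \<partial>lborel) < \<infinity>" using l2 by simp
    next
      fix j :: int
      show "(\<lambda>x. f (of_int j * \<delta>, x)) \<in> borel_measurable lebesgue"
        by (rule lebesgue_borel_version(1)[of "\<lambda>x. H (of_int j * \<delta>, x)"]) (use fv[of "of_int j * \<delta>"] in \<open>auto elim!: eventually_mono\<close>)
      fix A B
      have "(\<integral>\<^sup>+ x\<in>{A..B}. ennreal ((f (of_int j * \<delta>, x))\<^sup>2) \<partial>lborel) = (\<integral>\<^sup>+ x\<in>{A..B}. ennreal ((H (of_int j * \<delta>, x))\<^sup>2) \<partial>lborel)"
        by (rule nn_integral_cong_AE, use fv[of "of_int j * \<delta>"] in eventually_elim) simp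
      then show "(\<integral>\<^sup>+ x\<in>{A..B}. ennreal ((f (of_int j * \<delta>, x))\<^sup>2) \<partial>lborel) < \<infinity>" using l2' by simp
    qed
    then show "in_H12 \<delta> f" using nfin[OF d] by (simp add: in_H12_def)
  qed
qed

section \<open>Difference quotients of edge means\<close>

text \<open>Completeness of the space of square integrable functions, stated with a rate so that the
  distance from the limit to every member of the sequence is retained.\<close>

lemma riesz_fischer:
  fixes f :: "nat \<Rightarrow> 'a \<Rightarrow> real"
  assumes [measurable]: "\<And>n. f n \<in> borel_measurable M"
    and cauchy: "\<And>n n'. n \<le> n' \<Longrightarrow> (\<integral>\<^sup>+ x. ennreal ((f n' x - f n x)\<^sup>2) \<partial>M) \<le> ennreal (\<epsilon> n)"
    and eps: "\<epsilon> \<longlonglongrightarrow> 0"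
  obtains F where "F \<in> borel_measurable M" "\<And>n. (\<integral>\<^sup>+ x. ennreal ((F x - f n x)\<^sup>2) \<partial>M) \<le> ennreal (\<epsilon> n)"
proof -
  have "\<exists>N. \<forall>n\<ge>N. \<epsilon> n \<le> (1/4) ^ k" for k
    using order_tendstoD(2)[OF eps, of "(1/4) ^ k"] by (auto simp: eventually_sequentially intro: less_imp_le)
  then obtain N where N: "\<And>k n. n \<ge> N k \<Longrightarrow> \<epsilon> n \<le> (1/4) ^ k" by metis
  \<comment> \<open>The partial sums make \<open>r\<close> increasing and at least
    \<open>N k\<close>; the extra \<open>k\<close> forces it to infinity.\<close>
  define r where "r k = (\<Sum>j\<le>k. N j) + k" for k
  have rN: "N k \<le> r k" for k unfolding r_def by (simp add: member_le_sum trans_le_add1)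
  have rk: "k \<le> r k" and rmono: "r k \<le> r (Suc k)" for k unfolding r_def by auto
  \<comment> \<open>The weights \<open>2 ^ k\<close> against increments of squared norm at most
    \<open>(1/4) ^ k\<close> keep the series integrable, and where it is finite they force pointwise
    geometric decay of the increments.\<close>
  define S where "S x = (\<Sum>k. ennreal (2 ^ k * (f (r (Suc k)) x - f (r k) x)\<^sup>2))" for x
  have "(\<integral>\<^sup>+ x. S x \<partial>M) = (\<Sum>k. \<integral>\<^sup>+ x. ennreal (2 ^ k * (f (r (Suc k)) x - f (r k) x)\<^sup>2) \<partial>M)"
    unfolding S_def by (rule nn_integral_suminf) measurable
  also have "\<dots> \<le> (\<Sum>k. ennreal ((1/2) ^ k))"
  proof (rule suminf_le)
    fix k
    have "(\<integral>\<^sup>+ x. ennreal (2 ^ k * (f (r (Suc k)) x - f (r k) x)\<^sup>2) \<partial>M) = ennreal (2 ^ k) * (\<integral>\<^sup>+ x. ennreal ((f (r (Suc k)) x - f (r k) x)\<^sup>2) \<partial>M)"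
      by (subst nn_integral_cmult[symmetric]) (auto simp: ennreal_mult)
    also have "\<dots> \<le> ennreal (2 ^ k) * ennreal ((1/4) ^ k)"
      by (intro mult_left_mono order_trans[OF cauchy[OF rmono]] ennreal_leI N rN) auto
    also have "\<dots> = ennreal ((1/2) ^ k)"
      by (subst ennreal_mult[symmetric]) (auto simp: power_mult_distrib[symmetric])
    finally show "(\<integral>\<^sup>+ x. ennreal (2 ^ k * (f (r (Suc k)) x - f (r k) x)\<^sup>2) \<partial>M) \<le> ennreal ((1/2) ^ k)" .
  qed auto
  also have "\<dots> < \<infinity>"
  proof -
    have "summable (\<lambda>k. (1/2 :: real) ^ k)" by (rule summable_geometric) simp
    then show ?thesis by (subst suminf_ennreal2) auto
  qed
  finally have Sfin: "(\<integral>\<^sup>+ x. S x \<partial>M) < \<infinity>" .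
  have ae: "AE x in M. S x \<noteq> \<infinity>"
    by (rule nn_integral_PInf_AE) (use Sfin in \<open>auto simp: S_def\<close>)
  have conv: "convergent (\<lambda>k. f (r k) x)" if "S x \<noteq> \<infinity>" for x
  proof -
    define s where "s = enn2real (S x)"
    have s: "S x = ennreal s" "s \<ge> 0" using that by (auto simp: s_def less_top)
    have "\<bar>f (r (Suc k)) x - f (r k) x\<bar> \<le> sqrt s * (sqrt (1/2)) ^ k" for k
    proof -
      have "ennreal (2 ^ k * (f (r (Suc k)) x - f (r k) x)\<^sup>2) \<le> S x"
      proof -
        define h where "h k = ennreal (2 ^ k * (f (r (Suc k)) x - f (r k) x)\<^sup>2)" for k
        have "sum h {k} \<le> suminf h" by (rule sum_le_suminf) auto
        then show ?thesis unfolding S_def h_def by simp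
      qed
      then have "2 ^ k * (f (r (Suc k)) x - f (r k) x)\<^sup>2 \<le> s" using s by (simp add: ennreal_le_iff)
      then have "(f (r (Suc k)) x - f (r k) x)\<^sup>2 \<le> s * (1/2) ^ k" by (simp add: field_simps power_one_over)
      then have "\<bar>f (r (Suc k)) x - f (r k) x\<bar> \<le> sqrt (s * (1/2) ^ k)" by (metis real_sqrt_abs real_sqrt_le_mono)
      then show ?thesis by (simp add: real_sqrt_mult real_sqrt_power)
    qed
    moreover have "summable (\<lambda>k. sqrt s * (sqrt (1/2)) ^ k)"
    proof (intro summable_mult summable_geometric)
      have "sqrt (1/2) < sqrt 1" by (rule real_sqrt_less_mono) simp
      then show "norm (sqrt (1/2)) < 1" by simp
    qed
    ultimately have "summable (\<lambda>k. f (r (Suc k)) x - f (r k) x)"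
      using summable_comparison_test'[of "\<lambda>k. sqrt s * (sqrt (1/2)) ^ k" 0 "\<lambda>k. f (r (Suc k)) x - f (r k) x"]
      unfolding real_norm_def by blast
    then have c: "convergent (\<lambda>n. \<Sum>k<n. f (r (Suc k)) x - f (r k) x)" unfolding summable_iff_convergent .
    have t: "(\<Sum>k<n. f (r (Suc k)) x - f (r k) x) = f (r n) x - f (r 0) x" for n
      by (rule sum_lessThan_telescope)
    from c have "convergent (\<lambda>n. f (r n) x - f (r 0) x)" unfolding t .
    from convergent_add[OF this convergent_const[of "f (r 0) x"]] show ?thesis by (simp only: diff_add_cancel)
  qed
  define F where "F x = lim (\<lambda>k. f (r k) x)" for x
  have Fm: "F \<in> borel_measurable M" unfolding F_def by measurable
  have lim: "AE x in M. (\<lambda>k. f (r k) x) \<longlonglongrightarrow> F x"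
    using ae by eventually_elim (use conv in \<open>auto simp: F_def convergent_LIMSEQ_iff\<close>)
  show ?thesis
  proof (rule that[OF Fm])
    fix n
    \<comment> \<open>Fatou carries the Cauchy bound over to the limit along the
      subsequence.\<close>
    have "(\<integral>\<^sup>+ x. ennreal ((F x - f n x)\<^sup>2) \<partial>M) = (\<integral>\<^sup>+ x. liminf (\<lambda>k. ennreal ((f (r k) x - f n x)\<^sup>2)) \<partial>M)"
    proof (rule nn_integral_cong_AE, use lim in eventually_elim)
      case (elim x)
      have "(\<lambda>k. ennreal ((f (r k) x - f n x)\<^sup>2)) \<longlonglongrightarrow> ennreal ((F x - f n x)\<^sup>2)"
        by (intro tendsto_ennrealI tendsto_intros elim)
      from lim_imp_Liminf[OF sequentially_bot this, symmetric] show ?case .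
    qed
    also have "\<dots> \<le> liminf (\<lambda>k. \<integral>\<^sup>+ x. ennreal ((f (r k) x - f n x)\<^sup>2) \<partial>M)"
      by (rule nn_integral_liminf) measurable
    also have "\<dots> \<le> ennreal (\<epsilon> n)"
    proof (rule Liminf_le)
      show "\<forall>\<^sub>F k in sequentially. (\<integral>\<^sup>+ x. ennreal ((f (r k) x - f n x)\<^sup>2) \<partial>M) \<le> ennreal (\<epsilon> n)"
        using eventually_ge_at_top[of n] by eventually_elim (use rk order_trans in \<open>blast intro: cauchy\<close>)
    qed simp
    finally show "(\<integral>\<^sup>+ x. ennreal ((F x - f n x)\<^sup>2) \<partial>M) \<le> ennreal (\<epsilon> n)" .
  qed
qed

section \<open>Step functions and means over edges\<close>

lemma loc_int_step:
  assumes d: "\<delta> > 0"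
  shows "loc_int (\<lambda>x. s \<lfloor>x / \<delta>\<rfloor> :: real)"
  unfolding loc_int_def set_integrable_def
proof (intro conjI allI)
  show m [measurable]: "(\<lambda>x. s \<lfloor>x / \<delta>\<rfloor>) \<in> borel_measurable borel" by measurable
  fix a b
  define J where "J = {\<lfloor>a / \<delta>\<rfloor>..\<lfloor>b / \<delta>\<rfloor>}"
  have J: "finite J" by (simp add: J_def)
  show "integrable lborel (\<lambda>x. indicat_real {a..b} x *\<^sub>R s \<lfloor>x / \<delta>\<rfloor>)"
  proof (rule Bochner_Integration.integrable_bound)
    show "integrable lborel (\<lambda>x. (\<Sum>l\<in>J. \<bar>s l\<bar>) * indicat_real {a..b} x)"
      by (intro integrable_mult_right integrable_real_indicator) (auto simp: emeasure_lborel_Icc_eq)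
    show "AE x in lborel. norm (indicat_real {a..b} x *\<^sub>R s \<lfloor>x / \<delta>\<rfloor>) \<le> norm ((\<Sum>l\<in>J. \<bar>s l\<bar>) * indicat_real {a..b} x)"
    proof (rule AE_I2)
      fix x
      show "norm (indicat_real {a..b} x *\<^sub>R s \<lfloor>x / \<delta>\<rfloor>) \<le> norm ((\<Sum>l\<in>J. \<bar>s l\<bar>) * indicat_real {a..b} x)"
      proof (cases "x \<in> {a..b}")
        case True
        then have "\<lfloor>x / \<delta>\<rfloor> \<in> J" using d by (auto simp: J_def intro!: floor_mono divide_right_mono)
        then have "\<bar>s \<lfloor>x / \<delta>\<rfloor>\<bar> \<le> (\<Sum>l\<in>J. \<bar>s l\<bar>)" using J by (intro member_le_sum) auto
        then show ?thesis using True by (simp add: sum_nonneg)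
      qed simp
    qed
  qed measurable
qed

lemma lineint_cong_AE:
  assumes "\<And>x. a < x \<Longrightarrow> x < b \<Longrightarrow> f x = g x" "a \<le> b"
    "f \<in> borel_measurable borel" "g \<in> borel_measurable borel"
  shows "lineint f a b = lineint g a b"
  unfolding lineint_def
  by (rule integral_cong_AE) (use assms AE_lborel_singleton[of b] in \<open>auto simp: orient_def elim!: eventually_mono\<close>)

text \<open>The step function is the discrete derivative of \<open>\<Psi>\<close> on a mesh
  \<open>\<delta>\<close>, so its integral between grid points telescopes.\<close>

lemma step_lineint:
  fixes \<Psi> :: "int \<Rightarrow> real"
  assumes d: "\<delta> > 0" and jj: "j \<le> j'"
  shows "lineint (\<lambda>x. (\<Psi> (\<lfloor>x / \<delta>\<rfloor> + 1) - \<Psi> \<lfloor>x / \<delta>\<rfloor>) / \<delta>) (of_int j * \<delta>) (of_int j' * \<delta>) = \<Psi> j' - \<Psi> j"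
  using jj
proof (induction j' rule: int_ge_induct)
  case (step l)
  let ?f = "\<lambda>x. (\<Psi> (\<lfloor>x / \<delta>\<rfloor> + 1) - \<Psi> \<lfloor>x / \<delta>\<rfloor>) / \<delta>"
  have li: "loc_int ?f" by (rule loc_int_step[OF d, of "\<lambda>l. (\<Psi> (l + 1) - \<Psi> l) / \<delta>"])
  have "lineint ?f (of_int l * \<delta>) (of_int (l + 1) * \<delta>) = lineint (\<lambda>_. (\<Psi> (l + 1) - \<Psi> l) / \<delta>) (of_int l * \<delta>) (of_int (l + 1) * \<delta>)"
  proof (rule lineint_cong_AE)
    fix x assume "of_int l * \<delta> < x" "x < of_int (l + 1) * \<delta>"
    then have "\<lfloor>x / \<delta>\<rfloor> = l" using d by (intro floor_unique) (auto simp: field_simps)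
    then show "?f x = (\<Psi> (l + 1) - \<Psi> l) / \<delta>" by simp
  qed (use d loc_int_measurable[OF li] in auto)
  also have "\<dots> = \<Psi> (l + 1) - \<Psi> l" using d by (simp add: lineint_const distrib_right)
  finally show ?case
    using step.IH lineint_add[OF li, of "of_int j * \<delta>" "of_int l * \<delta>" "of_int (l + 1) * \<delta>"] by simp
qed simp

text \<open>Cauchy-Schwarz for the mean, then \<open>1 \<le> \<delta> / x\<close> on the interval.
  The powers of \<open>\<delta>\<close> cancel, in accordance with the scale invariance of the
  norm.\<close>

lemma mean_sq_le:
  assumes f: "loc_int f" and d: "\<delta> > 0"
  shows "ennreal ((lineint f 0 \<delta> / \<delta>)\<^sup>2) \<le> (\<integral>\<^sup>+ x\<in>{0..\<delta>}. ennreal ((f x)\<^sup>2 / x) \<partial>lborel)"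
proof -
  have [measurable]: "f \<in> borel_measurable borel" using f by (rule loc_int_measurable)
  have "ennreal ((lineint f 0 \<delta>)\<^sup>2) \<le> ennreal \<delta> * (\<integral>\<^sup>+ x\<in>{0..\<delta>}. ennreal ((f x)\<^sup>2) \<partial>lborel)"
    using lineint_sq_le[of f 0 \<delta>] d by simp
  also have "(\<integral>\<^sup>+ x\<in>{0..\<delta>}. ennreal ((f x)\<^sup>2) \<partial>lborel) \<le> (\<integral>\<^sup>+ x. ennreal \<delta> * (ennreal ((f x)\<^sup>2 / x) * indicator {0..\<delta>} x) \<partial>lborel)"
  proof (rule nn_integral_mono_AE, use AE_lborel_singleton[of 0] in eventually_elim)
    case (elim x)
    show ?case
    proof (cases "x \<in> {0..\<delta>}")
      case True
      with elim have x: "0 < x" "x \<le> \<delta>" by auto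
      have "x * (f x)\<^sup>2 \<le> \<delta> * (f x)\<^sup>2" using x by (intro mult_right_mono) auto
      then have "(f x)\<^sup>2 \<le> \<delta> * ((f x)\<^sup>2 / x)" using x by (simp add: field_simps)
      then show ?thesis using True d x by (simp add: ennreal_mult[symmetric] ennreal_leI)
    qed simp
  qed
  also have "\<dots> = ennreal \<delta> * (\<integral>\<^sup>+ x\<in>{0..\<delta>}. ennreal ((f x)\<^sup>2 / x) \<partial>lborel)"
    by (rule nn_integral_cmult) measurable
  finally have "ennreal ((lineint f 0 \<delta>)\<^sup>2) \<le> ennreal (\<delta>\<^sup>2) * (\<integral>\<^sup>+ x\<in>{0..\<delta>}. ennreal ((f x)\<^sup>2 / x) \<partial>lborel)"
    using d by (simp add: mult_left_mono power2_eq_square ennreal_mult mult.assoc)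
  from ennreal_divide_le[OF this] d show ?thesis by (simp add: power_divide)
qed

lemma lineint_shift:
  assumes [measurable]: "g \<in> borel_measurable borel"
  shows "lineint (\<lambda>x. g (c + x)) a b = lineint g (c + a) (c + b)"
proof -
  have "lineint g (c + a) (c + b) = (\<integral>s. orient (c + a) (c + b) (c + s) * g (c + s) \<partial>lborel)"
    unfolding lineint_def by (subst lborel_integral_real_affine[where c=1 and t=c]) auto
  moreover have "orient (c + a) (c + b) (c + s) = orient a b s" for s by (simp add: orient_def)
  ultimately show ?thesis by (simp add: lineint_def)
qed

lemma lineint_reflect:
  assumes [measurable]: "g \<in> borel_measurable borel"
  shows "lineint (\<lambda>x. g (c - x)) a b = lineint g (c - b) (c - a)"
  using lineint_uminus[of "\<lambda>x. g (c + x)" a b] lineint_shift[OF assms, of c "- b" "- a"] by simp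

lemma loc_int_shift: assumes "loc_int g" shows "loc_int (\<lambda>x. g (c + x))"
  unfolding loc_int_def set_integrable_def
proof (intro conjI allI)
  have [measurable]: "g \<in> borel_measurable borel" using assms by (rule loc_int_measurable)
  show "(\<lambda>x. g (c + x)) \<in> borel_measurable borel" by measurable
  fix a b
  have "integrable lborel (\<lambda>x. indicat_real {c + a..c + b} (c + 1 * x) *\<^sub>R g (c + 1 * x))"
    by (rule lborel_integrable_real_affine) (use loc_intD[OF assms] in \<open>simp_all add: set_integrable_def\<close>)
  moreover have "indicat_real {c + a..c + b} (c + x) = indicator {a..b} x" for x by (auto simp: indicator_def)
  ultimately show "integrable lborel (\<lambda>x. indicat_real {a..b} x *\<^sub>R g (c + x))" by simp
qed

lemma loc_int_reflect: "loc_int g \<Longrightarrow> loc_int (\<lambda>x. g (c - x))"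
  using loc_int_uminus[OF loc_int_shift[of g c]] by simp

lemma lineint_minus:
  assumes "loc_int f" "loc_int g"
  shows "lineint (\<lambda>x. f x - g x) a b = lineint f a b - lineint g a b"
  using loc_int_orient[OF assms(1)] loc_int_orient[OF assms(2)] by (simp add: lineint_def right_diff_distrib)

text \<open>Together with the next lemma this compares means over edges meeting at a vertex: the
  cross term links the edge to the right with the edge above, and the straight term links the edges
  on both sides.\<close>

lemma cross_mean_le:
  assumes p: "loc_int p" and q: "loc_int q" and d: "\<delta> > 0"
  shows "ennreal ((lineint p a (a + \<delta>) / \<delta> - lineint q b (b + \<delta>) / \<delta>)\<^sup>2) \<le> cross \<delta> p q a b"
proof -
  note [measurable] = loc_int_measurable[OF p] loc_int_measurable[OF q]
  have "lineint (\<lambda>x. p (a + x) - q (b + x)) 0 \<delta> = lineint p a (a + \<delta>) - lineint q b (b + \<delta>)"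
    by (subst lineint_minus) (auto intro!: loc_int_shift p q simp: lineint_shift)
  then have "ennreal ((lineint p a (a + \<delta>) / \<delta> - lineint q b (b + \<delta>) / \<delta>)\<^sup>2) \<le> (\<integral>\<^sup>+ x\<in>{0..\<delta>}. ennreal ((p (a + x) - q (b + x))\<^sup>2 / x) \<partial>lborel)"
    using mean_sq_le[OF loc_int_diff[OF loc_int_shift[OF p] loc_int_shift[OF q]] d, of a b] by (simp add: diff_divide_distrib)
  also have "\<dots> \<le> cross \<delta> p q a b"
    unfolding cross_def by (rule nn_integral_mono) (auto simp: indicator_def)
  finally show ?thesis .
qed

lemma straight_mean_le:
  assumes p: "loc_int p" and d: "\<delta> > 0"
  shows "ennreal ((lineint p a (a + \<delta>) / \<delta> - lineint p (a - \<delta>) a / \<delta>)\<^sup>2) \<le> straight \<delta> p a"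
proof -
  note [measurable] = loc_int_measurable[OF p]
  have "lineint (\<lambda>x. p (a + x) - p (a - x)) 0 \<delta> = lineint p a (a + \<delta>) - lineint p (a - \<delta>) a"
    by (subst lineint_minus) (auto intro!: loc_int_shift loc_int_reflect p simp: lineint_shift lineint_reflect)
  then show ?thesis
    using mean_sq_le[OF loc_int_diff[OF loc_int_shift[OF p] loc_int_reflect[OF p]] d, of a a] by (simp add: diff_divide_distrib straight_def)
qed

lemma lineint_abs:
  assumes "loc_int f" "a \<le> b"
  shows "\<bar>lineint f a b\<bar> \<le> lineint (\<lambda>x. \<bar>f x\<bar>) a b"
proof -
  have "\<bar>lineint f a b\<bar> \<le> (\<integral>x. \<bar>orient a b x * f x\<bar> \<partial>lborel)" unfolding lineint_def by (rule integral_abs_bound)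
  also have "\<dots> = lineint (\<lambda>x. \<bar>f x\<bar>) a b"
    unfolding lineint_def using assms(2) by (intro Bochner_Integration.integral_cong) (auto simp: orient_def)
  finally show ?thesis .
qed

lemma lineint_mono_interval:
  assumes "loc_int f" "\<And>x. 0 \<le> f x" "a \<le> b" "b \<le> c" "c \<le> d"
  shows "lineint f b c \<le> lineint f a d"
  using lineint_add[OF assms(1), of a b d] lineint_add[OF assms(1), of b c d]
    lineint_nonneg[of a b f] lineint_nonneg[of c d f] assms by simp

text \<open>At a Lebesgue point the averages over the grid cells containing it converge.\<close>

lemma zero_of_grid_integrals:
  fixes \<delta> :: "nat \<Rightarrow> real"
  assumes q: "loc_int q" and d: "\<And>i. \<delta> i > 0" "\<delta> \<longlonglongrightarrow> 0"
    and z: "\<And>i k. lineint q (of_int k * \<delta> i) (of_int k * \<delta> i + \<delta> i) = 0"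
  shows "AE x in lborel. q x = 0"
  using lebesgue_point[OF q]
proof eventually_elim
  case (elim x)
  have "filterlim \<delta> (at_right 0) sequentially"
    unfolding filterlim_at using d by (auto simp: less_imp_neq[symmetric] intro!: always_eventually)
  from filterlim_compose[OF elim this]
  have "(\<lambda>i. lineint (\<lambda>y. \<bar>q y - q x\<bar>) (x - \<delta> i) (x + \<delta> i) / \<delta> i) \<longlonglongrightarrow> 0" .
  \<comment> \<open>The mean of \<open>q\<close> over the cell containing \<open>x\<close> is 0, so
    \<open>q x\<close> is minus the mean of \<open>q y - q x\<close> there. The cell has length
    \<open>\<delta> i\<close>, hence lies between \<open>x - \<delta> i\<close> and
    \<open>x + \<delta> i\<close>.\<close>
  moreover have "\<bar>q x\<bar> \<le> lineint (\<lambda>y. \<bar>q y - q x\<bar>) (x - \<delta> i) (x + \<delta> i) / \<delta> i" for i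
  proof -
    define k where "k = \<lfloor>x / \<delta> i\<rfloor>"
    define a where "a = of_int k * \<delta> i"
    have "of_int k \<le> x / \<delta> i" "x / \<delta> i < of_int k + 1" unfolding k_def by linarith+
    then have a: "a \<le> x" "x \<le> a + \<delta> i" using d(1)[of i] by (auto simp: a_def field_simps)
    have "lineint (\<lambda>y. q y - q x) a (a + \<delta> i) = lineint q a (a + \<delta> i) - lineint (\<lambda>_. q x) a (a + \<delta> i)"
      by (rule lineint_minus[OF q]) simp
    also have "\<dots> = - (q x * \<delta> i)" using z[of k i] by (simp add: a_def lineint_const)
    finally have "\<bar>q x\<bar> * \<delta> i = \<bar>lineint (\<lambda>y. q y - q x) a (a + \<delta> i)\<bar>" using d(1)[of i] by (simp add: abs_mult)
    also have "\<dots> \<le> lineint (\<lambda>y. \<bar>q y - q x\<bar>) a (a + \<delta> i)"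
      using d(1)[of i] by (intro lineint_abs loc_int_diff q) auto
    also have "\<dots> \<le> lineint (\<lambda>y. \<bar>q y - q x\<bar>) (x - \<delta> i) (x + \<delta> i)"
      using a d(1)[of i] by (intro lineint_mono_interval loc_int_const_diff q) auto
    finally show ?thesis using d(1)[of i] by (simp add: field_simps)
  qed
  ultimately have "\<bar>q x\<bar> \<le> 0" by (intro LIMSEQ_le_const) auto
  then show ?case by simp
qed

section \<open>Cells of a grid\<close>

definition grid_cell :: "real \<Rightarrow> int \<times> int \<Rightarrow> pt set" where
  "grid_cell \<delta> jk = {of_int (fst jk) * \<delta>..<of_int (fst jk) * \<delta> + \<delta>} \<times> {of_int (snd jk) * \<delta>..<of_int (snd jk) * \<delta> + \<delta>}"

lemma grid_cell_sets [measurable]: "grid_cell \<delta> jk \<in> sets borel"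
  unfolding grid_cell_def by (simp add: borel_Times)

lemma emeasure_rect:
  fixes a a' b b' :: real
  assumes "a \<le> a'" "b \<le> b'"
  shows "emeasure lborel ({a..<a'} \<times> {b..<b'}) = ennreal ((a' - a) * (b' - b))"
  unfolding lborel_prod[symmetric] using assms
  by (subst lborel.emeasure_pair_measure_Times) (auto simp: ennreal_mult)

lemma emeasure_grid_cell: "\<delta> > 0 \<Longrightarrow> emeasure lborel (grid_cell \<delta> jk) = ennreal (\<delta>\<^sup>2)"
  unfolding grid_cell_def by (subst emeasure_rect) (auto simp: power2_eq_square)

lemma mem_grid_cell:
  assumes "\<delta> > 0"
  shows "p \<in> grid_cell \<delta> jk \<longleftrightarrow> jk = (\<lfloor>fst p / \<delta>\<rfloor>, \<lfloor>snd p / \<delta>\<rfloor>)"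
proof -
  have "x \<in> {of_int j * \<delta>..<of_int j * \<delta> + \<delta>} \<longleftrightarrow> j = \<lfloor>x / \<delta>\<rfloor>" for x and j :: int
  proof -
    have "x \<in> {of_int j * \<delta>..<of_int j * \<delta> + \<delta>} \<longleftrightarrow> of_int j \<le> x / \<delta> \<and> x / \<delta> < of_int j + 1"
      using assms by (auto simp: field_simps)
    also have "\<dots> \<longleftrightarrow> j = \<lfloor>x / \<delta>\<rfloor>" by linarith
    finally show ?thesis .
  qed
  then show ?thesis unfolding grid_cell_def by (cases jk; cases p) auto
qed

text \<open>Half-open cells partition the plane, so exactly one index contributes at each point and
  no boundaries have to be discarded.\<close>

lemma nn_integral_grid:
  fixes f :: "pt \<Rightarrow> ennreal"
  assumes [measurable]: "f \<in> borel_measurable borel" and d: "\<delta> > 0"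
  shows "(\<integral>\<^sup>+ p. f p \<partial>lborel) = (\<integral>\<^sup>+ jk. (\<integral>\<^sup>+ p\<in>grid_cell \<delta> jk. f p \<partial>lborel) \<partial>count_space UNIV)"
proof -
  have "(\<integral>\<^sup>+ jk. (\<integral>\<^sup>+ p\<in>grid_cell \<delta> jk. f p \<partial>lborel) \<partial>count_space UNIV) = (\<integral>\<^sup>+ p. \<integral>\<^sup>+ jk. f p * indicator (grid_cell \<delta> jk) p \<partial>count_space UNIV \<partial>lborel)"
    by (rule nn_integral_count_space_nn_integral[symmetric]) auto
  also have "\<dots> = (\<integral>\<^sup>+ p. f p \<partial>lborel)"
  proof (rule nn_integral_cong)
    fix p :: pt
    have "(\<integral>\<^sup>+ jk. f p * indicator (grid_cell \<delta> jk) p \<partial>count_space UNIV) = (\<integral>\<^sup>+ jk. f p * indicator {(\<lfloor>fst p / \<delta>\<rfloor>, \<lfloor>snd p / \<delta>\<rfloor>)} jk \<partial>count_space UNIV)"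
      by (rule nn_integral_cong) (simp add: indicator_def mem_grid_cell[OF d])
    also have "\<dots> = f p" by (subst nn_integral_cmult_indicator) auto
    finally show "(\<integral>\<^sup>+ jk. f p * indicator (grid_cell \<delta> jk) p \<partial>count_space UNIV) = f p" .
  qed
  finally show ?thesis by simp
qed

lemma rect_integral:
  fixes g :: "pt \<Rightarrow> real"
  assumes g: "loc_int_pt g" and ab: "a \<le> a'" "b \<le> b'"
  shows "(\<integral>p. indicator ({a..<a'} \<times> {b..<b'}) p * g p \<partial>lborel) = lineint (\<lambda>t. lineint (\<lambda>x. g (x, t)) a a') b b'"
    "integrable lborel (\<lambda>p. indicator ({a..<a'} \<times> {b..<b'}) p * g p)"
proof -
  have [measurable]: "g \<in> borel_measurable borel" using g by (rule loc_int_ptD)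
  have [measurable]: "{a..<a'} \<times> {b..<b'} \<in> sets borel" by (simp add: borel_Times)
  have "integrable lborel (\<lambda>p. g p * indicator ({a..<a'} \<times> {b..<b'}) p)"
    by (rule loc_int_pt_mult[OF g, of _ 1 "(a, b)" "(a', b')"]) (auto simp: indicator_def cbox_Pair_eq)
  then show i: "integrable lborel (\<lambda>p. indicator ({a..<a'} \<times> {b..<b'}) p * g p)" by (simp add: mult.commute)
  have l: "lineint h s t = (\<integral>x. indicator {s..<t} x * h x \<partial>lborel)" if "s \<le> t" "h \<in> borel_measurable borel" for h s t
    unfolding lineint_eq[OF that]
    by (rule integral_cong_AE) (use that AE_lborel_singleton[of t] in \<open>auto simp: indicator_def elim!: eventually_mono\<close>)
  have "(\<integral>p. indicator ({a..<a'} \<times> {b..<b'}) p * g p \<partial>lborel) = (\<integral>t. \<integral>x. indicator {b..<b'} t * (indicator {a..<a'} x * g (x, t)) \<partial>lborel \<partial>lborel)"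
    by (subst integral_pt(1)[OF i]) (auto simp: indicator_times mult_ac)
  also have "\<dots> = (\<integral>t. indicator {b..<b'} t * lineint (\<lambda>x. g (x, t)) a a' \<partial>lborel)"
    using ab by (simp add: l)
  also have "\<dots> = lineint (\<lambda>t. lineint (\<lambda>x. g (x, t)) a a') b b'"
    by (rule l[symmetric, OF ab(2)]) (rule lineint_measurable, measurable)
  finally show "(\<integral>p. indicator ({a..<a'} \<times> {b..<b'}) p * g p \<partial>lborel) = lineint (\<lambda>t. lineint (\<lambda>x. g (x, t)) a a') b b'" .
qed

text \<open>The constant \<open>c\<close> is the mean of \<open>g\<close> over \<open>Q\<close>,
  hence orthogonal to \<open>g - c\<close>. On a cell this is the martingale step: the coarse
  difference quotient is the mean of the finer one.\<close>

lemma variance_decomposition: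
  fixes g :: "'a \<Rightarrow> real"
  assumes [measurable]: "g \<in> borel_measurable M" "Q \<in> sets M" and Q: "emeasure M Q = ennreal \<mu>" "\<mu> \<ge> 0"
    and fin: "(\<integral>\<^sup>+ p\<in>Q. ennreal ((g p)\<^sup>2) \<partial>M) < \<infinity>"
    and i1: "integrable M (\<lambda>p. indicator Q p * g p)" and mean: "(\<integral>p. indicator Q p * g p \<partial>M) = c * \<mu>"
  shows "(\<integral>\<^sup>+ p\<in>Q. ennreal ((g p - c)\<^sup>2) \<partial>M) + (\<integral>\<^sup>+ p\<in>Q. ennreal (c\<^sup>2) \<partial>M) = (\<integral>\<^sup>+ p\<in>Q. ennreal ((g p)\<^sup>2) \<partial>M)"
proof -
  have e: "(\<integral>\<^sup>+ p\<in>Q. ennreal (h p) \<partial>M) = (\<integral>\<^sup>+ p. ennreal (indicator Q p * h p) \<partial>M)" for h :: "'a \<Rightarrow> real"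
    by (rule nn_integral_cong) (auto simp: indicator_def)
  have i2: "integrable M (\<lambda>p. indicator Q p * (g p)\<^sup>2)"
  proof (rule integrableI_bounded)
    have "(\<integral>\<^sup>+ p. ennreal (norm (indicator Q p * (g p)\<^sup>2)) \<partial>M) = (\<integral>\<^sup>+ p\<in>Q. ennreal ((g p)\<^sup>2) \<partial>M)"
      unfolding e by (rule nn_integral_cong) (simp add: abs_mult)
    then show "(\<integral>\<^sup>+ p. ennreal (norm (indicator Q p * (g p)\<^sup>2)) \<partial>M) < \<infinity>" using fin by simp
  qed measurable
  have i0: "integrable M (\<lambda>p. indicator Q p :: real)" using Q by (intro integrable_real_indicator) auto
  have m: "measure M Q = \<mu>" using Q by (simp add: measure_def)
  have f: "(\<lambda>p. indicator Q p * (g p - c)\<^sup>2) = (\<lambda>p. indicator Q p * (g p)\<^sup>2 - 2 * c * (indicator Q p * g p) + c\<^sup>2 * indicator Q p)"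
    by (auto simp: power2_diff algebra_simps)
  have i3: "integrable M (\<lambda>p. indicator Q p * (g p - c)\<^sup>2)"
    unfolding f using i0 i1 i2 by (intro Bochner_Integration.integrable_add Bochner_Integration.integrable_diff integrable_mult_right)
  have v: "(\<integral>p. indicator Q p * (g p - c)\<^sup>2 \<partial>M) = (\<integral>p. indicator Q p * (g p)\<^sup>2 \<partial>M) - c\<^sup>2 * \<mu>"
    unfolding f using i0 i1 i2 by (simp add: mean m power2_eq_square)
  have nn: "0 \<le> (\<integral>p. indicator Q p * (g p)\<^sup>2 \<partial>M) - c\<^sup>2 * \<mu>"
    unfolding v[symmetric] by (rule Bochner_Integration.integral_nonneg) simp
  have "(\<integral>\<^sup>+ p\<in>Q. ennreal ((g p - c)\<^sup>2) \<partial>M) = ennreal ((\<integral>p. indicator Q p * (g p)\<^sup>2 \<partial>M) - c\<^sup>2 * \<mu>)"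
    unfolding e v[symmetric] by (rule nn_integral_eq_integral[OF i3]) simp
  moreover have "(\<integral>\<^sup>+ p\<in>Q. ennreal (c\<^sup>2) \<partial>M) = ennreal (c\<^sup>2 * \<mu>)"
    by (subst nn_integral_cmult_indicator) (auto simp: Q ennreal_mult)
  moreover have "(\<integral>\<^sup>+ p\<in>Q. ennreal ((g p)\<^sup>2) \<partial>M) = ennreal (\<integral>p. indicator Q p * (g p)\<^sup>2 \<partial>M)"
    unfolding e by (rule nn_integral_eq_integral[OF i2]) auto
  ultimately show ?thesis using Q(2) nn by (simp add: ennreal_plus[symmetric] del: ennreal_plus)
qed

lemma vertex_swap: "vertex \<delta> p q a b = vertex \<delta> q p b a"
proof -
  have "cross \<delta> p q a b = cross \<delta> q p b a" unfolding cross_def by (simp add: power2_commute)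
  then show ?thesis by (simp add: vertex_def add_ac)
qed

text \<open>The data on the line \<open>y = b\<close> are \<open>u b\<close>, and those on the line \<open>x = a\<close> are \<open>w a\<close>; consistency is built in, since
  every grid uses the same functions.\<close>

locale grid_data =
  fixes \<delta> :: "nat \<Rightarrow> real" and m :: nat and u w :: "real \<Rightarrow> real \<Rightarrow> real" and M :: real
  assumes m: "m \<ge> 2" and \<delta>_def: "\<And>i. \<delta> i = (1 / real m) ^ i"
    and u: "\<And>b. loc_int (u b)" and w: "\<And>a. loc_int (w a)" and M0: "0 \<le> M"
    and norm_le: "\<And>i. (\<integral>\<^sup>+ jk. vertex (\<delta> i) (u (of_int (snd jk) * \<delta> i)) (w (of_int (fst jk) * \<delta> i))
       (of_int (fst jk) * \<delta> i) (of_int (snd jk) * \<delta> i) \<partial>count_space (UNIV :: (int \<times> int) set)) \<le> ennreal M"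
begin

lemma delta_pos: "\<delta> i > 0" using m by (simp add: \<delta>_def)

lemma delta_lim: "\<delta> \<longlonglongrightarrow> 0"
  unfolding \<delta>_def using m by (intro LIMSEQ_power_zero) simp

lemma delta_refine: "\<delta> i = of_int (int (m ^ n)) * \<delta> (i + n)"
  using m by (simp add: \<delta>_def power_add power_one_over field_simps)

text \<open>Transposing the index pairs; the vertical derivative is then obtained from the results
  on the horizontal one.\<close>

lemma grid_data_swap: "grid_data \<delta> m w u M"
proof
  fix i
  have "(\<integral>\<^sup>+ jk. vertex (\<delta> i) (w (of_int (snd jk) * \<delta> i)) (u (of_int (fst jk) * \<delta> i)) (of_int (fst jk) * \<delta> i) (of_int (snd jk) * \<delta> i) \<partial>count_space (UNIV :: (int \<times> int) set))
    = (\<integral>\<^sup>+ jk. vertex (\<delta> i) (w (of_int (snd (prod.swap jk)) * \<delta> i)) (u (of_int (fst (prod.swap jk)) * \<delta> i)) (of_int (fst (prod.swap jk)) * \<delta> i) (of_int (snd (prod.swap jk)) * \<delta> i) \<partial>count_space UNIV)"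
    by (rule nn_integral_bij_count_space[symmetric]) (auto intro: bij_swap)
  also have "\<dots> \<le> ennreal M"
    using norm_le[of i] by (simp add: vertex_swap)
  finally show "(\<integral>\<^sup>+ jk. vertex (\<delta> i) (w (of_int (snd jk) * \<delta> i)) (u (of_int (fst jk) * \<delta> i)) (of_int (fst jk) * \<delta> i) (of_int (snd jk) * \<delta> i) \<partial>count_space (UNIV :: (int \<times> int) set)) \<le> ennreal M" .
qed (use m \<delta>_def u w M0 in auto)

section \<open>The martingale of difference quotients\<close>

definition vx :: "nat \<Rightarrow> int \<times> int \<Rightarrow> ennreal" where
  "vx i jk = vertex (\<delta> i) (u (of_int (snd jk) * \<delta> i)) (w (of_int (fst jk) * \<delta> i)) (of_int (fst jk) * \<delta> i) (of_int (snd jk) * \<delta> i)"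

definition B :: "nat \<Rightarrow> int \<Rightarrow> int \<Rightarrow> real" where
  "B i j k = lineint (w (of_int j * \<delta> i)) (of_int k * \<delta> i) (of_int k * \<delta> i + \<delta> i) / \<delta> i"

text \<open>The means compared are those of the two vertical sides of a cell, so this approximates
  the horizontal derivative.\<close>

definition diff_quot :: "nat \<Rightarrow> pt \<Rightarrow> real" where
  "diff_quot i p = (B i (\<lfloor>fst p / \<delta> i\<rfloor> + 1) \<lfloor>snd p / \<delta> i\<rfloor> - B i \<lfloor>fst p / \<delta> i\<rfloor> \<lfloor>snd p / \<delta> i\<rfloor>) / \<delta> i"

lemma diff_quot_measurable [measurable]: "diff_quot i \<in> borel_measurable borel"
proof -
  define h where "h j k = (B i (j + 1) k - B i j k) / \<delta> i" for j k
  have "(\<lambda>p::pt. h j \<lfloor>snd p / \<delta> i\<rfloor>) \<in> borel_measurable borel" for j by measurable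
  then have "(\<lambda>p::pt. h \<lfloor>fst p / \<delta> i\<rfloor> \<lfloor>snd p / \<delta> i\<rfloor>) \<in> borel_measurable borel"
    by (rule measurable_compose_countable) measurable
  then show ?thesis by (simp add: diff_quot_def[abs_def] h_def)
qed

text \<open>The two vertical edges do not meet, so the comparison passes through the bottom: from
  the edge above \<open>(j + 1, k)\<close> to the horizontal edge on its right, back to the
  horizontal edge on its left, which starts at \<open>(j, k)\<close>, and up from there. This uses
  the cross and straight terms of one vertex and the cross term of the other.\<close>

lemma dB_le: "ennreal ((B i (j + 1) k - B i j k)\<^sup>2) \<le> 3 * (vx i (j + 1, k) + vx i (j, k))"
proof -
  define b where "b = of_int k * \<delta> i"
  define A where "A j = lineint (u b) (of_int j * \<delta> i) (of_int j * \<delta> i + \<delta> i) / \<delta> i" for j :: int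
  have c: "ennreal ((A j - B i j k)\<^sup>2) \<le> cross (\<delta> i) (u b) (w (of_int j * \<delta> i)) (of_int j * \<delta> i) b" for j
    unfolding A_def B_def b_def by (rule cross_mean_le[OF u w delta_pos])
  have e: "of_int (j + 1) * \<delta> i - \<delta> i = of_int j * \<delta> i" "of_int j * \<delta> i + \<delta> i = of_int (j + 1) * \<delta> i" by (simp_all add: algebra_simps)
  have s: "ennreal ((A (j + 1) - A j)\<^sup>2) \<le> straight (\<delta> i) (u b) (of_int (j + 1) * \<delta> i)"
    using straight_mean_le[OF u delta_pos, of b "of_int (j + 1) * \<delta> i" i] unfolding A_def e by simp
  have "ennreal ((B i (j + 1) k - B i j k)\<^sup>2) \<le> ennreal (3 * ((A (j + 1) - B i (j + 1) k)\<^sup>2 + (A (j + 1) - A j)\<^sup>2 + (A j - B i j k)\<^sup>2))"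
    using sq_add3[of "B i (j + 1) k - A (j + 1)" "A (j + 1) - A j" "A j - B i j k"]
    by (intro ennreal_leI) (simp add: power2_commute[of "B i (j + 1) k"])
  also have "\<dots> = 3 * (ennreal ((A (j + 1) - B i (j + 1) k)\<^sup>2) + ennreal ((A (j + 1) - A j)\<^sup>2) + ennreal ((A j - B i j k)\<^sup>2))"
    by (simp add: ennreal_mult)
  also have "\<dots> \<le> 3 * (cross (\<delta> i) (u b) (w (of_int (j + 1) * \<delta> i)) (of_int (j + 1) * \<delta> i) b + straight (\<delta> i) (u b) (of_int (j + 1) * \<delta> i)
      + cross (\<delta> i) (u b) (w (of_int j * \<delta> i)) (of_int j * \<delta> i) b)"
    by (intro mult_left_mono add_mono c s) auto
  also have "\<dots> \<le> 3 * (vx i (j + 1, k) + vx i (j, k))"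
  proof (intro mult_left_mono add_mono)
    have "x + y \<le> e1 + e2 + x + y + z" "x \<le> e1 + e2 + x + y + z" for x y z e1 e2 :: ennreal
    proof -
      have "x + y + 0 \<le> x + y + (e1 + e2 + z)" by (intro add_left_mono) simp
      then show "x + y \<le> e1 + e2 + x + y + z" by (simp add: add_ac)
      have "x + 0 \<le> x + (e1 + e2 + y + z)" by (intro add_left_mono) simp
      then show "x \<le> e1 + e2 + x + y + z" by (simp add: add_ac)
    qed
    then show "cross (\<delta> i) (u b) (w (of_int (j + 1) * \<delta> i)) (of_int (j + 1) * \<delta> i) b + straight (\<delta> i) (u b) (of_int (j + 1) * \<delta> i) \<le> vx i (j + 1, k)"
      "cross (\<delta> i) (u b) (w (of_int j * \<delta> i)) (of_int j * \<delta> i) b \<le> vx i (j, k)"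
      unfolding vx_def vertex_def b_def fst_conv snd_conv by blast+
  qed auto
  finally show ?thesis .
qed

lemma sum_vx: "(\<integral>\<^sup>+ jk. vx i jk \<partial>count_space UNIV) \<le> ennreal M"
  unfolding vx_def by (rule norm_le)

lemma diff_quot_on_cell: "p \<in> grid_cell (\<delta> i) (j, k) \<Longrightarrow> diff_quot i p = (B i (j + 1) k - B i j k) / \<delta> i"
  unfolding mem_grid_cell[OF delta_pos] by (auto simp: diff_quot_def)

text \<open>The area \<open>\<delta>^2\<close> of a cell cancels the square of the denominator, so
  the bound is the same at all levels. Each vertex is used by two cells, whence 3 * 2.\<close>

lemma diff_quot_L2: "(\<integral>\<^sup>+ p. ennreal ((diff_quot i p)\<^sup>2) \<partial>lborel) \<le> ennreal (6 * M)"
proof -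
  have "(\<integral>\<^sup>+ p. ennreal ((diff_quot i p)\<^sup>2) \<partial>lborel) = (\<integral>\<^sup>+ jk. (\<integral>\<^sup>+ p\<in>grid_cell (\<delta> i) jk. ennreal ((diff_quot i p)\<^sup>2) \<partial>lborel) \<partial>count_space UNIV)"
    by (rule nn_integral_grid[OF _ delta_pos]) measurable
  also have "\<dots> \<le> (\<integral>\<^sup>+ jk. 3 * (vx i (fst jk + 1, snd jk) + vx i jk) \<partial>count_space UNIV)"
  proof (rule nn_integral_mono)
    fix jk :: "int \<times> int"
    obtain j k where jk: "jk = (j, k)" by (cases jk)
    let ?c = "(B i (j + 1) k - B i j k) / \<delta> i"
    have "(\<integral>\<^sup>+ p\<in>grid_cell (\<delta> i) jk. ennreal ((diff_quot i p)\<^sup>2) \<partial>lborel) = (\<integral>\<^sup>+ p\<in>grid_cell (\<delta> i) jk. ennreal (?c\<^sup>2) \<partial>lborel)"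
      by (rule nn_integral_cong) (auto simp: indicator_def jk diff_quot_on_cell)
    also have "\<dots> = ennreal (?c\<^sup>2) * ennreal ((\<delta> i)\<^sup>2)"
      by (subst nn_integral_cmult_indicator) (auto simp: emeasure_grid_cell[OF delta_pos])
    also have "\<dots> = ennreal ((B i (j + 1) k - B i j k)\<^sup>2)"
      using delta_pos[of i] by (subst ennreal_mult[symmetric]) (auto simp: power_divide)
    also have "\<dots> \<le> 3 * (vx i (j + 1, k) + vx i (j, k))" by (rule dB_le)
    finally show "(\<integral>\<^sup>+ p\<in>grid_cell (\<delta> i) jk. ennreal ((diff_quot i p)\<^sup>2) \<partial>lborel) \<le> 3 * (vx i (fst jk + 1, snd jk) + vx i jk)" by (simp add: jk)
  qed
  also have "\<dots> = 3 * ((\<integral>\<^sup>+ jk. vx i (fst jk + 1, snd jk) \<partial>count_space UNIV) + (\<integral>\<^sup>+ jk. vx i jk \<partial>count_space UNIV))"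
    by (simp add: nn_integral_cmult nn_integral_add)
  also have "(\<integral>\<^sup>+ jk. vx i (fst jk + 1, snd jk) \<partial>count_space UNIV) = (\<integral>\<^sup>+ jk. vx i jk \<partial>count_space UNIV)"
  proof (rule nn_integral_bij_count_space)
    show "bij_betw (\<lambda>jk::int \<times> int. (fst jk + 1, snd jk)) UNIV UNIV"
      by (rule bij_betw_byWitness[where f'="\<lambda>jk. (fst jk - 1, snd jk)"]) auto
  qed
  also have "3 * ((\<integral>\<^sup>+ jk. vx i jk \<partial>count_space UNIV) + (\<integral>\<^sup>+ jk. vx i jk \<partial>count_space UNIV)) \<le> 3 * (ennreal M + ennreal M)"
    by (intro mult_left_mono add_mono sum_vx) auto
  also have "\<dots> = ennreal (6 * M)" using M0 by (simp add: ennreal_mult ennreal_plus[symmetric] del: ennreal_plus)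
  finally show ?thesis .
qed

lemma diff_quot_L2_fin: "(\<integral>\<^sup>+ p. ennreal ((diff_quot i p)\<^sup>2) \<partial>lborel) < \<infinity>"
  by (rule le_less_trans[OF diff_quot_L2]) simp

lemma diff_quot_loc_int_pt: "loc_int_pt (diff_quot i)"
  by (rule loc_int_pt_L2'[OF diff_quot_measurable diff_quot_L2_fin])

text \<open>Both integrations telescope: horizontally over the columns of cells, and vertically
  because a mean times the mesh is an increment of the primitive of the data. Only the integrals
  along the two vertical sides survive.\<close>

lemma diff_quot_lineint:
  assumes "j \<le> j'" "k \<le> k'"
  shows "lineint (\<lambda>t. lineint (\<lambda>x. diff_quot i (x, t)) (of_int j * \<delta> i) (of_int j' * \<delta> i)) (of_int k * \<delta> i) (of_int k' * \<delta> i)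
    = lineint (w (of_int j' * \<delta> i)) (of_int k * \<delta> i) (of_int k' * \<delta> i) - lineint (w (of_int j * \<delta> i)) (of_int k * \<delta> i) (of_int k' * \<delta> i)"
proof -
  define \<Psi> where "\<Psi> l = lineint (w (of_int j' * \<delta> i)) 0 (of_int l * \<delta> i) - lineint (w (of_int j * \<delta> i)) 0 (of_int l * \<delta> i)" for l :: int
  have inner: "lineint (\<lambda>x. diff_quot i (x, t)) (of_int j * \<delta> i) (of_int j' * \<delta> i) = (\<Psi> (\<lfloor>t / \<delta> i\<rfloor> + 1) - \<Psi> \<lfloor>t / \<delta> i\<rfloor>) / \<delta> i" for t
  proof -
    define l where "l = \<lfloor>t / \<delta> i\<rfloor>"
    have "lineint (\<lambda>x. diff_quot i (x, t)) (of_int j * \<delta> i) (of_int j' * \<delta> i) = B i j' l - B i j l"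
      using step_lineint[OF delta_pos assms(1), of "\<lambda>j. B i j l" i] by (simp add: diff_quot_def l_def)
    also have "\<dots> = (\<Psi> (l + 1) - \<Psi> l) / \<delta> i"
      using lineint_diff[OF w, of "of_int j' * \<delta> i" 0 "of_int l * \<delta> i + \<delta> i" "of_int l * \<delta> i"]
        lineint_diff[OF w, of "of_int j * \<delta> i" 0 "of_int l * \<delta> i + \<delta> i" "of_int l * \<delta> i"]
      by (simp add: B_def \<Psi>_def distrib_right diff_divide_distrib[symmetric])
    finally show ?thesis by (simp add: l_def)
  qed
  have "lineint (\<lambda>t. lineint (\<lambda>x. diff_quot i (x, t)) (of_int j * \<delta> i) (of_int j' * \<delta> i)) (of_int k * \<delta> i) (of_int k' * \<delta> i) = \<Psi> k' - \<Psi> k"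
    unfolding inner by (rule step_lineint[OF delta_pos assms(2)])
  then show ?thesis
    using lineint_diff[OF w, of "of_int j' * \<delta> i" 0 "of_int k' * \<delta> i" "of_int k * \<delta> i"]
      lineint_diff[OF w, of "of_int j * \<delta> i" 0 "of_int k' * \<delta> i" "of_int k * \<delta> i"] by (simp add: \<Psi>_def)
qed

text \<open>A rectangle of grid \<open>i\<close> is also made of cells of every finer grid
  \<open>i'\<close>, and the data on its sides are the same functions at both levels. The value is
  thus independent of \<open>i'\<close>: this is the martingale property, and the place where
  consistency enters.\<close>

lemma diff_quot_rect:
  assumes "i \<le> i'" "j \<le> j'" "k \<le> k'"
  shows "(\<integral>p. indicator ({of_int j * \<delta> i..<of_int j' * \<delta> i} \<times> {of_int k * \<delta> i..<of_int k' * \<delta> i}) p * diff_quot i' p \<partial>lborel)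
    = lineint (w (of_int j' * \<delta> i)) (of_int k * \<delta> i) (of_int k' * \<delta> i) - lineint (w (of_int j * \<delta> i)) (of_int k * \<delta> i) (of_int k' * \<delta> i)"
proof -
  obtain n where n: "i' = i + n" using assms(1) le_Suc_ex by blast
  define r where "r = int (m ^ n)"
  have r: "of_int l * \<delta> i = of_int (l * r) * \<delta> i'" for l unfolding n r_def by (subst delta_refine[of i n]) simp
  have r0: "r \<ge> 0" by (simp add: r_def)
  have "(\<integral>p. indicator ({of_int j * \<delta> i..<of_int j' * \<delta> i} \<times> {of_int k * \<delta> i..<of_int k' * \<delta> i}) p * diff_quot i' p \<partial>lborel)
    = lineint (\<lambda>t. lineint (\<lambda>x. diff_quot i' (x, t)) (of_int j * \<delta> i) (of_int j' * \<delta> i)) (of_int k * \<delta> i) (of_int k' * \<delta> i)"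
    using assms delta_pos[of i] by (intro rect_integral diff_quot_loc_int_pt) (auto intro!: mult_right_mono)
  also have "\<dots> = lineint (w (of_int j' * \<delta> i)) (of_int k * \<delta> i) (of_int k' * \<delta> i) - lineint (w (of_int j * \<delta> i)) (of_int k * \<delta> i) (of_int k' * \<delta> i)"
    unfolding r by (rule diff_quot_lineint) (use assms r0 in \<open>auto intro: mult_right_mono\<close>)
  finally show ?thesis .
qed

text \<open>On each cell of the coarse grid the coarse quotient is the mean of the fine one; summing
  the variance decomposition over the cells gives Pythagoras in the plane.\<close>

lemma diff_quot_orthogonal:
  assumes "i \<le> i'"
  shows "(\<integral>\<^sup>+ p. ennreal ((diff_quot i' p - diff_quot i p)\<^sup>2) \<partial>lborel) + (\<integral>\<^sup>+ p. ennreal ((diff_quot i p)\<^sup>2) \<partial>lborel) = (\<integral>\<^sup>+ p. ennreal ((diff_quot i' p)\<^sup>2) \<partial>lborel)"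
proof -
  have cell: "(\<integral>\<^sup>+ p\<in>grid_cell (\<delta> i) jk. ennreal ((diff_quot i' p - diff_quot i p)\<^sup>2) \<partial>lborel) + (\<integral>\<^sup>+ p\<in>grid_cell (\<delta> i) jk. ennreal ((diff_quot i p)\<^sup>2) \<partial>lborel)
     = (\<integral>\<^sup>+ p\<in>grid_cell (\<delta> i) jk. ennreal ((diff_quot i' p)\<^sup>2) \<partial>lborel)" for jk
  proof -
    obtain j k where jk: "jk = (j, k)" by (cases jk)
    let ?c = "(B i (j + 1) k - B i j k) / \<delta> i"
    have Q: "grid_cell (\<delta> i) jk = {of_int j * \<delta> i..<of_int (j + 1) * \<delta> i} \<times> {of_int k * \<delta> i..<of_int (k + 1) * \<delta> i}"
      by (simp add: grid_cell_def jk distrib_right)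
    have "(\<integral>\<^sup>+ p\<in>grid_cell (\<delta> i) jk. ennreal ((diff_quot i' p - ?c)\<^sup>2) \<partial>lborel) + (\<integral>\<^sup>+ p\<in>grid_cell (\<delta> i) jk. ennreal (?c\<^sup>2) \<partial>lborel)
       = (\<integral>\<^sup>+ p\<in>grid_cell (\<delta> i) jk. ennreal ((diff_quot i' p)\<^sup>2) \<partial>lborel)"
    proof (rule variance_decomposition[where \<mu>="(\<delta> i)\<^sup>2"])
      show "emeasure lborel (grid_cell (\<delta> i) jk) = ennreal ((\<delta> i)\<^sup>2)" by (rule emeasure_grid_cell[OF delta_pos])
      show "(\<integral>\<^sup>+ p\<in>grid_cell (\<delta> i) jk. ennreal ((diff_quot i' p)\<^sup>2) \<partial>lborel) < \<infinity>"
        by (rule le_less_trans[OF nn_integral_mono diff_quot_L2_fin[of i']]) (auto simp: indicator_def)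
      show "integrable lborel (\<lambda>p. indicator (grid_cell (\<delta> i) jk) p * diff_quot i' p)"
        unfolding Q using delta_pos[of i] by (intro rect_integral(2) diff_quot_loc_int_pt) (auto intro!: mult_right_mono)
      show "(\<integral>p. indicator (grid_cell (\<delta> i) jk) p * diff_quot i' p \<partial>lborel) = ?c * (\<delta> i)\<^sup>2"
      proof -
        have "(x / \<delta> i - y / \<delta> i) / \<delta> i * (\<delta> i)\<^sup>2 = x - y" for x y
          using delta_pos[of i] by (simp add: power2_eq_square diff_divide_distrib[symmetric])
        then show ?thesis unfolding Q by (subst diff_quot_rect[OF assms]) (simp_all add: B_def distrib_right)
      qed
    qed auto
    moreover have "(\<integral>\<^sup>+ p\<in>grid_cell (\<delta> i) jk. ennreal ((diff_quot i' p - ?c)\<^sup>2) \<partial>lborel) = (\<integral>\<^sup>+ p\<in>grid_cell (\<delta> i) jk. ennreal ((diff_quot i' p - diff_quot i p)\<^sup>2) \<partial>lborel)"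
      "(\<integral>\<^sup>+ p\<in>grid_cell (\<delta> i) jk. ennreal (?c\<^sup>2) \<partial>lborel) = (\<integral>\<^sup>+ p\<in>grid_cell (\<delta> i) jk. ennreal ((diff_quot i p)\<^sup>2) \<partial>lborel)"
      by (rule nn_integral_cong; auto simp: indicator_def jk diff_quot_on_cell)+
    ultimately show ?thesis by simp
  qed
  have g: "(\<integral>\<^sup>+ p. ennreal (h p) \<partial>lborel) = (\<integral>\<^sup>+ jk. (\<integral>\<^sup>+ p\<in>grid_cell (\<delta> i) jk. ennreal (h p) \<partial>lborel) \<partial>count_space UNIV)"
    if "h \<in> borel_measurable borel" for h
    using that by (intro nn_integral_grid[OF _ delta_pos]) measurable
  have "(\<integral>\<^sup>+ p. ennreal ((diff_quot i' p - diff_quot i p)\<^sup>2) \<partial>lborel) + (\<integral>\<^sup>+ p. ennreal ((diff_quot i p)\<^sup>2) \<partial>lborel)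
    = (\<integral>\<^sup>+ jk. (\<integral>\<^sup>+ p\<in>grid_cell (\<delta> i) jk. ennreal ((diff_quot i' p - diff_quot i p)\<^sup>2) \<partial>lborel) + (\<integral>\<^sup>+ p\<in>grid_cell (\<delta> i) jk. ennreal ((diff_quot i p)\<^sup>2) \<partial>lborel) \<partial>count_space UNIV)"
    by (subst nn_integral_add) (auto simp: g)
  then show ?thesis unfolding cell by (subst (3) g) auto
qed

text \<open>By orthogonality squared distances are differences of the squared norms
  \<open>E i\<close>, which increase and are bounded; so the sequence is Cauchy with rate
  \<open>L - E n\<close>. Integrals over grid rectangles are eventually constant along the sequence
  and pass to the limit.\<close>

lemma limit_derivative:
  obtains G where "G \<in> borel_measurable borel" "(\<integral>\<^sup>+ p. ennreal ((G p)\<^sup>2) \<partial>lborel) \<le> ennreal (12 * M)"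
    "\<And>i j j' k k'. j \<le> j' \<Longrightarrow> k \<le> k' \<Longrightarrow>
      (\<integral>p. indicator ({of_int j * \<delta> i..<of_int j' * \<delta> i} \<times> {of_int k * \<delta> i..<of_int k' * \<delta> i}) p * G p \<partial>lborel)
      = lineint (w (of_int j' * \<delta> i)) (of_int k * \<delta> i) (of_int k' * \<delta> i) - lineint (w (of_int j * \<delta> i)) (of_int k * \<delta> i) (of_int k' * \<delta> i)"
proof -
  define E where "E i = enn2real (\<integral>\<^sup>+ p. ennreal ((diff_quot i p)\<^sup>2) \<partial>lborel)" for i
  have E: "(\<integral>\<^sup>+ p. ennreal ((diff_quot i p)\<^sup>2) \<partial>lborel) = ennreal (E i)" for i
    unfolding E_def using diff_quot_L2_fin[of i] by (simp add: less_top)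
  have E0: "E i \<ge> 0" for i by (simp add: E_def)
  have EM: "E i \<le> 6 * M" for i using diff_quot_L2[of i] M0 unfolding E by (subst (asm) ennreal_le_iff) auto
  have dE: "(\<integral>\<^sup>+ p. ennreal ((diff_quot i' p - diff_quot i p)\<^sup>2) \<partial>lborel) = ennreal (E i' - E i)" and Emono: "E i \<le> E i'" if "i \<le> i'" for i i'
  proof -
    have "(\<integral>\<^sup>+ p. ennreal ((diff_quot i' p - diff_quot i p)\<^sup>2) \<partial>lborel) + ennreal (E i) = ennreal (E i')" using diff_quot_orthogonal[OF that] unfolding E .
    then obtain y where y: "(\<integral>\<^sup>+ p. ennreal ((diff_quot i' p - diff_quot i p)\<^sup>2) \<partial>lborel) = ennreal y" "y \<ge> 0" "y + E i = E i'"
      using E0[of i] E0[of i'] by (cases "\<integral>\<^sup>+ p. ennreal ((diff_quot i' p - diff_quot i p)\<^sup>2) \<partial>lborel") (auto simp: ennreal_plus[symmetric] simp del: ennreal_plus)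
    then have "y = E i' - E i" by simp
    with y show "(\<integral>\<^sup>+ p. ennreal ((diff_quot i' p - diff_quot i p)\<^sup>2) \<partial>lborel) = ennreal (E i' - E i)" "E i \<le> E i'" by auto
  qed
  have "incseq E" using Emono by (simp add: incseq_def)
  then obtain L where L: "E \<longlonglongrightarrow> L" and EL: "\<And>i. E i \<le> L" using incseq_convergent[of E "6 * M"] EM by metis
  have LM: "L \<le> 6 * M" by (rule LIMSEQ_le_const2[OF L]) (use EM in auto)
  have "(\<lambda>i. L - E i) \<longlonglongrightarrow> L - L" by (intro tendsto_intros L)
  then have eps: "(\<lambda>i. L - E i) \<longlonglongrightarrow> 0" by simp
  obtain G where G0 [measurable]: "G \<in> borel_measurable lborel" and Ge: "\<And>n. (\<integral>\<^sup>+ x. ennreal ((G x - diff_quot n x)\<^sup>2) \<partial>lborel) \<le> ennreal (L - E n)"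
  proof (rule riesz_fischer[of diff_quot lborel "\<lambda>i. L - E i"])
    show "(\<integral>\<^sup>+ x. ennreal ((diff_quot n' x - diff_quot n x)\<^sup>2) \<partial>lborel) \<le> ennreal (L - E n)" if "n \<le> n'" for n n'
      unfolding dE[OF that] using EL by (intro ennreal_leI) simp
  qed (use eps that in auto)
  have [measurable]: "G \<in> borel_measurable borel" using G0 by simp
  \<comment> \<open>Splitting \<open>G\<close> at level 0 gives
    \<open>2 * ((L - E 0) + E 0) = 2 * L\<close>, with \<open>L\<close> at most
    \<open>6 * M\<close>.\<close>
  have "(\<integral>\<^sup>+ p. ennreal ((G p)\<^sup>2) \<partial>lborel) \<le> (\<integral>\<^sup>+ p. 2 * (ennreal ((G p - diff_quot 0 p)\<^sup>2) + ennreal ((diff_quot 0 p)\<^sup>2)) \<partial>lborel)"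
  proof (rule nn_integral_mono)
    fix p
    have "ennreal ((G p)\<^sup>2) \<le> ennreal (2 * ((G p - diff_quot 0 p)\<^sup>2 + (diff_quot 0 p)\<^sup>2))"
      using sq_add2[of "G p - diff_quot 0 p" "diff_quot 0 p"] by (intro ennreal_leI) simp
    then show "ennreal ((G p)\<^sup>2) \<le> 2 * (ennreal ((G p - diff_quot 0 p)\<^sup>2) + ennreal ((diff_quot 0 p)\<^sup>2))" by (simp add: ennreal_mult)
  qed
  also have "\<dots> = 2 * ((\<integral>\<^sup>+ p. ennreal ((G p - diff_quot 0 p)\<^sup>2) \<partial>lborel) + (\<integral>\<^sup>+ p. ennreal ((diff_quot 0 p)\<^sup>2) \<partial>lborel))"
    by (simp add: nn_integral_cmult nn_integral_add)
  also have "\<dots> \<le> 2 * (ennreal (L - E 0) + ennreal (E 0))" unfolding E by (intro mult_left_mono add_mono Ge) auto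
  also have "\<dots> = ennreal (2 * L)" using EL[of 0] E0[of 0] by (simp add: ennreal_mult ennreal_plus[symmetric] del: ennreal_plus)
  also have "\<dots> \<le> ennreal (12 * M)" using LM by (intro ennreal_leI) simp
  finally have GL: "(\<integral>\<^sup>+ p. ennreal ((G p)\<^sup>2) \<partial>lborel) \<le> ennreal (12 * M)" .
  have Gfin: "(\<integral>\<^sup>+ p. ennreal ((G p)\<^sup>2) \<partial>lborel) < \<infinity>" by (rule le_less_trans[OF GL]) simp
  have Gl: "loc_int_pt G" by (rule loc_int_pt_L2'[OF _ Gfin]) measurable
  show ?thesis
  proof (rule that[OF _ GL])
    fix i and j j' k k' :: int assume jk: "j \<le> j'" "k \<le> k'"
    define R where "R = {of_int j * \<delta> i..<of_int j' * \<delta> i} \<times> {of_int k * \<delta> i..<of_int k' * \<delta> i}"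
    have le: "of_int j * \<delta> i \<le> of_int j' * \<delta> i" "of_int k * \<delta> i \<le> of_int k' * \<delta> i"
      using jk delta_pos[of i] by (auto intro!: mult_right_mono)
    have [measurable]: "R \<in> sets borel" unfolding R_def by (simp add: borel_Times)
    define \<mu> where "\<mu> = (of_int j' * \<delta> i - of_int j * \<delta> i) * (of_int k' * \<delta> i - of_int k * \<delta> i)"
    have mu: "emeasure lborel R = ennreal \<mu>" "\<mu> \<ge> 0" unfolding R_def \<mu>_def using le by (auto simp: emeasure_rect)
    define \<Phi> where "\<Phi> = lineint (w (of_int j' * \<delta> i)) (of_int k * \<delta> i) (of_int k' * \<delta> i) - lineint (w (of_int j * \<delta> i)) (of_int k * \<delta> i) (of_int k' * \<delta> i)"
    \<comment> \<open>Cauchy-Schwarz on the rectangle; at every level from \<open>i\<close> on the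
      approximating integral is \<open>\<Phi>\<close>, so the right side can be made arbitrarily
      small.\<close>
    have "((\<integral>p. indicator R p * G p \<partial>lborel) - \<Phi>)\<^sup>2 \<le> \<mu> * (L - E i')" if "i \<le> i'" for i'
    proof -
      have "(\<integral>p. indicator R p * diff_quot i' p \<partial>lborel) = \<Phi>" unfolding R_def \<Phi>_def by (rule diff_quot_rect[OF that jk])
      moreover have "integrable lborel (\<lambda>p. indicator R p * diff_quot i' p)" "integrable lborel (\<lambda>p. indicator R p * G p)"
        unfolding R_def by (intro rect_integral(2) diff_quot_loc_int_pt Gl le)+
      ultimately have e: "(\<integral>p. indicator R p * G p \<partial>lborel) - \<Phi> = (\<integral>p. indicator R p * (G p - diff_quot i' p) \<partial>lborel)"
        by (simp add: right_diff_distrib)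
      have "ennreal (((\<integral>p. indicator R p * G p \<partial>lborel) - \<Phi>)\<^sup>2) \<le> (\<integral>\<^sup>+ p. ennreal \<bar>indicator R p * (G p - diff_quot i' p)\<bar> \<partial>lborel)\<^sup>2"
        unfolding e ennreal_power2 by (intro power_mono ennreal_abs_integral_le) auto
      also have "(\<integral>\<^sup>+ p. ennreal \<bar>indicator R p * (G p - diff_quot i' p)\<bar> \<partial>lborel) = (\<integral>\<^sup>+ p\<in>R. ennreal \<bar>G p - diff_quot i' p\<bar> \<partial>lborel)"
        by (rule nn_integral_cong) (auto simp: indicator_def)
      also have "\<dots>\<^sup>2 \<le> emeasure lborel R * (\<integral>\<^sup>+ p\<in>R. (ennreal \<bar>G p - diff_quot i' p\<bar>)\<^sup>2 \<partial>lborel)"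
        by (rule nn_integral_sq_le) measurable
      also have "\<dots> \<le> ennreal \<mu> * ennreal (L - E i')"
        unfolding mu ennreal_power2[symmetric]
        by (intro mult_left_mono order_trans[OF nn_integral_mono Ge[of i']]) (auto simp: indicator_def)
      finally have "ennreal (((\<integral>p. indicator R p * G p \<partial>lborel) - \<Phi>)\<^sup>2) \<le> ennreal (\<mu> * (L - E i'))"
        using mu EL[of i'] by (simp add: ennreal_mult)
      then show ?thesis using mu EL[of i'] by (subst (asm) ennreal_le_iff) auto
    qed
    moreover have "(\<lambda>i'. \<mu> * (L - E i')) \<longlonglongrightarrow> \<mu> * 0" by (intro tendsto_mult_left eps)
    ultimately have "((\<integral>p. indicator R p * G p \<partial>lborel) - \<Phi>)\<^sup>2 \<le> \<mu> * 0" by (intro LIMSEQ_le_const) auto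
    then have "(\<integral>p. indicator R p * G p \<partial>lborel) = \<Phi>" by simp
    then show "(\<integral>p. indicator ({of_int j * \<delta> i..<of_int j' * \<delta> i} \<times> {of_int k * \<delta> i..<of_int k' * \<delta> i}) p * G p \<partial>lborel)
      = lineint (w (of_int j' * \<delta> i)) (of_int k * \<delta> i) (of_int k' * \<delta> i) - lineint (w (of_int j * \<delta> i)) (of_int k * \<delta> i) (of_int k' * \<delta> i)"
      unfolding R_def \<Phi>_def .
  qed measurable
qed

end

section \<open>Extension of consistent data\<close>

lemma cell_strip_integral:
  fixes h :: "pt \<Rightarrow> ennreal"
  assumes [measurable]: "h \<in> borel_measurable borel" and d: "\<delta> \<ge> 0"
  shows "(\<integral>\<^sup>+ p\<in>{a..<a + \<delta>} \<times> {b..<b + \<delta>}. (\<integral>\<^sup>+ s\<in>{a..<a + \<delta>}. h (s, snd p) \<partial>lborel) \<partial>lborel) = ennreal \<delta> * (\<integral>\<^sup>+ p\<in>{a..<a + \<delta>} \<times> {b..<b + \<delta>}. h p \<partial>lborel)"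
proof -
  have [measurable]: "{a..<a + \<delta>} \<times> {b..<b + \<delta>} \<in> sets borel" by (simp add: borel_Times)
  define K where "K t = (\<integral>\<^sup>+ s\<in>{a..<a + \<delta>}. h (s, t) \<partial>lborel)" for t
  have [measurable]: "K \<in> borel_measurable borel" unfolding K_def by measurable
  have "(\<integral>\<^sup>+ p\<in>{a..<a + \<delta>} \<times> {b..<b + \<delta>}. K (snd p) \<partial>lborel) = (\<integral>\<^sup>+ t. \<integral>\<^sup>+ x. (K t * indicator {b..<b + \<delta>} t) * indicator {a..<a + \<delta>} x \<partial>lborel \<partial>lborel)"
    by (subst nn_integral_pt(2), measurable) (auto intro!: nn_integral_cong simp: indicator_def)
  also have "\<dots> = (\<integral>\<^sup>+ t. (K t * indicator {b..<b + \<delta>} t) * ennreal \<delta> \<partial>lborel)"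
    using d by (subst nn_integral_cmult_indicator) auto
  also have "\<dots> = (\<integral>\<^sup>+ t. K t * indicator {b..<b + \<delta>} t \<partial>lborel) * ennreal \<delta>"
    by (rule nn_integral_multc) measurable
  also have "(\<integral>\<^sup>+ t. K t * indicator {b..<b + \<delta>} t \<partial>lborel) = (\<integral>\<^sup>+ p\<in>{a..<a + \<delta>} \<times> {b..<b + \<delta>}. h p \<partial>lborel)"
    unfolding K_def by (subst nn_integral_pt(2), measurable) (auto intro!: nn_integral_cong simp: indicator_def nn_integral_multc[symmetric])
  finally show ?thesis unfolding K_def by (simp add: mult.commute)
qed

lemma rect_swap_integral:
  fixes h :: "pt \<Rightarrow> ennreal"
  assumes [measurable]: "h \<in> borel_measurable borel"
  shows "(\<integral>\<^sup>+ p\<in>{b..<b'} \<times> {a..<a'}. h (prod.swap p) \<partial>lborel) = (\<integral>\<^sup>+ p\<in>{a..<a'} \<times> {b..<b'}. h p \<partial>lborel)"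
proof -
  have [measurable]: "{a..<a'} \<times> {b..<b'} \<in> sets borel" by (simp add: borel_Times)
  have "(\<integral>\<^sup>+ p. h (prod.swap p) * indicator ({a..<a'} \<times> {b..<b'}) (prod.swap p) \<partial>lborel) = (\<integral>\<^sup>+ p\<in>{a..<a'} \<times> {b..<b'}. h p \<partial>lborel)"
    by (rule nn_integral_swap) measurable
  moreover have "(\<integral>\<^sup>+ p. h (prod.swap p) * indicator ({a..<a'} \<times> {b..<b'}) (prod.swap p) \<partial>lborel) = (\<integral>\<^sup>+ p\<in>{b..<b'} \<times> {a..<a'}. h (prod.swap p) \<partial>lborel)"
    by (rule nn_integral_cong) (auto simp: indicator_def)
  ultimately show ?thesis by simp
qed

lemma cell_integral_le:
  fixes f :: "pt \<Rightarrow> ennreal"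
  assumes [measurable]: "f \<in> borel_measurable borel"
  shows "(\<integral>\<^sup>+ p\<in>{a..<a + \<delta>} \<times> {b..<b + \<delta>}. f p \<partial>lborel) \<le> (\<integral>\<^sup>+ x\<in>{0..\<delta>}. (\<integral>\<^sup>+ y\<in>{0..\<delta>}. f (a + x, b + y) \<partial>lborel) \<partial>lborel)"
proof -
  have [measurable]: "{a..<a + \<delta>} \<times> {b..<b + \<delta>} \<in> sets borel" by (simp add: borel_Times)
  have "(\<integral>\<^sup>+ p\<in>{a..<a + \<delta>} \<times> {b..<b + \<delta>}. f p \<partial>lborel) \<le> (\<integral>\<^sup>+ x. (\<integral>\<^sup>+ y\<in>{b..b + \<delta>}. f (x, y) \<partial>lborel) * indicator {a..a + \<delta>} x \<partial>lborel)"
    by (subst nn_integral_pt(1), measurable) (auto intro!: nn_integral_mono simp: indicator_def)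
  also have "\<dots> = (\<integral>\<^sup>+ x\<in>{0..\<delta>}. (\<integral>\<^sup>+ y\<in>{b..b + \<delta>}. f (a + x, y) \<partial>lborel) \<partial>lborel)"
    by (subst set_nn_integral_shift[where f="\<lambda>x. \<integral>\<^sup>+ y\<in>{b..b + \<delta>}. f (x, y) \<partial>lborel"]) auto
  also have "\<dots> = (\<integral>\<^sup>+ x\<in>{0..\<delta>}. (\<integral>\<^sup>+ y\<in>{0..\<delta>}. f (a + x, b + y) \<partial>lborel) \<partial>lborel)"
  proof (rule nn_integral_cong)
    fix x
    show "(\<integral>\<^sup>+ y\<in>{b..b + \<delta>}. f (a + x, y) \<partial>lborel) * indicator {0..\<delta>} x = (\<integral>\<^sup>+ y\<in>{0..\<delta>}. f (a + x, b + y) \<partial>lborel) * indicator {0..\<delta>} x"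
      by (subst set_nn_integral_shift[where f="\<lambda>y. f (a + x, y)"]) auto
  qed
  finally show ?thesis .
qed

text \<open>Both coordinates of a point of the cell, measured from its corner, are used as positions
  on the same vertical edge. The integral over the cell then has the form of the edge term without
  its denominator, which is at most \<open>\<delta>^2\<close>.\<close>

lemma cell_edge_le:
  assumes [measurable]: "q \<in> borel_measurable borel" and d: "\<delta> \<ge> 0"
  shows "(\<integral>\<^sup>+ p\<in>{a..<a + \<delta>} \<times> {b..<b + \<delta>}. ennreal ((q (snd p) - q (b + (fst p - a)))\<^sup>2) \<partial>lborel) \<le> ennreal (\<delta>\<^sup>2) * edge \<delta> q b"
proof -
  have "(\<integral>\<^sup>+ p\<in>{a..<a + \<delta>} \<times> {b..<b + \<delta>}. ennreal ((q (snd p) - q (b + (fst p - a)))\<^sup>2) \<partial>lborel)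
    \<le> (\<integral>\<^sup>+ x\<in>{0..\<delta>}. (\<integral>\<^sup>+ y\<in>{0..\<delta>}. ennreal ((q (b + y) - q (b + x))\<^sup>2) \<partial>lborel) \<partial>lborel)"
    by (rule order_trans[OF cell_integral_le]) auto
  also have "\<dots> \<le> (\<integral>\<^sup>+ x. ennreal (\<delta>\<^sup>2) * ((\<integral>\<^sup>+ y\<in>{0..\<delta>}. ennreal ((q (b + x) - q (b + y))\<^sup>2 / (x - y)\<^sup>2) \<partial>lborel) * indicator {0..\<delta>} x) \<partial>lborel)"
  proof (rule nn_integral_mono)
    fix x
    have "(\<integral>\<^sup>+ y\<in>{0..\<delta>}. ennreal ((q (b + y) - q (b + x))\<^sup>2) \<partial>lborel) \<le> (\<integral>\<^sup>+ y. ennreal (\<delta>\<^sup>2) * (ennreal ((q (b + x) - q (b + y))\<^sup>2 / (x - y)\<^sup>2) * indicator {0..\<delta>} y) \<partial>lborel)" if x: "x \<in> {0..\<delta>}"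
    proof (rule nn_integral_mono)
      fix y
      show "ennreal ((q (b + y) - q (b + x))\<^sup>2) * indicator {0..\<delta>} y \<le> ennreal (\<delta>\<^sup>2) * (ennreal ((q (b + x) - q (b + y))\<^sup>2 / (x - y)\<^sup>2) * indicator {0..\<delta>} y)"
      proof (cases "y \<in> {0..\<delta>}")
        case True
        have "(q (b + y) - q (b + x))\<^sup>2 \<le> \<delta>\<^sup>2 * ((q (b + x) - q (b + y))\<^sup>2 / (x - y)\<^sup>2)"
        proof (cases "x = y")
          case False
          have "(x - y)\<^sup>2 \<le> \<delta>\<^sup>2" using x True d by (intro power2_le_iff_abs_le[THEN iffD2]) auto
          then have "(q (b + x) - q (b + y))\<^sup>2 * (x - y)\<^sup>2 \<le> \<delta>\<^sup>2 * (q (b + x) - q (b + y))\<^sup>2"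
            by (simp add: mult.commute mult_right_mono)
          then show ?thesis using False by (simp add: field_simps power2_commute[of "q (b + y)"])
        qed simp
        then have "ennreal ((q (b + y) - q (b + x))\<^sup>2) \<le> ennreal (\<delta>\<^sup>2 * ((q (b + x) - q (b + y))\<^sup>2 / (x - y)\<^sup>2))" by (rule ennreal_leI)
        also have "\<dots> = ennreal (\<delta>\<^sup>2) * ennreal ((q (b + x) - q (b + y))\<^sup>2 / (x - y)\<^sup>2)" by (rule ennreal_mult) auto
        finally show ?thesis using True by simp
      qed simp
    qed
    also have "(\<integral>\<^sup>+ y. ennreal (\<delta>\<^sup>2) * (ennreal ((q (b + x) - q (b + y))\<^sup>2 / (x - y)\<^sup>2) * indicator {0..\<delta>} y) \<partial>lborel) = ennreal (\<delta>\<^sup>2) * (\<integral>\<^sup>+ y\<in>{0..\<delta>}. ennreal ((q (b + x) - q (b + y))\<^sup>2 / (x - y)\<^sup>2) \<partial>lborel)"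
      by (rule nn_integral_cmult) measurable
    finally show "(\<integral>\<^sup>+ y\<in>{0..\<delta>}. ennreal ((q (b + y) - q (b + x))\<^sup>2) \<partial>lborel) * indicator {0..\<delta>} x \<le> ennreal (\<delta>\<^sup>2) * ((\<integral>\<^sup>+ y\<in>{0..\<delta>}. ennreal ((q (b + x) - q (b + y))\<^sup>2 / (x - y)\<^sup>2) \<partial>lborel) * indicator {0..\<delta>} x)"
      by (cases "x \<in> {0..\<delta>}") simp_all
  qed
  also have "\<dots> = ennreal (\<delta>\<^sup>2) * edge \<delta> q b"
    unfolding edge_def by (rule nn_integral_cmult) measurable
  finally show ?thesis .
qed

text \<open>Only the first coordinate occurs. The second one contributes a factor
  \<open>\<delta>\<close>, and \<open>x \<le> \<delta>\<close> supplies the other power together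
  with the weight.\<close>

lemma cell_cross_le:
  assumes [measurable]: "p \<in> borel_measurable borel" "q \<in> borel_measurable borel" and d: "\<delta> \<ge> 0"
  shows "(\<integral>\<^sup>+ z\<in>{a..<a + \<delta>} \<times> {b..<b + \<delta>}. ennreal ((q (b + (fst z - a)) - p (fst z))\<^sup>2) \<partial>lborel) \<le> ennreal (\<delta>\<^sup>2) * cross \<delta> p q a b"
proof -
  have "(\<integral>\<^sup>+ z\<in>{a..<a + \<delta>} \<times> {b..<b + \<delta>}. ennreal ((q (b + (fst z - a)) - p (fst z))\<^sup>2) \<partial>lborel)
    \<le> (\<integral>\<^sup>+ x\<in>{0..\<delta>}. (\<integral>\<^sup>+ y\<in>{0..\<delta>}. ennreal ((q (b + x) - p (a + x))\<^sup>2) \<partial>lborel) \<partial>lborel)"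
    by (rule order_trans[OF cell_integral_le]) auto
  also have "\<dots> \<le> (\<integral>\<^sup>+ x. ennreal (\<delta>\<^sup>2) * (ennreal ((p (a + x) - q (b + x))\<^sup>2 / \<bar>x\<bar>) * indicator {-\<delta>..\<delta>} x) \<partial>lborel)"
  proof (rule nn_integral_mono_AE, use AE_lborel_singleton[of 0] in eventually_elim)
    case (elim x)
    show ?case
    proof (cases "x \<in> {0..\<delta>}")
      case True
      with elim have x: "0 < x" "x \<le> \<delta>" by auto
      have "(\<integral>\<^sup>+ y\<in>{0..\<delta>}. ennreal ((q (b + x) - p (a + x))\<^sup>2) \<partial>lborel) = ennreal ((q (b + x) - p (a + x))\<^sup>2) * ennreal \<delta>"
        using d by (subst nn_integral_cmult_indicator) auto
      also have "\<dots> = ennreal (\<delta> * (q (b + x) - p (a + x))\<^sup>2)" using d by (simp add: ennreal_mult mult.commute)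
      also have "\<dots> \<le> ennreal (\<delta>\<^sup>2 * ((p (a + x) - q (b + x))\<^sup>2 / \<bar>x\<bar>))"
      proof (rule ennreal_leI)
        have "\<delta> * (p (a + x) - q (b + x))\<^sup>2 * x \<le> \<delta> * (p (a + x) - q (b + x))\<^sup>2 * \<delta>" using x d by (intro mult_left_mono) auto
        then show "\<delta> * (q (b + x) - p (a + x))\<^sup>2 \<le> \<delta>\<^sup>2 * ((p (a + x) - q (b + x))\<^sup>2 / \<bar>x\<bar>)"
          using x by (simp add: field_simps power2_eq_square[of \<delta>] power2_commute[of "q (b + x)"])
      qed
      also have "\<dots> = ennreal (\<delta>\<^sup>2) * ennreal ((p (a + x) - q (b + x))\<^sup>2 / \<bar>x\<bar>)" by (rule ennreal_mult) auto
      finally show ?thesis using True by simp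
    qed simp
  qed
  also have "\<dots> = ennreal (\<delta>\<^sup>2) * cross \<delta> p q a b"
    unfolding cross_def by (rule nn_integral_cmult) measurable
  finally show ?thesis .
qed

lemma sq_add4: "((a::real) + b + c + d)\<^sup>2 \<le> 4 * (a\<^sup>2 + b\<^sup>2 + c\<^sup>2 + d\<^sup>2)"
  using sq_add2[of "a + b" "c + d"] sq_add2[of a b] sq_add2[of c d] by (simp add: add.assoc)

lemma loc_int_pt_snd:
  assumes c: "loc_int c"
  shows "loc_int_pt (\<lambda>p. c (snd p))"
  unfolding loc_int_pt_def set_integrable_def
proof (intro conjI allI integrableI_bounded)
  have [measurable]: "c \<in> borel_measurable borel" using c by (rule loc_int_measurable)
  show "(\<lambda>p::pt. c (snd p)) \<in> borel_measurable borel" by measurable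
  fix A B :: pt
  obtain a b a' b' where AB: "A = (a, b)" "B = (a', b')" by (cases A; cases B)
  show "(\<lambda>p. indicat_real (cbox A B) p *\<^sub>R c (snd p)) \<in> borel_measurable lborel" by measurable
  have "(\<integral>\<^sup>+ p. ennreal (norm (indicat_real (cbox A B) p *\<^sub>R c (snd p))) \<partial>lborel) = (\<integral>\<^sup>+ t. \<integral>\<^sup>+ x. (ennreal \<bar>c t\<bar> * indicator {b..b'} t) * indicator {a..a'} x \<partial>lborel \<partial>lborel)"
    by (subst nn_integral_pt(2), measurable) (auto intro!: nn_integral_cong simp: indicator_def AB cbox_Pair_eq)
  also have "\<dots> = (\<integral>\<^sup>+ t. (ennreal \<bar>c t\<bar> * indicator {b..b'} t) * emeasure lborel {a..a'} \<partial>lborel)"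
    by (subst nn_integral_cmult_indicator) auto
  also have "\<dots> = (\<integral>\<^sup>+ t\<in>{b..b'}. ennreal \<bar>c t\<bar> \<partial>lborel) * emeasure lborel {a..a'}"
    by (rule nn_integral_multc) measurable
  also have "\<dots> < \<infinity>"
  proof -
    have "(\<integral>\<^sup>+ t\<in>{b..b'}. ennreal \<bar>c t\<bar> \<partial>lborel) = (\<integral>\<^sup>+ t. ennreal (norm (indicat_real {b..b'} t *\<^sub>R c t)) \<partial>lborel)"
      by (rule nn_integral_cong) (auto simp: indicator_def)
    also have "\<dots> < \<infinity>" using loc_intD[OF c, of b b'] unfolding set_integrable_def integrable_iff_bounded by blast
    finally show ?thesis by (simp add: ennreal_mult_less_top emeasure_lborel_Icc_eq)
  qed
  finally show "(\<integral>\<^sup>+ p. ennreal (norm (indicat_real (cbox A B) p *\<^sub>R c (snd p))) \<partial>lborel) < \<infinity>" .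
qed

lemma loc_int_lineint_param:
  fixes g :: "pt \<Rightarrow> real"
  assumes [measurable]: "g \<in> borel_measurable borel"
    and fin: "(\<integral>\<^sup>+ p. ennreal ((g p)\<^sup>2) \<partial>lborel) < \<infinity>"
  shows "loc_int (\<lambda>t. lineint (\<lambda>s. g (s, t)) a b)"
proof (rule loc_int_L2)
  show m: "(\<lambda>t. lineint (\<lambda>s. g (s, t)) a b) \<in> borel_measurable borel" by (rule lineint_measurable) measurable
  fix c e
  have "(\<integral>\<^sup>+ t\<in>{c..e}. ennreal ((lineint (\<lambda>s. g (s, t)) a b)\<^sup>2) \<partial>lborel) \<le> (\<integral>\<^sup>+ t. ennreal \<bar>b - a\<bar> * (\<integral>\<^sup>+ s. ennreal ((g (s, t))\<^sup>2) \<partial>lborel) \<partial>lborel)"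
  proof (rule nn_integral_mono)
    fix t
    have "ennreal ((lineint (\<lambda>s. g (s, t)) a b)\<^sup>2) \<le> ennreal \<bar>b - a\<bar> * (\<integral>\<^sup>+ s\<in>{min a b..max a b}. ennreal ((g (s, t))\<^sup>2) \<partial>lborel)"
      by (rule lineint_sq_le) measurable
    also have "\<dots> \<le> ennreal \<bar>b - a\<bar> * (\<integral>\<^sup>+ s. ennreal ((g (s, t))\<^sup>2) \<partial>lborel)"
      by (intro mult_left_mono nn_integral_mono) (auto simp: indicator_def)
    finally show "ennreal ((lineint (\<lambda>s. g (s, t)) a b)\<^sup>2) * indicator {c..e} t \<le> ennreal \<bar>b - a\<bar> * (\<integral>\<^sup>+ s. ennreal ((g (s, t))\<^sup>2) \<partial>lborel)"
      by (auto simp: indicator_def)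
  qed
  also have "\<dots> = ennreal \<bar>b - a\<bar> * (\<integral>\<^sup>+ p. ennreal ((g p)\<^sup>2) \<partial>lborel)"
    by (subst nn_integral_cmult) (auto simp: nn_integral_pt(2))
  also have "\<dots> < \<infinity>" using fin by (simp add: ennreal_mult_less_top)
  finally show "(\<integral>\<^sup>+ t\<in>{c..e}. ennreal ((lineint (\<lambda>s. g (s, t)) a b)\<^sup>2) \<partial>lborel) < \<infinity>" .
qed

section \<open>From rectangle integrals to the extension\<close>

context grid_data
begin

text \<open>For two fixed vertical lines, the rectangle formula says that the difference of the data
  and the horizontal integral of \<open>G\<close> have equal integrals over all fine grid intervals.
  Such intervals determine a locally integrable function almost everywhere.\<close>

lemma line_values:
  obtains G where "G \<in> borel_measurable borel" "\<And>t. loc_int (\<lambda>s. G (s, t))"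
    "(\<integral>\<^sup>+ p. ennreal ((G p)\<^sup>2) \<partial>lborel) \<le> ennreal (12 * M)"
    "\<And>i (j::int). AE t in lborel. w (of_int j * \<delta> i) t = w 0 t + lineint (\<lambda>s. G (s, t)) 0 (of_int j * \<delta> i)"
proof -
  obtain G0 where G0: "G0 \<in> borel_measurable borel" "(\<integral>\<^sup>+ p. ennreal ((G0 p)\<^sup>2) \<partial>lborel) \<le> ennreal (12 * M)"
    and R0: "\<And>i j j' k k'. j \<le> j' \<Longrightarrow> k \<le> k' \<Longrightarrow>
      (\<integral>p. indicator ({of_int j * \<delta> i..<of_int j' * \<delta> i} \<times> {of_int k * \<delta> i..<of_int k' * \<delta> i}) p * G0 p \<partial>lborel)
      = lineint (w (of_int j' * \<delta> i)) (of_int k * \<delta> i) (of_int k' * \<delta> i) - lineint (w (of_int j * \<delta> i)) (of_int k * \<delta> i) (of_int k' * \<delta> i)"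
    by (rule limit_derivative) (rule that, assumption+)
  have fin0: "(\<integral>\<^sup>+ p. ennreal ((G0 p)\<^sup>2) \<partial>lborel) < \<infinity>" by (rule le_less_trans[OF G0(2)]) simp
  obtain G where G [measurable]: "G \<in> borel_measurable borel" and ae: "AE p in lborel. G p = G0 p"
    and Gl: "\<And>t. loc_int (\<lambda>s. G (s, t))" and fin: "(\<integral>\<^sup>+ p. ennreal ((G p)\<^sup>2) \<partial>lborel) < \<infinity>"
    by (rule truncate_L2[OF G0(1) fin0]) (rule that, assumption+)
  note [measurable] = G0(1)
  have GM: "(\<integral>\<^sup>+ p. ennreal ((G p)\<^sup>2) \<partial>lborel) \<le> ennreal (12 * M)"
    by (rule order_trans[OF eq_refl[OF nn_integral_cong_AE] G0(2)]) (use ae in auto)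
  have Glp: "loc_int_pt G" by (rule loc_int_pt_L2'[OF G fin])
  have R: "lineint (\<lambda>t. lineint (\<lambda>x. G (x, t)) (of_int j * \<delta> i) (of_int j' * \<delta> i)) (of_int k * \<delta> i) (of_int k' * \<delta> i)
      = lineint (w (of_int j' * \<delta> i)) (of_int k * \<delta> i) (of_int k' * \<delta> i) - lineint (w (of_int j * \<delta> i)) (of_int k * \<delta> i) (of_int k' * \<delta> i)"
    if "j \<le> j'" "k \<le> k'" for i and j j' k k' :: int
  proof -
    have [measurable]: "{of_int j * \<delta> i..<of_int j' * \<delta> i} \<times> {of_int k * \<delta> i..<of_int k' * \<delta> i} \<in> sets borel" by (simp add: borel_Times)
    have "lineint (\<lambda>t. lineint (\<lambda>x. G (x, t)) (of_int j * \<delta> i) (of_int j' * \<delta> i)) (of_int k * \<delta> i) (of_int k' * \<delta> i)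
      = (\<integral>p. indicator ({of_int j * \<delta> i..<of_int j' * \<delta> i} \<times> {of_int k * \<delta> i..<of_int k' * \<delta> i}) p * G p \<partial>lborel)"
      using that delta_pos[of i] by (intro rect_integral(1)[symmetric] Glp) (auto intro!: mult_right_mono)
    also have "\<dots> = (\<integral>p. indicator ({of_int j * \<delta> i..<of_int j' * \<delta> i} \<times> {of_int k * \<delta> i..<of_int k' * \<delta> i}) p * G0 p \<partial>lborel)"
      by (rule integral_cong_AE) (use ae in auto)
    finally show ?thesis using R0[OF that] by simp
  qed
  have diff: "AE t in lborel. w (of_int j' * \<delta> i) t - w (of_int j * \<delta> i) t = lineint (\<lambda>s. G (s, t)) (of_int j * \<delta> i) (of_int j' * \<delta> i)"
    if jj: "j \<le> j'" for i and j j' :: int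
  proof -
    define W where "W t = w (of_int j' * \<delta> i) t - w (of_int j * \<delta> i) t" for t
    define Z where "Z t = lineint (\<lambda>s. G (s, t)) (of_int j * \<delta> i) (of_int j' * \<delta> i)" for t
    have lW: "loc_int W" unfolding W_def by (intro loc_int_diff w)
    have lZ: "loc_int Z" unfolding Z_def by (rule loc_int_lineint_param[OF G fin])
    have "AE t in lborel. W t - Z t = 0"
    \<comment> \<open>The levels start at \<open>i\<close>, so that both vertical lines belong to
      all the grids used while the heights are refined.\<close>
    proof (rule zero_of_grid_integrals[of _ "\<lambda>n. \<delta> (i + n)"])
      show "loc_int (\<lambda>t. W t - Z t)" by (rule loc_int_diff[OF lW lZ])
      show "\<delta> (i + n) > 0" for n by (rule delta_pos)
      show "(\<lambda>n. \<delta> (i + n)) \<longlonglongrightarrow> 0" using LIMSEQ_ignore_initial_segment[OF delta_lim, of i] by (simp add: add.commute)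
      fix n and k :: int
      define r where "r = int (m ^ n)"
      have r0: "r \<ge> 0" by (simp add: r_def)
      have r: "of_int l * \<delta> i = of_int (l * r) * \<delta> (i + n)" for l :: int unfolding r_def by (subst delta_refine[of i n]) simp
      have k1: "of_int k * \<delta> (i + n) + \<delta> (i + n) = of_int (k + 1) * \<delta> (i + n)" by (simp add: distrib_right)
      have "lineint Z (of_int k * \<delta> (i + n)) (of_int (k + 1) * \<delta> (i + n))
        = lineint (w (of_int j' * \<delta> i)) (of_int k * \<delta> (i + n)) (of_int (k + 1) * \<delta> (i + n)) - lineint (w (of_int j * \<delta> i)) (of_int k * \<delta> (i + n)) (of_int (k + 1) * \<delta> (i + n))"
        unfolding Z_def r by (rule R) (use jj r0 in \<open>auto intro: mult_right_mono\<close>)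
      also have "\<dots> = lineint W (of_int k * \<delta> (i + n)) (of_int (k + 1) * \<delta> (i + n))"
        unfolding W_def by (rule lineint_minus[OF w w, symmetric])
      finally show "lineint (\<lambda>t. W t - Z t) (of_int k * \<delta> (i + n)) (of_int k * \<delta> (i + n) + \<delta> (i + n)) = 0"
        unfolding k1 lineint_minus[OF lW lZ] by simp
    qed
    then show ?thesis unfolding W_def Z_def by simp
  qed
  \<comment> \<open>The line \<open>x = 0\<close> belongs to every grid and can serve as common
    base; negative \<open>j\<close> reverse the orientation.\<close>
  have "AE t in lborel. w (of_int j * \<delta> i) t = w 0 t + lineint (\<lambda>s. G (s, t)) 0 (of_int j * \<delta> i)" for i and j :: int
  proof (cases "0 \<le> j")
    case True
    from diff[OF this, of i] show ?thesis by (auto elim!: eventually_mono)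
  next
    case False
    then have "j \<le> 0" by simp
    from diff[OF this, of i] show ?thesis
    proof eventually_elim
      case (elim t)
      then show ?case using lineint_swap[of "\<lambda>s. G (s, t)" 0 "of_int j * \<delta> i"] by simp
    qed
  qed
  then show ?thesis by (rule that[OF G Gl GM])
qed

text \<open>The two candidates obtained by integrating horizontally and vertically from the axes agree:
  on a cell of side \<open>\<delta>\<close> each differs from the data on the adjacent edges by \<open>O(\<delta>)\<close> in mean square.\<close>

lemma extensions_agree:
  assumes [measurable]: "G \<in> borel_measurable borel" "K \<in> borel_measurable borel"
    and Gl: "\<And>t. loc_int (\<lambda>s. G (s, t))" and Kl: "\<And>t. loc_int (\<lambda>s. K (s, t))"
    and GM: "(\<integral>\<^sup>+ p. ennreal ((G p)\<^sup>2) \<partial>lborel) \<le> ennreal (12 * M)" and KM: "(\<integral>\<^sup>+ p. ennreal ((K p)\<^sup>2) \<partial>lborel) \<le> ennreal (12 * M)"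
    and wv: "\<And>i (j::int). AE t in lborel. w (of_int j * \<delta> i) t = w 0 t + lineint (\<lambda>s. G (s, t)) 0 (of_int j * \<delta> i)"
    and uv: "\<And>i (j::int). AE x in lborel. u (of_int j * \<delta> i) x = u 0 x + lineint (\<lambda>s. K (s, x)) 0 (of_int j * \<delta> i)"
  shows "AE p in lborel. w 0 (snd p) + lineint (\<lambda>s. G (s, snd p)) 0 (fst p) = u 0 (fst p) + lineint (\<lambda>s. K (s, fst p)) 0 (snd p)"
proof -
  note [measurable] = loc_int_measurable[OF u] loc_int_measurable[OF w]
  define K' where "K' p = K (prod.swap p)" for p :: pt
  have [measurable]: "K' \<in> borel_measurable borel" unfolding K'_def by measurable
  define F where "F p = w 0 (snd p) + lineint (\<lambda>s. G (s, snd p)) 0 (fst p)" for p :: pt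
  define F' where "F' p = u 0 (fst p) + lineint (\<lambda>s. K' (fst p, s)) 0 (snd p)" for p :: pt
  have [measurable]: "F \<in> borel_measurable borel" "F' \<in> borel_measurable borel" unfolding F_def F'_def by measurable
  have K'M: "(\<integral>\<^sup>+ p. ennreal ((K' p)\<^sup>2) \<partial>lborel) \<le> ennreal (12 * M)"
    using KM nn_integral_swap[of "\<lambda>p. ennreal ((K p)\<^sup>2)"] by (simp add: K'_def)
  \<comment> \<open>The factor 25 is 12 for each derivative and 1 for the data themselves. The left
    side does not depend on \<open>i\<close>, so letting the mesh tend to 0 makes it vanish.\<close>
  have level: "(\<integral>\<^sup>+ p. ennreal ((F p - F' p)\<^sup>2) \<partial>lborel) \<le> ennreal (4 * (\<delta> i)\<^sup>2 * (25 * M))" for i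
  proof -
    define \<eta> where "\<eta> = \<delta> i"
    have eta: "\<eta> > 0" using delta_pos by (simp add: \<eta>_def)
    \<comment> \<open>All indices at once outside one null set, so that afterwards the index can be
      chosen according to the cell.\<close>
    have aeF: "AE p in lborel. \<forall>j::int. F p = w (of_int j * \<eta>) (snd p) + lineint (\<lambda>s. G (s, snd p)) (of_int j * \<eta>) (fst p)"
    proof -
      have "AE t in lborel. \<forall>j::int. w (of_int j * \<eta>) t = w 0 t + lineint (\<lambda>s. G (s, t)) 0 (of_int j * \<eta>)"
        unfolding \<eta>_def AE_all_countable using wv by blast
      then have "AE p in (lborel :: pt measure). \<forall>j::int. w (of_int j * \<eta>) (snd p) = w 0 (snd p) + lineint (\<lambda>s. G (s, snd p)) 0 (of_int j * \<eta>)"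
        by (intro AE_swap_pt_I) auto
      then show ?thesis
      proof eventually_elim
        case (elim p)
        show ?case
        proof
          fix j :: int
          show "F p = w (of_int j * \<eta>) (snd p) + lineint (\<lambda>s. G (s, snd p)) (of_int j * \<eta>) (fst p)"
            using elim lineint_add[OF Gl, of "snd p" 0 "of_int j * \<eta>" "fst p"] by (simp add: F_def)
        qed
      qed
    qed
    have aeF': "AE p in lborel. \<forall>k::int. F' p = u (of_int k * \<eta>) (fst p) + lineint (\<lambda>s. K' (fst p, s)) (of_int k * \<eta>) (snd p)"
    proof -
      have "AE t in lborel. \<forall>j::int. u (of_int j * \<eta>) t = u 0 t + lineint (\<lambda>s. K' (t, s)) 0 (of_int j * \<eta>)"
        unfolding \<eta>_def AE_all_countable K'_def using uv by simp
      then have "AE p in (lborel :: pt measure). \<forall>j::int. u (of_int j * \<eta>) (fst p) = u 0 (fst p) + lineint (\<lambda>s. K' (fst p, s)) 0 (of_int j * \<eta>)"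
        by (intro AE_pt_I) auto
      then show ?thesis
      proof eventually_elim
        case (elim p)
        show ?case
        proof
          fix j :: int
          show "F' p = u (of_int j * \<eta>) (fst p) + lineint (\<lambda>s. K' (fst p, s)) (of_int j * \<eta>) (snd p)"
            using elim lineint_add[OF Kl, of "fst p" 0 "of_int j * \<eta>" "snd p"] by (simp add: F'_def K'_def)
        qed
      qed
    qed
    have cell: "(\<integral>\<^sup>+ p\<in>grid_cell \<eta> jk. ennreal ((F p - F' p)\<^sup>2) \<partial>lborel)
      \<le> ennreal (4 * \<eta>\<^sup>2) * ((\<integral>\<^sup>+ p\<in>grid_cell \<eta> jk. ennreal ((G p)\<^sup>2) \<partial>lborel) + (\<integral>\<^sup>+ p\<in>grid_cell \<eta> jk. ennreal ((K' p)\<^sup>2) \<partial>lborel) + vx i jk)" for jk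
    proof -
      define a where "a = of_int (fst jk) * \<eta>"
      define b where "b = of_int (snd jk) * \<eta>"
      define Q where "Q = {a..<a + \<eta>} \<times> {b..<b + \<eta>}"
      have Q: "grid_cell \<eta> jk = Q" by (simp add: grid_cell_def Q_def a_def b_def)
      have [measurable]: "Q \<in> sets borel" unfolding Q_def by (simp add: borel_Times)
      \<comment> \<open>The chain from \<open>F p\<close> to \<open>F' p\<close>: horizontally to
        the left side of the cell (\<open>T1\<close>), along this side to the height equal to the
        horizontal offset (\<open>T2\<close>, edge term), over to the bottom side at that offset
        (\<open>T3\<close>, cross term), and vertically up to the point (\<open>T4\<close>).\<close>
      define T1 where "T1 p = ennreal \<eta> * (\<integral>\<^sup>+ s\<in>{a..<a + \<eta>}. ennreal ((G (s, snd p))\<^sup>2) \<partial>lborel)" for p :: pt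
      define T2 where "T2 p = ennreal ((w a (snd p) - w a (b + (fst p - a)))\<^sup>2)" for p :: pt
      define T3 where "T3 p = ennreal ((w a (b + (fst p - a)) - u b (fst p))\<^sup>2)" for p :: pt
      define T4 where "T4 p = ennreal \<eta> * (\<integral>\<^sup>+ s\<in>{b..<b + \<eta>}. ennreal ((K' (fst p, s))\<^sup>2) \<partial>lborel)" for p :: pt
      have [measurable]: "T1 \<in> borel_measurable borel" "T2 \<in> borel_measurable borel" "T3 \<in> borel_measurable borel" "T4 \<in> borel_measurable borel"
        unfolding T1_def T2_def T3_def T4_def by measurable
      have "(\<integral>\<^sup>+ p\<in>Q. ennreal ((F p - F' p)\<^sup>2) \<partial>lborel) \<le> (\<integral>\<^sup>+ p. 4 * (T1 p * indicator Q p + T2 p * indicator Q p + T3 p * indicator Q p + T4 p * indicator Q p) \<partial>lborel)"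
      proof (rule nn_integral_mono_AE, use aeF aeF' in eventually_elim)
        case (elim p)
        show ?case
        proof (cases "p \<in> Q")
          case True
          then have x: "a \<le> fst p" "fst p < a + \<eta>" and t: "b \<le> snd p" "snd p < b + \<eta>" by (auto simp: Q_def)
          let ?l1 = "lineint (\<lambda>s. G (s, snd p)) a (fst p)" and ?l2 = "lineint (\<lambda>s. K' (fst p, s)) b (snd p)"
          have Fp: "F p = w a (snd p) + ?l1" using elim(1) unfolding a_def by blast
          have Fp': "F' p = u b (fst p) + ?l2" using elim(2) unfolding b_def by blast
          have l1: "ennreal (?l1\<^sup>2) \<le> T1 p"
          proof -
            have "ennreal (?l1\<^sup>2) \<le> ennreal \<bar>fst p - a\<bar> * (\<integral>\<^sup>+ s\<in>{min a (fst p)..max a (fst p)}. ennreal ((G (s, snd p))\<^sup>2) \<partial>lborel)"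
              by (rule lineint_sq_le) measurable
            also have "\<dots> \<le> T1 p" unfolding T1_def
              using x by (intro mult_mono ennreal_leI nn_integral_mono) (auto simp: indicator_def)
            finally show ?thesis .
          qed
          have l2: "ennreal (?l2\<^sup>2) \<le> T4 p"
          proof -
            have "ennreal (?l2\<^sup>2) \<le> ennreal \<bar>snd p - b\<bar> * (\<integral>\<^sup>+ s\<in>{min b (snd p)..max b (snd p)}. ennreal ((K' (fst p, s))\<^sup>2) \<partial>lborel)"
              by (rule lineint_sq_le) measurable
            also have "\<dots> \<le> T4 p" unfolding T4_def
              using t by (intro mult_mono ennreal_leI nn_integral_mono) (auto simp: indicator_def)
            finally show ?thesis .
          qed
          have "(F p - F' p)\<^sup>2 \<le> 4 * (?l1\<^sup>2 + (w a (snd p) - w a (b + (fst p - a)))\<^sup>2 + (w a (b + (fst p - a)) - u b (fst p))\<^sup>2 + ?l2\<^sup>2)"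
            using sq_add4[of ?l1 "w a (snd p) - w a (b + (fst p - a))" "w a (b + (fst p - a)) - u b (fst p)" "- ?l2"]
            by (simp add: Fp Fp' algebra_simps)
          then have "ennreal ((F p - F' p)\<^sup>2) \<le> ennreal (4 * (?l1\<^sup>2 + (w a (snd p) - w a (b + (fst p - a)))\<^sup>2 + (w a (b + (fst p - a)) - u b (fst p))\<^sup>2 + ?l2\<^sup>2))"
            by (rule ennreal_leI)
          also have "\<dots> = 4 * (ennreal (?l1\<^sup>2) + T2 p + T3 p + ennreal (?l2\<^sup>2))"
            by (simp add: ennreal_mult T2_def T3_def)
          also have "\<dots> \<le> 4 * (T1 p + T2 p + T3 p + T4 p)"
            by (intro mult_left_mono add_mono l1 l2 order_refl) auto
          finally show ?thesis using True by simp
        qed simp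
      qed
      also have "\<dots> = 4 * ((\<integral>\<^sup>+ p\<in>Q. T1 p \<partial>lborel) + (\<integral>\<^sup>+ p\<in>Q. T2 p \<partial>lborel) + (\<integral>\<^sup>+ p\<in>Q. T3 p \<partial>lborel) + (\<integral>\<^sup>+ p\<in>Q. T4 p \<partial>lborel))"
        by (simp add: nn_integral_cmult nn_integral_add)
      also have "(\<integral>\<^sup>+ p\<in>Q. T1 p \<partial>lborel) = ennreal (\<eta>\<^sup>2) * (\<integral>\<^sup>+ p\<in>Q. ennreal ((G p)\<^sup>2) \<partial>lborel)"
      proof -
        have "(\<integral>\<^sup>+ p\<in>Q. T1 p \<partial>lborel) = ennreal \<eta> * (\<integral>\<^sup>+ p\<in>Q. (\<integral>\<^sup>+ s\<in>{a..<a + \<eta>}. ennreal ((G (s, snd p))\<^sup>2) \<partial>lborel) \<partial>lborel)"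
          unfolding T1_def mult.assoc by (rule nn_integral_cmult) measurable
        also have "\<dots> = ennreal \<eta> * (ennreal \<eta> * (\<integral>\<^sup>+ p\<in>Q. ennreal ((G p)\<^sup>2) \<partial>lborel))"
          unfolding Q_def using eta by (subst cell_strip_integral) auto
        finally show ?thesis using eta by (simp add: power2_eq_square ennreal_mult mult.assoc)
      qed
      also have "(\<integral>\<^sup>+ p\<in>Q. T4 p \<partial>lborel) = ennreal (\<eta>\<^sup>2) * (\<integral>\<^sup>+ p\<in>Q. ennreal ((K' p)\<^sup>2) \<partial>lborel)"
      proof -
        have Km: "(\<lambda>p. ennreal ((K p)\<^sup>2)) \<in> borel_measurable borel" by measurable
        have "(\<integral>\<^sup>+ p\<in>Q. T4 p \<partial>lborel) = ennreal \<eta> * (\<integral>\<^sup>+ p\<in>Q. (\<integral>\<^sup>+ s\<in>{b..<b + \<eta>}. ennreal ((K (s, snd (prod.swap p)))\<^sup>2) \<partial>lborel) \<partial>lborel)"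
          unfolding T4_def mult.assoc K'_def by (subst nn_integral_cmult) auto
        also have "(\<integral>\<^sup>+ p\<in>Q. (\<integral>\<^sup>+ s\<in>{b..<b + \<eta>}. ennreal ((K (s, snd (prod.swap p)))\<^sup>2) \<partial>lborel) \<partial>lborel)
          = (\<integral>\<^sup>+ p\<in>{b..<b + \<eta>} \<times> {a..<a + \<eta>}. (\<integral>\<^sup>+ s\<in>{b..<b + \<eta>}. ennreal ((K (s, snd p))\<^sup>2) \<partial>lborel) \<partial>lborel)"
          unfolding Q_def by (rule rect_swap_integral[where h="\<lambda>p. \<integral>\<^sup>+ s\<in>{b..<b + \<eta>}. ennreal ((K (s, snd p))\<^sup>2) \<partial>lborel"]) measurable
        also have "\<dots> = ennreal \<eta> * (\<integral>\<^sup>+ p\<in>{b..<b + \<eta>} \<times> {a..<a + \<eta>}. ennreal ((K p)\<^sup>2) \<partial>lborel)"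
          using eta by (intro cell_strip_integral[OF Km]) auto
        also have "(\<integral>\<^sup>+ p\<in>{b..<b + \<eta>} \<times> {a..<a + \<eta>}. ennreal ((K p)\<^sup>2) \<partial>lborel) = (\<integral>\<^sup>+ p\<in>Q. ennreal ((K' p)\<^sup>2) \<partial>lborel)"
          unfolding Q_def K'_def by (rule rect_swap_integral[OF Km, symmetric])
        finally show ?thesis using eta by (simp add: power2_eq_square ennreal_mult mult.assoc)
      qed
      also have "4 * (ennreal (\<eta>\<^sup>2) * (\<integral>\<^sup>+ p\<in>Q. ennreal ((G p)\<^sup>2) \<partial>lborel) + (\<integral>\<^sup>+ p\<in>Q. T2 p \<partial>lborel) + (\<integral>\<^sup>+ p\<in>Q. T3 p \<partial>lborel) + ennreal (\<eta>\<^sup>2) * (\<integral>\<^sup>+ p\<in>Q. ennreal ((K' p)\<^sup>2) \<partial>lborel))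
        \<le> 4 * (ennreal (\<eta>\<^sup>2) * (\<integral>\<^sup>+ p\<in>Q. ennreal ((G p)\<^sup>2) \<partial>lborel) + ennreal (\<eta>\<^sup>2) * edge \<eta> (w a) b + ennreal (\<eta>\<^sup>2) * cross \<eta> (u b) (w a) a b + ennreal (\<eta>\<^sup>2) * (\<integral>\<^sup>+ p\<in>Q. ennreal ((K' p)\<^sup>2) \<partial>lborel))"
        unfolding T2_def T3_def Q_def using eta
        by (intro mult_left_mono add_mono order_refl cell_edge_le cell_cross_le) auto
      also have "\<dots> = 4 * (ennreal (\<eta>\<^sup>2) * ((\<integral>\<^sup>+ p\<in>Q. ennreal ((G p)\<^sup>2) \<partial>lborel) + (\<integral>\<^sup>+ p\<in>Q. ennreal ((K' p)\<^sup>2) \<partial>lborel) + (edge \<eta> (w a) b + cross \<eta> (u b) (w a) a b)))"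
        by (simp add: distrib_left add_ac)
      also have "\<dots> \<le> 4 * (ennreal (\<eta>\<^sup>2) * ((\<integral>\<^sup>+ p\<in>Q. ennreal ((G p)\<^sup>2) \<partial>lborel) + (\<integral>\<^sup>+ p\<in>Q. ennreal ((K' p)\<^sup>2) \<partial>lborel) + vx i jk))"
      proof (intro mult_left_mono add_left_mono)
        have "edge \<eta> (w a) b + cross \<eta> (u b) (w a) a b + 0 \<le> edge \<eta> (w a) b + cross \<eta> (u b) (w a) a b + (edge \<eta> (u b) a + straight \<eta> (u b) a + straight \<eta> (w a) b)"
          by (intro add_left_mono) simp
        then show "edge \<eta> (w a) b + cross \<eta> (u b) (w a) a b \<le> vx i jk"
          by (simp add: vx_def vertex_def a_def b_def \<eta>_def add_ac)
      qed auto
      also have "\<dots> = ennreal (4 * \<eta>\<^sup>2) * ((\<integral>\<^sup>+ p\<in>Q. ennreal ((G p)\<^sup>2) \<partial>lborel) + (\<integral>\<^sup>+ p\<in>Q. ennreal ((K' p)\<^sup>2) \<partial>lborel) + vx i jk)"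
        by (simp add: ennreal_mult mult.assoc)
      finally show ?thesis unfolding Q .
    qed
    have g: "(\<integral>\<^sup>+ p. ennreal (h p) \<partial>lborel) = (\<integral>\<^sup>+ jk. (\<integral>\<^sup>+ p\<in>grid_cell \<eta> jk. ennreal (h p) \<partial>lborel) \<partial>count_space UNIV)"
      if "h \<in> borel_measurable borel" for h
      using that by (intro nn_integral_grid[OF _ eta]) measurable
    have "(\<integral>\<^sup>+ p. ennreal ((F p - F' p)\<^sup>2) \<partial>lborel) = (\<integral>\<^sup>+ jk. (\<integral>\<^sup>+ p\<in>grid_cell \<eta> jk. ennreal ((F p - F' p)\<^sup>2) \<partial>lborel) \<partial>count_space UNIV)"
      by (rule g) measurable
    also have "\<dots> \<le> (\<integral>\<^sup>+ jk. ennreal (4 * \<eta>\<^sup>2) * ((\<integral>\<^sup>+ p\<in>grid_cell \<eta> jk. ennreal ((G p)\<^sup>2) \<partial>lborel) + (\<integral>\<^sup>+ p\<in>grid_cell \<eta> jk. ennreal ((K' p)\<^sup>2) \<partial>lborel) + vx i jk) \<partial>count_space UNIV)"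
      by (intro nn_integral_mono cell)
    also have "\<dots> = ennreal (4 * \<eta>\<^sup>2) * ((\<integral>\<^sup>+ p. ennreal ((G p)\<^sup>2) \<partial>lborel) + (\<integral>\<^sup>+ p. ennreal ((K' p)\<^sup>2) \<partial>lborel) + (\<integral>\<^sup>+ jk. vx i jk \<partial>count_space UNIV))"
      by (simp add: nn_integral_cmult nn_integral_add g)
    also have "\<dots> \<le> ennreal (4 * \<eta>\<^sup>2) * (ennreal (12 * M) + ennreal (12 * M) + ennreal M)"
      by (intro mult_left_mono add_mono GM K'M sum_vx) auto
    also have "ennreal (12 * M) + ennreal (12 * M) + ennreal M = ennreal (25 * M)"
    proof -
      have "ennreal (12 * M + 12 * M + M) = ennreal (12 * M + 12 * M) + ennreal M" by (rule ennreal_plus) (use M0 in auto)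
      also have "ennreal (12 * M + 12 * M) = ennreal (12 * M) + ennreal (12 * M)" by (rule ennreal_plus) (use M0 in auto)
      also have "12 * M + 12 * M + M = 25 * M" by simp
      finally show ?thesis by (rule sym)
    qed
    also have "ennreal (4 * \<eta>\<^sup>2) * ennreal (25 * M) = ennreal (4 * \<eta>\<^sup>2 * (25 * M))"
      by (rule ennreal_mult[symmetric]) (use M0 in auto)
    finally show ?thesis unfolding \<eta>_def .
  qed
  have lim: "(\<lambda>i. ennreal (4 * (\<delta> i)\<^sup>2 * (25 * M))) \<longlonglongrightarrow> ennreal (4 * 0\<^sup>2 * (25 * M))"
    by (intro tendsto_ennrealI tendsto_intros delta_lim)
  have "(\<integral>\<^sup>+ p. ennreal ((F p - F' p)\<^sup>2) \<partial>lborel) \<le> ennreal (4 * 0\<^sup>2 * (25 * M))"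
    by (rule LIMSEQ_le_const[OF lim]) (use level in auto)
  then have "(\<integral>\<^sup>+ p. ennreal ((F p - F' p)\<^sup>2) \<partial>lborel) = 0" by simp
  then have "AE p in lborel. ennreal ((F p - F' p)\<^sup>2) = 0" by (subst (asm) nn_integral_0_iff_AE) auto
  then have "AE p in lborel. F p = F' p" by eventually_elim simp
  then show ?thesis by (simp add: F_def F'_def K'_def)
qed

text \<open>Agreement of the two primitives gives one function with a representation in each
  direction. Each representation then does two things: it yields a weak derivative by parts, and
  through \<open>hrep_trace\<close> it identifies the disc-mean limits on the lines across its
  direction with the data.\<close>

lemma extension:
  obtains F where "in_H1 F" "H1_norm2 F \<le> ennreal (24 * M)"
    "\<And>i (k::int). AE x in lborel. (disc_mean F (x, of_int k * \<delta> i) \<longlongrightarrow> u (of_int k * \<delta> i) x) (at_right 0)"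
    "\<And>i (j::int). AE t in lborel. (disc_mean F (of_int j * \<delta> i, t) \<longlongrightarrow> w (of_int j * \<delta> i) t) (at_right 0)"
proof -
  obtain G where G [measurable]: "G \<in> borel_measurable borel" and Gl: "\<And>t. loc_int (\<lambda>s. G (s, t))"
    and GM: "(\<integral>\<^sup>+ p. ennreal ((G p)\<^sup>2) \<partial>lborel) \<le> ennreal (12 * M)"
    and wv: "\<And>i (j::int). AE t in lborel. w (of_int j * \<delta> i) t = w 0 t + lineint (\<lambda>s. G (s, t)) 0 (of_int j * \<delta> i)"
    by (rule line_values) (rule that, assumption+)
  obtain K where K [measurable]: "K \<in> borel_measurable borel" and Kl: "\<And>t. loc_int (\<lambda>s. K (s, t))"
    and KM: "(\<integral>\<^sup>+ p. ennreal ((K p)\<^sup>2) \<partial>lborel) \<le> ennreal (12 * M)"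
    and uv: "\<And>i (j::int). AE t in lborel. u (of_int j * \<delta> i) t = u 0 t + lineint (\<lambda>s. K (s, t)) 0 (of_int j * \<delta> i)"
    by (rule grid_data.line_values[OF grid_data_swap]) (rule that, assumption+)
  note [measurable] = loc_int_measurable[OF u] loc_int_measurable[OF w]
  have Gfin: "(\<integral>\<^sup>+ p. ennreal ((G p)\<^sup>2) \<partial>lborel) < \<infinity>" by (rule le_less_trans[OF GM]) simp
  have Kfin: "(\<integral>\<^sup>+ p. ennreal ((K p)\<^sup>2) \<partial>lborel) < \<infinity>" by (rule le_less_trans[OF KM]) simp
  define F where "F p = w 0 (snd p) + lineint (\<lambda>s. G (s, snd p)) 0 (fst p)" for p :: pt
  have Fl: "loc_int_pt F" unfolding F_def
    by (intro loc_int_pt_add loc_int_pt_snd w loc_int_pt_lineint G Gfin)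
  have [measurable]: "F \<in> borel_measurable borel" using Fl by (rule loc_int_ptD)
  have hr: "hrep F (w 0) G" unfolding hrep_def F_def using Gl Gfin by auto
  have vr: "hrep (F \<circ> prod.swap) (u 0) K"
    unfolding hrep_def
  proof (intro conjI allI Kl Kfin K)
    show "AE p in lborel. (F \<circ> prod.swap) p = u 0 (snd p) + lineint (\<lambda>s. K (s, snd p)) 0 (fst p)"
      using AE_swap[OF extensions_agree[OF G K Gl Kl GM KM wv uv]] by (simp add: F_def)
  qed measurable
  have Fs: "loc_int_pt (F \<circ> prod.swap)" by (rule loc_int_pt_swap[OF Fl])
  define G2 where "G2 p = K (prod.swap p)" for p :: pt
  have [measurable]: "G2 \<in> borel_measurable borel" unfolding G2_def by measurable
  have en: "(\<integral>\<^sup>+ p. ennreal ((G p)\<^sup>2 + (G2 p)\<^sup>2) \<partial>lebesgue) \<le> ennreal (24 * M)"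
  proof -
    have "(\<integral>\<^sup>+ p. ennreal ((G p)\<^sup>2 + (G2 p)\<^sup>2) \<partial>lebesgue) = (\<integral>\<^sup>+ p. ennreal ((G p)\<^sup>2) \<partial>lborel) + (\<integral>\<^sup>+ p. ennreal ((G2 p)\<^sup>2) \<partial>lborel)"
      unfolding nn_integral_completion by (subst nn_integral_add[symmetric]) auto
    also have "(\<integral>\<^sup>+ p. ennreal ((G2 p)\<^sup>2) \<partial>lborel) = (\<integral>\<^sup>+ p. ennreal ((K p)\<^sup>2) \<partial>lborel)"
      unfolding G2_def by (rule nn_integral_swap[of "\<lambda>p. ennreal ((K p)\<^sup>2)"]) measurable
    also have "(\<integral>\<^sup>+ p. ennreal ((G p)\<^sup>2) \<partial>lborel) + (\<integral>\<^sup>+ p. ennreal ((K p)\<^sup>2) \<partial>lborel) \<le> ennreal (12 * M) + ennreal (12 * M)"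
      by (intro add_mono GM KM)
    also have "\<dots> = ennreal (24 * M)" using M0 by (simp add: ennreal_plus[symmetric] del: ennreal_plus)
    finally show ?thesis .
  qed
  have W: "weak_grad_L2 F G G2"
    unfolding weak_grad_L2_def
  proof (intro conjI allI impI)
    show "loc_integrable F" by (rule loc_integrable_of_loc_int_pt[OF Fl])
    show "G \<in> borel_measurable lebesgue" "G2 \<in> borel_measurable lebesgue"
      by (rule lebesgue_borel_version(1)[OF \<open>G \<in> borel_measurable borel\<close> AE_I2[OF refl]], rule lebesgue_borel_version(1)[OF \<open>G2 \<in> borel_measurable borel\<close> AE_I2[OF refl]])
    show "(\<integral>\<^sup>+ p. ennreal ((G p)\<^sup>2 + (G2 p)\<^sup>2) \<partial>lebesgue) < \<infinity>" by (rule le_less_trans[OF en]) simp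
    fix phi assume "test_fun phi"
    then obtain R where sm: "smooth2 phi" and R: "\<And>p. norm p > R \<Longrightarrow> phi p = 0" by (auto simp: test_fun_def)
    have z: "phi (x, t) = 0" if "\<bar>x\<bar> > R \<or> \<bar>t\<bar> > R" for x t
    proof -
      have "norm (x, t) \<ge> \<bar>x\<bar>" "norm (x, t) \<ge> \<bar>t\<bar>" using norm_fst_le[of x t] norm_snd_le[of t x] by auto
      then show ?thesis using that by (intro R) linarith
    qed
    have c: "continuous_on UNIV phi" "continuous_on UNIV (\<lambda>p. frechet_derivative phi (at p) (1, 0))" "continuous_on UNIV (\<lambda>p. frechet_derivative phi (at p) (0, 1))"
      using sm by (auto intro: smooth2_continuous smooth2D)
    have [measurable]: "phi \<in> borel_measurable borel" "(\<lambda>p. frechet_derivative phi (at p) (1, 0)) \<in> borel_measurable borel"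
       "(\<lambda>p. frechet_derivative phi (at p) (0, 1)) \<in> borel_measurable borel"
      using c by (auto intro: borel_measurable_continuous_onI)
    have L: "(\<integral>p. f p * h p \<partial>lebesgue) = (\<integral>p. f p * h p \<partial>lborel)" if "f \<in> borel_measurable borel" "h \<in> borel_measurable borel" for f h :: "pt \<Rightarrow> real"
      by (rule lebesgue_borel_version(2)[OF _ AE_I2[OF refl]]) (use that in auto)
    have "(\<integral>p. F p * frechet_derivative phi (at p) (1, 0) \<partial>lborel) = - (\<integral>p. G p * phi p \<partial>lborel)"
      by (rule hrep_integration_by_parts[OF Fl hr _ c(2) c(1) z]) (rule smooth2_section_derivative(1)[OF sm])
    then show "(\<integral>p. F p * frechet_derivative phi (at p) (1, 0) \<partial>lebesgue) = - (\<integral>p. G p * phi p \<partial>lebesgue)"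
      by (simp add: L)
    \<comment> \<open>The vertical derivative is obtained as a horizontal one of the exchanged
      function, against the exchanged test function.\<close>
    have "(\<integral>p. (F \<circ> prod.swap) p * frechet_derivative phi (at (prod.swap p)) (0, 1) \<partial>lborel) = - (\<integral>p. K p * phi (prod.swap p) \<partial>lborel)"
    proof (rule hrep_integration_by_parts[OF Fs vr])
      show "((\<lambda>x. phi (prod.swap (x, t))) has_real_derivative frechet_derivative phi (at (prod.swap (x, t))) (0, 1)) (at x)" for x t
        using smooth2_section_derivative(2)[OF sm] by simp
      have "continuous_on UNIV (prod.swap :: pt \<Rightarrow> pt)" unfolding prod.swap_def by (intro continuous_intros)
      then show "continuous_on UNIV (\<lambda>p. frechet_derivative phi (at (prod.swap p)) (0, 1))" "continuous_on UNIV (\<lambda>p. phi (prod.swap p))"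
        by (auto intro!: continuous_on_compose2[OF c(1)] continuous_on_compose2[OF c(3)])
      show "phi (prod.swap (x, t)) = 0" if "\<bar>x\<bar> > R \<or> \<bar>t\<bar> > R" for x t using that z by auto
    qed
    moreover have "(\<integral>p. (F \<circ> prod.swap) p * frechet_derivative phi (at (prod.swap p)) (0, 1) \<partial>lborel) = (\<integral>p. F p * frechet_derivative phi (at p) (0, 1) \<partial>lborel)"
      using integral_swap_pt[of "\<lambda>p. F p * frechet_derivative phi (at p) (0, 1)"] by simp
    moreover have "(\<integral>p. K p * phi (prod.swap p) \<partial>lborel) = (\<integral>p. G2 p * phi p \<partial>lborel)"
      using integral_swap_pt[of "\<lambda>p. G2 p * phi p"] by (simp add: G2_def)
    ultimately show "(\<integral>p. F p * frechet_derivative phi (at p) (0, 1) \<partial>lebesgue) = - (\<integral>p. G2 p * phi p \<partial>lebesgue)"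
      by (simp add: L)
  qed
  show ?thesis
  proof (rule that[of F])
    show "in_H1 F" unfolding in_H1_def using W by blast
    show "H1_norm2 F \<le> ennreal (24 * M)" unfolding H1_norm2_eq[OF W] by (rule en)
    show "AE t in lborel. (disc_mean F (of_int j * \<delta> i, t) \<longlongrightarrow> w (of_int j * \<delta> i) t) (at_right 0)" for i and j :: int
    proof -
      have "AE t in lborel. (disc_mean F (of_int j * \<delta> i, t) \<longlongrightarrow> w 0 t + lineint (\<lambda>s. G (s, t)) 0 (of_int j * \<delta> i)) (at_right 0)"
        using hrep_trace[OF Fl hr, of 0 "of_int j * \<delta> i"] by simp
      then show ?thesis using wv[of j i] by eventually_elim simp
    qed
    show "AE x in lborel. (disc_mean F (x, of_int k * \<delta> i) \<longlongrightarrow> u (of_int k * \<delta> i) x) (at_right 0)" for i and k :: int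
    proof -
      have e: "disc_mean (F \<circ> prod.swap) p = disc_mean F (prod.swap p)" for p
        by (rule ext) (rule disc_mean_swap, measurable)
      have "AE x in lborel. (disc_mean F (x, of_int k * \<delta> i) \<longlongrightarrow> u 0 x + lineint (\<lambda>s. K (s, x)) 0 (of_int k * \<delta> i)) (at_right 0)"
        using hrep_trace[OF Fs vr, of 0 "of_int k * \<delta> i"] by (simp add: e)
      then show ?thesis using uv[of k i] by eventually_elim simp
    qed
  qed
qed

end

section \<open>Additive constants and choice of representatives\<close>

lemma vertex_minus_const: "vertex \<delta> (\<lambda>x. p x - C) (\<lambda>t. q t - C) a b = vertex \<delta> p q a b"
  by (simp add: vertex_def edge_def cross_def straight_def)

lemma loc_int_version:
  fixes h :: "real \<Rightarrow> real"
  assumes h: "h \<in> borel_measurable lebesgue"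
    and fin: "\<And>a b. (\<integral>\<^sup>+ x\<in>{a..b}. ennreal ((h x)\<^sup>2) \<partial>lebesgue) < \<infinity>"
  obtains v where "loc_int v" "AE x in lborel. v x = h x - C"
proof -
  obtain g where g [measurable]: "g \<in> borel_measurable borel" and ae: "AE x in lborel. h x = g x"
    using completion_ex_borel_measurable_real[of h lborel] h by auto
  have "loc_int g"
  proof (rule loc_int_L2[OF g])
    fix a b
    have "(\<integral>\<^sup>+ x\<in>{a..b}. ennreal ((g x)\<^sup>2) \<partial>lborel) = (\<integral>\<^sup>+ x\<in>{a..b}. ennreal ((h x)\<^sup>2) \<partial>lebesgue)"
      unfolding nn_integral_completion by (rule nn_integral_cong_AE) (use ae in auto)
    then show "(\<integral>\<^sup>+ x\<in>{a..b}. ennreal ((g x)\<^sup>2) \<partial>lborel) < \<infinity>" using fin by simp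
  qed
  then have "loc_int (\<lambda>x. g x - C)" by (intro loc_int_diff) auto
  moreover have "AE x in lborel. g x - C = h x - C" using ae by eventually_elim simp
  ultimately show ?thesis by (rule that)
qed

text \<open>Since \<open>restr_eq\<close> ignores additive constants, the functions are first normalised on the line \<open>y = 0\<close>,
  which belongs to all the grids.\<close>

lemma extension_theorem:
  fixes m :: nat and f :: "int \<Rightarrow> pt \<Rightarrow> real"
  assumes m: "m \<ge> 2"
    and H: "\<And>n. in_H12 (real m powi n) (f n)"
    and S: "(SUP n. H12_norm2 (real m powi n) (f n)) < \<infinity>"
    and cons: "\<And>n n'. n' < n \<Longrightarrow> restr_eq (real m powi n) (f n') (f n)"
  obtains F where "in_H1 F" "\<And>n. trace_eq (real m powi n) F (f n)"
    "H1_norm2 F \<le> 24 * (SUP n. H12_norm2 (real m powi n) (f n))"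
proof -
  \<comment> \<open>The meshes at most 1, numbered from coarse to fine; the larger meshes are
    recovered at the end.\<close>
  define \<delta> where "\<delta> i = (1 / real m) ^ i" for i
  have delta_powi: "\<delta> i = real m powi (- int i)" for i
    by (simp add: \<delta>_def power_int_minus power_one_over inverse_eq_divide)
  have agree: "(\<forall>k::int. AE x in lborel. f' (x, of_int k * \<epsilon>) = g' (x, of_int k * \<epsilon>) + C) \<and> (\<forall>j::int. AE y in lborel. f' (of_int j * \<epsilon>, y) = g' (of_int j * \<epsilon>, y) + C)
      \<longleftrightarrow> AE_gp \<epsilon> (\<lambda>p. f' p = g' p + C)" for f' g' :: "pt \<Rightarrow> real" and \<epsilon> C
    unfolding AE_gp_def AE_lebesgue_lborel by simp
  \<comment> \<open>Every level is compared with the unit grid, which all these grids contain.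
    \<open>C 0 = 0\<close> leaves level 0 unchanged, which the coarser grids will use.\<close>
  have "\<exists>C. AE_gp (\<delta> 0) (\<lambda>p. f (- int i) p = f 0 p + C) \<and> (i = 0 \<longrightarrow> C = 0)" for i
  proof (cases i)
    case 0
    then show ?thesis by (intro exI[of _ 0]) (simp add: AE_gp_def)
  next
    case (Suc n)
    then show ?thesis using cons[of "- int i" 0] by (simp add: restr_eq_def \<delta>_def)
  qed
  then obtain C where C: "\<And>i. AE_gp (\<delta> 0) (\<lambda>p. f (- int i) p = f 0 p + C i)" and C0: "C 0 = 0" by metis
  define h where "h i p = f (- int i) p - C i" for i p
  have hh: "AE_gp (\<delta> i) (\<lambda>p. h i' p = h i p)" if "i \<le> i'" for i i'
  proof (cases "i = i'")
    case False
    then have "- int i' < - int i" using that by simp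
    from cons[OF this] obtain D where D: "AE_gp (\<delta> i) (\<lambda>p. f (- int i') p = f (- int i) p + D)"
      unfolding restr_eq_def delta_powi by blast
    have D0: "AE x in lborel. f (- int i') (x, 0) = f (- int i) (x, 0) + D"
      using D[unfolded agree[symmetric], THEN conjunct1, rule_format, of 0] by simp
    have Cl: "AE x in lborel. f (- int l) (x, 0) = f 0 (x, 0) + C l" for l
      using C[of l, unfolded agree[symmetric], THEN conjunct1, rule_format, of 0] by simp
    \<comment> \<open>Three identities hold almost everywhere on the line \<open>y = 0\<close>,
      hence at some common point, where the constants can be compared.\<close>
    from AE_lborel_ex[OF AE_conjI[OF D0 AE_conjI[OF Cl[of i] Cl[of i']]]] have "D = C i' - C i" by auto
    then have "(\<lambda>p. h i' p = h i p) = (\<lambda>p. f (- int i') p = f (- int i) p + D)" unfolding h_def by fastforce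
    then show ?thesis using D by simp
  qed (simp add: AE_gp_def)
  have Hi: "in_H12 (\<delta> i) (f (- int i))" for i using H[of "- int i"] by (simp add: delta_powi)
  \<comment> \<open>The data on \<open>y = b\<close> are taken from the coarsest of these grids that
    contains the line, which makes them a function of \<open>b\<close> alone. Finer grids have the
    same normalised values there by \<open>hh\<close>. On lines in none of the grids nothing is
    prescribed but local integrability.\<close>
  define Pu where "Pu b v \<longleftrightarrow> loc_int v \<and> ((\<exists>i k::int. b = of_int k * \<delta> i) \<longrightarrow> (AE x in lborel. v x = h (LEAST i. \<exists>k::int. b = of_int k * \<delta> i) (x, b)))" for b :: real and v :: "real \<Rightarrow> real"
  have "\<exists>v. Pu b v" for b
  proof (cases "\<exists>i k::int. b = of_int k * \<delta> i")
    case True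
    define i where "i = (LEAST i. \<exists>k::int. b = of_int k * \<delta> i)"
    from LeastI_ex[OF True] obtain k :: int where k: "b = of_int k * \<delta> i" unfolding i_def by blast
    have "(\<lambda>x. f (- int i) (x, b)) \<in> borel_measurable lebesgue" "\<And>s t. (\<integral>\<^sup>+ x\<in>{s..t}. ennreal ((f (- int i) (x, b))\<^sup>2) \<partial>lebesgue) < \<infinity>"
      using Hi[of i] unfolding in_H12_def loc_L2_gp_def k by blast+
    then obtain v where "loc_int v" "AE x in lborel. v x = f (- int i) (x, b) - C i" by (rule loc_int_version)
    then show ?thesis unfolding Pu_def i_def[symmetric] h_def by blast
  next
    case False
    then show ?thesis unfolding Pu_def using loc_int_const by blast
  qed
  then obtain u where "\<And>b. Pu b (u b)" by metis
  then have u'': "loc_int (u b) \<and> ((\<exists>i k::int. b = of_int k * \<delta> i) \<longrightarrow> (AE x in lborel. u b x = h (LEAST i. \<exists>k::int. b = of_int k * \<delta> i) (x, b)))" for b unfolding Pu_def .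
  have u: "loc_int (u b)" for b using u'' by simp
  have u': "AE x in lborel. u b x = h (LEAST i. \<exists>k::int. b = of_int k * \<delta> i) (x, b)" if "\<exists>i k::int. b = of_int k * \<delta> i" for b
    by (rule u''[THEN conjunct2, rule_format, OF that])
  define Pw where "Pw b v \<longleftrightarrow> loc_int v \<and> ((\<exists>i k::int. b = of_int k * \<delta> i) \<longrightarrow> (AE x in lborel. v x = h (LEAST i. \<exists>k::int. b = of_int k * \<delta> i) (b, x)))" for b :: real and v :: "real \<Rightarrow> real"
  have "\<exists>v. Pw b v" for b
  proof (cases "\<exists>i k::int. b = of_int k * \<delta> i")
    case True
    define i where "i = (LEAST i. \<exists>k::int. b = of_int k * \<delta> i)"
    from LeastI_ex[OF True] obtain k :: int where k: "b = of_int k * \<delta> i" unfolding i_def by blast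
    have "(\<lambda>x. f (- int i) (b, x)) \<in> borel_measurable lebesgue" "\<And>s t. (\<integral>\<^sup>+ x\<in>{s..t}. ennreal ((f (- int i) (b, x))\<^sup>2) \<partial>lebesgue) < \<infinity>"
      using Hi[of i] unfolding in_H12_def loc_L2_gp_def k by blast+
    then obtain v where "loc_int v" "AE x in lborel. v x = f (- int i) (b, x) - C i" by (rule loc_int_version)
    then show ?thesis unfolding Pw_def i_def[symmetric] h_def by blast
  next
    case False
    then show ?thesis unfolding Pw_def using loc_int_const by blast
  qed
  then obtain w where "\<And>b. Pw b (w b)" by metis
  then have w'': "loc_int (w b) \<and> ((\<exists>i k::int. b = of_int k * \<delta> i) \<longrightarrow> (AE x in lborel. w b x = h (LEAST i. \<exists>k::int. b = of_int k * \<delta> i) (b, x)))" for b unfolding Pw_def .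
  have w: "loc_int (w b)" for b using w'' by simp
  have w': "AE x in lborel. w b x = h (LEAST i. \<exists>k::int. b = of_int k * \<delta> i) (b, x)" if "\<exists>i k::int. b = of_int k * \<delta> i" for b
    by (rule w''[THEN conjunct2, rule_format, OF that])
  have ul: "AE x in lborel. u (of_int k * \<delta> i) x = h i (x, of_int k * \<delta> i)"
    and wl: "AE x in lborel. w (of_int k * \<delta> i) x = h i (of_int k * \<delta> i, x)" for i and k :: int
  proof -
    define b where "b = of_int k * \<delta> i"
    have ex: "\<exists>i k::int. b = of_int k * \<delta> i" unfolding b_def by blast
    define l where "l = (LEAST i. \<exists>k::int. b = of_int k * \<delta> i)"
    have li: "l \<le> i" unfolding l_def b_def by (rule Least_le) blast
    from LeastI_ex[OF ex] obtain k' :: int where k': "b = of_int k' * \<delta> l" unfolding l_def by blast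
    have "AE x in lborel. h i (x, b) = h l (x, b)" "AE x in lborel. h i (b, x) = h l (b, x)"
      using hh[OF li] unfolding AE_gp_def AE_lebesgue_lborel k' by blast+
    with u'[OF ex] w'[OF ex] show "AE x in lborel. u (of_int k * \<delta> i) x = h i (x, of_int k * \<delta> i)"
      "AE x in lborel. w (of_int k * \<delta> i) x = h i (of_int k * \<delta> i, x)"
      unfolding l_def[symmetric] b_def[symmetric] by (eventually_elim; simp)+
  qed
  define M where "M = enn2real (SUP n. H12_norm2 (real m powi n) (f n))"
  have M: "(SUP n. H12_norm2 (real m powi n) (f n)) = ennreal M" using S by (simp add: M_def less_top)
  interpret grid_data \<delta> m u w M
  proof
    fix i
    have "(\<integral>\<^sup>+ jk. vertex (\<delta> i) (u (of_int (snd jk) * \<delta> i)) (w (of_int (fst jk) * \<delta> i)) (of_int (fst jk) * \<delta> i) (of_int (snd jk) * \<delta> i) \<partial>count_space (UNIV :: (int \<times> int) set))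
      = (\<integral>\<^sup>+ jk. vertex (\<delta> i) (\<lambda>x. f (- int i) (x, of_int (snd jk) * \<delta> i) - C i) (\<lambda>t. f (- int i) (of_int (fst jk) * \<delta> i, t) - C i) (of_int (fst jk) * \<delta> i) (of_int (snd jk) * \<delta> i) \<partial>count_space UNIV)"
      by (intro nn_integral_cong vertex_cong_AE) (use ul wl in \<open>auto simp: h_def\<close>)
    also have "\<dots> = H12_norm2 (\<delta> i) (f (- int i))" unfolding vertex_minus_const H12_norm2_vertex ..
    also have "\<dots> \<le> ennreal M" unfolding M[symmetric] delta_powi by (rule SUP_upper) simp
    finally show "(\<integral>\<^sup>+ jk. vertex (\<delta> i) (u (of_int (snd jk) * \<delta> i)) (w (of_int (fst jk) * \<delta> i)) (of_int (fst jk) * \<delta> i) (of_int (snd jk) * \<delta> i) \<partial>count_space (UNIV :: (int \<times> int) set)) \<le> ennreal M" .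
  qed (use m u w in \<open>auto simp: \<delta>_def M_def\<close>)
  obtain F where F: "in_H1 F" "H1_norm2 F \<le> ennreal (24 * M)"
    and tu: "\<And>i (k::int). AE x in lborel. (disc_mean F (x, of_int k * \<delta> i) \<longlongrightarrow> u (of_int k * \<delta> i) x) (at_right 0)"
    and tw: "\<And>i (j::int). AE t in lborel. (disc_mean F (of_int j * \<delta> i, t) \<longlongrightarrow> w (of_int j * \<delta> i) t) (at_right 0)"
    by (rule extension) (rule that, assumption+)
  have tr: "is_trace (\<delta> i) F (h i)" for i
    unfolding is_trace_def AE_gp_def AE_lebesgue_lborel disc_mean_def[symmetric]
  proof (intro conjI allI)
    fix k :: int
    show "AE x in lborel. (disc_mean F (x, of_int k * \<delta> i) \<longlongrightarrow> h i (x, of_int k * \<delta> i)) (at_right 0)"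
      using tu[of k i] ul[of k i] by eventually_elim simp
    show "AE y in lborel. (disc_mean F (of_int k * \<delta> i, y) \<longlongrightarrow> h i (of_int k * \<delta> i, y)) (at_right 0)"
      using tw[of k i] wl[of k i] by eventually_elim simp
  qed
  have "trace_eq (real m powi n) F (f n)" for n
  proof (cases "n \<le> 0")
    case True
    have "is_trace (real m powi n) F (\<lambda>p. f n p + (- C (nat (- n))))"
      using tr[of "nat (- n)", unfolded delta_powi h_def] True by simp
    then show ?thesis unfolding trace_eq_def by blast
  next
    case False
    then have n: "0 < n" by simp
    from cons[OF this] obtain D where D: "AE_gp (real m powi n) (\<lambda>p. f 0 p = f n p + D)" unfolding restr_eq_def by blast
    \<comment> \<open>For \<open>n > 0\<close> each grid line is also a line of the unit grid, so
      its trace is already known, and consistency replaces \<open>f 0\<close> by \<open>f n\<close>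
      up to a constant.\<close>
    have p: "of_int k * real m powi n = of_int (k * int m ^ nat n) * \<delta> 0" for k :: int
      using n by (simp add: \<delta>_def power_int_def)
    have "is_trace (real m powi n) F (\<lambda>p. f n p + D)"
      unfolding is_trace_def AE_gp_def disc_mean_def[symmetric]
    proof (intro conjI allI)
      fix k :: int
      have "AE x in lebesgue. (disc_mean F (x, of_int k * real m powi n) \<longlongrightarrow> h 0 (x, of_int k * real m powi n)) (at_right 0)"
        using tr[of 0] unfolding p is_trace_def AE_gp_def disc_mean_def[symmetric] by blast
      moreover have "AE x in lebesgue. f 0 (x, of_int k * real m powi n) = f n (x, of_int k * real m powi n) + D"
        using D unfolding AE_gp_def by blast
      ultimately show "AE x in lebesgue. (disc_mean F (x, of_int k * real m powi n) \<longlongrightarrow> f n (x, of_int k * real m powi n) + D) (at_right 0)"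
        by eventually_elim (simp add: h_def C0)
      have "AE y in lebesgue. (disc_mean F (of_int k * real m powi n, y) \<longlongrightarrow> h 0 (of_int k * real m powi n, y)) (at_right 0)"
        using tr[of 0] unfolding p is_trace_def AE_gp_def disc_mean_def[symmetric] by blast
      moreover have "AE y in lebesgue. f 0 (of_int k * real m powi n, y) = f n (of_int k * real m powi n, y) + D"
        using D unfolding AE_gp_def by blast
      ultimately show "AE y in lebesgue. (disc_mean F (of_int k * real m powi n, y) \<longlongrightarrow> f n (of_int k * real m powi n, y) + D) (at_right 0)"
        by eventually_elim (simp add: h_def C0)
    qed
    then show ?thesis unfolding trace_eq_def by blast
  qed
  moreover have "H1_norm2 F \<le> 24 * (SUP n. H12_norm2 (real m powi n) (f n))"
    using F(2) unfolding M by (simp add: ennreal_mult' M_def)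
  ultimately show ?thesis using F(1) that by blast
qed

theorem theorem4p1:
  fixes m :: nat
  assumes "m \<ge> 2"
  shows "\<exists>c::real. c > 0 \<and>
    (\<forall>F. in_H1 F \<longrightarrow>
       (\<exists>f :: int \<Rightarrow> pt \<Rightarrow> real.
          (\<forall>n. trace_eq (real m powi n) F (f n) \<and> in_H12 (real m powi n) (f n)) \<and>
          (SUP n. H12_norm2 (real m powi n) (f n)) \<le> ennreal c * H1_norm2 F)) \<and>
    (\<forall>f :: int \<Rightarrow> pt \<Rightarrow> real.
       (\<forall>n. in_H12 (real m powi n) (f n)) \<and>
       (SUP n. H12_norm2 (real m powi n) (f n)) < \<infinity> \<and>
       (\<forall>n n'. n' < n \<longrightarrow> restr_eq (real m powi n) (f n') (f n)) \<longrightarrow>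
       (\<exists>F. in_H1 F \<and> (\<forall>n. trace_eq (real m powi n) F (f n)) \<and>
            H1_norm2 F \<le> ennreal c * (SUP n. H12_norm2 (real m powi n) (f n))))"
proof (intro exI[of _ 990] conjI allI impI)
  \<comment> \<open>The constant from (a); the extension needs only 24.\<close>
  show "(0::real) < 990" by simp
  have pos: "real m powi n > 0" for n using assms by simp
  fix F assume "in_H1 F"
  then obtain G1 G2 where W: "weak_grad_L2 F G1 G2" unfolding in_H1_def by blast
  obtain f where f: "\<And>\<delta>. \<delta> > 0 \<Longrightarrow> is_trace \<delta> F f" "\<And>\<delta>. \<delta> > 0 \<Longrightarrow> in_H12 \<delta> f"
    "\<And>\<delta>. \<delta> > 0 \<Longrightarrow> H12_norm2 \<delta> f \<le> 990 * H1_norm2 F"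
    by (rule trace_theorem[OF W, folded H1_norm2_eq[OF W]]) (rule that, assumption+)
  show "\<exists>f. (\<forall>n. trace_eq (real m powi n) F (f n) \<and> in_H12 (real m powi n) (f n)) \<and>
      (SUP n. H12_norm2 (real m powi n) (f n)) \<le> ennreal 990 * H1_norm2 F"
  \<comment> \<open>The trace obtained from \<open>trace_theorem\<close> is independent of the mesh,
    so the family is constant in \<open>n\<close>.\<close>
  proof (intro exI[of _ "\<lambda>_. f"] conjI allI SUP_least)
    fix n
    have "is_trace (real m powi n) F (\<lambda>p. f p + 0)" using f(1)[OF pos] by simp
    then show "trace_eq (real m powi n) F f" unfolding trace_eq_def by blast
    show "in_H12 (real m powi n) f" by (rule f(2)[OF pos])
    show "H12_norm2 (real m powi n) f \<le> ennreal 990 * H1_norm2 F" using f(3)[OF pos] by simp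
  qed
next
  fix f :: "int \<Rightarrow> pt \<Rightarrow> real"
  assume A: "(\<forall>n. in_H12 (real m powi n) (f n)) \<and> (SUP n. H12_norm2 (real m powi n) (f n)) < \<infinity> \<and>
    (\<forall>n n'. n' < n \<longrightarrow> restr_eq (real m powi n) (f n') (f n))"
  obtain F where F: "in_H1 F" "\<And>n. trace_eq (real m powi n) F (f n)"
    "H1_norm2 F \<le> 24 * (SUP n. H12_norm2 (real m powi n) (f n))"
    by (rule extension_theorem[OF assms, of f]) (use A in blast)+
  note F(3)
  also have "24 * (SUP n. H12_norm2 (real m powi n) (f n)) \<le> ennreal 990 * (SUP n. H12_norm2 (real m powi n) (f n))"
    by (intro mult_right_mono) auto
  finally show "\<exists>F. in_H1 F \<and> (\<forall>n. trace_eq (real m powi n) F (f n)) \<and>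
      H1_norm2 F \<le> ennreal 990 * (SUP n. H12_norm2 (real m powi n) (f n))"
    using F(1,2) by blast
qed

end
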